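(* Let $d\in\mathbb N$, $T>0$, $\gamma>1$, and let $(\nu^\varepsilon)_{\varepsilon>0}$ be a family of Young measures on $(0,T)\times\mathbb T^d$ with values in $\mathcal P(\mathbb R^+\times\mathbb R^d)$ with the following properties: (i) For each $\varepsilon>0$, $\nu^\varepsilon$ is a measure-valued solution of the isentropic Euler system with Mach number $\sqrt\varepsilon$ and initial data $(\rho_0^\varepsilon,u_0^\varepsilon)\in L^1(\mathbb T^d)$. (ii) As $\varepsilon\to0$, the initial data $(\rho_0^\varepsilon,u_0^\varepsilon)$ converge weakly in $L^1$ to $(\bar\rho,u_0)$, where $\bar\rho>0$ is constant and $\operatorname{div}u_0=0$. (iii) There exist $R>\eta>0$ and a compact set $K\subset\mathbb R^d\times\mathbb R$ such that $\operatorname{supp}\big((T_{\bar\rho}^\varepsilon)_\#\nu^\varepsilon\big)\subset[\eta,R]\times K$ (for all $\varepsilon$ and almost every $(t,x)$), where $T_{\bar\rho}^\varepsilon(\rho,u)=\left(\rho,u,\frac1{\varepsilon\bar\rho}(\rho^\gamma-\bar\rho^\gamma)\right)$. Then there exists a subsequence $\varepsilon_k\to0$ such that the pressure lifts $(P_{\bar\rho}^{\varepsilon_k})_\#\nu^{\varepsilon_k}$, where $P_{\bar\rho}^\varepsilon(\rho,u)=\left(u,\frac1{\varepsilon\bar\rho}(\rho^\gamma-\bar\rho^\gamma)\right)$, converge in the sense of Young measures to an augmented measure-valued solution $\mu$ of the incompressible Euler system with initial data $u_0$. If, in addition, the measure-valued solutions $\nu^\varepsilon$ are energy admissible and the initial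 data $(\rho_0^\varepsilon,u_0^\varepsilon)$ converge strongly in $L^\gamma\times L^2$, then $\mu$ is moreover energy admissible.
   Context: Young measures: for $\Omega=(0,T)\times\mathbb T^d$, a Young measure is a weakly*-measurable map $\nu$ from $\Omega$ into probability measures on $\mathbb R^m$ (or a subset); $\langle\nu,f\rangle(t,x)=\int f\,d\nu_{(t,x)}$; pushforwards $F_\#\nu$ are taken pointwise. A sequence of Young measures $\nu_n$ converges to $\nu$ in the sense of Young measures (also: generates $\nu$) if $\langle\nu_n,f\rangle\overset{*}{\rightharpoonup}\langle\nu,f\rangle$ in $L^\infty(\Omega)$ for all $f\in C_0(\mathbb R^m)$ (continuous functions vanishing at infinity). Measure-valued solution of the isentropic Euler system with Mach number $\sqrt\varepsilon$ and initial data $(\rho_0,u_0)\in L^1(\mathbb T^d)$: a Young measure $\nu$ with values in $\mathcal P(\mathbb R^+\times\mathbb R^d)$ (variables $(\rho,u)$) such that (all integrals being assumed to exist) $$\int_0^T\!\!\int_{\mathbb T^d}\partial_t\varphi\cdot\langle\nu,\rho u\rangle+\nabla\varphi:\langle\nu,\rho u\otimes u\rangle+\left\langle\nu,\tfrac1\varepsilon\rho^\gamma\right\rangle\operatorname{div}\varphi\,dx\,dt=-\int_{\mathbb T^d}\varphi(0,\cdot)\cdot\rho_0u_0\,dx,$$ $$\int_0^T\!\!\int_{\mathbb T^d}\langle\nu,\rho\rangle\partial_t\psi+\nabla\psi\cdot\langle\nu,\rho u\rangle\,dx\,dt=-\int_{\mathbb T^d}\rho_0\psi(0,\cdot)\,dx$$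 for all $\varphi\in C_c^\infty([0,T)\times\mathbb T^d,\mathbb R^d)$, $\psi\in C_c^\infty([0,T)\times\mathbb T^d)$. It is energy admissible if $\operatorname{ess\,sup}_{t\in(0,T)}\int_{\mathbb T^d}\langle\nu_{(t,x)},e_\varepsilon\rangle\,dx\le\int_{\mathbb T^d}e_\varepsilon(\rho_0,u_0)\,dx<\infty$, with $e_\varepsilon(\rho,u)=\frac12\rho|u|^2+\frac1{\gamma-1}\frac1\varepsilon\rho^\gamma$. Augmented measure-valued solution of the incompressible Euler system with initial data $u_0\in L^1(\mathbb T^d)$: a Young measure $\mu$ with values in $\mathcal P(\mathbb R^d\times\mathbb R)$ (variables $(u,P)$) such that $\langle\mu,|u|^2\rangle\in L^\infty((0,T)\times\mathbb T^d)$ and $$\int_0^T\!\!\int_{\mathbb T^d}\partial_t\varphi\cdot\langle\mu,u\rangle+\nabla\varphi:\langle\mu,u\otimes u\rangle+\langle\mu,P\rangle\operatorname{div}\varphi\,dx\,dt=-\int_{\mathbb T^d}\varphi(0)\cdot u_0\,dx,\qquad\int_{\mathbb T^d}\nabla\psi\cdot\langle\mu,u\rangle\,dx=0\ \text{ (for a.e. }t)$$ for all $\varphi\in C_c^\infty([0,T)\times\mathbb T^d,\mathbb R^d)$, $\psi\in C^\infty(\mathbb T^d)$. It is energy admissible if $u_0\in L^2$ and $\operatorname{ess\,sup}_{t\in(0,T)}\int_{\mathbb T^d}\langle\mu_{(t,x)},\frac12|u|^2\rangle\,dx\le\int_{\mathbb T^d}\frac12|u_0|^2\,dx$. *)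

theory Defs
  imports "HOL-Probability.Probability"
begin

section \<open>Smooth functions, differential operators and test functions\<close>

primrec C_k :: "nat \<Rightarrow> ('a::euclidean_space \<Rightarrow> 'b::real_normed_vector) \<Rightarrow> bool" where
  "C_k 0 f \<longleftrightarrow> continuous_on UNIV f"
| "C_k (Suc k) f \<longleftrightarrow>
     (\<forall>x. f differentiable (at x)) \<and> (\<forall>b\<in>Basis. C_k k (\<lambda>x. frechet_derivative f (at x) b))"

definition C_infinity :: "('a::euclidean_space \<Rightarrow> 'b::real_normed_vector) \<Rightarrow> bool" where
  "C_infinity f \<longleftrightarrow> (\<forall>k. C_k k f)"

definition grad :: "(real^'d \<Rightarrow> real) \<Rightarrow> real^'d \<Rightarrow> real^'d" where
  "grad f x = (\<chi> i. frechet_derivative f (at x) (axis i 1))"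

text \<open>For a vector field on space, \<^const>\<open>jacobian\<close> is the matrix $\nabla\varphi$ with entries
  $\partial_j\varphi_i$, and its trace is the divergence.  The derivatives of functions on
  space-time below are partial derivatives, i.e. derivatives of the slices.\<close>

definition time_deriv :: "(real \<times> (real^'d) \<Rightarrow> 'b::real_normed_vector) \<Rightarrow> real \<times> (real^'d) \<Rightarrow> 'b" where
  "time_deriv \<phi> = (\<lambda>(t, x). vector_derivative (\<lambda>s. \<phi> (s, x)) (at t))"

definition space_jacobian :: "(real \<times> (real^'d) \<Rightarrow> real^'d) \<Rightarrow> real \<times> (real^'d) \<Rightarrow> real^'d^'d" where
  "space_jacobian \<phi> = (\<lambda>(t, x). jacobian (\<lambda>y. \<phi> (t, y)) (at x))"

definition space_div :: "(real \<times> (real^'d) \<Rightarrow> real^'d) \<Rightarrow> real \<times> (real^'d) \<Rightarrow> real" where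
  "space_div \<phi> z = trace (space_jacobian \<phi> z)"

definition space_grad :: "(real \<times> (real^'d) \<Rightarrow> real) \<Rightarrow> real \<times> (real^'d) \<Rightarrow> real^'d" where
  "space_grad \<psi> = (\<lambda>(t, x). grad (\<lambda>y. \<psi> (t, y)) x)"

definition tensor :: "real^'d \<Rightarrow> real^'d \<Rightarrow> real^'d^'d" (infixl "\<otimes>\<^sub>v" 75) where
  "u \<otimes>\<^sub>v v = (\<chi> i j. u $ i * v $ j)"

text \<open>The torus is $\mathbb R^d/\mathbb Z^d$.  Functions on it that occur only up to null sets
  live on the fundamental cell $[0,1)^d$ with Lebesgue measure; smooth functions on it are the
  smooth functions on $\mathbb R^d$ with period 1 in each coordinate.\<close>

definition unit_cell :: "(real^'d) set" where
  "unit_cell = {x. \<forall>i. 0 \<le> x $ i \<and> x $ i < 1}"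

abbreviation torus :: "(real^'d) measure" where
  "torus \<equiv> lebesgue_on unit_cell"

abbreviation space_time :: "real \<Rightarrow> (real \<times> (real^'d)) measure" where
  "space_time T \<equiv> lebesgue_on ({0<..<T} \<times> unit_cell)"

definition periodic :: "(real^'d \<Rightarrow> 'b) \<Rightarrow> bool" where
  "periodic f \<longleftrightarrow> (\<forall>x i. f (x + axis i 1) = f x)"

definition torus_smooth :: "(real^'d \<Rightarrow> real) set" where
  "torus_smooth = {\<psi>. C_infinity \<psi> \<and> periodic \<psi>}"

text \<open>$C_c^\infty([0,T)\times\mathbb T^d)$: smoothness up to $t=0$ is expressed by
  smooth extendability to negative times; only the values at $t\ge 0$ are ever used.
  The support may touch $t=0$ but stays away from $t=T$.\<close>

definition test_functions :: "real \<Rightarrow> (real \<times> (real^'d) \<Rightarrow> 'b::real_normed_vector) set" where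
  "test_functions T = {\<phi>. C_infinity \<phi> \<and> (\<forall>t. periodic (\<lambda>x. \<phi> (t, x)))
     \<and> (\<exists>T'<T. \<forall>t\<ge>T'. \<forall>x. \<phi> (t, x) = 0)}"

text \<open>Distributional divergence.\<close>

definition divergence_free :: "(real^'d \<Rightarrow> real^'d) \<Rightarrow> bool" where
  "divergence_free u \<longleftrightarrow> (\<forall>\<psi>\<in>torus_smooth. (LINT x|torus. grad \<psi> x \<bullet> u x) = 0)"

section \<open>Lebesgue spaces and modes of convergence\<close>

definition L_infinity :: "'a measure \<Rightarrow> ('a \<Rightarrow> 'b::euclidean_space) set" where
  "L_infinity M = {f. f \<in> borel_measurable M \<and> (\<exists>C. AE x in M. norm (f x) \<le> C)}"

definition L_p :: "'a measure \<Rightarrow> real \<Rightarrow> ('a \<Rightarrow> 'b::euclidean_space) set" where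
  "L_p M p = {f. f \<in> borel_measurable M \<and> integrable M (\<lambda>x. norm (f x) powr p)}"

definition L_p_norm :: "'a measure \<Rightarrow> real \<Rightarrow> ('a \<Rightarrow> 'b::euclidean_space) \<Rightarrow> real" where
  "L_p_norm M p f = (LINT x|M. norm (f x) powr p) powr (1 / p)"

definition weakly_converges_L1 ::
  "'a measure \<Rightarrow> ('e \<Rightarrow> 'a \<Rightarrow> 'b::euclidean_space) \<Rightarrow> ('a \<Rightarrow> 'b) \<Rightarrow> 'e filter \<Rightarrow> bool" where
  "weakly_converges_L1 M f l F \<longleftrightarrow>
     (\<forall>\<^sub>F e in F. integrable M (f e)) \<and> integrable M l \<and>
     (\<forall>g\<in>L_infinity M. ((\<lambda>e. LINT x|M. f e x \<bullet> g x) \<longlongrightarrow> (LINT x|M. l x \<bullet> g x)) F)"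

definition strongly_converges_Lp ::
  "'a measure \<Rightarrow> real \<Rightarrow> ('e \<Rightarrow> 'a \<Rightarrow> 'b::euclidean_space) \<Rightarrow> ('a \<Rightarrow> 'b) \<Rightarrow> 'e filter \<Rightarrow> bool" where
  "strongly_converges_Lp M p f l F \<longleftrightarrow>
     (\<forall>\<^sub>F e in F. f e \<in> L_p M p) \<and> l \<in> L_p M p \<and>
     ((\<lambda>e. L_p_norm M p (\<lambda>x. f e x - l x)) \<longlongrightarrow> 0) F"

definition weakstar_converges_Linf ::
  "'a measure \<Rightarrow> (nat \<Rightarrow> 'a \<Rightarrow> real) \<Rightarrow> ('a \<Rightarrow> real) \<Rightarrow> bool" where
  "weakstar_converges_Linf M f l \<longleftrightarrow>
     (\<forall>n. f n \<in> L_infinity M) \<and> l \<in> L_infinity M \<and>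
     (\<forall>g. integrable M g \<longrightarrow> (\<lambda>n. LINT x|M. f n x * g x) \<longlonglongrightarrow> (LINT x|M. l x * g x))"

section \<open>Young measures\<close>

definition C_0 :: "('v::euclidean_space \<Rightarrow> real) set" where
  "C_0 = {f. continuous_on UNIV f \<and> (f \<longlongrightarrow> 0) at_infinity}"

definition pairing ::
  "('z \<Rightarrow> 'v measure) \<Rightarrow> ('v \<Rightarrow> 'b::{banach, second_countable_topology}) \<Rightarrow> 'z \<Rightarrow> 'b" where
  "pairing \<nu> f z = (LINT v|\<nu> z. f v)"

text \<open>Young measures on the measure space \<open>M\<close> with values in the Borel probability measures
  on (the subset \<open>S\<close> of) a Euclidean space.\<close>

definition young_measure ::
  "'z measure \<Rightarrow> 'v::euclidean_space set \<Rightarrow> ('z \<Rightarrow> 'v measure) \<Rightarrow> bool" where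
  "young_measure M S \<nu> \<longleftrightarrow>
     (\<forall>z\<in>space M. prob_space (\<nu> z) \<and> sets (\<nu> z) = sets borel \<and> (AE v in \<nu> z. v \<in> S)) \<and>
     (\<forall>f\<in>C_0. pairing \<nu> f \<in> borel_measurable M)"

definition pushforward ::
  "('v \<Rightarrow> 'w::euclidean_space) \<Rightarrow> ('z \<Rightarrow> 'v measure) \<Rightarrow> 'z \<Rightarrow> 'w measure" where
  "pushforward F \<nu> z = distr (\<nu> z) borel F"

definition young_converges ::
  "'z measure \<Rightarrow> (nat \<Rightarrow> 'z \<Rightarrow> 'v::euclidean_space measure) \<Rightarrow> ('z \<Rightarrow> 'v measure) \<Rightarrow> bool" where
  "young_converges M \<nu> \<mu> \<longleftrightarrow>
     (\<forall>f\<in>C_0. weakstar_converges_Linf M (\<lambda>n. pairing (\<nu> n) f) (pairing \<mu> f))"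

definition supp :: "'v::topological_space measure \<Rightarrow> 'v set" where
  "supp m = {v. \<forall>U. open U \<and> v \<in> U \<longrightarrow> emeasure m U > 0}"

section \<open>Measure-valued solutions of the isentropic Euler system\<close>

text \<open>The conditions on integrability express that all integrals involved exist.
  The inner product of matrices is the Frobenius product $A:B$.\<close>

definition isentropic_momentum_integrand ::
  "real \<Rightarrow> real \<Rightarrow> (real \<times> (real^'d) \<Rightarrow> (real \<times> (real^'d)) measure) \<Rightarrow>
   (real \<times> (real^'d) \<Rightarrow> real^'d) \<Rightarrow> real \<times> (real^'d) \<Rightarrow> real" where
  "isentropic_momentum_integrand \<gamma> \<epsilon> \<nu> \<phi> z =
     time_deriv \<phi> z \<bullet> pairing \<nu> (\<lambda>(\<rho>, u). \<rho> *\<^sub>R u) z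
     + space_jacobian \<phi> z \<bullet> pairing \<nu> (\<lambda>(\<rho>, u). \<rho> *\<^sub>R (u \<otimes>\<^sub>v u)) z
     + pairing \<nu> (\<lambda>(\<rho>, u). 1 / \<epsilon> * \<rho> powr \<gamma>) z * space_div \<phi> z"

definition isentropic_mass_integrand ::
  "(real \<times> (real^'d) \<Rightarrow> (real \<times> (real^'d)) measure) \<Rightarrow>
   (real \<times> (real^'d) \<Rightarrow> real) \<Rightarrow> real \<times> (real^'d) \<Rightarrow> real" where
  "isentropic_mass_integrand \<nu> \<psi> z =
     pairing \<nu> (\<lambda>(\<rho>, u). \<rho>) z * time_deriv \<psi> z
     + space_grad \<psi> z \<bullet> pairing \<nu> (\<lambda>(\<rho>, u). \<rho> *\<^sub>R u) z"

text \<open>Solutions with Mach number $\sqrt\varepsilon$.\<close>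

definition isentropic_mv_solution ::
  "real \<Rightarrow> real \<Rightarrow> real \<Rightarrow> (real^'d \<Rightarrow> real) \<Rightarrow> (real^'d \<Rightarrow> real^'d) \<Rightarrow>
   (real \<times> (real^'d) \<Rightarrow> (real \<times> (real^'d)) measure) \<Rightarrow> bool" where
  "isentropic_mv_solution T \<gamma> \<epsilon> \<rho>0 u0 \<nu> \<longleftrightarrow>
     young_measure (space_time T) ({0..} \<times> UNIV) \<nu> \<and>
     integrable torus \<rho>0 \<and> integrable torus u0 \<and> integrable torus (\<lambda>x. \<rho>0 x *\<^sub>R u0 x) \<and>
     (AE z in space_time T.
        integrable (\<nu> z) (\<lambda>(\<rho>, u). \<rho>) \<and>
        integrable (\<nu> z) (\<lambda>(\<rho>, u). \<rho> *\<^sub>R u) \<and>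
        integrable (\<nu> z) (\<lambda>(\<rho>, u). \<rho> *\<^sub>R (u \<otimes>\<^sub>v u)) \<and>
        integrable (\<nu> z) (\<lambda>(\<rho>, u). 1 / \<epsilon> * \<rho> powr \<gamma>)) \<and>
     (\<forall>\<phi>\<in>test_functions T.
        integrable (space_time T) (isentropic_momentum_integrand \<gamma> \<epsilon> \<nu> \<phi>) \<and>
        (LINT z|space_time T. isentropic_momentum_integrand \<gamma> \<epsilon> \<nu> \<phi> z)
          = - (LINT x|torus. \<phi> (0, x) \<bullet> (\<rho>0 x *\<^sub>R u0 x))) \<and>
     (\<forall>\<psi>\<in>test_functions T.
        integrable (space_time T) (isentropic_mass_integrand \<nu> \<psi>) \<and>
        (LINT z|space_time T. isentropic_mass_integrand \<nu> \<psi> z)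
          = - (LINT x|torus. \<rho>0 x * \<psi> (0, x)))"

definition isentropic_energy :: "real \<Rightarrow> real \<Rightarrow> real \<times> (real^'d) \<Rightarrow> real" where
  "isentropic_energy \<gamma> \<epsilon> =
     (\<lambda>(\<rho>, u). 1 / 2 * \<rho> * (norm u)\<^sup>2 + 1 / (\<gamma> - 1) * (1 / \<epsilon>) * \<rho> powr \<gamma>)"

text \<open>Energies are non-negative, so that their integrals always exist in $[0,\infty]$.\<close>

definition isentropic_energy_admissible ::
  "real \<Rightarrow> real \<Rightarrow> real \<Rightarrow> (real^'d \<Rightarrow> real) \<Rightarrow> (real^'d \<Rightarrow> real^'d) \<Rightarrow>
   (real \<times> (real^'d) \<Rightarrow> (real \<times> (real^'d)) measure) \<Rightarrow> bool" where
  "isentropic_energy_admissible T \<gamma> \<epsilon> \<rho>0 u0 \<nu> \<longleftrightarrow>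
     esssup (lebesgue_on {0<..<T})
        (\<lambda>t. \<integral>\<^sup>+x. (\<integral>\<^sup>+v. ennreal (isentropic_energy \<gamma> \<epsilon> v) \<partial>\<nu> (t, x)) \<partial>torus)
       \<le> (\<integral>\<^sup>+x. ennreal (isentropic_energy \<gamma> \<epsilon> (\<rho>0 x, u0 x)) \<partial>torus) \<and>
     (\<integral>\<^sup>+x. ennreal (isentropic_energy \<gamma> \<epsilon> (\<rho>0 x, u0 x)) \<partial>torus) < \<infinity>"

section \<open>Augmented measure-valued solutions of the incompressible Euler system\<close>

definition incompressible_momentum_integrand ::
  "(real \<times> (real^'d) \<Rightarrow> ((real^'d) \<times> real) measure) \<Rightarrow>
   (real \<times> (real^'d) \<Rightarrow> real^'d) \<Rightarrow> real \<times> (real^'d) \<Rightarrow> real" where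
  "incompressible_momentum_integrand \<mu> \<phi> z =
     time_deriv \<phi> z \<bullet> pairing \<mu> (\<lambda>(u, P). u) z
     + space_jacobian \<phi> z \<bullet> pairing \<mu> (\<lambda>(u, P). u \<otimes>\<^sub>v u) z
     + pairing \<mu> (\<lambda>(u, P). P) z * space_div \<phi> z"

definition augmented_mv_solution ::
  "real \<Rightarrow> (real^'d \<Rightarrow> real^'d) \<Rightarrow> (real \<times> (real^'d) \<Rightarrow> ((real^'d) \<times> real) measure) \<Rightarrow> bool" where
  "augmented_mv_solution T u0 \<mu> \<longleftrightarrow>
     young_measure (space_time T) UNIV \<mu> \<and>
     integrable torus u0 \<and>
     (AE z in space_time T.
        integrable (\<mu> z) (\<lambda>(u, P). u) \<and>
        integrable (\<mu> z) (\<lambda>(u, P). u \<otimes>\<^sub>v u) \<and>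
        integrable (\<mu> z) (\<lambda>(u, P). P) \<and>
        integrable (\<mu> z) (\<lambda>(u, P). (norm u)\<^sup>2)) \<and>
     pairing \<mu> (\<lambda>(u, P). (norm u)\<^sup>2) \<in> L_infinity (space_time T) \<and>
     (\<forall>\<phi>\<in>test_functions T.
        integrable (space_time T) (incompressible_momentum_integrand \<mu> \<phi>) \<and>
        (LINT z|space_time T. incompressible_momentum_integrand \<mu> \<phi> z)
          = - (LINT x|torus. \<phi> (0, x) \<bullet> u0 x)) \<and>
     (\<forall>\<psi>\<in>torus_smooth. AE t in lebesgue_on {0<..<T}.
        integrable torus (\<lambda>x. grad \<psi> x \<bullet> pairing \<mu> (\<lambda>(u, P). u) (t, x)) \<and>
        (LINT x|torus. grad \<psi> x \<bullet> pairing \<mu> (\<lambda>(u, P). u) (t, x)) = 0)"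

definition augmented_energy_admissible ::
  "real \<Rightarrow> (real^'d \<Rightarrow> real^'d) \<Rightarrow> (real \<times> (real^'d) \<Rightarrow> ((real^'d) \<times> real) measure) \<Rightarrow> bool" where
  "augmented_energy_admissible T u0 \<mu> \<longleftrightarrow>
     u0 \<in> L_p torus 2 \<and>
     esssup (lebesgue_on {0<..<T})
        (\<lambda>t. \<integral>\<^sup>+x. (\<integral>\<^sup>+(u, P). ennreal (1 / 2 * (norm u)\<^sup>2) \<partial>\<mu> (t, x)) \<partial>torus)
       \<le> (\<integral>\<^sup>+x. ennreal (1 / 2 * (norm (u0 x))\<^sup>2) \<partial>torus)"

section \<open>Pressure lifts\<close>

definition rescaled_pressure :: "real \<Rightarrow> real \<Rightarrow> real \<Rightarrow> real \<Rightarrow> real" where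
  "rescaled_pressure \<gamma> \<rho>bar \<epsilon> \<rho> = 1 / (\<epsilon> * \<rho>bar) * (\<rho> powr \<gamma> - \<rho>bar powr \<gamma>)"

definition T_lift ::
  "real \<Rightarrow> real \<Rightarrow> real \<Rightarrow> real \<times> (real^'d) \<Rightarrow> real \<times> ((real^'d) \<times> real)" where
  "T_lift \<gamma> \<rho>bar \<epsilon> = (\<lambda>(\<rho>, u). (\<rho>, u, rescaled_pressure \<gamma> \<rho>bar \<epsilon> \<rho>))"

definition P_lift :: "real \<Rightarrow> real \<Rightarrow> real \<Rightarrow> real \<times> (real^'d) \<Rightarrow> (real^'d) \<times> real" where
  "P_lift \<gamma> \<rho>bar \<epsilon> = (\<lambda>(\<rho>, u). (u, rescaled_pressure \<gamma> \<rho>bar \<epsilon> \<rho>))"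

end

theory Submission
  imports Defs
begin

text \<open>Since the rescaled pressures stay bounded, the densities are $\bar\rho + O(\varepsilon)$.
  Test functions that decay linearly to zero at a time close to $0$ transfer confinement to the
  initial data: the mass balance gives $|\rho_0^\varepsilon - \bar\rho| = O(\varepsilon)$ and the
  momentum balance gives a uniform bound on $u_0^\varepsilon$, so that
  $\rho_0^\varepsilon u_0^\varepsilon$ converges weakly to $\bar\rho u_0$.  Divided by $\bar\rho$, the
  isentropic balance laws thus agree with the incompressible ones up to $O(\varepsilon)$; the constant
  part of the pressure drops out because a divergence integrates to zero over the torus.

  The lifted measures live on a fixed compact set, which a Borel map codes by points of an interval.
  On the interval a Young measure is described by its distribution functions at rational points, and
  weak-* sequential compactness of bounded sets in $L^\infty$ yields the limit.  Coding by a
  continuous curve turns convergence on the interval into convergence on the compact set.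

  For the energy, the tangent of $\rho^\gamma$ at $\bar\rho$ and conservation of mass cancel the
  internal energies, which are of order $1/\varepsilon$, up to $O(\varepsilon)$.\<close>

section \<open>Smooth functions and ramps in time\<close>

text \<open>The initial data are only known to converge weakly in L^1, yet the product \<rho> u has
  to pass to the limit, so pointwise bounds on the data must be extracted from the equations at each
  fixed \<epsilon>. In a balance tested with a ramp of length s the time derivative contributes a
  term of order s and the flux one of order s^2. After division by s and s -> 0 only the former
  survives, so even a pressure of size 1/\<epsilon> does no harm and the bound is uniform in
  \<epsilon>. Integrals against nonnegative smooth periodic functions turn into pointwise bounds
  because such functions approximate indicators of open sets.

  Distribution functions suit weak-* limits: they take values in [0,1], and monotonicity and
  normalization at rational points survive the limit and determine a probability measure. This
  requires a one-dimensional state space, hence the coding. The code itself is merely Borel, but its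
  left inverse is continuous, so continuous functions of the state become continuous functions of
  the code.\<close>

lemma C_k_SucI:
  assumes "\<And>x. (f has_derivative f' x) (at x)" "\<And>b. b \<in> Basis \<Longrightarrow> C_k k (\<lambda>x. f' x b)"
  shows "C_k (Suc k) f"
proof -
  have "frechet_derivative f (at x) = f' x" for x
    using frechet_derivative_at[OF assms(1)[of x]] by simp
  then show ?thesis
    using assms by (auto simp: differentiable_def)
qed

lemma C_k_Suc_has_derivative:
  "C_k (Suc k) f \<Longrightarrow> (f has_derivative frechet_derivative f (at x)) (at x)"
  by (simp add: frechet_derivative_works)

lemma C_k_SucD: "C_k (Suc k) f \<Longrightarrow> C_k k f"
proof (induction k arbitrary: f)
  case 0
  then show ?case
    by (simp add: differentiable_imp_continuous_on differentiable_on_def differentiable_at_withinI)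
next
  case (Suc k)
  then show ?case by simp
qed

lemma C_k_const [intro]: "C_k k (\<lambda>x. c)"
proof (induction k arbitrary: c)
  case (Suc k)
  show ?case by (rule C_k_SucI[where f' = "\<lambda>x h. 0"]) (use Suc in auto)
qed simp

lemma C_k_add: "C_k k f \<Longrightarrow> C_k k g \<Longrightarrow> C_k k (\<lambda>x. f x + g x)"
proof (induction k arbitrary: f g)
  case 0
  then show ?case by (auto intro: continuous_intros)
next
  case (Suc k)
  show ?case
  proof (rule C_k_SucI)
    show "((\<lambda>x. f x + g x) has_derivative
      (\<lambda>h. frechet_derivative f (at x) h + frechet_derivative g (at x) h)) (at x)" for x
      by (rule has_derivative_add[OF C_k_Suc_has_derivative[OF Suc.prems(1)]
          C_k_Suc_has_derivative[OF Suc.prems(2)]])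
  qed (use Suc in auto)
qed

lemma (in bounded_linear) C_k: "C_k k g \<Longrightarrow> C_k k (\<lambda>x. f (g x))"
proof (induction k arbitrary: g)
  case 0
  then show ?case by (auto intro: continuous_on)
next
  case (Suc k)
  show ?case
    by (rule C_k_SucI[OF has_derivative[OF C_k_Suc_has_derivative[OF Suc.prems]]]) (use Suc in auto)
qed

lemma (in bounded_bilinear) C_k: "C_k k f \<Longrightarrow> C_k k g \<Longrightarrow> C_k k (\<lambda>x. prod (f x) (g x))"
proof (induction k arbitrary: f g)
  case 0
  then show ?case by (auto intro: continuous_on)
next
  case (Suc k)
  show ?case
  proof (rule C_k_SucI[OF FDERIV[OF C_k_Suc_has_derivative[OF Suc.prems(1)]
        C_k_Suc_has_derivative[OF Suc.prems(2)]]])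
    fix b :: 'd assume b: "b \<in> Basis"
    show "C_k k (\<lambda>x. prod (f x) (frechet_derivative g (at x) b) + prod (frechet_derivative f (at x) b) (g x))"
      using b Suc.prems C_k_SucD[OF Suc.prems(1)] C_k_SucD[OF Suc.prems(2)]
      by (intro C_k_add Suc.IH) auto
  qed
qed

lemma C_k_sum: "(\<And>i. i \<in> I \<Longrightarrow> C_k k (f i)) \<Longrightarrow> C_k k (\<lambda>x. \<Sum>i\<in>I. f i x)"
  by (induction I rule: infinite_finite_induct) (auto intro: C_k_add)

lemma C_k_compose_linear:
  fixes L :: "'a::euclidean_space \<Rightarrow> 'b::euclidean_space"
  assumes L: "bounded_linear L"
  shows "C_k k f \<Longrightarrow> C_k k (\<lambda>x. f (L x))"
proof (induction k arbitrary: f)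
  case 0
  have "continuous_on UNIV L"
    using L by (simp add: linear_continuous_on)
  then show ?case
    using 0 continuous_on_compose2[of UNIV f UNIV L] by simp
next
  case (Suc k)
  show ?case
  proof (rule C_k_SucI)
    show "((\<lambda>x. f (L x)) has_derivative (\<lambda>h. frechet_derivative f (at (L x)) (L h))) (at x)" for x
      by (rule has_derivative_compose[OF bounded_linear_imp_has_derivative[OF L]
            C_k_Suc_has_derivative[OF Suc.prems]])
  next
    fix b :: 'a assume b: "b \<in> Basis"
    \<comment> \<open>\<open>C_k\<close> speaks of derivatives along basis vectors only, and L b
      need not be one, so the directional derivative is expanded in the basis.\<close>
    have "frechet_derivative f (at (L x)) (L b) =
        (\<Sum>i\<in>Basis. (L b \<bullet> i) *\<^sub>R frechet_derivative f (at (L x)) i)" for x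
    proof -
      have lin: "linear (frechet_derivative f (at (L x)))"
        using C_k_Suc_has_derivative[OF Suc.prems] has_derivative_linear by blast
      have "frechet_derivative f (at (L x)) (L b) =
          frechet_derivative f (at (L x)) (\<Sum>i\<in>Basis. (L b \<bullet> i) *\<^sub>R i)"
        by (simp add: euclidean_representation)
      then show ?thesis
        by (simp add: linear_sum[OF lin] linear_cmul[OF lin])
    qed
    then show "C_k k (\<lambda>x. frechet_derivative f (at (L x)) (L b))"
      using Suc.prems
      by (auto intro!: C_k_sum bounded_linear.C_k[OF bounded_linear_scaleR_right] Suc.IH)
  qed
qed

lemma C_k_compose_real:
  fixes F :: "real \<Rightarrow> 'b::real_normed_vector" and f :: "'a::euclidean_space \<Rightarrow> real"
  shows "C_k k F \<Longrightarrow> C_k k f \<Longrightarrow> C_k k (\<lambda>x. F (f x))"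
proof (induction k arbitrary: F)
  case 0
  then show ?case
    using continuous_on_compose2[of UNIV F UNIV f] by simp
next
  case (Suc k)
  show ?case
  proof (rule C_k_SucI)
    show "((\<lambda>x. F (f x)) has_derivative
      (\<lambda>h. frechet_derivative F (at (f x)) (frechet_derivative f (at x) h))) (at x)" for x
      by (rule has_derivative_compose[OF C_k_Suc_has_derivative[OF Suc.prems(2)]
          C_k_Suc_has_derivative[OF Suc.prems(1)]])
  next
    fix b :: 'a assume b: "b \<in> Basis"
    have "frechet_derivative F (at (f x)) (frechet_derivative f (at x) b) =
       frechet_derivative f (at x) b *\<^sub>R frechet_derivative F (at (f x)) 1" for x
      using linear_cmul[of "frechet_derivative F (at (f x))" "frechet_derivative f (at x) b" 1]
        C_k_Suc_has_derivative[OF Suc.prems(1)] has_derivative_linear by fastforce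
    moreover have "C_k k (\<lambda>x. frechet_derivative F (at (f x)) 1)"
      using Suc.prems(1) C_k_SucD[OF Suc.prems(2)] by (intro Suc.IH) auto
    ultimately show "C_k k (\<lambda>x. frechet_derivative F (at (f x)) (frechet_derivative f (at x) b))"
      using b Suc.prems by (auto intro!: bounded_bilinear.C_k[OF bounded_bilinear_scaleR])
  qed
qed

lemma C_infinity_const [intro]: "C_infinity (\<lambda>x. c)"
  by (simp add: C_infinity_def C_k_const)

lemma C_infinity_add: "C_infinity f \<Longrightarrow> C_infinity g \<Longrightarrow> C_infinity (\<lambda>x. f x + g x)"
  by (simp add: C_infinity_def C_k_add)

lemma C_infinity_mult:
  fixes f g :: "'a::euclidean_space \<Rightarrow> real"
  shows "C_infinity f \<Longrightarrow> C_infinity g \<Longrightarrow> C_infinity (\<lambda>x. f x * g x)"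
  by (simp add: C_infinity_def bounded_bilinear.C_k[OF bounded_bilinear_mult])

lemma C_infinity_scaleR:
  "C_infinity f \<Longrightarrow> C_infinity g \<Longrightarrow> C_infinity (\<lambda>x. f x *\<^sub>R g x)"
  by (simp add: C_infinity_def bounded_bilinear.C_k[OF bounded_bilinear_scaleR])

lemma C_infinity_sum: "(\<And>i. i \<in> I \<Longrightarrow> C_infinity (f i)) \<Longrightarrow> C_infinity (\<lambda>x. \<Sum>i\<in>I. f i x)"
  by (simp add: C_infinity_def C_k_sum)

lemma C_infinity_prod:
  fixes f :: "'i \<Rightarrow> 'a::euclidean_space \<Rightarrow> real"
  shows "(\<And>i. i \<in> I \<Longrightarrow> C_infinity (f i)) \<Longrightarrow> C_infinity (\<lambda>x. \<Prod>i\<in>I. f i x)"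
  by (induction I rule: infinite_finite_induct) (auto intro: C_infinity_mult)

lemma C_infinity_compose_linear:
  fixes L :: "'a::euclidean_space \<Rightarrow> 'b::euclidean_space"
  shows "bounded_linear L \<Longrightarrow> C_infinity f \<Longrightarrow> C_infinity (\<lambda>x. f (L x))"
  by (simp add: C_infinity_def C_k_compose_linear)

lemma C_infinity_compose_real:
  fixes F :: "real \<Rightarrow> 'b::real_normed_vector" and f :: "'a::euclidean_space \<Rightarrow> real"
  shows "C_infinity F \<Longrightarrow> C_infinity f \<Longrightarrow> C_infinity (\<lambda>x. F (f x))"
  by (simp add: C_infinity_def C_k_compose_real)

lemma C_infinity_bounded_linear: "bounded_linear f \<Longrightarrow> C_infinity f"
  unfolding C_infinity_def
proof
  fix k assume f: "bounded_linear f"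
  show "C_k k f"
  proof (cases k)
    case 0
    then show ?thesis using f by (simp add: linear_continuous_on)
  next
    case (Suc l)
    then show ?thesis
      using C_k_SucI[OF bounded_linear_imp_has_derivative[OF f]] by blast
  qed
qed

section \<open>Cosine and flat bump functions\<close>

lemma C_infinity_cos: "C_infinity (cos :: real \<Rightarrow> real)"
proof -
  \<comment> \<open>Generalized to all amplitudes and phases: differentiation only shifts the phase
    by pi / 2, so the family is closed under it.\<close>
  have "C_k k (\<lambda>x::real. c * cos (x + d))" for k and c d :: real
  proof (induction k arbitrary: c d)
    case 0
    show ?case by (auto intro!: continuous_intros)
  next
    case (Suc k)
    have "((\<lambda>x. c * cos (x + d)) has_derivative (\<lambda>h. (c * h) * cos (x + (d + pi / 2)))) (at x)" for x
    proof -
      have "cos (x + (d + pi / 2)) = - sin (x + d)"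
        using minus_sin_cos_eq[of "x + d"] by (simp add: add.assoc)
      then show ?thesis
        by (auto intro!: derivative_eq_intros)
    qed
    then show ?case
      by (rule C_k_SucI) (use Suc in auto)
  qed
  from this[where c = 1 and d = 0] show ?thesis
    by (simp add: C_infinity_def)
qed

text \<open>The case n = 0 is the classical flat function exp (-1/y). The power is carried as an
  index because the derivative of one member of the family is a combination of two others.\<close>

definition bump_fun :: "nat \<Rightarrow> real \<Rightarrow> real" where
  "bump_fun n y = (if 0 < y then (1 / y) ^ n * exp (- (1 / y)) else 0)"

abbreviation bump :: "real \<Rightarrow> real" where "bump \<equiv> bump_fun 0"

text \<open>A single term of the exponential series is at most the whole sum.\<close>

lemma power_le_fact_exp: "0 \<le> x \<Longrightarrow> x ^ n \<le> fact n * exp (x::real)"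
proof -
  assume x: "0 \<le> x"
  have "x ^ n / fact n \<le> exp x"
  proof -
    have "(\<Sum>i\<in>{n}. x ^ i /\<^sub>R fact i) \<le> (\<Sum>i. x ^ i /\<^sub>R fact i)"
      by (rule sum_le_suminf) (use x summable_exp_generic[of x] in auto)
    then show ?thesis by (simp add: exp_def divide_inverse mult.commute)
  qed
  then show ?thesis by (simp add: field_simps)
qed

lemma bump_fun_nonneg: "0 \<le> bump_fun n y"
  by (simp add: bump_fun_def)

text \<open>The exponential beats every power, so the decay at the origin can be chosen: m = 2 makes
  the difference quotient at 0 vanish in the limit, m = 0 gives boundedness.\<close>

lemma bump_fun_le: "bump_fun n y \<le> fact (n + m) * \<bar>y\<bar> ^ m"
proof (cases "0 < y")
  case True
  have "(1 / y) ^ (n + m) \<le> fact (n + m) * exp (1 / y)"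
    using True by (intro power_le_fact_exp) simp
  then have "(1 / y) ^ (n + m) / exp (1 / y) \<le> fact (n + m)"
    by (subst pos_divide_le_eq) auto
  then have "(1 / y) ^ (n + m) * exp (- (1 / y)) \<le> fact (n + m)"
    by (simp only: exp_minus divide_inverse)
  then have "(1 / y) ^ (n + m) * exp (- (1 / y)) * y ^ m \<le> fact (n + m) * y ^ m"
    using True by (intro mult_right_mono) auto
  moreover have "(1 / y) ^ (n + m) * exp (- (1 / y)) * y ^ m = bump_fun n y"
    using True by (simp add: bump_fun_def power_add power_one_over)
  ultimately show ?thesis using True by simp
qed (simp add: bump_fun_def)

lemma bump_fun_has_real_derivative:
  "(bump_fun n has_real_derivative (bump_fun (n + 2) y - real n * bump_fun (n + 1) y)) (at y)"
proof -
  consider "y > 0" | "y < 0" | "y = 0" by linarith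
  then show ?thesis
  proof cases
    case 1
    have inv: "((\<lambda>y. 1 / y) has_real_derivative - ((1 / y) ^ 2)) (at y)"
      using 1 by (auto intro!: derivative_eq_intros simp: power2_eq_square)
    have "((\<lambda>y. (1 / y) ^ n * exp (- (1 / y))) has_real_derivative
       real n * (1 / y) ^ (n - 1) * - ((1 / y) ^ 2) * exp (- (1 / y))
       + exp (- (1 / y)) * ((1 / y) ^ 2) * (1 / y) ^ n) (at y)"
      by (rule derivative_eq_intros inv refl | simp)+
    \<comment> \<open>The exponent n - 1 is truncated at n = 0, where the factor n vanishes; hence
      the case split.\<close>
    moreover have "real n * z ^ (n - 1) * - (z ^ 2) * e + e * z ^ 2 * z ^ n
       = z ^ (n + 2) * e - real n * (z ^ (n + 1) * e)" for z e :: real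
      by (cases n) (simp_all add: power2_eq_square algebra_simps)
    ultimately have "((\<lambda>y. (1 / y) ^ n * exp (- (1 / y))) has_real_derivative
       (bump_fun (n + 2) y - real n * bump_fun (n + 1) y)) (at y)"
      using 1 by (simp add: bump_fun_def del: power_Suc power_Suc2)
    then show ?thesis
    proof (rule has_field_derivative_transform_within_open[where S = "{0<..}"])
    qed (use 1 in \<open>auto simp: bump_fun_def\<close>)
  next
    case 2
    have "((\<lambda>y. 0::real) has_real_derivative 0) (at y)" by simp
    then have "(bump_fun n has_real_derivative 0) (at y)"
    proof (rule has_field_derivative_transform_within_open[where S = "{..<0}"])
    qed (use 2 in \<open>auto simp: bump_fun_def\<close>)
    then show ?thesis using 2 by (simp add: bump_fun_def)
  next
    case 3
    have "(bump_fun n has_real_derivative 0) (at 0)"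
      unfolding has_field_derivative_iff
    proof (rule Lim_null_comparison)
      show "\<forall>\<^sub>F h in at 0. norm ((bump_fun n h - bump_fun n 0) / (h - 0)) \<le> fact (n + 2) * \<bar>h\<bar>"
      proof (rule eventuallyI)
        fix h :: real
        show "norm ((bump_fun n h - bump_fun n 0) / (h - 0)) \<le> fact (n + 2) * \<bar>h\<bar>"
        proof (cases "h = 0")
          case False
          have "norm ((bump_fun n h - bump_fun n 0) / (h - 0)) = bump_fun n h / \<bar>h\<bar>"
            by (simp add: bump_fun_def[of n 0] bump_fun_nonneg)
          also have "\<dots> \<le> fact (n + 2) * \<bar>h\<bar> ^ 2 / \<bar>h\<bar>"
            by (intro divide_right_mono bump_fun_le) simp
          also have "\<dots> = fact (n + 2) * \<bar>h\<bar>"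
            using False by (simp add: power2_eq_square del: power2_abs fact_Suc abs_mult_self_eq)
          finally show ?thesis .
        qed simp
      qed
      show "((\<lambda>h. fact (n + 2) * \<bar>h\<bar>) \<longlongrightarrow> 0) (at (0::real))"
        by (auto intro!: tendsto_eq_intros)
    qed
    then show ?thesis using 3 by (simp add: bump_fun_def)
  qed
qed

lemma C_infinity_bump_fun: "C_infinity (bump_fun n)"
proof -
  have "C_k k (bump_fun n)" for k
  proof (induction k arbitrary: n)
    case 0
    show ?case
      using bump_fun_has_real_derivative[of n]
      by (auto intro!: continuous_at_imp_continuous_on DERIV_isCont)
  next
    case (Suc k)
    show ?case
    proof (rule C_k_SucI)
      show "(bump_fun n has_derivative (\<lambda>h. (bump_fun (n + 2) y - real n * bump_fun (n + 1) y) * h)) (at y)" for y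
        using bump_fun_has_real_derivative[of n y] by (simp add: has_field_derivative_def)
      have "C_k k (\<lambda>y. bump_fun (n + 2) y + (- real n) * bump_fun (n + 1) y)"
        by (intro C_k_add Suc bounded_linear.C_k[OF bounded_linear_mult_right])
      then show "C_k k (\<lambda>y. (bump_fun (n + 2) y - real n * bump_fun (n + 1) y) * b)" if "b \<in> Basis" for b
        using that by simp
    qed
  qed
  then show ?thesis by (simp add: C_infinity_def)
qed

lemma bump_pos_iff: "0 < bump y \<longleftrightarrow> 0 < y"
  by (simp add: bump_fun_def)

lemma bump_le_1: "bump y \<le> 1"
  by (simp add: bump_fun_def)

text \<open>Used twice: it sharpens the ramps in time, and it turns a smooth periodic function into
  the indicator of the set where it is positive.\<close>

lemma bump_tendsto_indicator: "(\<lambda>k. bump (real k * y)) \<longlonglongrightarrow> indicator {0<..} y"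
proof (cases "0 < y")
  case True
  have "(\<lambda>k. exp (- (1 / (real k * y)))) \<longlonglongrightarrow> exp (- 0)"
  proof (intro tendsto_intros)
    have "(\<lambda>k. (1 / y) * (1 / real k)) \<longlonglongrightarrow> (1 / y) * 0"
      by (intro tendsto_intros lim_1_over_n)
    then show "(\<lambda>k. 1 / (real k * y)) \<longlonglongrightarrow> 0" by (simp add: field_simps)
  qed
  moreover have "\<forall>\<^sub>F k in sequentially. exp (- (1 / (real k * y))) = bump (real k * y)"
    using True by (intro eventually_sequentiallyI[of 1]) (auto simp: bump_fun_def)
  ultimately show ?thesis
    using True by (simp add: tendsto_cong)
next
  case False
  then have "bump (real k * y) = 0" for k
    by (simp add: bump_fun_def zero_less_mult_iff)
  then show ?thesis using False by simp
qed

lemma bump_fun_1_tendsto: "(\<lambda>k. bump_fun 1 (real k * y)) \<longlonglongrightarrow> 0"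
proof (cases "0 < y")
  case True
  have "(\<lambda>k. 1 / y * (1 / real k)) \<longlonglongrightarrow> 1 / y * 0"
    by (intro tendsto_intros lim_1_over_n)
  then have lim: "(\<lambda>k. 1 / (real k * y)) \<longlonglongrightarrow> 0" by (simp add: field_simps)
  show ?thesis
  proof (rule tendsto_sandwich[OF _ _ tendsto_const lim])
    show "\<forall>\<^sub>F k in sequentially. 0 \<le> bump_fun 1 (real k * y)"
      by (simp add: bump_fun_nonneg)
    show "\<forall>\<^sub>F k in sequentially. bump_fun 1 (real k * y) \<le> 1 / (real k * y)"
      using True by (intro eventually_sequentiallyI[of 1])
        (auto simp: bump_fun_def field_simps)
  qed
next
  case False
  then have "bump_fun 1 (real k * y) = 0" for k
    by (simp add: bump_fun_def zero_less_mult_iff)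
  then show ?thesis by simp
qed

section \<open>Partial derivatives on space-time and separated test functions\<close>

lemma C_infinity_has_derivative:
  "C_infinity f \<Longrightarrow> (f has_derivative frechet_derivative f (at x)) (at x)"
  unfolding C_infinity_def using C_k_Suc_has_derivative by blast

lemma C_infinity_continuous_on: "C_infinity f \<Longrightarrow> continuous_on S f"
  using continuous_on_subset[of UNIV f S] C_k.simps(1)[of f] unfolding C_infinity_def by blast

lemma C_infinity_frechet_derivative_continuous:
  assumes "C_infinity f" "b \<in> Basis"
  shows "continuous_on UNIV (\<lambda>x. frechet_derivative f (at x) b)"
proof -
  have "C_k (Suc 0) f" using assms(1) C_infinity_def by blast
  then show ?thesis using assms(2) by simp
qed

lemma time_slice_has_vector_derivative:
  assumes "C_infinity \<phi>"
  shows "((\<lambda>s. \<phi> (s, x)) has_vector_derivative frechet_derivative \<phi> (at (t, x)) (1, 0)) (at t)"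
proof -
  have "((\<lambda>s. (s, x)) has_derivative (\<lambda>h. (h, 0))) (at t)"
    by (intro has_derivative_Pair has_derivative_ident has_derivative_const)
  from has_derivative_compose[OF this C_infinity_has_derivative[OF assms, of "(t, x)"]]
  have "((\<lambda>s. \<phi> (s, x)) has_derivative (\<lambda>h. frechet_derivative \<phi> (at (t, x)) (h, 0))) (at t)" .
  moreover have "(\<lambda>h. frechet_derivative \<phi> (at (t, x)) (h, 0)) = (\<lambda>h. h *\<^sub>R frechet_derivative \<phi> (at (t, x)) (1, 0))"
  proof
    fix h
    show "frechet_derivative \<phi> (at (t, x)) (h, 0) = h *\<^sub>R frechet_derivative \<phi> (at (t, x)) (1, 0)"
      using linear_cmul[OF has_derivative_linear[OF C_infinity_has_derivative[OF assms, of "(t, x)"]], of h "(1, 0)"]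
      by (simp only: scaleR_Pair scaleR_zero_right real_scaleR_def mult_1_right)
  qed
  ultimately show ?thesis by (simp only: has_vector_derivative_def)
qed

lemma space_slice_has_derivative:
  assumes "C_infinity \<phi>"
  shows "((\<lambda>y. \<phi> (t, y)) has_derivative (\<lambda>h. frechet_derivative \<phi> (at (t, x)) (0, h))) (at x)"
proof -
  have "((\<lambda>y. (t, y)) has_derivative (\<lambda>h. (0, h))) (at x)"
    by (intro has_derivative_Pair has_derivative_ident has_derivative_const)
  from has_derivative_compose[OF this C_infinity_has_derivative[OF assms, of "(t, x)"]]
  show ?thesis .
qed

lemma time_deriv_eq:
  "C_infinity \<phi> \<Longrightarrow> time_deriv \<phi> z = frechet_derivative \<phi> (at z) (1, 0)"
  by (cases z) (simp add: time_deriv_def vector_derivative_at[OF time_slice_has_vector_derivative])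

lemma space_jacobian_eq:
  "C_infinity \<phi> \<Longrightarrow> space_jacobian \<phi> z = (\<chi> i j. frechet_derivative \<phi> (at z) (0, axis j 1) $ i)"
  by (cases z) (simp add: space_jacobian_def jacobian_def matrix_def
      frechet_derivative_at[OF space_slice_has_derivative, symmetric])

lemma zero_axis_in_Basis: "((0, axis j 1) :: real \<times> (real^'d)) \<in> Basis"
  by (auto simp: Basis_prod_def axis_in_Basis_iff)

lemma one_zero_in_Basis: "((1, 0) :: real \<times> 'a::euclidean_space) \<in> Basis"
  by (auto simp: Basis_prod_def)

lemma continuous_on_time_deriv: "C_infinity \<phi> \<Longrightarrow> continuous_on UNIV (time_deriv \<phi>)"
  using C_infinity_frechet_derivative_continuous[OF _ one_zero_in_Basis]
  by (simp add: time_deriv_eq)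

lemma continuous_on_space_jacobian: "C_infinity \<phi> \<Longrightarrow> continuous_on UNIV (space_jacobian \<phi>)"
  using C_infinity_frechet_derivative_continuous[OF _ zero_axis_in_Basis]
  by (auto simp: space_jacobian_eq intro!: continuous_on_vec_lambda continuous_on_component)

lemma continuous_on_space_div: "C_infinity \<phi> \<Longrightarrow> continuous_on UNIV (space_div \<phi>)"
  unfolding space_div_def[abs_def] trace_def
  by (intro continuous_intros continuous_on_component continuous_on_space_jacobian)

lemma continuous_on_bounded_set:
  fixes f :: "'a::euclidean_space \<Rightarrow> 'b::real_normed_vector"
  assumes "continuous_on UNIV f" "bounded S"
  obtains C where "0 \<le> C" "\<And>z. z \<in> S \<Longrightarrow> norm (f z) \<le> C"
proof -
  have "compact (f ` closure S)"
    using assms by (intro compact_continuous_image) (auto intro: continuous_on_subset)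
  then have "bounded (f ` closure S)" by (rule compact_imp_bounded)
  then obtain C where "\<And>z. z \<in> closure S \<Longrightarrow> norm (f z) \<le> C"
    by (auto simp: bounded_iff)
  then show ?thesis
    using closure_subset[of S] by (intro that[of "max 0 C"]) (auto simp: max.coboundedI2)
qed

text \<open>Products of a time profile and a function of space localize the balance laws in time;
  the differential operators factor on them, as the lemmas below record.\<close>

lemma separated_test_function:
  assumes "C_infinity \<theta>" "\<And>t. T' \<le> t \<Longrightarrow> \<theta> t = 0" "T' < T" "C_infinity G" "periodic G"
  shows "(\<lambda>(t, x). \<theta> t *\<^sub>R G x) \<in> test_functions T"
proof -
  have "C_infinity (\<lambda>z. \<theta> (fst z) *\<^sub>R G (snd z))"
    by (rule C_infinity_scaleR[OF C_infinity_compose_linear[OF bounded_linear_fst assms(1)]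
          C_infinity_compose_linear[OF bounded_linear_snd assms(4)]])
  then show ?thesis
    using assms by (auto simp: test_functions_def case_prod_unfold periodic_def)
qed

lemma time_deriv_separated:
  assumes "(\<theta> has_real_derivative c) (at (fst z))"
  shows "time_deriv (\<lambda>(t, x). \<theta> t *\<^sub>R G x) z = c *\<^sub>R G (snd z)"
proof -
  have "((\<lambda>s. \<theta> s *\<^sub>R G (snd z)) has_vector_derivative c *\<^sub>R G (snd z)) (at (fst z))"
    using assms by (auto intro!: derivative_eq_intros)
  then show ?thesis
    by (cases z) (simp add: time_deriv_def vector_derivative_at)
qed

lemma frechet_derivative_scaleR_left:
  assumes "C_infinity G"
  shows "frechet_derivative (\<lambda>y. c *\<^sub>R G y) (at x) h = c *\<^sub>R frechet_derivative G (at x) h"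
proof -
  have "((\<lambda>y. c *\<^sub>R G y) has_derivative (\<lambda>h. c *\<^sub>R frechet_derivative G (at x) h)) (at x)"
    by (intro has_derivative_scaleR_right C_infinity_has_derivative assms)
  from frechet_derivative_at[OF this] show ?thesis by metis
qed

lemma space_jacobian_separated:
  "C_infinity G \<Longrightarrow>
    space_jacobian (\<lambda>(t, x). \<theta> t *\<^sub>R G x) z = \<theta> (fst z) *\<^sub>R jacobian G (at (snd z))"
  by (cases z) (simp add: space_jacobian_def jacobian_def matrix_def vec_eq_iff
      frechet_derivative_scaleR_left)

lemma space_div_separated:
  "C_infinity G \<Longrightarrow>
    space_div (\<lambda>(t, x). \<theta> t *\<^sub>R G x) z = \<theta> (fst z) * trace (jacobian G (at (snd z)))"
  by (simp add: space_div_def space_jacobian_separated trace_def sum_distrib_left)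

lemma space_grad_separated:
  "C_infinity g \<Longrightarrow> space_grad (\<lambda>(t, x). \<theta> t *\<^sub>R g x) z = \<theta> (fst z) *\<^sub>R grad g (snd z)"
  using frechet_derivative_scaleR_left[of g "\<theta> (fst z)" "snd z"]
  by (cases z) (simp add: space_grad_def grad_def vec_eq_iff)

lemma axis_one_in_Basis: "(axis j 1 :: real^'d) \<in> Basis"
  by (simp add: axis_in_Basis_iff)

lemma continuous_on_grad: "C_infinity g \<Longrightarrow> continuous_on UNIV (grad g)"
  using C_infinity_frechet_derivative_continuous[OF _ axis_one_in_Basis]
  by (auto simp: grad_def[abs_def] intro!: continuous_on_vec_lambda)

lemma continuous_on_jacobian:
  fixes G :: "real^'d \<Rightarrow> real^'m"
  shows "C_infinity G \<Longrightarrow> continuous_on UNIV (\<lambda>x. jacobian G (at x))"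
  by (auto simp: jacobian_def matrix_def intro!: continuous_on_vec_lambda continuous_on_component
      C_infinity_frechet_derivative_continuous[OF _ axis_one_in_Basis])

text \<open>A smooth approximation of \<open>(s - t)\<^sub>+\<close>: it vanishes to infinite order at \<open>t = s\<close>.\<close>

definition ramp :: "nat \<Rightarrow> real \<Rightarrow> real \<Rightarrow> real" where
  "ramp k s t = (s - t) * bump (real k * (s - t))"

text \<open>With y = k (s - t), the derivative of \<open>ramp\<close> is - bump y - y bump' y. Here
  bump' = \<open>bump_fun 2\<close>, and y \<open>bump_fun 2 y\<close> =
  \<open>bump_fun 1 y\<close>. In this form both terms are visibly bounded uniformly in k, as
  dominated convergence requires.\<close>

definition ramp_deriv :: "nat \<Rightarrow> real \<Rightarrow> real \<Rightarrow> real" where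
  "ramp_deriv k s t = - bump (real k * (s - t)) - bump_fun 1 (real k * (s - t))"

lemma C_infinity_bump_shift: "C_infinity (\<lambda>t. bump_fun n (k * (s - t)))"
proof -
  have "C_infinity (\<lambda>t::real. k * s + (- k) * t)"
    by (rule C_infinity_add[OF C_infinity_const C_infinity_bounded_linear[OF bounded_linear_mult_right]])
  then have "C_infinity (\<lambda>t. bump_fun n (k * s + (- k) * t))"
    by (rule C_infinity_compose_real[OF C_infinity_bump_fun])
  then show ?thesis by (simp add: algebra_simps)
qed

lemma C_infinity_ramp: "C_infinity (ramp k s)"
proof -
  have "C_infinity (\<lambda>t::real. s + (- 1) * t)"
    by (rule C_infinity_add[OF C_infinity_const C_infinity_bounded_linear[OF bounded_linear_mult_right]])
  then have "C_infinity (\<lambda>t. (s + (- 1) * t) * bump (real k * (s - t)))"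
    by (rule C_infinity_mult[OF _ C_infinity_bump_shift])
  then show ?thesis by (simp add: ramp_def[abs_def])
qed

lemma ramp_eq_0: "s \<le> t \<Longrightarrow> ramp k s t = 0"
  by (auto simp: ramp_def bump_fun_def zero_less_mult_iff)

lemma ramp_has_real_derivative: "(ramp k s has_real_derivative ramp_deriv k s t) (at t)"
proof -
  have "((\<lambda>t. bump (real k * (s - t))) has_real_derivative
      (bump_fun (0 + 2) (real k * (s - t)) - real 0 * bump_fun (0 + 1) (real k * (s - t))) * (- real k)) (at t)"
    by (rule DERIV_chain2[OF bump_fun_has_real_derivative]) (auto intro!: derivative_eq_intros)
  then have "(ramp k s has_real_derivative
      - 1 * bump (real k * (s - t)) + bump_fun 2 (real k * (s - t)) * (- real k) * (s - t)) (at t)"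
    unfolding ramp_def[abs_def]
    by - (rule derivative_eq_intros refl | assumption | simp add: numeral_2_eq_2)+
  moreover have "bump_fun 2 y * y = bump_fun 1 y" for y
    by (simp add: bump_fun_def power2_eq_square)
  then have "bump_fun 2 (real k * (s - t)) * (- real k) * (s - t) = - bump_fun 1 (real k * (s - t))"
    by (metis (no_types, lifting) mult.assoc mult_minus_left mult_minus_right)
  ultimately show ?thesis by (simp add: ramp_deriv_def)
qed

lemma ramp_deriv_tendsto: "(\<lambda>k. ramp_deriv k s t) \<longlonglongrightarrow> - indicator {..<s} t"
  using tendsto_diff[OF tendsto_minus[OF bump_tendsto_indicator[of "s - t"]] bump_fun_1_tendsto[of "s - t"]]
  by (simp add: ramp_deriv_def indicator_def)

lemma ramp_tendsto: "(\<lambda>k. ramp k s t) \<longlonglongrightarrow> (s - t) * indicator {..<s} t"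
  using tendsto_mult[OF tendsto_const bump_tendsto_indicator[of "s - t"], of "s - t"]
  by (simp add: ramp_def indicator_def)

lemma ramp_deriv_bound: "\<bar>ramp_deriv k s t\<bar> \<le> 2"
  using bump_le_1[of "real k * (s - t)"] bump_fun_le[of 1 "real k * (s - t)" 0]
    bump_fun_nonneg[of 1 "real k * (s - t)"] bump_fun_nonneg[of 0 "real k * (s - t)"]
  by (simp add: ramp_deriv_def)

lemma ramp_bound: "\<bar>ramp k s t\<bar> \<le> \<bar>s - t\<bar>"
  using mult_left_mono[OF bump_le_1[of "real k * (s - t)"], of "\<bar>s - t\<bar>"]
    bump_fun_nonneg[of 0 "real k * (s - t)"]
  by (simp add: ramp_def abs_mult)

lemma space_time_measurable_continuous:
  "continuous_on UNIV f \<Longrightarrow> f \<in> borel_measurable (lebesgue_on S)"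
  by (metis borel_measurable_continuous_onI measurable_completion measurable_lborel2 measurable_restrict_space1)

section \<open>Integration on space-time\<close>

lemma complete_measure_lebesgue_on:
  assumes "S \<in> sets lebesgue"
  shows "complete_measure (lebesgue_on S)"
proof
  fix A B assume A: "A \<subseteq> B" "B \<in> null_sets (lebesgue_on S)"
  then have "B \<in> null_sets lebesgue" "B \<subseteq> S"
    using assms by (auto simp: null_sets_restrict_space dest: null_setsD2 sets.sets_into_space)
  then have "A \<in> null_sets lebesgue"
    using A(1) null_sets_completion_subset by blast
  then show "A \<in> sets (lebesgue_on S)"
    using A(1) \<open>B \<subseteq> S\<close> assms by (auto simp: sets_restrict_space_iff dest: null_setsD2)
qed

text \<open>Fubini is applied to Borel representatives, and slice integrals of the original function
  agree with theirs only almost everywhere. Completeness carries measurability across such an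
  equality.\<close>

lemma (in complete_measure) measurable_AE_eq:
  assumes f: "f \<in> measurable M N" and eq: "AE x in M. f x = g x" and g: "g \<in> space M \<rightarrow> space N"
  shows "g \<in> measurable M N"
proof (rule measurableI)
  fix A assume A: "A \<in> sets N"
  show "g -` A \<inter> space M \<in> sets M"
  proof (rule in_sets_AE)
    show "AE x in M. x \<in> f -` A \<inter> space M \<longleftrightarrow> x \<in> g -` A \<inter> space M"
      using eq by eventually_elim auto
    show "f -` A \<inter> space M \<in> sets M"
      using f A by (rule measurable_sets)
  qed auto
qed (use g in auto)

lemma borel_measurable_lebesgue_on_AE_eq:
  assumes "S \<in> sets lebesgue" "f \<in> borel_measurable (lebesgue_on S)" "AE x in lebesgue_on S. f x = g x"
  shows "g \<in> borel_measurable (lebesgue_on S)"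
  using complete_measure.measurable_AE_eq[OF complete_measure_lebesgue_on[OF assms(1)] assms(2,3)] by simp

lemma sets_lebesgue_borel: "S \<in> sets borel \<Longrightarrow> S \<in> sets lebesgue"
  by simp

lemma AE_lebesgue_on_borel_iff:
  assumes "S \<in> sets borel"
  shows "(AE x in lebesgue_on S. P x) \<longleftrightarrow> (AE x in lborel. x \<in> S \<longrightarrow> P x)"
  using assms by (simp add: AE_restrict_space_iff AE_completion_iff)

lemma borel_measurable_lebesgue_onI:
  "f \<in> borel_measurable borel \<Longrightarrow> f \<in> borel_measurable (lebesgue_on S)"
  by (intro measurable_restrict_space1 measurable_completion) simp

lemma nn_integral_lebesgue_on_borel:
  assumes "S \<in> sets borel"
  shows "(\<integral>\<^sup>+x. f x \<partial>lebesgue_on S) = (\<integral>\<^sup>+x. f x * indicator S x \<partial>lborel)"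
  using assms by (simp add: nn_integral_restrict_space nn_integral_completion)

lemma integrable_lebesgue_on_borel_iff:
  fixes f :: "'a::euclidean_space \<Rightarrow> 'b::{banach, second_countable_topology}"
  assumes "S \<in> sets borel" "f \<in> borel_measurable borel"
  shows "integrable (lebesgue_on S) f \<longleftrightarrow> integrable lborel (\<lambda>x. indicator S x *\<^sub>R f x)"
  using assms by (simp add: integrable_restrict_space integrable_completion)

lemma integral_lebesgue_on_borel:
  fixes f :: "'a::euclidean_space \<Rightarrow> 'b::{banach, second_countable_topology}"
  assumes "S \<in> sets borel" "f \<in> borel_measurable borel"
  shows "integral\<^sup>L (lebesgue_on S) f = integral\<^sup>L lborel (\<lambda>x. indicator S x *\<^sub>R f x)"
  using assms by (simp add: integral_restrict_space integral_completion)

lemma lebesgue_on_borel_representative_ennreal: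
  fixes f :: "'a::euclidean_space \<Rightarrow> ennreal"
  assumes S: "S \<in> sets borel" and f: "f \<in> borel_measurable (lebesgue_on S)"
  obtains g where "g \<in> borel_measurable borel" "AE x in lborel. x \<in> S \<longrightarrow> f x = g x"
proof -
  have "(\<lambda>x. f x * indicator S x) \<in> borel_measurable lebesgue"
    using f S by (simp add: borel_measurable_restrict_space_iff_ennreal)
  from completion_ex_borel_measurable[OF this]
  obtain g where "g \<in> borel_measurable lborel" "AE x in lborel. f x * indicator S x = g x"
    by blast
  then show ?thesis
    by (intro that[of g]) (auto elim!: eventually_mono)
qed

lemma lebesgue_on_borel_representative_real:
  fixes f :: "'a::euclidean_space \<Rightarrow> real"
  assumes S: "S \<in> sets borel" and f: "f \<in> borel_measurable (lebesgue_on S)"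
  obtains g where "g \<in> borel_measurable borel" "AE x in lborel. x \<in> S \<longrightarrow> f x = g x"
proof -
  have "(\<lambda>x. indicator S x *\<^sub>R f x) \<in> borel_measurable lebesgue"
    using f S by (simp add: borel_measurable_restrict_space_iff)
  from completion_ex_borel_measurable_real[OF this]
  obtain g where "g \<in> borel_measurable lborel" "AE x in lborel. indicator S x *\<^sub>R f x = g x"
    by blast
  then show ?thesis
    by (intro that[of g]) (auto elim!: eventually_mono)
qed

section \<open>Fubini's theorem on products\<close>

text \<open>The completed measure on a product is not the product of the completed measures, so the
  null set is moved to \<open>lborel\<close>, where the product formula holds.\<close>

lemma AE_lebesgue_on_pair:
  fixes I :: "'a::euclidean_space set" and C :: "'b::euclidean_space set"
  assumes "I \<in> sets borel" "C \<in> sets borel" "AE z in lebesgue_on (I \<times> C). P z"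
  shows "AE t in lebesgue_on I. AE x in lebesgue_on C. P (t, x)"
proof -
  have "AE z in lborel \<Otimes>\<^sub>M lborel. z \<in> I \<times> C \<longrightarrow> P z"
    using assms(3) unfolding lborel_prod AE_lebesgue_on_borel_iff[OF borel_Times[OF assms(1,2)]] .
  from lborel_pair.AE_pair[OF this]
  show ?thesis
    using assms by (auto simp: AE_lebesgue_on_borel_iff elim!: eventually_mono)
qed

lemma borel_measurable_nn_integral_lebesgue_on:
  fixes I :: "'a::euclidean_space set" and C :: "'b::euclidean_space set"
    and f :: "'a \<times> 'b \<Rightarrow> ennreal"
  assumes I: "I \<in> sets borel" and C: "C \<in> sets borel"
    and f: "f \<in> borel_measurable (lebesgue_on (I \<times> C))"
  shows "(\<lambda>t. \<integral>\<^sup>+x. f (t, x) \<partial>lebesgue_on C) \<in> borel_measurable (lebesgue_on I)"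
proof -
  note IC = borel_Times[OF I C]
  obtain g where g: "g \<in> borel_measurable borel" and eq: "AE z in lborel. z \<in> I \<times> C \<longrightarrow> f z = g z"
    using lebesgue_on_borel_representative_ennreal[OF IC f] .
  have eq': "AE z in lebesgue_on (I \<times> C). f z = g z"
    using eq IC by (simp add: AE_lebesgue_on_borel_iff)
  have ae: "AE t in lebesgue_on I. (\<integral>\<^sup>+x. f (t, x) \<partial>lebesgue_on C) = (\<integral>\<^sup>+x. g (t, x) \<partial>lebesgue_on C)"
    using AE_lebesgue_on_pair[OF I C eq'] by eventually_elim (rule nn_integral_cong_AE)
  have g_slice: "(\<lambda>t. \<integral>\<^sup>+x. g (t, x) \<partial>lebesgue_on C) = (\<lambda>t. \<integral>\<^sup>+x. g (t, x) * indicator C x \<partial>lborel)"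
    by (simp add: nn_integral_lebesgue_on_borel[OF C])
  have [measurable]: "g \<in> borel_measurable (lborel \<Otimes>\<^sub>M lborel)" "C \<in> sets borel"
    using g C by (simp_all add: lborel_prod)
  have "(\<lambda>t. \<integral>\<^sup>+x. g (t, x) * indicator C x \<partial>lborel) \<in> borel_measurable borel"
    using lborel.borel_measurable_nn_integral_fst[of "\<lambda>z. g z * indicator C (snd z)" "lborel :: 'a measure"]
    by simp
  then have g_meas: "(\<lambda>t. \<integral>\<^sup>+x. g (t, x) \<partial>lebesgue_on C) \<in> borel_measurable (lebesgue_on I)"
    unfolding g_slice by (rule borel_measurable_lebesgue_onI)
  show ?thesis
    by (rule borel_measurable_lebesgue_on_AE_eq[OF sets_lebesgue_borel[OF I] g_meas])
      (use ae in \<open>eventually_elim, simp\<close>)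
qed

text \<open>A Borel function g replaces f off a null set. Fubini holds for g on
  \<open>lborel\<close>, and almost every slice of f agrees almost everywhere with that of g, so all
  three conclusions carry over.\<close>

lemma
  fixes I :: "'a::euclidean_space set" and C :: "'b::euclidean_space set"
    and f :: "'a \<times> 'b \<Rightarrow> real"
  assumes I: "I \<in> sets borel" and C: "C \<in> sets borel"
    and f: "integrable (lebesgue_on (I \<times> C)) f"
  shows AE_integrable_slice_lebesgue_on:
      "AE t in lebesgue_on I. integrable (lebesgue_on C) (\<lambda>x. f (t, x))" (is ?th1)
    and integrable_integral_slice_lebesgue_on:
      "integrable (lebesgue_on I) (\<lambda>t. LINT x|lebesgue_on C. f (t, x))" (is ?th2)
    and integral_lebesgue_on_prod:
      "(LINT z|lebesgue_on (I \<times> C). f z) = (LINT t|lebesgue_on I. LINT x|lebesgue_on C. f (t, x))" (is ?th3)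
proof -
  note IC = borel_Times[OF I C]
  obtain g where g: "g \<in> borel_measurable borel" and eq: "AE z in lborel. z \<in> I \<times> C \<longrightarrow> f z = g z"
    using lebesgue_on_borel_representative_real[OF IC borel_measurable_integrable[OF f]] .
  have eq': "AE z in lebesgue_on (I \<times> C). f z = g z"
    using eq IC by (simp add: AE_lebesgue_on_borel_iff)
  have "integrable (lebesgue_on (I \<times> C)) g"
    using integrable_cong_AE_imp[OF f borel_measurable_lebesgue_onI[OF g]] eq' by (simp add: eq_commute)
  then have int: "integrable (lborel \<Otimes>\<^sub>M lborel) (\<lambda>z. indicator (I \<times> C) z *\<^sub>R g z)"
    by (simp add: integrable_lebesgue_on_borel_iff[OF IC g] lborel_prod)
  have slice: "(\<lambda>x. g (t, x)) \<in> borel_measurable borel" for t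
    using measurable_compose[OF measurable_Pair1' g[unfolded borel_prod[symmetric]], of t] by simp
  have ae0: "AE t in lebesgue_on I. AE x in lebesgue_on C. f (t, x) = g (t, x)"
    by (rule AE_lebesgue_on_pair[OF I C eq'])
  have meas_f: "(\<lambda>x. f (t, x)) \<in> borel_measurable (lebesgue_on C)"
    if "AE x in lebesgue_on C. f (t, x) = g (t, x)" for t
    by (rule borel_measurable_lebesgue_on_AE_eq[OF sets_lebesgue_borel[OF C] borel_measurable_lebesgue_onI[OF slice]])
      (use that in \<open>eventually_elim, simp\<close>)
  have ae: "AE t in lebesgue_on I. (LINT x|lebesgue_on C. f (t, x)) = (LINT x|lebesgue_on C. g (t, x))"
    using ae0 by eventually_elim (rule integral_cong_AE[OF meas_f borel_measurable_lebesgue_onI[OF slice]])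
  have "AE t in lborel. integrable lborel (\<lambda>x. indicator (I \<times> C) (t, x) *\<^sub>R g (t, x))"
    by (rule lborel_pair.AE_integrable_fst'[OF int])
  then have "AE t in lborel. t \<in> I \<longrightarrow> integrable lborel (\<lambda>x. indicator C x *\<^sub>R g (t, x))"
    by eventually_elim (auto simp: indicator_times)
  then have "AE t in lebesgue_on I. integrable (lebesgue_on C) (\<lambda>x. g (t, x))"
    by (simp add: AE_lebesgue_on_borel_iff[OF I] integrable_lebesgue_on_borel_iff[OF C slice])
  then show ?th1
    using ae0
  proof eventually_elim
    case (elim t)
    show ?case
      by (rule integrable_cong_AE_imp[OF elim(1) meas_f[OF elim(2)]]) (use elim(2) in \<open>eventually_elim, simp\<close>)
  qed
  have sl: "(LINT x|lborel. indicator (I \<times> C) (t, x) *\<^sub>R g (t, x)) = indicator I t *\<^sub>R (LINT x|lebesgue_on C. g (t, x))" for t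
    by (simp add: integral_lebesgue_on_borel[OF C slice] indicator_times mult.assoc)
  have int2: "integrable lborel (\<lambda>t. indicator I t *\<^sub>R (LINT x|lebesgue_on C. g (t, x)))"
    using lborel_pair.integrable_fst'[OF int] unfolding sl .
  have gm: "(\<lambda>t. LINT x|lebesgue_on C. g (t, x)) \<in> borel_measurable borel"
  proof -
    have [measurable]: "g \<in> borel_measurable (borel \<Otimes>\<^sub>M lborel)"
      using g by (subst measurable_cong_sets[OF sets_pair_measure_cong[OF refl sets_lborel] refl])
        (simp add: borel_prod)
    note C [measurable]
    have "(\<lambda>t. LINT x|lborel. indicator C x *\<^sub>R g (t, x)) \<in> borel_measurable borel"
      by measurable
    then show ?thesis by (simp add: integral_lebesgue_on_borel[OF C slice])
  qed
  have int3: "integrable (lebesgue_on I) (\<lambda>t. LINT x|lebesgue_on C. g (t, x))"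
    using int2 by (simp add: integrable_lebesgue_on_borel_iff[OF I gm])
  have fm: "(\<lambda>t. LINT x|lebesgue_on C. f (t, x)) \<in> borel_measurable (lebesgue_on I)"
    by (rule borel_measurable_lebesgue_on_AE_eq[OF sets_lebesgue_borel[OF I] borel_measurable_integrable[OF int3]])
      (use ae in \<open>eventually_elim, simp\<close>)
  show ?th2
    by (rule integrable_cong_AE_imp[OF int3 fm]) (use ae in \<open>eventually_elim, simp\<close>)
  have "(LINT z|lebesgue_on (I \<times> C). f z) = (LINT z|lebesgue_on (I \<times> C). g z)"
    by (rule integral_cong_AE[OF borel_measurable_integrable[OF f] borel_measurable_lebesgue_onI[OF g] eq'])
  also have "\<dots> = (LINT z|(lborel \<Otimes>\<^sub>M lborel). indicator (I \<times> C) z *\<^sub>R g z)"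
    by (simp add: integral_lebesgue_on_borel[OF IC g] lborel_prod)
  also have "\<dots> = (LINT t|lborel. LINT x|lborel. indicator (I \<times> C) (t, x) *\<^sub>R g (t, x))"
    by (rule lborel_pair.integral_fst'[OF int, symmetric])
  also have "\<dots> = (LINT t|lebesgue_on I. LINT x|lebesgue_on C. g (t, x))"
    unfolding sl by (simp add: integral_lebesgue_on_borel[OF I gm])
  also have "\<dots> = (LINT t|lebesgue_on I. LINT x|lebesgue_on C. f (t, x))"
    by (rule integral_cong_AE[OF borel_measurable_integrable[OF int3] fm]) (use ae in \<open>eventually_elim, simp\<close>)
  finally show ?th3 .
qed

section \<open>The unit cell and integrals of periodic derivatives\<close>

lemma borel_unit_cell [measurable]: "(unit_cell :: (real^'d) set) \<in> sets borel"
  unfolding unit_cell_def by measurable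

lemma bounded_unit_cell: "bounded (unit_cell :: (real^'d) set)"
  by (rule bounded_subset[OF bounded_cbox[of 0 1]]) (auto simp: unit_cell_def mem_box_cart less_imp_le)

lemma borel_space_time: "{0<..<T::real} \<times> (unit_cell :: (real^'d) set) \<in> sets borel"
  by (intro borel_Times borel_unit_cell) simp

lemma finite_measure_lebesgue_on_bounded: "S \<in> sets borel \<Longrightarrow> bounded S \<Longrightarrow> finite_measure (lebesgue_on S)"
  by (intro finite_measure_lebesgue_on bounded_set_imp_lmeasurable) auto

lemma bounded_space_time: "bounded ({0<..<T::real} \<times> (unit_cell :: (real^'d) set))"
  by (intro bounded_Times bounded_unit_cell) simp

lemma finite_measure_torus: "finite_measure (torus :: (real^'d) measure)"
  by (intro finite_measure_lebesgue_on_bounded borel_unit_cell bounded_unit_cell)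

lemma finite_measure_space_time: "finite_measure (space_time T :: (real \<times> (real^'d)) measure)"
  by (intro finite_measure_lebesgue_on_bounded borel_space_time bounded_space_time)

lemma integral_lborel_shift:
  fixes f :: "'a::euclidean_space \<Rightarrow> real"
  assumes "f \<in> borel_measurable borel"
  shows "(LINT z|lborel. f (z + c)) = (LINT z|lborel. f z)"
proof -
  have "(LINT z|lborel. f z) = (LINT z|distr lborel borel ((+) c). f z)"
    by (simp add: lborel_distr_plus)
  also have "\<dots> = (LINT z|lborel. f (c + z))"
    using assms by (intro integral_distr) auto
  finally show ?thesis by (simp add: add.commute)
qed

lemma integrable_lborel_shift:
  fixes f :: "'a::euclidean_space \<Rightarrow> real"
  assumes "integrable lborel f"
  shows "integrable lborel (\<lambda>z. f (z + c))"
proof -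
  have "integrable (distr lborel borel ((+) c)) f"
    using assms by (simp add: lborel_distr_plus)
  then show ?thesis
    using assms by (subst (asm) integrable_distr_eq) (auto simp: add.commute)
qed

text \<open>Translating the cell by \<open>c\<close> and moving the part that sticks out back by the period \<open>e\<close>.\<close>

lemma integral_periodic_shift:
  fixes f :: "'a::euclidean_space \<Rightarrow> real"
  assumes [measurable]: "f \<in> borel_measurable borel" "A \<in> sets borel" "B \<in> sets borel" "S \<in> sets borel"
    and per: "\<And>z. f (z + e) = f z"
    and split: "\<And>z. indicator S z = (indicator A z + indicator B z :: real)"
    and shift: "\<And>z. indicator S (z - c) = (indicator A z + indicator B (z - e) :: real)"
    and int: "integrable lborel (\<lambda>z. indicator A z * f z)" "integrable lborel (\<lambda>z. indicator B z * f z)"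
  shows "(LINT z|lborel. indicator S z * f (z + c)) = (LINT z|lborel. indicator S z * f z)"
proof -
  have per': "f (z - e) = f z" for z using per[of "z - e"] by simp
  have iB: "integrable lborel (\<lambda>z. indicator B (z - e) * f z)"
    using integrable_lborel_shift[OF int(2), of "- e"] by (simp add: per')
  have "(LINT z|lborel. indicator S z * f (z + c)) = (LINT z|lborel. indicator S (z + c - c) * f (z + c))"
    by simp
  also have "\<dots> = (LINT z|lborel. indicator S (z - c) * f z)"
    by (rule integral_lborel_shift[where f = "\<lambda>z. indicator S (z - c) * f z"]) measurable
  also have "\<dots> = (LINT z|lborel. indicator A z * f z + indicator B (z - e) * f z)"
    by (simp add: shift algebra_simps)
  also have "\<dots> = (LINT z|lborel. indicator A z * f z) + (LINT z|lborel. indicator B (z - e) * f z)"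
    by (rule Bochner_Integration.integral_add[OF int(1) iB])
  also have "(LINT z|lborel. indicator B (z - e) * f z) = (LINT z|lborel. indicator B (z + e - e) * f (z + e))"
    by (rule integral_lborel_shift[where f = "\<lambda>z. indicator B (z - e) * f z", symmetric]) measurable
  also have "\<dots> = (LINT z|lborel. indicator B z * f z)"
    by (simp add: per)
  also have "(LINT z|lborel. indicator A z * f z) + (LINT z|lborel. indicator B z * f z)
      = (LINT z|lborel. indicator A z * f z + indicator B z * f z)"
    by (rule Bochner_Integration.integral_add[OF int, symmetric])
  also have "\<dots> = (LINT z|lborel. indicator S z * f z)"
    by (simp add: split algebra_simps)
  finally show ?thesis .
qed

lemma integrable_continuous_bounded_set:
  fixes f :: "'a::euclidean_space \<Rightarrow> 'b::{banach, second_countable_topology}"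
  assumes "continuous_on UNIV f" "S \<in> sets borel" "bounded S"
  shows "integrable (lebesgue_on S) f"
proof -
  obtain C where "\<And>z. z \<in> S \<Longrightarrow> norm (f z) \<le> C"
    using continuous_on_bounded_set[OF assms(1,3)] by blast
  then show ?thesis
    using assms finite_measure_lebesgue_on_bounded[OF assms(2,3)]
    by (intro finite_measure.integrable_const_bound[where B = C] AE_I2 borel_measurable_lebesgue_onI
        borel_measurable_continuous_onI) auto
qed

text \<open>The difference quotients along axis i integrate to zero, because a shift rearranges the
  cell modulo periods. By the mean value theorem they converge boundedly to the derivative, so no
  coordinate has to be singled out for an iterated integral.\<close>

lemma integral_space_derivative_eq_0:
  fixes f :: "real \<times> (real^'d) \<Rightarrow> real" and i :: 'd
  assumes f: "C_infinity f" and per: "\<And>t. periodic (\<lambda>x. f (t, x))"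
  shows "(LINT z|space_time T. frechet_derivative f (at z) (0, axis i 1)) = 0"
proof -
  define e :: "real \<times> (real^'d)" where "e = (0, axis i 1)"
  define D where "D z = frechet_derivative f (at z) e" for z
  define S :: "(real \<times> (real^'d)) set" where "S = {0<..<T} \<times> unit_cell"
  have S: "S \<in> sets borel" "bounded S"
    using borel_space_time bounded_space_time by (auto simp: S_def)
  interpret finite_measure "lebesgue_on S"
    by (rule finite_measure_lebesgue_on_bounded[OF S])
  have D_cont: "continuous_on UNIV D"
    unfolding D_def[abs_def] e_def
    by (rule C_infinity_frechet_derivative_continuous[OF f zero_axis_in_Basis])
  have f_cont: "continuous_on UNIV f" by (rule C_infinity_continuous_on[OF f])
  have D: "((\<lambda>r. f (z + r *\<^sub>R e)) has_real_derivative D (z + r *\<^sub>R e)) (at r)" for z r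
  proof -
    have "((\<lambda>r. z + r *\<^sub>R e) has_derivative (\<lambda>h. h *\<^sub>R e)) (at r)"
      by (auto intro!: derivative_eq_intros)
    from has_derivative_compose[OF this C_infinity_has_derivative[OF f]]
    have "((\<lambda>r. f (z + r *\<^sub>R e)) has_derivative (\<lambda>h. frechet_derivative f (at (z + r *\<^sub>R e)) (h *\<^sub>R e))) (at r)" .
    moreover have "frechet_derivative f (at y) (h *\<^sub>R e) = D y * h" for y h
      using linear_cmul[OF has_derivative_linear[OF C_infinity_has_derivative[OF f, of y]], of h e]
      by (simp add: D_def mult.commute)
    ultimately show ?thesis by (simp add: has_field_derivative_def)
  qed
  have mvt: "\<exists>r. 0 < r \<and> r < h \<and> f (z + h *\<^sub>R e) - f z = h * D (z + r *\<^sub>R e)" if "0 < h" for z h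
    using MVT2[OF that, of "\<lambda>r. f (z + r *\<^sub>R e)" "\<lambda>r. D (z + r *\<^sub>R e)"] D by auto
  define h where "h n = 1 / (real n + 1)" for n
  have h: "0 < h n" "h n \<le> 1" for n by (auto simp: h_def)
  have h0: "h \<longlonglongrightarrow> 0"
    unfolding h_def[abs_def] using LIMSEQ_inverse_real_of_nat by (simp add: divide_inverse add.commute)
  define q where "q n z = (f (z + h n *\<^sub>R e) - f z) / h n" for n z
  obtain r where r: "0 < r n z" "r n z < h n" "q n z = D (z + r n z *\<^sub>R e)" for n z
  proof -
    have "\<forall>n z. \<exists>r. 0 < r \<and> r < h n \<and> q n z = D (z + r *\<^sub>R e)"
      using mvt[OF h(1)] h(1) by (simp add: q_def less_imp_neq[THEN not_sym] nonzero_divide_eq_eq) 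
        (metis mult.commute)
    then show ?thesis using that by metis
  qed
  \<comment> \<open>Since h n is at most 1, all intermediate points of the mean value theorem lie in
    this compact set, whence a bound on the quotients independent of n.\<close>
  define S' where "S' = (\<lambda>(z, r). z + r *\<^sub>R e) ` (closure S \<times> {0..1})"
  have "compact S'"
    unfolding S'_def using S(2)
    by (intro compact_continuous_image compact_Times) (auto simp: case_prod_unfold intro!: continuous_intros)
  then obtain C where C: "\<And>z. z \<in> S' \<Longrightarrow> norm (D z) \<le> C"
    using continuous_on_bounded_set[OF D_cont compact_imp_bounded] by blast
  have q_bound: "norm (q n z) \<le> C" if "z \<in> S" for n z
  proof -
    have "z + r n z *\<^sub>R e \<in> S'"
      unfolding S'_def using that closure_subset[of S] r(1,2)[of n z] h(2)[of n]
      by (intro image_eqI[of _ _ "(z, r n z)"]) auto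
    then show ?thesis using C r(3) by simp
  qed
  have q_lim: "(\<lambda>n. q n z) \<longlonglongrightarrow> D z" for z
  proof -
    have "(\<lambda>n. r n z) \<longlonglongrightarrow> 0"
      by (rule tendsto_sandwich[OF _ _ tendsto_const h0]) (auto intro!: always_eventually less_imp_le r)
    then have "(\<lambda>n. z + r n z *\<^sub>R e) \<longlonglongrightarrow> z + 0 *\<^sub>R e"
      by (intro tendsto_intros)
    then have "(\<lambda>n. D (z + r n z *\<^sub>R e)) \<longlonglongrightarrow> D z"
      using D_cont by (intro continuous_on_tendsto_compose[OF D_cont]) auto
    then show ?thesis by (simp add: r(3))
  qed
  have f_borel: "f \<in> borel_measurable borel"
    by (rule borel_measurable_continuous_onI[OF f_cont])
  have shift_cont: "continuous_on UNIV (\<lambda>z. f (z + c))" for c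
    by (rule continuous_on_compose2[OF f_cont]) (auto intro!: continuous_intros)
  have q_meas: "q n \<in> borel_measurable (lebesgue_on S)" for n
    unfolding q_def[abs_def] using shift_cont f_cont h(1)[of n]
    by (intro borel_measurable_lebesgue_onI borel_measurable_continuous_onI continuous_intros) auto
  have "(\<lambda>n. LINT z|lebesgue_on S. q n z) \<longlonglongrightarrow> (LINT z|lebesgue_on S. D z)"
  proof (rule integral_dominated_convergence[where w = "\<lambda>_. C"])
    show "D \<in> borel_measurable (lebesgue_on S)"
      by (intro borel_measurable_lebesgue_onI borel_measurable_continuous_onI D_cont)
  qed (use q_meas q_lim q_bound in auto)
  moreover have "(LINT z|lebesgue_on S. q n z) = 0" for n
  proof -
    \<comment> \<open>The cell translated by h n along axis i is the union of A and of the strip B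
      moved by one period; h n \<le> 1 ensures that this strip fits in the cell.\<close>
    define A where "A = {z \<in> S. h n \<le> snd z $ i}"
    define B where "B = {z \<in> S. snd z $ i < h n}"
    have AB: "A = S \<inter> (\<lambda>z. snd z $ i) -` {h n..}" "B = S \<inter> (\<lambda>z. snd z $ i) -` {..<h n}"
      by (auto simp: A_def B_def)
    have cm: "(\<lambda>z :: real \<times> (real^'d). snd z $ i) \<in> borel_measurable borel"
      by (intro borel_measurable_continuous_onI continuous_intros continuous_on_component)
    have ABm: "A \<in> sets borel" "B \<in> sets borel"
      unfolding AB using S(1) measurable_sets[OF cm, of "{h n..}"] measurable_sets[OF cm, of "{..<h n}"] by auto
    have bdd: "bounded A" "bounded B"
      using S(2) by (auto intro: bounded_subset simp: A_def B_def)
    have int: "integrable lborel (\<lambda>z. indicator W z * f z)" if "W \<in> sets borel" "bounded W" for W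
      using integrable_continuous_bounded_set[OF f_cont that]
        integrable_lebesgue_on_borel_iff[OF that(1) f_borel] by simp
    have "f (z + e) = f z" for z
      using per by (cases z) (simp add: periodic_def e_def)
    moreover have "indicator S z = (indicator A z + indicator B z :: real)" for z
      by (auto simp: A_def B_def indicator_def)
    moreover have "indicator S (z - h n *\<^sub>R e) = (indicator A z + indicator B (z - e) :: real)" for z
    proof -
      obtain t x where z: "z = (t, x)" by (cases z)
      define y where "y = x - h n *\<^sub>R axis i 1"
      define y' where "y' = x - axis i 1"
      have y: "y $ j = (if j = i then x $ i - h n else x $ j)" "y' $ j = (if j = i then x $ i - 1 else x $ j)" for j
        by (auto simp: axis_def y_def y'_def)
      have zy: "z - h n *\<^sub>R e = (t, y)" "z - e = (t, y')"
        by (simp_all add: z e_def y_def y'_def)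
      have 1: "z - h n *\<^sub>R e \<in> S \<longleftrightarrow> t \<in> {0<..<T} \<and> (\<forall>j. j \<noteq> i \<longrightarrow> 0 \<le> x $ j \<and> x $ j < 1) \<and> h n \<le> x $ i \<and> x $ i < 1 + h n"
        unfolding S_def zy unit_cell_def by (auto simp: y split: if_splits)
      have 2: "z \<in> A \<longleftrightarrow> t \<in> {0<..<T} \<and> (\<forall>j. j \<noteq> i \<longrightarrow> 0 \<le> x $ j \<and> x $ j < 1) \<and> h n \<le> x $ i \<and> x $ i < 1"
        unfolding A_def S_def z unit_cell_def using h(1)[of n] by (auto split: if_splits) (metis less_le_trans less_imp_le order.trans)+
      have 3: "z - e \<in> B \<longleftrightarrow> t \<in> {0<..<T} \<and> (\<forall>j. j \<noteq> i \<longrightarrow> 0 \<le> x $ j \<and> x $ j < 1) \<and> 1 \<le> x $ i \<and> x $ i < 1 + h n"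
        unfolding B_def S_def zy unit_cell_def using h(2)[of n] by (auto simp: y split: if_splits)
      show ?thesis
        using 1 2 3 h(1,2)[of n] by (auto simp: indicator_def)
    qed
    ultimately have eq: "(LINT z|lborel. indicator S z * f (z + h n *\<^sub>R e)) = (LINT z|lborel. indicator S z * f z)"
      by (intro integral_periodic_shift[OF f_borel ABm S(1)] int ABm bdd)
    have i1: "integrable lborel (\<lambda>z. indicator S z * f (z + h n *\<^sub>R e))"
      using integrable_continuous_bounded_set[OF shift_cont S]
        integrable_lebesgue_on_borel_iff[OF S(1) borel_measurable_continuous_onI[OF shift_cont]] by simp
    have q_borel: "q n \<in> borel_measurable borel"
      unfolding q_def[abs_def] using borel_measurable_continuous_onI[OF shift_cont[of "h n *\<^sub>R e"]] f_borel by measurable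
    have "(LINT z|lebesgue_on S. q n z)
        = (LINT z|lborel. (indicator S z * f (z + h n *\<^sub>R e) - indicator S z * f z) / h n)"
      unfolding integral_lebesgue_on_borel[OF S(1) q_borel]
      by (intro Bochner_Integration.integral_cong) (auto simp: q_def algebra_simps)
    also have "\<dots> = ((LINT z|lborel. indicator S z * f (z + h n *\<^sub>R e)) - (LINT z|lborel. indicator S z * f z)) / h n"
      using Bochner_Integration.integral_diff[OF i1 int[OF S]] by simp
    also have "\<dots> = 0" by (simp add: eq)
    finally show ?thesis .
  qed
  ultimately have "(\<lambda>n. 0 :: real) \<longlonglongrightarrow> (LINT z|lebesgue_on S. D z)" by simp
  then show ?thesis by (simp add: LIMSEQ_const_iff D_def e_def S_def)
qed

lemma integral_space_div_eq_0:
  fixes \<phi> :: "real \<times> (real^'d) \<Rightarrow> real^'d"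
  assumes \<phi>: "C_infinity \<phi>" and per: "\<And>t. periodic (\<lambda>x. \<phi> (t, x))"
  shows "(LINT z|space_time T. space_div \<phi> z) = 0"
proof -
  have comp: "C_infinity (\<lambda>z. \<phi> z $ i)" for i
    using \<phi> by (simp add: C_infinity_def bounded_linear.C_k[OF bounded_linear_vec_nth])
  have deriv: "frechet_derivative (\<lambda>z. \<phi> z $ i) (at z) v = frechet_derivative \<phi> (at z) v $ i" for i z v
    using frechet_derivative_at[OF bounded_linear.has_derivative[OF bounded_linear_vec_nth
          C_infinity_has_derivative[OF \<phi>, of z]], of i] by metis
  have "space_div \<phi> z = (\<Sum>i\<in>UNIV. frechet_derivative (\<lambda>z. \<phi> z $ i) (at z) (0, axis i 1))" for z
    by (simp add: space_div_def trace_def space_jacobian_eq[OF \<phi>] deriv)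
  then have "(LINT z|space_time T. space_div \<phi> z)
      = (LINT z|space_time T. (\<Sum>i\<in>UNIV. frechet_derivative (\<lambda>z. \<phi> z $ i) (at z) (0, axis i 1)))"
    by simp
  also have "\<dots> = (\<Sum>i\<in>UNIV. LINT z|space_time T. frechet_derivative (\<lambda>z. \<phi> z $ i) (at z) (0, axis i 1))"
    by (intro Bochner_Integration.integral_sum integrable_continuous_bounded_set borel_space_time
        bounded_space_time C_infinity_frechet_derivative_continuous[OF comp zero_axis_in_Basis])
  also have "\<dots> = 0"
    using per by (intro sum.neutral ballI integral_space_derivative_eq_0[OF comp]) (auto simp: periodic_def)
  finally show ?thesis .
qed

section \<open>From smooth periodic test functions to pointwise bounds\<close>

lemma torus_smooth_const: "(\<lambda>x. c) \<in> torus_smooth"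
  by (auto simp: torus_smooth_def periodic_def)

lemma torus_smooth_sum: "(\<And>i. i \<in> I \<Longrightarrow> f i \<in> torus_smooth) \<Longrightarrow> (\<lambda>x. \<Sum>i\<in>I. f i x) \<in> torus_smooth"
  by (auto simp: torus_smooth_def periodic_def intro: C_infinity_sum)

lemma torus_smooth_bump: "f \<in> torus_smooth \<Longrightarrow> (\<lambda>x. bump (k * f x)) \<in> torus_smooth"
proof -
  assume f: "f \<in> torus_smooth"
  then have "C_infinity (\<lambda>x. k * f x)"
    by (intro C_infinity_mult[OF C_infinity_const]) (simp add: torus_smooth_def)
  then have "C_infinity (\<lambda>x. bump (k * f x))"
    by (rule C_infinity_compose_real[OF C_infinity_bump_fun])
  then show ?thesis using f by (simp add: torus_smooth_def periodic_def)
qed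

text \<open>Makes the indicator of an arc of the circle a limit of smooth periodic functions.\<close>

lemma cos_arc_iff:
  fixes a b x :: real
  assumes "0 \<le> a" "a < b" "b \<le> 1" "0 \<le> x" "x < 1"
  shows "cos (pi * (b - a)) < cos (2 * pi * (x - (a + b) / 2)) \<longleftrightarrow> a < x \<and> x < b"
proof -
  define y where "y = \<bar>x - (a + b) / 2\<bar>"
  have cosy: "cos (2 * pi * (x - (a + b) / 2)) = cos (2 * pi * y)"
  proof -
    have "2 * pi * y = \<bar>2 * pi * (x - (a + b) / 2)\<bar>" by (simp add: y_def abs_mult)
    then show ?thesis by (simp only: cos_abs_real)
  qed
  have iff: "a < x \<and> x < b \<longleftrightarrow> y < (b - a) / 2"
    unfolding y_def by (auto simp: abs_if field_simps)
  show ?thesis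
  proof (cases "a < x \<and> x < b")
    case True
    then have y: "0 \<le> y" "y < (b - a) / 2" using iff by (auto simp: y_def)
    have "cos (pi * (b - a)) < cos (2 * pi * y)"
    proof (rule cos_monotone_0_pi)
      show "0 \<le> 2 * pi * y" using y by simp
      have "pi * (2 * y) < pi * (b - a)" using y by (intro mult_strict_left_mono) auto
      then show "2 * pi * y < pi * (b - a)" by simp
      show "pi * (b - a) \<le> pi" using assms by simp
    qed
    then show ?thesis using True cosy by simp
  next
    case False
    then have y: "(b - a) / 2 \<le> y" "y \<le> 1 - (b - a) / 2"
      using assms iff unfolding y_def by (auto simp: abs_if field_simps)
    have "cos (2 * pi * y) \<le> cos (pi * (b - a))"
    proof (cases "y \<le> 1 / 2")
      case True
      have "pi * (b - a) \<le> pi * (2 * y)" using y by (intro mult_left_mono) auto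
      moreover have "pi * (2 * y) \<le> pi * 1" using True by (intro mult_left_mono) auto
      ultimately have "cos (pi * (2 * y)) \<le> cos (pi * (b - a))"
        using assms by (intro cos_monotone_0_pi_le) auto
      then show ?thesis by (simp add: mult_ac)
    next
      case False
      have "b - a \<le> 2 * (1 - y)" using y(2) by argo
      then have "pi * (b - a) \<le> pi * (2 * (1 - y))" by (intro mult_left_mono) auto
      moreover have "pi * (2 * (1 - y)) \<le> pi * 1" using False by (intro mult_left_mono) auto
      ultimately have "cos (pi * (2 * (1 - y))) \<le> cos (pi * (b - a))"
        using assms by (intro cos_monotone_0_pi_le) auto
      moreover have "cos (pi * (2 * (1 - y))) = cos (2 * pi * y)"
        using cos_2pi_minus[of "2 * pi * y"] by (simp add: algebra_simps)
      ultimately show ?thesis by simp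
    qed
    then show ?thesis using False cosy by auto
  qed
qed

lemma C_infinity_cos_coordinate:
  "C_infinity (\<lambda>x :: real^'d. bump (cos (2 * pi * (x $ i - m)) - c))"
proof -
  have "C_infinity (\<lambda>x :: real^'d. (- 2 * pi * m) + (2 * pi) * x $ i)"
    by (rule C_infinity_add[OF C_infinity_const
          C_infinity_mult[OF C_infinity_const C_infinity_bounded_linear[OF bounded_linear_vec_nth]]])
  then have "C_infinity (\<lambda>x :: real^'d. (- c) + cos ((- 2 * pi * m) + (2 * pi) * x $ i))"
    by (rule C_infinity_add[OF C_infinity_const C_infinity_compose_real[OF C_infinity_cos]])
  then have "C_infinity (\<lambda>x :: real^'d. bump ((- c) + cos ((- 2 * pi * m) + (2 * pi) * x $ i)))"
    by (rule C_infinity_compose_real[OF C_infinity_bump_fun])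
  then show ?thesis by (simp add: algebra_simps)
qed

text \<open>In each coordinate the cosine centred at the midpoint exceeds its value at the endpoints
  exactly on the open interval. A bump of the difference, multiplied over the coordinates, is
  positive exactly on the box, and periodicity comes for free.\<close>

lemma box_smooth_indicator:
  fixes a b :: "real^'d"
  assumes "box a b \<subseteq> box 0 1"
  obtains \<beta> where "\<beta> \<in> torus_smooth" "\<And>x. 0 \<le> \<beta> x" "\<And>x. x \<in> unit_cell \<Longrightarrow> 0 < \<beta> x \<longleftrightarrow> x \<in> box a b"
proof (cases "box a b = {}")
  case True
  then show ?thesis using that[OF torus_smooth_const[of 0]] by simp
next
  case False
  then have lt: "a $ i < b $ i" for i
    by (metis box_ne_empty(2) axis_in_Basis_iff cart_eq_inner_axis insertI1 Basis_real_def)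
  have le: "0 \<le> a $ i" "b $ i \<le> 1" for i
  proof -
    have "(\<chi> i. 1 / 2) \<in> box 0 (1::real^'d)" by (simp add: mem_box_cart)
    then have "box 0 (1::real^'d) \<noteq> {}" by blast
    then have "cbox a b \<subseteq> cbox 0 1"
      using closure_mono[OF assms] closure_box[OF False] closure_box[of "0::real^'d" 1] by simp
    moreover have "a \<in> cbox a b" "b \<in> cbox a b"
      using lt by (auto simp: mem_box_cart less_imp_le)
    ultimately have "a \<in> cbox 0 1" "b \<in> cbox 0 1" by auto
    then show "0 \<le> a $ i" "b $ i \<le> 1" by (auto simp: mem_box_cart)
  qed
  define \<beta> :: "real^'d \<Rightarrow> real" where "\<beta> x =
    (\<Prod>i\<in>UNIV. bump (cos (2 * pi * (x $ i - (a $ i + b $ i) / 2)) - cos (pi * (b $ i - a $ i))))" for x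
  show ?thesis
  proof (rule that)
    have "C_infinity \<beta>"
      unfolding \<beta>_def[abs_def] by (intro C_infinity_prod C_infinity_cos_coordinate)
    moreover have "\<beta> (x + axis j 1) = \<beta> x" for x j
      unfolding \<beta>_def
    proof (rule prod.cong)
      fix i
      have "cos (2 * pi * ((x + axis j 1) $ i - (a $ i + b $ i) / 2)) = cos (2 * pi * (x $ i - (a $ i + b $ i) / 2))"
      proof (cases "i = j")
        case True
        then have "2 * pi * ((x + axis j 1) $ i - (a $ i + b $ i) / 2) = 2 * pi * (x $ i - (a $ i + b $ i) / 2) + 2 * pi"
          by (simp add: axis_def algebra_simps)
        then show ?thesis by simp
      qed (simp add: axis_def)
      then show "bump (cos (2 * pi * ((x + axis j 1) $ i - (a $ i + b $ i) / 2)) - cos (pi * (b $ i - a $ i)))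
        = bump (cos (2 * pi * (x $ i - (a $ i + b $ i) / 2)) - cos (pi * (b $ i - a $ i)))" by simp
    qed simp
    ultimately show "\<beta> \<in> torus_smooth" by (simp add: torus_smooth_def periodic_def)
    show "0 \<le> \<beta> x" for x
      unfolding \<beta>_def by (intro prod_nonneg) (simp add: bump_fun_nonneg)
    show "0 < \<beta> x \<longleftrightarrow> x \<in> box a b" if x: "x \<in> unit_cell" for x
    proof -
      have arc: "0 < bump (cos (2 * pi * (x $ i - (a $ i + b $ i) / 2)) - cos (pi * (b $ i - a $ i)))
          \<longleftrightarrow> a $ i < x $ i \<and> x $ i < b $ i" for i
        unfolding bump_pos_iff using cos_arc_iff[OF le(1) lt le(2), of "x $ i"] x by (simp add: unit_cell_def)
      have "0 < \<beta> x \<longleftrightarrow> (\<forall>i. 0 < bump (cos (2 * pi * (x $ i - (a $ i + b $ i) / 2)) - cos (pi * (b $ i - a $ i))))"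
        unfolding \<beta>_def
      proof
        assume pos: "0 < (\<Prod>i\<in>UNIV. bump (cos (2 * pi * (x $ i - (a $ i + b $ i) / 2)) - cos (pi * (b $ i - a $ i))))"
        show "\<forall>i. 0 < bump (cos (2 * pi * (x $ i - (a $ i + b $ i) / 2)) - cos (pi * (b $ i - a $ i)))"
        proof (rule allI, rule ccontr)
          fix i assume "\<not> 0 < bump (cos (2 * pi * (x $ i - (a $ i + b $ i) / 2)) - cos (pi * (b $ i - a $ i)))"
          then have "bump (cos (2 * pi * (x $ i - (a $ i + b $ i) / 2)) - cos (pi * (b $ i - a $ i))) = 0"
            using bump_fun_nonneg[of 0] by (meson antisym_conv2 not_less order.order_iff_strict)
          then have "(\<Prod>i\<in>UNIV. bump (cos (2 * pi * (x $ i - (a $ i + b $ i) / 2)) - cos (pi * (b $ i - a $ i)))) = 0"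
            by (intro prod_zero) auto
          with pos show False by linarith
        qed
      qed (intro prod_pos, simp)
      then show ?thesis by (simp add: arc mem_box_cart)
    qed
  qed
qed

lemma integrable_mult_bounded:
  fixes f g :: "'a \<Rightarrow> real"
  assumes "integrable M f" "g \<in> borel_measurable M" "\<And>x. x \<in> space M \<Longrightarrow> \<bar>g x\<bar> \<le> C"
  shows "integrable M (\<lambda>x. f x * g x)"
proof (rule Bochner_Integration.integrable_bound)
  show "integrable M (\<lambda>x. C * f x)" using assms(1) by simp
  show "AE x in M. norm (f x * g x) \<le> norm (C * f x)"
  proof (rule AE_I2)
    fix x assume "x \<in> space M"
    then have "\<bar>g x\<bar> \<le> \<bar>C\<bar>" using assms(3)[of x] by simp
    then have "\<bar>f x\<bar> * \<bar>g x\<bar> \<le> \<bar>f x\<bar> * \<bar>C\<bar>" by (rule mult_left_mono) simp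
    then show "norm (f x * g x) \<le> norm (C * f x)"
      by (simp add: abs_mult mult.commute)
  qed
qed (use assms in auto)

lemma integral_bounded_convergence:
  fixes h :: "'a \<Rightarrow> real"
  assumes h: "integrable M h" and g: "\<And>n. g n \<in> borel_measurable M" "l \<in> borel_measurable M"
    and bound: "\<And>n x. x \<in> space M \<Longrightarrow> \<bar>g n x\<bar> \<le> C"
    and lim: "\<And>x. x \<in> space M \<Longrightarrow> (\<lambda>n. g n x) \<longlonglongrightarrow> l x"
  shows "(\<lambda>n. LINT x|M. h x * g n x) \<longlonglongrightarrow> (LINT x|M. h x * l x)"
proof (rule integral_dominated_convergence[where w = "\<lambda>x. \<bar>h x\<bar> * C"])
  show "AE x in M. (\<lambda>n. h x * g n x) \<longlonglongrightarrow> h x * l x"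
    using lim by (auto intro!: tendsto_intros AE_I2)
  show "AE x in M. norm (h x * g n x) \<le> \<bar>h x\<bar> * C" for n
    using bound by (auto simp: abs_mult intro!: AE_I2 mult_left_mono)
qed (use h g in auto)

text \<open>The admissible test functions grow in stages: bumps of smooth functions tend to
  indicators of finite unions of boxes, these increase to indicators of open sets, and open sets
  decrease to a G-delta set that differs from {h < 0} by a null set. The integral of h over {h < 0}
  is then nonnegative, which forces the set to be null.\<close>

lemma AE_torus_nonneg:
  fixes h :: "real^'d \<Rightarrow> real"
  assumes h: "integrable torus h"
    and pos: "\<And>g. g \<in> torus_smooth \<Longrightarrow> (\<And>x. 0 \<le> g x) \<Longrightarrow> 0 \<le> (LINT x|torus. h x * g x)"
  shows "AE x in torus. 0 \<le> h x"
proof -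
  have meas_open: "(indicator U :: real^'d \<Rightarrow> real) \<in> borel_measurable torus" if "U \<in> sets lebesgue" for U :: "(real^'d) set"
    using that by (intro measurable_restrict_space1 borel_measurable_indicator) 
  have meas_smooth: "g \<in> borel_measurable torus" if "g \<in> torus_smooth" for g :: "real^'d \<Rightarrow> real"
    using that by (intro borel_measurable_lebesgue_onI borel_measurable_continuous_onI C_infinity_continuous_on)
      (simp add: torus_smooth_def)
  have open_case: "0 \<le> (LINT x|torus. h x * indicator U x)" if U: "open U" "U \<subseteq> box 0 1" for U :: "(real^'d) set"
  proof (cases "U = {}")
    case False
    obtain \<D> where \<D>: "countable \<D>" "\<D> \<subseteq> Pow U" "\<And>X. X \<in> \<D> \<Longrightarrow> \<exists>a b. X = box a b" "\<Union>\<D> = U"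
      by (rule open_countable_Union_open_box[OF U(1)]) blast
    have "\<D> \<noteq> {}" using False \<D>(4) by auto
    define X where "X = from_nat_into \<D>"
    have X: "X n \<in> \<D>" for n unfolding X_def by (rule from_nat_into[OF \<open>\<D> \<noteq> {}\<close>])
    have UX: "U = (\<Union>n. X n)"
      using \<D>(4) range_from_nat_into[OF \<open>\<D> \<noteq> {}\<close> \<D>(1)] by (simp add: X_def)
    have "\<exists>\<beta>\<in>torus_smooth. (\<forall>x. 0 \<le> \<beta> x) \<and> (\<forall>x\<in>unit_cell. 0 < \<beta> x \<longleftrightarrow> x \<in> X n)" for n
    proof -
      obtain a b where ab: "X n = box a b" using \<D>(3)[OF X] by blast
      then have "box a b \<subseteq> box 0 1" using X \<D>(2) U(2) by blast
      then show ?thesis using box_smooth_indicator[of a b] ab by metis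
    qed
    then obtain \<beta> where \<beta>: "\<And>n. \<beta> n \<in> torus_smooth" "\<And>n x. 0 \<le> \<beta> n x"
        "\<And>n x. x \<in> unit_cell \<Longrightarrow> 0 < \<beta> n x \<longleftrightarrow> x \<in> X n"
      by metis
    define V where "V n = (\<Union>i<n. X i)" for n
    have V_open: "open (V n)" for n unfolding V_def using \<D>(3)[OF X] by (auto intro!: open_UN) (metis open_box)
    have V_nonneg: "0 \<le> (LINT x|torus. h x * indicator (V n) x)" for n
    proof -
      \<comment> \<open>Only the positivity set of g matters: it is the finite union of boxes, and
        bump (k g) tends to the indicator of that set.\<close>
      define g where "g x = (\<Sum>i<n. \<beta> i x)" for x
      have g: "g \<in> torus_smooth" unfolding g_def[abs_def] using \<beta>(1) by (intro torus_smooth_sum)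
      have g_pos: "0 < g x \<longleftrightarrow> x \<in> V n" if cell: "x \<in> unit_cell" for x
      proof
        assume "0 < g x"
        then have "\<exists>i<n. 0 < \<beta> i x"
          unfolding g_def by (metis lessThan_iff not_less sum_nonpos)
        then show "x \<in> V n" using \<beta>(3)[OF cell] by (auto simp: V_def)
      next
        assume "x \<in> V n"
        then obtain i where "i < n" "0 < \<beta> i x" using \<beta>(3)[OF cell] by (auto simp: V_def)
        then show "0 < g x" unfolding g_def using \<beta>(2) by (intro sum_pos2[of _ i]) auto
      qed
      have "(\<lambda>k. LINT x|torus. h x * bump (real k * g x)) \<longlonglongrightarrow> (LINT x|torus. h x * indicator (V n) x)"
      proof (rule integral_bounded_convergence[OF h, where C = 1])
        show "(\<lambda>x. bump (real k * g x)) \<in> borel_measurable torus" for k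
          by (rule meas_smooth[OF torus_smooth_bump[OF g]])
        show "(indicator (V n) :: real^'d \<Rightarrow> real) \<in> borel_measurable torus"
          using V_open by (intro meas_open) auto
        show "\<bar>bump (real k * g x)\<bar> \<le> 1" for k x
          using bump_le_1 bump_fun_nonneg by simp
        fix x :: "real^'d" assume "x \<in> space torus"
        then have "indicator {0<..} (g x) = (indicator (V n) x :: real)"
          using g_pos[of x] by (auto simp: indicator_def)
        then show "(\<lambda>k. bump (real k * g x)) \<longlonglongrightarrow> indicator (V n) x"
          using bump_tendsto_indicator[of "g x"] by simp
      qed
      moreover have "0 \<le> (LINT x|torus. h x * bump (real k * g x))" for k
        using g by (intro pos torus_smooth_bump bump_fun_nonneg)
      ultimately show ?thesis by (meson LIMSEQ_le_const)
    qed
    have "(\<lambda>n. LINT x|torus. h x * indicator (V n) x) \<longlonglongrightarrow> (LINT x|torus. h x * indicator U x)"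
    proof (rule integral_bounded_convergence[OF h, where C = 1])
      show "(indicator (V n) :: real^'d \<Rightarrow> real) \<in> borel_measurable torus" for n
        using V_open by (intro meas_open) auto
      show "(indicator U :: real^'d \<Rightarrow> real) \<in> borel_measurable torus" using U by (intro meas_open) auto
      show "(\<lambda>n. indicator (V n) x) \<longlonglongrightarrow> (indicator U x :: real)" for x
        unfolding V_def UX by (rule LIMSEQ_indicator_UN)
    qed (simp add: indicator_def)
    then show ?thesis using V_nonneg by (meson LIMSEQ_le_const)
  qed simp
  \<comment> \<open>Restricting to the open cube loses nothing, because the rest of the cell lies in
    the frontier of the cube, a null set. The smooth functions resolve boxes only inside this
    cube.\<close>
  define A where "A = {x \<in> box 0 1. h x < 0}"
  have box_cell: "box 0 (1::real^'d) \<subseteq> unit_cell"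
    by (auto simp: mem_box_cart unit_cell_def less_imp_le)
  have A: "A \<in> sets lebesgue"
  proof -
    have "{x \<in> space torus. h x < 0} \<in> sets torus"
      using borel_measurable_integrable[OF h] by measurable
    then have "{x \<in> unit_cell. h x < 0} \<in> sets lebesgue"
      by (simp add: sets_restrict_space_iff)
    moreover have "A = {x \<in> unit_cell. h x < 0} \<inter> box 0 1"
      using box_cell by (auto simp: A_def)
    ultimately show ?thesis by auto
  qed
  obtain G N where G: "gdelta G" "N \<in> null_sets lebesgue" "A \<union> N = G" "disjnt A N"
    using lebesgue_set_almost_gdelta[OF A] .
  from G(1) obtain W :: "nat \<Rightarrow> (real^'d) set" where W: "\<And>n. open (W n)" "G = \<Inter>(range W)"
    by (auto simp: gdelta.simps)
  have "A \<union> N \<in> sets lebesgue" using A null_setsD2[OF G(2)] by (rule sets.Un)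
  then have G_box: "G \<inter> box 0 1 \<in> sets lebesgue" unfolding G(3) by (rule sets.Int) simp
  define V where "V n = (\<Inter>k\<le>n. W k) \<inter> box 0 1" for n
  have V: "open (V n)" "V n \<subseteq> box 0 1" for n
    unfolding V_def using W(1) by (auto intro!: open_INT open_Int)
  have "(\<lambda>n. LINT x|torus. h x * indicator (V n) x) \<longlonglongrightarrow> (LINT x|torus. h x * indicator (G \<inter> box 0 1) x)"
  proof (rule integral_bounded_convergence[OF h, where C = 1])
    show "(indicator (V n) :: real^'d \<Rightarrow> real) \<in> borel_measurable torus" for n
      using V(1) by (intro meas_open) auto
    show "(indicator (G \<inter> box 0 1) :: real^'d \<Rightarrow> real) \<in> borel_measurable torus"
      by (rule meas_open[OF G_box])
    show "(\<lambda>n. indicator (V n) x) \<longlonglongrightarrow> (indicator (G \<inter> box 0 1) x :: real)" for x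
    proof -
      have "decseq V" unfolding V_def decseq_def by auto
      moreover have "(\<Inter>n. V n) = G \<inter> box 0 1" unfolding V_def W(2) by auto
      ultimately show ?thesis using LIMSEQ_indicator_decseq[of V x] by (metis (no_types))
    qed
  qed (simp add: indicator_def)
  then have "0 \<le> (LINT x|torus. h x * indicator (G \<inter> box 0 1) x)"
    using open_case[OF V] by (meson LIMSEQ_le_const)
  also have "\<dots> = (LINT x|torus. h x * indicator A x)"
  proof (rule integral_cong_AE)
    have "AE x in lebesgue. x \<notin> N" using G(2) by (rule AE_not_in)
    then have "AE x in torus. x \<notin> N"
      by (auto simp: AE_restrict_space_iff elim!: eventually_mono)
    then show "AE x in torus. h x * indicator (G \<inter> box 0 1) x = h x * indicator A x"
      using G(3) by (auto elim!: eventually_mono simp: indicator_def A_def)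
    from meas_open[OF G_box] show "(\<lambda>x. h x * indicator (G \<inter> box 0 1) x) \<in> borel_measurable torus"
      by (intro borel_measurable_times borel_measurable_integrable[OF h])
    show "(\<lambda>x. h x * indicator A x) \<in> borel_measurable torus"
      by (intro borel_measurable_times borel_measurable_integrable[OF h] meas_open[OF A])
  qed
  finally have int_A: "0 \<le> (LINT x|torus. h x * indicator A x)" .
  have i: "integrable torus (\<lambda>x. - (h x * indicator A x))"
    using integrable_mult_bounded[OF h meas_open[OF A], of 1] by (simp add: indicator_def)
  have nn: "AE x in torus. 0 \<le> - (h x * indicator A x)"
    by (auto simp: A_def indicator_def)
  have "(LINT x|torus. - (h x * indicator A x)) = 0"
    using int_A integral_nonneg_AE[OF nn] by simp
  then have "AE x in torus. - (h x * indicator A x) = 0"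
    using integral_nonneg_eq_0_iff_AE[OF i nn] by simp
  moreover have "AE x in torus. x \<in> box 0 (1::real^'d)"
  proof -
    have "negligible (cbox 0 (1::real^'d) - box 0 1)" by (rule negligible_frontier_interval)
    then have "AE x in lebesgue. x \<notin> cbox 0 (1::real^'d) - box 0 1"
      by (intro AE_not_in) (simp add: negligible_iff_null_sets)
    moreover have cell: "x \<in> cbox 0 1" if "x \<in> unit_cell" for x :: "real^'d"
      using that by (auto simp: unit_cell_def mem_box_cart less_imp_le)
    ultimately have "AE x in lebesgue. x \<in> unit_cell \<longrightarrow> x \<in> box 0 (1::real^'d)"
      by eventually_elim (use cell in blast)
    then show ?thesis by (simp add: AE_restrict_space_iff)
  qed
  ultimately show ?thesis
    by eventually_elim (auto simp: A_def indicator_def split: if_splits)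
qed

text \<open>Nonnegativity is applied to C - f and to C + f, that is, to s = 1 and s = -1.\<close>

lemma AE_torus_bound:
  fixes f :: "real^'d \<Rightarrow> real"
  assumes f: "integrable torus f"
    and bound: "\<And>g. g \<in> torus_smooth \<Longrightarrow> (\<And>x. 0 \<le> g x) \<Longrightarrow>
      \<bar>LINT x|torus. f x * g x\<bar> \<le> C * (LINT x|torus. g x)"
  shows "AE x in torus. \<bar>f x\<bar> \<le> C"
proof -
  interpret finite_measure "torus :: (real^'d) measure" by (rule finite_measure_torus)
  have g: "integrable torus (\<lambda>x. f x * g x)" "integrable torus g" if "g \<in> torus_smooth" for g
  proof -
    have c: "continuous_on UNIV g" using that by (auto simp: torus_smooth_def intro: C_infinity_continuous_on)
    obtain B where "\<And>x. x \<in> unit_cell \<Longrightarrow> norm (g x) \<le> B"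
      using continuous_on_bounded_set[OF c bounded_unit_cell] by blast
    then show "integrable torus (\<lambda>x. f x * g x)"
      by (intro integrable_mult_bounded[OF f, where C = B] borel_measurable_lebesgue_onI
          borel_measurable_continuous_onI[OF c]) auto
    show "integrable torus g"
      by (rule integrable_continuous_bounded_set[OF c borel_unit_cell bounded_unit_cell])
  qed
  have *: "AE x in torus. 0 \<le> C - s * f x" if s: "\<bar>s\<bar> = 1" for s
  proof (rule AE_torus_nonneg)
    show "integrable torus (\<lambda>x. C - s * f x)" using f by simp
    fix \<beta> :: "real^'d \<Rightarrow> real" assume \<beta>: "\<beta> \<in> torus_smooth" "\<And>x. 0 \<le> \<beta> x"
    have "(LINT x|torus. (C - s * f x) * \<beta> x) = (LINT x|torus. C * \<beta> x - s * (f x * \<beta> x))"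
      by (simp add: algebra_simps)
    also have "\<dots> = C * (LINT x|torus. \<beta> x) - s * (LINT x|torus. f x * \<beta> x)"
      using g[OF \<beta>(1)] by simp
    also have "0 \<le> \<dots>"
    proof -
      have "s * (LINT x|torus. f x * \<beta> x) \<le> \<bar>s\<bar> * \<bar>LINT x|torus. f x * \<beta> x\<bar>"
        by (metis abs_ge_self abs_mult)
      then show ?thesis using bound[OF \<beta>] s by simp
    qed
    finally show "0 \<le> (LINT x|torus. (C - s * f x) * \<beta> x)" .
  qed
  show ?thesis
    using *[of 1] *[of "-1"] by (auto elim!: eventually_elim2)
qed

section \<open>Weak-* compactness\<close>

text \<open>The half-lines {..<s} are closed under intersection and generate the Borel sets, so h
  has zero integral over every Borel set. This includes the sets where a Borel representative of h
  is positive or negative.\<close>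

lemma AE_eq_0_initial_integrals:
  fixes h :: "real \<Rightarrow> real"
  assumes h: "integrable (lebesgue_on {0<..<T}) h"
    and zero: "\<And>s. 0 < s \<Longrightarrow> s < T \<Longrightarrow> (LINT t|lebesgue_on {0<..<T}. h t * indicator {..<s} t) = 0"
  shows "AE t in lebesgue_on {0<..<T}. h t = 0"
proof -
  let ?M = "lebesgue_on {0<..<T}"
  have ind: "(indicator A :: real \<Rightarrow> real) \<in> borel_measurable ?M" if "A \<in> sets borel" for A
    using that by (intro borel_measurable_lebesgue_onI borel_measurable_indicator)
  have int_ind: "integrable ?M (\<lambda>t. h t * indicator A t)" if "A \<in> sets borel" for A
    by (rule integrable_mult_bounded[OF h ind[OF that], of 1]) (simp add: indicator_def)
  \<comment> \<open>The hypothesis stops short of s = T, but passing to complements requires the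
    integral over the whole interval; it is the limit along s n -> T.\<close>
  have total: "(LINT t|?M. h t) = 0"
  proof -
    define s where "s n = T - 1 / (real n + 1)" for n
    have s: "s \<longlonglongrightarrow> T - 0"
      unfolding s_def[abs_def] using LIMSEQ_inverse_real_of_nat
      by (intro tendsto_intros) (simp add: divide_inverse add.commute)
    have "(\<lambda>n. LINT t|?M. h t * indicator {..<s n} t) \<longlonglongrightarrow> (LINT t|?M. h t * 1)"
    proof (rule integral_bounded_convergence[OF h, where C = 1])
      fix t assume "t \<in> space ?M"
      then have "\<forall>\<^sub>F n in sequentially. t < s n" using s by (intro order_tendstoD(1)[OF s]) auto
      then have "\<forall>\<^sub>F n in sequentially. indicator {..<s n} t = (1::real)"
        by eventually_elim simp
      then show "(\<lambda>n. indicator {..<s n} t) \<longlonglongrightarrow> (1::real)"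
        by (rule tendsto_eventually)
    qed (auto intro: ind)
    moreover have "(LINT t|?M. h t * indicator {..<s n} t) = 0" for n
    proof (cases "0 < s n")
      case False
      then have "(LINT t|?M. h t * indicator {..<s n} t) = (LINT t|?M. 0)"
        by (intro Bochner_Integration.integral_cong) (auto simp: indicator_def)
      then show ?thesis by simp
    qed (use zero[of "s n"] in \<open>auto simp: s_def\<close>)
    ultimately show ?thesis by (simp add: LIMSEQ_const_iff)
  qed
  have borel_zero: "(LINT t|?M. h t * indicator A t) = 0" if A: "A \<in> sets borel" for A
  proof -
    have G: "A \<in> sigma_sets UNIV (range lessThan)"
        "Int_stable (range (lessThan :: real \<Rightarrow> real set))"
        "range (lessThan :: real \<Rightarrow> real set) \<subseteq> Pow UNIV"
    proof -
      have "{..<a} \<inter> {..<b} = {..<min a b}" for a b :: real by auto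
      then show "Int_stable (range (lessThan :: real \<Rightarrow> real set))"
        by (auto simp: Int_stable_def)
    qed (use A in \<open>simp_all add: borel_Iio sets_measure_of\<close>)
    from G(2,3,1) show ?thesis
    proof (induction A rule: sigma_sets_induct_disjoint)
      case (basic A)
      then obtain s where A: "A = {..<s}" by auto
      consider "s \<le> 0" | "T \<le> s" | "0 < s" "s < T" by linarith
      then show ?case
      proof cases
        case 1
        then have "(LINT t|?M. h t * indicator A t) = (LINT t|?M. 0)"
          by (intro Bochner_Integration.integral_cong) (auto simp: A indicator_def)
        then show ?thesis by simp
      next
        case 2
        then have "(LINT t|?M. h t * indicator A t) = (LINT t|?M. h t)"
          by (intro Bochner_Integration.integral_cong) (auto simp: A indicator_def)
        then show ?thesis using total by simp
      qed (use zero A in auto)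
    next
      case (compl A)
      then have A: "A \<in> sets borel"
        unfolding borel_Iio by (simp add: sets_measure_of)
      have "(LINT t|?M. h t * indicator (UNIV - A) t) = (LINT t|?M. h t - h t * indicator A t)"
        by (intro Bochner_Integration.integral_cong) (auto simp: indicator_def)
      also have "\<dots> = 0" using total compl(2) h int_ind[OF A] by simp
      finally show ?case .
    next
      case (union A)
      have A: "A i \<in> sets borel" for i
        using union(2) unfolding borel_Iio by (auto simp: sets_measure_of)
      have "(\<lambda>n. LINT t|?M. h t * indicator (\<Union>i<n. A i) t) \<longlonglongrightarrow> (LINT t|?M. h t * indicator (\<Union>i. A i) t)"
      proof (rule integral_bounded_convergence[OF h, where C = 1])
        show "(indicator (\<Union>i<n. A i) :: real \<Rightarrow> real) \<in> borel_measurable ?M" for n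
          using A by (intro ind) auto
        show "(indicator (\<Union>i. A i) :: real \<Rightarrow> real) \<in> borel_measurable ?M"
          using A by (intro ind) auto
        show "(\<lambda>n. indicator (\<Union>i<n. A i) t) \<longlonglongrightarrow> (indicator (\<Union>i. A i) t :: real)" for t
          by (rule LIMSEQ_indicator_UN)
      qed simp
      moreover have "(LINT t|?M. h t * indicator (\<Union>i<n. A i) t) = 0" for n
      proof -
        have "(LINT t|?M. h t * indicator (\<Union>i<n. A i) t) = (LINT t|?M. (\<Sum>i<n. h t * indicator (A i) t))"
          using union(1) by (intro Bochner_Integration.integral_cong)
            (auto simp: indicator_UN_disjoint disjoint_family_on_def sum_distrib_left)
        also have "\<dots> = (\<Sum>i<n. LINT t|?M. h t * indicator (A i) t)"
          by (intro Bochner_Integration.integral_sum int_ind A)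
        also have "\<dots> = 0" using union(3) by simp
        finally show ?thesis .
      qed
      ultimately show ?case by (simp add: LIMSEQ_const_iff)
    qed auto
  qed
  obtain g where g: "g \<in> borel_measurable borel" and eq: "AE t in lborel. t \<in> {0<..<T} \<longrightarrow> h t = g t"
    using lebesgue_on_borel_representative_real[OF _ borel_measurable_integrable[OF h]] by auto
  have eq': "AE t in ?M. h t = g t"
    using eq by (simp add: AE_lebesgue_on_borel_iff)
  have sign: "AE t in ?M. s * g t \<le> 0" for s
  proof -
    define A where "A = {t. 0 < s * g t}"
    have A: "A \<in> sets borel" unfolding A_def using g by measurable
    have nn: "AE t in ?M. 0 \<le> s * (h t * indicator A t)"
      using eq' by eventually_elim (auto simp: A_def indicator_def)
    have "integrable ?M (\<lambda>t. s * (h t * indicator A t))" using int_ind[OF A] by simp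
    moreover have "(LINT t|?M. s * (h t * indicator A t)) = 0"
      using borel_zero[OF A] by simp
    ultimately have "AE t in ?M. s * (h t * indicator A t) = 0"
      using integral_nonneg_eq_0_iff_AE[OF _ nn] by simp
    then show ?thesis
      using eq' by eventually_elim (auto simp: A_def indicator_def split: if_splits)
  qed
  show ?thesis
    using sign[of 1] sign[of "-1"] eq' by eventually_elim auto
qed

section \<open>Separable measures and limits of bounded functions\<close>

text \<open>Separability of the measure algebra under the symmetric-difference metric. It reduces
  convergence of integrals over all measurable sets to countably many of them.\<close>

definition separable_measure :: "'a measure \<Rightarrow> bool" where
  "separable_measure M \<longleftrightarrow> (\<exists>B :: nat \<Rightarrow> 'a set. range B \<subseteq> sets M \<and>
     (\<forall>A\<in>sets M. \<forall>e>0. \<exists>n. measure M ((A - B n) \<union> (B n - A)) < e))"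

text \<open>The countable family consists of the finite unions of basic open sets, cut down to S.
  Outer regularity encloses A in an open set U of nearly the same measure, and U is an increasing
  union of such finite unions; each of the two approximations costs e / 2.\<close>

lemma separable_measure_lebesgue_on:
  fixes S :: "'a::euclidean_space set"
  assumes S: "S \<in> sets borel" "bounded S"
  shows "separable_measure (lebesgue_on S)"
proof -
  interpret finite_measure "lebesgue_on S" by (rule finite_measure_lebesgue_on_bounded[OF S])
  obtain \<B> :: "'a set set" where \<B>: "countable \<B>" "topological_basis \<B>"
    using ex_countable_basis by blast
  define \<F> where "\<F> = {F. finite F \<and> F \<subseteq> \<B>}"
  have \<F>: "countable \<F>" "\<F> \<noteq> {}"
    using countable_Collect_finite_subset[OF \<B>(1)] by (auto simp: \<F>_def)
  define B where "B n = S \<inter> \<Union>(from_nat_into \<F> n)" for n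
  have open_B: "open (\<Union>F)" if "F \<in> \<F>" for F
    using that topological_basis_open[OF \<B>(2)] by (auto simp: \<F>_def)
  have sets_I: "S \<inter> U \<in> sets (lebesgue_on S)" if "U \<in> sets lebesgue" for U
    using that S(1) by (auto simp: sets_restrict_space_iff)
  have B_sets: "range B \<subseteq> sets (lebesgue_on S)"
    unfolding B_def using open_B[OF from_nat_into[OF \<F>(2)]] by (auto intro!: sets_I)
  show ?thesis
    unfolding separable_measure_def
  proof (intro exI[of _ B] conjI B_sets ballI allI impI)
    fix A and e :: real assume A: "A \<in> sets (lebesgue_on S)" and e: "0 < e"
    have A': "A \<in> sets lebesgue" "A \<subseteq> S"
      using A S(1) by (auto simp: sets_restrict_space_iff dest: sets.sets_into_space)
    obtain U where U: "open U" "A \<subseteq> U" "U - A \<in> lmeasurable" "emeasure lebesgue (U - A) < ennreal (e / 2)"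
      by (rule sets_lebesgue_outer_open[OF A'(1), of "e / 2"]) (use e in auto)
    obtain \<C> where \<C>: "\<C> \<subseteq> \<B>" "\<Union>\<C> = U"
      using \<B>(2) U(1) by (metis topological_basis_def)
    have cC: "countable \<C>" using \<C>(1) \<B>(1) countable_subset by blast
    \<comment> \<open>The case distinction guards \<open>from_nat_into\<close>, which enumerates
      nonempty families only.\<close>
    define X where "X n = (\<Union>i<n. if \<C> = {} then {} else from_nat_into \<C> i)" for n :: nat
    have X_open: "open (X n)" for n
      unfolding X_def using topological_basis_open[OF \<B>(2)] \<C>(1) from_nat_into[of \<C>] by (intro open_UN) auto
    have X_UN: "(\<Union>n. X n) = U"
    proof (cases "\<C> = {}")
      case False
      then have "(\<Union>n. X n) = (\<Union>i. from_nat_into \<C> i)" unfolding X_def by auto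
      then show ?thesis using \<C>(2) range_from_nat_into[OF False cC] by simp
    qed (use \<C>(2) in \<open>auto simp: X_def\<close>)
    have incX: "incseq X" unfolding X_def incseq_def by (intro allI impI UN_mono) auto
    have "(\<lambda>n. measure (lebesgue_on S) (S \<inter> (U - X n))) \<longlonglongrightarrow> measure (lebesgue_on S) (\<Inter>n. S \<inter> (U - X n))"
    proof (rule finite_Lim_measure_decseq)
      show "range (\<lambda>n. S \<inter> (U - X n)) \<subseteq> sets (lebesgue_on S)"
        using X_open U(1) by (auto intro!: sets_I)
      show "decseq (\<lambda>n. S \<inter> (U - X n))"
        using incX unfolding decseq_def incseq_def by blast
    qed
    moreover have "(\<Inter>n. S \<inter> (U - X n)) = {}" using X_UN by auto
    ultimately have "\<forall>\<^sub>F n in sequentially. measure (lebesgue_on S) (S \<inter> (U - X n)) < e / 2"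
      using e by (intro order_tendstoD(2)) auto
    then obtain n where n: "measure (lebesgue_on S) (S \<inter> (U - X n)) < e / 2"
      by (auto simp: eventually_sequentially)
    define F where "F = (if \<C> = {} then {} else from_nat_into \<C> ` {..<n})"
    have F: "F \<in> \<F>" "\<Union>F = X n"
      using \<C>(1) from_nat_into[of \<C>] by (auto simp: F_def \<F>_def X_def)
    obtain m where m: "from_nat_into \<F> m = F"
      using from_nat_into_surj[OF \<F>(1) F(1)] by blast
    have Bm: "B m = S \<inter> X n" by (simp add: B_def m F(2))
    have XU: "X n \<subseteq> U" using X_UN by auto
    have m2: "measure (lebesgue_on S) (S \<inter> (U - A)) < e / 2"
    proof -
      have "emeasure (lebesgue_on S) (S \<inter> (U - A)) = emeasure lebesgue (S \<inter> (U - A))"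
        using S(1) by (subst emeasure_restrict_space) auto
      also have "\<dots> \<le> emeasure lebesgue (U - A)"
        using U(3) by (intro emeasure_mono) auto
      also have "\<dots> < ennreal (e / 2)" by (rule U(4))
      finally show ?thesis by (simp add: emeasure_eq_measure ennreal_less_iff)
    qed
    have "measure (lebesgue_on S) ((A - B m) \<union> (B m - A))
        \<le> measure (lebesgue_on S) (S \<inter> (U - X n) \<union> S \<inter> (U - A))"
    proof (rule finite_measure_mono)
      show "A - B m \<union> (B m - A) \<subseteq> S \<inter> (U - X n) \<union> S \<inter> (U - A)"
        using A'(2) U(2) XU by (auto simp: Bm)
      show "S \<inter> (U - X n) \<union> S \<inter> (U - A) \<in> sets (lebesgue_on S)"
        using X_open U(1) A' by (auto intro!: sets_I sets.Un)
    qed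
    also have "\<dots> \<le> measure (lebesgue_on S) (S \<inter> (U - X n)) + measure (lebesgue_on S) (S \<inter> (U - A))"
      using X_open U(1) A' by (intro measure_Un_le sets_I) auto
    also have "\<dots> < e" using n m2 by simp
    finally show "\<exists>n. measure (lebesgue_on S) (A - B n \<union> (B n - A)) < e" by blast
  qed
qed

lemma tendsto_approx:
  fixes a :: "nat \<Rightarrow> real"
  assumes "\<And>e. 0 < e \<Longrightarrow> \<exists>a' l'. a' \<longlonglongrightarrow> l' \<and> (\<forall>n. \<bar>a n - a' n\<bar> \<le> e) \<and> \<bar>l - l'\<bar> \<le> e"
  shows "a \<longlonglongrightarrow> l"
proof (rule LIMSEQ_I)
  fix r :: real assume r: "0 < r"
  then obtain a' l' where *: "a' \<longlonglongrightarrow> l'" "\<And>n. \<bar>a n - a' n\<bar> \<le> r / 4" "\<bar>l - l'\<bar> \<le> r / 4"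
    using assms[of "r / 4"] by auto
  obtain N where N: "\<And>n. N \<le> n \<Longrightarrow> norm (a' n - l') < r / 4"
    using LIMSEQ_D[OF *(1), of "r / 4"] r by auto
  then show "\<exists>N. \<forall>n\<ge>N. norm (a n - l) < r"
  proof (intro exI[of _ N] allI impI)
    fix n assume "N \<le> n"
    have "\<bar>a n - l\<bar> \<le> \<bar>a n - a' n\<bar> + \<bar>a' n - l'\<bar> + \<bar>l - l'\<bar>" by linarith
    also have "\<dots> < r"
      using *(2)[of n] *(3) N[OF \<open>N \<le> n\<close>] r unfolding real_norm_def by linarith
    finally show "norm (a n - l) < r" by simp
  qed
qed

lemma Cauchy_approx:
  fixes a :: "nat \<Rightarrow> real"
  assumes "\<And>e. 0 < e \<Longrightarrow> \<exists>a'. convergent a' \<and> (\<forall>n. \<bar>a n - a' n\<bar> \<le> e)"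
  shows "convergent a"
proof (rule Cauchy_convergent, rule CauchyI)
  fix r :: real assume r: "0 < r"
  then obtain a' where *: "convergent a'" "\<And>n. \<bar>a n - a' n\<bar> \<le> r / 4"
    using assms[of "r / 4"] by auto
  obtain N where N: "\<And>m n. N \<le> m \<Longrightarrow> N \<le> n \<Longrightarrow> norm (a' m - a' n) < r / 4"
    using CauchyD[OF convergent_Cauchy[OF *(1)], of "r / 4"] r by auto
  then show "\<exists>M. \<forall>m\<ge>M. \<forall>n\<ge>M. norm (a m - a n) < r"
  proof (intro exI[of _ N] allI impI)
    fix m n assume mn: "N \<le> m" "N \<le> n"
    have "\<bar>a m - a n\<bar> \<le> \<bar>a m - a' m\<bar> + \<bar>a' m - a' n\<bar> + \<bar>a n - a' n\<bar>" by linarith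
    also have "\<dots> < r"
      using *(2)[of n] *(2)[of m] N[OF mn] r unfolding real_norm_def by linarith
    finally show "norm (a m - a n) < r" by simp
  qed
qed

lemma abs_integral_mult_le:
  fixes F h :: "'a \<Rightarrow> real"
  assumes "integrable M h" "F \<in> borel_measurable M" "\<And>x. x \<in> space M \<Longrightarrow> \<bar>F x\<bar> \<le> 1"
  shows "\<bar>LINT x|M. F x * h x\<bar> \<le> (LINT x|M. \<bar>h x\<bar>)"
proof -
  have "\<bar>LINT x|M. F x * h x\<bar> \<le> (LINT x|M. \<bar>F x * h x\<bar>)"
    using integral_norm_bound[of M "\<lambda>x. F x * h x"] by simp
  also have "\<dots> \<le> (LINT x|M. \<bar>h x\<bar>)"
  proof (rule integral_mono)
    show "integrable M (\<lambda>x. \<bar>F x * h x\<bar>)"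
      using integrable_mult_bounded[OF assms] by (simp add: mult.commute)
    show "integrable M (\<lambda>x. \<bar>h x\<bar>)" using assms(1) by simp
    show "\<bar>F x * h x\<bar> \<le> \<bar>h x\<bar>" if "x \<in> space M" for x
      using mult_right_mono[OF assms(3)[OF that], of "\<bar>h x\<bar>"] by (simp add: abs_mult)
  qed
  finally show ?thesis .
qed

text \<open>The limits over sets form a finitely additive set function L with 0 \<le> L A \<le>
  \<open>measure M A\<close>. The upper bound yields continuity at the empty set, hence countable
  additivity, as well as absolute continuity; the Radon-Nikodym density is the limit function.
  Simple functions then lead to all integrable h, uniformly in k because the F k are bounded by
  1.\<close>

lemma weakstar_limit_of_set_convergence:
  fixes F :: "nat \<Rightarrow> 'a \<Rightarrow> real"
  assumes fin: "finite_measure M"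
    and F: "\<And>k. F k \<in> borel_measurable M" "\<And>k x. x \<in> space M \<Longrightarrow> 0 \<le> F k x \<and> F k x \<le> 1"
    and conv: "\<And>A. A \<in> sets M \<Longrightarrow> convergent (\<lambda>k. LINT x|M. F k x * indicator A x)"
  obtains g where "g \<in> borel_measurable M" "\<And>x. 0 \<le> g x \<and> g x \<le> 1"
    "\<And>h. integrable M h \<Longrightarrow> (\<lambda>k. LINT x|M. F k x * h x) \<longlonglongrightarrow> (LINT x|M. g x * h x)"
proof -
  interpret finite_measure M by (rule fin)
  define L where "L A = lim (\<lambda>k. LINT x|M. F k x * indicator A x)" for A
  have L: "(\<lambda>k. LINT x|M. F k x * indicator A x) \<longlonglongrightarrow> L A" if "A \<in> sets M" for A
    using conv[OF that] by (simp add: L_def convergent_LIMSEQ_iff)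
  have int: "integrable M (\<lambda>x. F k x * indicator A x)" if "A \<in> sets M" for k A
    using F that by (intro integrable_const_bound[where B = 1]) (auto simp: indicator_def)
  have L_nonneg: "0 \<le> L A" if "A \<in> sets M" for A
    by (rule LIMSEQ_le_const[OF L[OF that]]) (use F in \<open>auto intro!: Bochner_Integration.integral_nonneg\<close>)
  have L_le: "L A \<le> measure M A" if A: "A \<in> sets M" for A
  proof (rule LIMSEQ_le_const2[OF L[OF A]])
    have "(LINT x|M. F k x * indicator A x) \<le> (LINT x|M. indicator A x)" for k
    proof (rule integral_mono[OF int[OF A]])
      show "integrable M (indicator A :: 'a \<Rightarrow> real)" using A by (simp add: emeasure_eq_measure)
      show "F k x * indicator A x \<le> indicator A x" if "x \<in> space M" for x
        using F(2)[OF that, of k] by (simp add: indicator_def)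
    qed
    then show "\<exists>N. \<forall>k\<ge>N. (LINT x|M. F k x * indicator A x) \<le> measure M A"
      using A by (auto simp: Int_absorb2 sets.sets_into_space)
  qed
  have L_add: "L (A \<union> B) = L A + L B" if "A \<in> sets M" "B \<in> sets M" "A \<inter> B = {}" for A B
  proof (rule LIMSEQ_unique[OF L])
    have "(LINT x|M. F k x * indicator (A \<union> B) x)
        = (LINT x|M. F k x * indicator A x) + (LINT x|M. F k x * indicator B x)" for k
    proof -
      have "(LINT x|M. F k x * indicator (A \<union> B) x) = (LINT x|M. F k x * indicator A x + F k x * indicator B x)"
        using that(3) by (intro Bochner_Integration.integral_cong) (auto simp: indicator_def)
      then show ?thesis using int that by simp
    qed
    then show "(\<lambda>k. LINT x|M. F k x * indicator (A \<union> B) x) \<longlonglongrightarrow> L A + L B"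
      using tendsto_add[OF L[OF that(1)] L[OF that(2)]] by simp
  qed (use that in auto)
  have L_empty: "L {} = 0" by (simp add: L_def)
  define N where "N = measure_of (space M) (sets M) (\<lambda>A. ennreal (L A))"
  have sets_N: "sets N = sets M" by (simp add: N_def)
  have N: "emeasure N A = ennreal (L A)" if "A \<in> sets M" for A
  proof (rule emeasure_measure_of[OF N_def])
    show "sets M \<subseteq> Pow (space M)" by (rule sets.space_closed)
    show "positive (sets N) (\<lambda>A. ennreal (L A))" by (simp add: positive_def L_empty)
    show "countably_additive (sets N) (\<lambda>A. ennreal (L A))"
      unfolding sets_N
    proof (rule sets.empty_continuous_imp_countably_additive)
      show "positive (sets M) (\<lambda>A. ennreal (L A))" by (simp add: positive_def L_empty)
      show "additive (sets M) (\<lambda>A. ennreal (L A))"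
        by (auto simp: additive_def L_add L_nonneg)
      fix A :: "nat \<Rightarrow> 'a set" assume A: "range A \<subseteq> sets M" "decseq A" "(\<Inter>i. A i) = {}"
      have "(\<lambda>i. measure M (A i)) \<longlonglongrightarrow> measure M (\<Inter>i. A i)"
        by (rule finite_Lim_measure_decseq[OF A(1,2)])
      then have m: "(\<lambda>i. measure M (A i)) \<longlonglongrightarrow> 0" by (simp add: A(3))
      have "(\<lambda>i. L (A i)) \<longlonglongrightarrow> 0"
        by (rule tendsto_sandwich[OF _ _ tendsto_const m]) (use A(1) in \<open>auto intro!: always_eventually L_nonneg L_le\<close>)
      then show "(\<lambda>i. ennreal (L (A i))) \<longlonglongrightarrow> 0"
        using tendsto_ennrealI[of "\<lambda>i. L (A i)" 0 sequentially] by simp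
    qed auto
    show "A \<in> sets N" using that sets_N by simp
  qed
  have "absolutely_continuous M N"
    unfolding absolutely_continuous_def
  proof
    fix A assume A: "A \<in> null_sets M"
    then have "A \<in> sets M" "measure M A = 0" by (auto simp: measure_def)
    then have "L A \<le> 0" using L_le[of A] by simp
    then show "A \<in> null_sets N" using N[of A] \<open>A \<in> sets M\<close> sets_N by (auto simp: null_sets_def ennreal_neg)
  qed
  from Radon_Nikodym[OF this sets_N] obtain f where f: "f \<in> borel_measurable M" "density M f = N"
    by blast
  \<comment> \<open>Truncation makes the bounds hold everywhere; \<open>f_le\<close> below shows
    that it alters f on a null set only.\<close>
  define g where "g x = enn2real (min 1 (f x))" for x
  have g_meas: "g \<in> borel_measurable M" unfolding g_def[abs_def] using f(1) by measurable
  have g_ennreal: "ennreal (g x) = min 1 (f x)" for x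
    unfolding g_def by (rule ennreal_enn2real) (simp add: min_less_iff_disj)
  have g01: "0 \<le> g x \<and> g x \<le> 1" for x
  proof -
    have "ennreal (g x) \<le> ennreal 1" unfolding g_ennreal by simp
    then have "g x \<le> 1" by (simp add: ennreal_le_iff)
    then show ?thesis by (simp add: g_def)
  qed
  have f_le: "AE x in M. f x \<le> 1"
  proof -
    define A where "A = {x \<in> space M. 1 < f x}"
    have A: "A \<in> sets M" unfolding A_def using f(1) by measurable
    \<comment> \<open>The integral of f over A is at most the measure of A, so the excess f - 1,
      positive on A, must integrate to zero.\<close>
    have "(\<integral>\<^sup>+x. (f x - 1) * indicator A x \<partial>M) + emeasure M A = (\<integral>\<^sup>+x. (f x - 1) * indicator A x + indicator A x \<partial>M)"
      using f(1) A by (subst nn_integral_add) auto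
    also have "\<dots> = (\<integral>\<^sup>+x. f x * indicator A x \<partial>M)"
      by (intro nn_integral_cong) (auto simp: indicator_def A_def less_imp_le diff_add_cancel_ennreal)
    also have "\<dots> = emeasure N A"
      using f A by (simp add: f(2)[symmetric] emeasure_density)
    also have "\<dots> \<le> 0 + emeasure M A"
      using N[OF A] L_le[OF A] by (simp add: emeasure_eq_measure ennreal_leI)
    finally have "(\<integral>\<^sup>+x. (f x - 1) * indicator A x \<partial>M) = 0"
      by (simp add: emeasure_eq_measure ennreal_add_left_cancel_le add.commute[of _ "ennreal _"])
    then have "AE x in M. (f x - 1) * indicator A x = 0"
      using f(1) A by (subst (asm) nn_integral_0_iff_AE) auto
    then show ?thesis
      using AE_space
    proof eventually_elim
      case (elim x)
      show ?case
      proof (rule ccontr)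
        assume "\<not> f x \<le> 1"
        then have "x \<in> A" using elim(2) by (simp add: A_def)
        then have "f x - 1 = 0" using elim(1) by simp
        then show False using \<open>\<not> f x \<le> 1\<close> by (simp add: diff_eq_0_iff_ennreal)
      qed
    qed
  qed
  have g_int: "(LINT x|M. g x * indicator A x) = L A" if A: "A \<in> sets M" for A
  proof -
    have "(\<integral>\<^sup>+x. ennreal (g x * indicator A x) \<partial>M) = (\<integral>\<^sup>+x. f x * indicator A x \<partial>M)"
    proof (rule nn_integral_cong_AE)
      show "AE x in M. ennreal (g x * indicator A x) = f x * indicator A x"
        using f_le by eventually_elim (auto simp: indicator_def g_ennreal)
    qed
    also have "\<dots> = ennreal (L A)"
      using f A N[OF A] by (simp add: f(2)[symmetric] emeasure_density)
    finally have "(\<integral>\<^sup>+x. ennreal (g x * indicator A x) \<partial>M) = ennreal (L A)" .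
    then show ?thesis
      using g_meas A g01 L_nonneg[OF A]
      by (subst integral_eq_nn_integral) auto
  qed
  have F1: "\<bar>F k x\<bar> \<le> 1" if "x \<in> space M" for k x using F(2)[OF that, of k] by auto
  have g1: "\<bar>g x\<bar> \<le> 1" for x using g01[of x] by auto
  have intFh: "integrable M (\<lambda>x. F k x * h x)" if "integrable M h" for k h
    using integrable_mult_bounded[OF that F(1) F1] by (simp add: mult.commute)
  have intgh: "integrable M (\<lambda>x. g x * h x)" if "integrable M h" for h
    using integrable_mult_bounded[OF that g_meas, of 1] g1 by (simp add: mult.commute)
  have main: "(\<lambda>k. LINT x|M. F k x * h x) \<longlonglongrightarrow> (LINT x|M. g x * h x)" if "integrable M h" for h
    using that
  proof (induction rule: integrable_induct)
    case (base A c)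
    have "(\<lambda>k. (LINT x|M. F k x * indicator A x) * c) \<longlonglongrightarrow> (LINT x|M. g x * indicator A x) * c"
      using tendsto_mult[OF L[OF base(1)] tendsto_const] g_int[OF base(1)] by simp
    then show ?case by (simp add: mult.assoc[symmetric])
  next
    case (add f h)
    then show ?case
      using tendsto_add[OF add.IH] by (simp add: distrib_left intFh intgh)
  next
    case (lim f s)
    have "(\<lambda>i. LINT x|M. \<bar>s i x - f x\<bar>) \<longlonglongrightarrow> (LINT x|M. 0)"
    proof (rule integral_dominated_convergence[where w = "\<lambda>x. 3 * \<bar>f x\<bar>"])
      show "AE x in M. (\<lambda>i. \<bar>s i x - f x\<bar>) \<longlonglongrightarrow> 0"
        using lim.hyps(2) by (auto intro!: AE_I2 tendsto_rabs_zero simp: LIM_zero_iff)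
      show "AE x in M. norm \<bar>s i x - f x\<bar> \<le> 3 * \<bar>f x\<bar>" for i
      proof (rule AE_I2)
        fix x assume "x \<in> space M"
        then show "norm \<bar>s i x - f x\<bar> \<le> 3 * \<bar>f x\<bar>"
          using lim.hyps(3)[of x i] by (simp add: abs_le_iff) linarith
      qed
    qed (use lim in auto)
    then have lim0: "(\<lambda>i. LINT x|M. \<bar>s i x - f x\<bar>) \<longlonglongrightarrow> 0" by simp
    show ?case
    proof (rule tendsto_approx)
      fix e :: real assume "0 < e"
      then have "\<forall>\<^sub>F i in sequentially. (LINT x|M. \<bar>s i x - f x\<bar>) < e"
        by (rule order_tendstoD(2)[OF lim0])
      then obtain i where i: "(LINT x|M. \<bar>s i x - f x\<bar>) < e"
        by (auto simp: eventually_sequentially)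
      have d: "integrable M (\<lambda>x. s i x - f x)" using lim by simp
      have "\<bar>(LINT x|M. F k x * f x) - (LINT x|M. F k x * s i x)\<bar> \<le> e" for k
      proof -
        have "(LINT x|M. F k x * s i x) - (LINT x|M. F k x * f x) = (LINT x|M. F k x * (s i x - f x))"
          using intFh[OF lim.hyps(1)] intFh[OF lim.hyps(4)] by (simp add: right_diff_distrib)
        then show ?thesis
          using abs_integral_mult_le[OF d F(1) F1, of k] i by (simp add: abs_minus_commute)
      qed
      moreover have "\<bar>(LINT x|M. g x * f x) - (LINT x|M. g x * s i x)\<bar> \<le> e"
      proof -
        have "(LINT x|M. g x * s i x) - (LINT x|M. g x * f x) = (LINT x|M. g x * (s i x - f x))"
          using intgh[OF lim.hyps(1)] intgh[OF lim.hyps(4)] by (simp add: right_diff_distrib)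
        then show ?thesis
          using abs_integral_mult_le[OF d g_meas g1] i by (simp add: abs_minus_commute)
      qed
      ultimately show "\<exists>a' l'. a' \<longlonglongrightarrow> l' \<and> (\<forall>k. \<bar>(LINT x|M. F k x * f x) - a' k\<bar> \<le> e)
          \<and> \<bar>(LINT x|M. g x * f x) - l'\<bar> \<le> e"
        using lim.IH[of i] by blast
    qed
  qed
  show ?thesis by (rule that[OF g_meas g01 main])
qed

text \<open>Tychonoff instead of an explicit diagonal extraction: the countable power of an interval
  is compact, hence sequentially compact, and coordinates are continuous.\<close>

lemma bounded_sequences_common_subsequence:
  fixes X :: "nat \<Rightarrow> nat \<Rightarrow> real"
  assumes "\<And>k n. X k n \<in> {0..c}"
  obtains r where "strict_mono r" "\<And>n. convergent (\<lambda>k. X (r k) n)"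
proof -
  have "compact (PiE UNIV (\<lambda>n::nat. {0..c}))"
    using compactin_PiE[of "\<lambda>_. euclidean" UNIV "\<lambda>_. {0..c}"]
    by (simp add: euclidean_product_topology)
  then have "seq_compact (PiE UNIV (\<lambda>n::nat. {0..c}))"
    by (rule compact_imp_seq_compact)
  moreover have "\<forall>k. X k \<in> PiE UNIV (\<lambda>n::nat. {0..c})"
    using assms by auto
  ultimately obtain l r where r: "strict_mono r" "(X \<circ> r) \<longlonglongrightarrow> l"
    unfolding seq_compact_def by metis
  have "(\<lambda>k. (X \<circ> r) k n) \<longlonglongrightarrow> l n" for n
    by (rule continuous_on_tendsto_compose[OF continuous_on_product_coordinates r(2)]) auto
  then show ?thesis
    using r(1) by (intro that[of r]) (auto simp: convergent_def comp_def)
qed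

text \<open>Sequential Banach-Alaoglu for the unit ball of L^infinity, for countably many sequences
  at once. One subsequence handles all integrals over the dense family of sets, and approximation in
  measure, uniform in k, extends convergence to every measurable set.\<close>

theorem weakstar_compactness:
  fixes f :: "nat \<Rightarrow> nat \<Rightarrow> 'a \<Rightarrow> real"
  assumes fin: "finite_measure M" and sep: "separable_measure M"
    and f: "\<And>j k. f j k \<in> borel_measurable M" "\<And>j k x. x \<in> space M \<Longrightarrow> 0 \<le> f j k x \<and> f j k x \<le> 1"
  obtains r g where "strict_mono (r :: nat \<Rightarrow> nat)" "\<And>j. g j \<in> borel_measurable M" "\<And>j x. 0 \<le> g j x \<and> g j x \<le> 1"
    "\<And>j h. integrable M h \<Longrightarrow> (\<lambda>k. LINT x|M. f j (r k) x * h x) \<longlonglongrightarrow> (LINT x|M. g j x * h x)"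
proof -
  interpret finite_measure M by (rule fin)
  obtain B :: "nat \<Rightarrow> 'a set" where B: "range B \<subseteq> sets M"
    "\<And>A e. A \<in> sets M \<Longrightarrow> 0 < e \<Longrightarrow> \<exists>n. measure M ((A - B n) \<union> (B n - A)) < e"
    using sep unfolding separable_measure_def by metis
  have int: "integrable M (\<lambda>x. f j k x * indicator A x)" if "A \<in> sets M" for j k A
    using f that by (intro integrable_const_bound[where B = 1]) (auto simp: indicator_def)
  \<comment> \<open>\<open>prod_decode\<close> enumerates the pairs of a sequence index j and a set
    of the dense family, so that a single subsequence serves every j.\<close>
  define X where "X k n = (LINT x|M. f (fst (prod_decode n)) k x * indicator (B (snd (prod_decode n))) x)" for k n
  have X_range: "X k n \<in> {0..measure M (space M)}" for k n
  proof -
    have "X k n \<le> (LINT x|M. 1)"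
      unfolding X_def using f B(1) by (intro integral_mono int) (auto simp: indicator_def)
    moreover have "0 \<le> X k n"
      unfolding X_def using f by (intro Bochner_Integration.integral_nonneg) auto
    ultimately show ?thesis by simp
  qed
  obtain r where r: "strict_mono r" "\<And>n. convergent (\<lambda>k. X (r k) n)"
    by (rule bounded_sequences_common_subsequence[OF X_range]) (rule that, auto)
  have conv: "convergent (\<lambda>k. LINT x|M. f j (r k) x * indicator A x)" if A: "A \<in> sets M" for j A
  proof (rule Cauchy_approx)
    fix e :: real assume "0 < e"
    then obtain n where n: "measure M ((A - B n) \<union> (B n - A)) < e" using B(2)[OF A] by blast
    have Bn: "B n \<in> sets M" using B(1) by auto
    have "\<bar>(LINT x|M. f j (r k) x * indicator A x) - (LINT x|M. f j (r k) x * indicator (B n) x)\<bar> \<le> e" for k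
    proof -
      have d: "integrable M (\<lambda>x. indicator A x - indicator (B n) x :: real)"
        using A Bn by (intro Bochner_Integration.integrable_diff) (auto simp: emeasure_eq_measure)
      have "(LINT x|M. f j (r k) x * indicator A x) - (LINT x|M. f j (r k) x * indicator (B n) x)
          = (LINT x|M. f j (r k) x * (indicator A x - indicator (B n) x))"
        using int[OF A] int[OF Bn] by (simp add: right_diff_distrib)
      also have "\<bar>\<dots>\<bar> \<le> (LINT x|M. \<bar>indicator A x - indicator (B n) x\<bar>)"
      proof (rule abs_integral_mult_le[OF d f(1)])
        show "\<bar>f j (r k) x\<bar> \<le> 1" if "x \<in> space M" for x
          using f(2)[OF that, of j "r k"] by simp
      qed
      also have "\<dots> = (LINT x|M. indicator ((A - B n) \<union> (B n - A)) x)"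
        by (intro Bochner_Integration.integral_cong) (auto simp: indicator_def)
      also have "\<dots> = measure M ((A - B n) \<union> (B n - A))"
        using A Bn by (simp add: Int_absorb2 sets.sets_into_space)
      finally show ?thesis using n by simp
    qed
    moreover have "convergent (\<lambda>k. LINT x|M. f j (r k) x * indicator (B n) x)"
      using r(2)[of "prod_encode (j, n)"] by (simp add: X_def)
    ultimately show "\<exists>a'. convergent a' \<and> (\<forall>k. \<bar>(LINT x|M. f j (r k) x * indicator A x) - a' k\<bar> \<le> e)"
      by blast
  qed
  have "\<exists>g. g \<in> borel_measurable M \<and> (\<forall>x. 0 \<le> g x \<and> g x \<le> 1) \<and>
      (\<forall>h. integrable M h \<longrightarrow> (\<lambda>k. LINT x|M. f j (r k) x * h x) \<longlonglongrightarrow> (LINT x|M. g x * h x))" for j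
  proof (rule weakstar_limit_of_set_convergence[OF fin, of "\<lambda>k. f j (r k)"])
    fix g assume "g \<in> borel_measurable M" "\<And>x. 0 \<le> g x \<and> g x \<le> 1"
      "\<And>h. integrable M h \<Longrightarrow> (\<lambda>k. LINT x|M. f j (r k) x * h x) \<longlonglongrightarrow> (LINT x|M. g x * h x)"
    then show ?thesis by (intro exI[of _ g]) simp
  qed (use f conv in simp_all)
  then have "\<forall>j. \<exists>g. g \<in> borel_measurable M \<and> (\<forall>x. 0 \<le> g x \<and> g x \<le> 1) \<and>
      (\<forall>h. integrable M h \<longrightarrow> (\<lambda>k. LINT x|M. f j (r k) x * h x) \<longlonglongrightarrow> (LINT x|M. g x * h x))" ..
  from choice[OF this] obtain g where g: "\<forall>j. g j \<in> borel_measurable M \<and> (\<forall>x. 0 \<le> g j x \<and> g j x \<le> 1) \<and>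
      (\<forall>h. integrable M h \<longrightarrow> (\<lambda>k. LINT x|M. f j (r k) x * h x) \<longlonglongrightarrow> (LINT x|M. g j x * h x))" ..
  show ?thesis by (rule that[OF r(1), of g]) (use g in simp_all)
qed

section \<open>Compactness of Young measures\<close>

text \<open>Schoenberg's construction: a continuous curve through every point of a cube with an explicit
  Borel right inverse, built from a 2-periodic function that reads off a ternary digit.\<close>

definition digit_wave :: "real \<Rightarrow> real" where
  "digit_wave y = max 0 (min 1 (3 * (arccos (cos (pi * y)) / pi) - 1))"

lemma digit_wave_range: "0 \<le> digit_wave y" "digit_wave y \<le> 1"
  by (auto simp: digit_wave_def)

lemma continuous_digit_wave: "continuous_on A digit_wave"
  unfolding digit_wave_def[abs_def] by (intro continuous_intros) (auto simp: field_simps)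

text \<open>Up to the factor pi, arccos (cos (pi y)) is the distance of y to the nearest even
  integer. The wave clips it to 0 on [0, 1/3] and to 1 on [2/3, 1], and has period 2.\<close>

lemma digit_wave_eq:
  assumes d: "d \<in> {0, 1}" and \<rho>: "0 \<le> \<rho>" "\<rho> \<le> 1 / 3"
  shows "digit_wave (2 * real n + (2 / 3 * d + \<rho>)) = d"
proof -
  define z where "z = 2 / 3 * d + \<rho>"
  have z: "0 \<le> z" "z \<le> 1" using assms by (auto simp: z_def)
  have "cos (pi * (2 * real n + z)) = cos (pi * z + real n * (2 * pi))"
    by (simp add: algebra_simps)
  also have "\<dots> = cos (pi * z)"
    by (induction n) (simp_all add: algebra_simps cos_add sin_add) 
  finally have "arccos (cos (pi * (2 * real n + z))) = pi * z"
    using z by (simp add: arccos_cos mult_le_cancel_left1)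
  then have "digit_wave (2 * real n + z) = max 0 (min 1 (3 * z - 1))"
    by (simp add: digit_wave_def)
  also have "\<dots> = d" using assms by (auto simp: z_def)
  finally show ?thesis by (simp add: z_def)
qed

text \<open>A point of the Cantor set, with ternary digits 0 and 2. The missing digit 1 leaves the
  gap in which the continuous wave passes from 0 to 1.\<close>

definition ternary_code :: "(nat \<Rightarrow> real) \<Rightarrow> real" where
  "ternary_code d = (\<Sum>j. 2 * d j / 3 ^ (j + 1))"

lemma summable_ternary_code:
  assumes "\<And>j. d j \<in> {0, 1::real}"
  shows "summable (\<lambda>j. 2 * d j / 3 ^ (j + 1))"
proof (rule summable_comparison_test')
  show "summable (\<lambda>j. 2 / 3 * (1 / 3 :: real) ^ j)"
    by (intro summable_mult summable_geometric) simp
  show "norm (2 * d j / 3 ^ (j + 1)) \<le> 2 / 3 * (1 / 3) ^ j" for j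
    using assms[of j] by (auto simp: power_one_over)
qed

lemma ternary_code_range:
  assumes "\<And>j. d j \<in> {0, 1::real}"
  shows "0 \<le> ternary_code d" "ternary_code d \<le> 1"
proof -
  have d: "0 \<le> d j" "d j \<le> 1" for j using assms[of j] by auto
  show "0 \<le> ternary_code d"
    unfolding ternary_code_def using d by (intro suminf_nonneg summable_ternary_code assms) auto
  have "(\<lambda>j. 2 / 3 * (1 / 3 :: real) ^ j) sums (2 / 3 * (1 / (1 - 1 / 3)))"
    by (intro sums_mult geometric_sums) simp
  then have g: "(\<lambda>j. 2 / 3 * (1 / 3 :: real) ^ j) sums 1" by simp
  have "ternary_code d \<le> (\<Sum>j. 2 / 3 * (1 / 3 :: real) ^ j)"
    unfolding ternary_code_def
    using d g by (intro suminf_le summable_ternary_code assms) (auto simp: sums_iff power_one_over field_simps)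
  also have "\<dots> = 1" using g by (simp add: sums_iff)
  finally show "ternary_code d \<le> 1" .
qed

text \<open>After multiplication by 3^j the earlier digits contribute an even integer, invisible to
  a wave of period 2. Digit j contributes 0 or 2/3, and the tail at most 1/3, so the argument falls
  on a plateau of the wave.\<close>

lemma digit_wave_ternary_code:
  assumes d: "\<And>j. d j \<in> {0, 1::real}"
  shows "digit_wave (3 ^ j * ternary_code d) = d j"
proof -
  define a where "a i = 2 * d i / 3 ^ (i + 1)" for i
  have sa: "summable a" unfolding a_def[abs_def] by (rule summable_ternary_code[OF d])
  have "ternary_code d = suminf a" by (simp add: ternary_code_def a_def[abs_def])
  also have "\<dots> = (\<Sum>i. a (i + Suc j)) + (\<Sum>i<Suc j. a i)"
    by (rule suminf_split_initial_segment[OF sa])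
  also have "(\<Sum>i. a (i + Suc j)) = (\<Sum>i. 1 / 3 ^ Suc j * (2 * d (i + Suc j) / 3 ^ (i + 1)))"
    by (intro suminf_cong) (simp add: a_def power_add)
  also have "\<dots> = 1 / 3 ^ Suc j * ternary_code (\<lambda>i. d (i + Suc j))"
    unfolding ternary_code_def using d by (intro suminf_mult summable_ternary_code)
  finally have split: "ternary_code d = 1 / 3 ^ Suc j * ternary_code (\<lambda>i. d (i + Suc j)) + (\<Sum>i<j. a i) + a j"
    by simp
  have "\<exists>n::nat. 3 ^ j * (\<Sum>i<j. a i) = 2 * real n" for j
  proof (induction j)
    case (Suc j)
    then obtain n where n: "3 ^ j * (\<Sum>i<j. a i) = 2 * real n" by blast
    have "3 ^ Suc j * (\<Sum>i<Suc j. a i) = 3 * (3 ^ j * (\<Sum>i<j. a i)) + 2 * d j"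
      by (simp add: a_def algebra_simps)
    then have "3 ^ Suc j * (\<Sum>i<Suc j. a i) = 2 * (3 * real n + d j)"
      unfolding n by simp
    moreover have "\<exists>m::nat. d j = real m" using d[of j] by (metis empty_iff insert_iff of_nat_0 of_nat_1)
    ultimately show ?case by (metis of_nat_add of_nat_mult of_nat_numeral)
  qed (auto intro: exI[of _ 0])
  then obtain n :: nat where n: "3 ^ j * (\<Sum>i<j. a i) = 2 * real n" by blast
  define \<rho> where "\<rho> = 1 / 3 * ternary_code (\<lambda>i. d (i + Suc j))"
  have \<rho>: "0 \<le> \<rho>" "\<rho> \<le> 1 / 3"
    using ternary_code_range[of "\<lambda>i. d (i + Suc j)"] d by (auto simp: \<rho>_def)
  have "3 ^ j * ternary_code d = 2 * real n + (2 / 3 * d j + \<rho>)"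
    unfolding split distrib_left n by (simp add: \<rho>_def a_def)
  then show ?thesis using digit_wave_eq[OF d \<rho>] by simp
qed

definition binary_digit :: "nat \<Rightarrow> real \<Rightarrow> real" where
  "binary_digit k x = of_int (\<lfloor>2 ^ (k + 1) * x\<rfloor> mod 2)"

lemma binary_digit_01: "binary_digit k x \<in> {0, 1}"
proof -
  have "\<lfloor>2 ^ (k + 1) * x\<rfloor> mod 2 = 0 \<or> \<lfloor>2 ^ (k + 1) * x\<rfloor> mod 2 = 1" by presburger
  then show ?thesis by (auto simp: binary_digit_def)
qed

text \<open>The first n digits add up to the floor of 2^n x divided by 2^n; x < 1 makes the empty
  sum agree with the floor of x.\<close>

lemma binary_digit_sums:
  assumes "0 \<le> x" "x < 1"
  shows "(\<lambda>k. binary_digit k x / 2 ^ (k + 1)) sums x"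
proof -
  have partial: "(\<Sum>k<n. binary_digit k x / 2 ^ (k + 1)) = of_int \<lfloor>2 ^ n * x\<rfloor> / 2 ^ n" for n
  proof (induction n)
    case 0
    have "\<lfloor>x\<rfloor> = 0" using assms by (simp add: floor_eq_iff)
    then show ?case by simp
  next
    case (Suc n)
    define m where "m = \<lfloor>2 ^ (n + 1) * x\<rfloor>"
    have "\<lfloor>2 ^ n * x\<rfloor> = m div 2"
    proof -
      have "\<lfloor>2 ^ n * x\<rfloor> = \<lfloor>(2 ^ (n + 1) * x) / real_of_int 2\<rfloor>" by simp
      also have "\<dots> = m div 2" unfolding m_def by (rule floor_divide_real_eq_div) simp
      finally show ?thesis .
    qed
    moreover have "real_of_int m = 2 * of_int (m div 2) + of_int (m mod 2)"
      by (metis of_int_add of_int_mult of_int_numeral mult_div_mod_eq)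
    moreover have "binary_digit n x = of_int (m mod 2)" "\<lfloor>2 ^ Suc n * x\<rfloor> = m"
      by (simp_all add: binary_digit_def m_def)
    ultimately have "(\<Sum>k<Suc n. binary_digit k x / 2 ^ (k + 1)) = of_int (m div 2) / 2 ^ n + of_int (m mod 2) / 2 ^ (n + 1)"
        "of_int \<lfloor>2 ^ Suc n * x\<rfloor> / 2 ^ Suc n = (2 * of_int (m div 2) + of_int (m mod 2)) / (2 ^ (n + 1) :: real)"
      using Suc by simp_all
    then show ?case by (simp add: field_simps)
  qed
  have "(\<lambda>n. of_int \<lfloor>2 ^ n * x\<rfloor> / 2 ^ n) \<longlonglongrightarrow> x"
  proof (rule tendsto_sandwich)
    show "\<forall>\<^sub>F n in sequentially. x - (1 / 2) ^ n \<le> of_int \<lfloor>2 ^ n * x\<rfloor> / 2 ^ n"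
    proof (rule always_eventually, rule allI)
      fix n :: nat
      have "2 ^ n * x - 1 \<le> of_int \<lfloor>2 ^ n * x\<rfloor>" by linarith
      then have "(2 ^ n * x - 1) / 2 ^ n \<le> of_int \<lfloor>2 ^ n * x\<rfloor> / 2 ^ n"
        by (rule divide_right_mono) simp
      then show "x - (1 / 2) ^ n \<le> of_int \<lfloor>2 ^ n * x\<rfloor> / 2 ^ n"
        by (simp add: diff_divide_distrib power_one_over)
    qed
    show "\<forall>\<^sub>F n in sequentially. of_int \<lfloor>2 ^ n * x\<rfloor> / 2 ^ n \<le> x"
      by (rule always_eventually) (simp add: pos_divide_le_eq mult.commute)
    have "(\<lambda>n. x - (1 / 2) ^ n) \<longlonglongrightarrow> x - 0"
      by (intro tendsto_intros LIMSEQ_realpow_zero) auto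
    then show "(\<lambda>n. x - (1 / 2) ^ n) \<longlonglongrightarrow> x" by simp
  qed simp
  then show ?thesis unfolding sums_def partial .
qed

text \<open>The binary digits of the m coordinates are interleaved: digit k of coordinate i becomes
  digit m k + i of the ternary code. The curve recovers each coordinate as a uniformly convergent
  series of digit waves, hence continuously, even though the digits themselves are only Borel
  functions of the point.\<close>

lemma unit_cube_coded_curve:
  obtains c :: "real \<Rightarrow> 'v::euclidean_space" and s :: "'v \<Rightarrow> real"
  where "continuous_on UNIV c" "bounded (range c)" "s \<in> borel_measurable borel"
    "\<And>v. s v \<in> {0..1}" "\<And>v. (\<And>b. b \<in> Basis \<Longrightarrow> 0 \<le> v \<bullet> b \<and> v \<bullet> b < 1) \<Longrightarrow> c (s v) = v"
proof -
  define m where "m = DIM('v)"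
  have "\<exists>e. bij_betw e {..<m} (Basis :: 'v set)"
    unfolding m_def using ex_bij_betw_nat_finite[OF finite_Basis] by (simp add: atLeast0LessThan)
  then obtain e where e: "bij_betw e {..<m} (Basis :: 'v set)" ..
  define D where "D v j = binary_digit (j div m) (v \<bullet> e (j mod m))" for v :: 'v and j
  have D01: "D v j \<in> {0, 1}" for v j unfolding D_def by (rule binary_digit_01)
  define s where "s v = ternary_code (D v)" for v
  define x where "x i t = (\<Sum>k. digit_wave (3 ^ (m * k + i) * t) / 2 ^ (k + 1))" for i :: nat and t
  define c where "c t = (\<Sum>i<m. x i t *\<^sub>R e i)" for t
  have half: "(\<lambda>k. 1 / 2 * (1 / 2 :: real) ^ k) sums 1"
    using sums_mult[OF geometric_sums[of "1 / 2 :: real"], of "1 / 2"] by simp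
  have x_term: "norm (digit_wave (3 ^ (m * k + i) * t) / 2 ^ (k + 1)) \<le> 1 / 2 * (1 / 2) ^ k" for k i t
    using digit_wave_range[of "3 ^ (m * k + i) * t"] by (simp add: power_one_over divide_right_mono)
  have x_cont: "continuous_on UNIV (x i)" for i
  proof -
    have "uniform_limit UNIV (\<lambda>n t. \<Sum>k<n. digit_wave (3 ^ (m * k + i) * t) / 2 ^ (k + 1)) (x i) sequentially"
      unfolding x_def[abs_def] using half by (intro Weierstrass_m_test[OF x_term]) (simp add: sums_iff)
    moreover have "continuous_on UNIV (\<lambda>t. \<Sum>k<n. digit_wave (3 ^ (m * k + i) * t) / 2 ^ (k + 1))" for n
      by (intro continuous_intros continuous_on_compose2[OF continuous_digit_wave]) auto
    ultimately show ?thesis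
      by (intro uniform_limit_theorem) auto
  qed
  have x_bound: "\<bar>x i t\<bar> \<le> 1" for i t
  proof -
    have "norm (x i t) \<le> (\<Sum>k. 1 / 2 * (1 / 2) ^ k)"
      unfolding x_def using half x_term by (intro norm_suminf_le) (auto simp: sums_iff)
    then show ?thesis using half by (simp add: sums_iff)
  qed
  show ?thesis
  proof (rule that[of c s])
    show "continuous_on UNIV c"
      unfolding c_def[abs_def] using x_cont by (intro continuous_intros) auto
    have "norm (c t) \<le> real m" for t
    proof -
      have "norm (x i t *\<^sub>R e i) \<le> 1" if "i < m" for i
        using x_bound[of i t] norm_Basis[OF bij_betw_apply[OF e, of i]] that by simp
      then have "norm (c t) \<le> (\<Sum>i<m. 1)"
        unfolding c_def by (intro order_trans[OF norm_sum sum_mono]) auto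
      then show ?thesis by simp
    qed
    then show "bounded (range c)" by (auto simp: bounded_iff)
    have "(\<lambda>v. D v j) \<in> borel_measurable borel" for j
      unfolding D_def binary_digit_def by measurable
    then show "s \<in> borel_measurable borel"
      unfolding s_def[abs_def] ternary_code_def by measurable
    show "s v \<in> {0..1}" for v
      using ternary_code_range[OF D01] by (simp add: s_def)
    show "c (s v) = v" if v: "\<And>b. b \<in> Basis \<Longrightarrow> 0 \<le> v \<bullet> b \<and> v \<bullet> b < 1" for v
    proof -
      have "x i (s v) = v \<bullet> e i" if i: "i < m" for i
      proof -
        have "digit_wave (3 ^ (m * k + i) * s v) = binary_digit k (v \<bullet> e i)" for k
          unfolding s_def digit_wave_ternary_code[OF D01] using i by (simp add: D_def)
        moreover have "e i \<in> Basis" using e i by (auto simp: bij_betw_def)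
        ultimately show ?thesis
          unfolding x_def using binary_digit_sums[of "v \<bullet> e i"] v[of "e i"] by (simp add: sums_iff)
      qed
      then have "c (s v) = (\<Sum>i<m. (v \<bullet> e i) *\<^sub>R e i)" by (simp add: c_def)
      also have "\<dots> = (\<Sum>b\<in>Basis. (v \<bullet> b) *\<^sub>R b)"
        by (rule sum.reindex_bij_betw[OF e])
      finally show ?thesis by (simp add: euclidean_representation)
    qed
  qed
qed

lemma bounded_set_coded_curve:
  fixes K :: "'v::euclidean_space set"
  assumes "bounded K"
  obtains c :: "real \<Rightarrow> 'v" and s :: "'v \<Rightarrow> real"
  where "continuous_on UNIV c" "bounded (range c)" "s \<in> borel_measurable borel"
    "\<And>v. s v \<in> {0..1}" "\<And>v. v \<in> K \<Longrightarrow> c (s v) = v"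
proof -
  obtain B where "0 < B" "\<And>v. v \<in> K \<Longrightarrow> norm v \<le> B"
    using assms unfolding bounded_pos by blast
  then have "0 < B + 1" "\<And>v. v \<in> K \<Longrightarrow> norm v < B + 1" by force+
  then obtain N where N: "0 < N" "\<And>v. v \<in> K \<Longrightarrow> norm v < N" by blast
  obtain c :: "real \<Rightarrow> 'v" and s :: "'v \<Rightarrow> real" where cs:
    "continuous_on UNIV c" "bounded (range c)" "s \<in> borel_measurable borel"
    "\<And>v. s v \<in> {0..1}" "\<And>v. (\<And>b. b \<in> Basis \<Longrightarrow> 0 \<le> v \<bullet> b \<and> v \<bullet> b < 1) \<Longrightarrow> c (s v) = v"
    by (rule unit_cube_coded_curve) blast
  \<comment> \<open>The centre of the unit cube: K is shrunk by 1 / (2 N) and moved there, which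
    places it inside the half-open cube.\<close>
  define w :: 'v where "w = (\<Sum>b\<in>Basis. (1 / 2) *\<^sub>R b)"
  have w: "w \<bullet> b = 1 / 2" if "b \<in> Basis" for b
    using that by (simp add: w_def inner_sum_left inner_Basis if_distrib sum.delta cong: if_cong)
  define A where "A v = (1 / (2 * N)) *\<^sub>R v + w" for v
  show ?thesis
  proof (rule that[of "\<lambda>t. (2 * N) *\<^sub>R (c t - w)" "\<lambda>v. s (A v)"])
    show "continuous_on UNIV (\<lambda>t. (2 * N) *\<^sub>R (c t - w))"
      using cs(1) by (intro continuous_intros)
    show "bounded (range (\<lambda>t. (2 * N) *\<^sub>R (c t - w)))"
    proof -
      have "bounded ((\<lambda>y. (2 * N) *\<^sub>R (y - w)) ` range c)"
        using bounded_scaling[OF bounded_translation_minus[OF cs(2), of w], of "2 * N"] by (simp add: image_image)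
      then show ?thesis by (simp add: image_image)
    qed
    have "A \<in> borel_measurable borel" unfolding A_def[abs_def] by measurable
    then show "(\<lambda>v. s (A v)) \<in> borel_measurable borel"
      using cs(3) by (rule measurable_compose)
    show "s (A v) \<in> {0..1}" for v by (rule cs(4))
    show "(2 * N) *\<^sub>R (c (s (A v)) - w) = v" if "v \<in> K" for v
    proof -
      have "c (s (A v)) = A v"
      proof (rule cs(5))
        fix b :: 'v assume b: "b \<in> Basis"
        have "\<bar>v \<bullet> b\<bar> < N" using Basis_le_norm[OF b, of v] N(2)[OF that] by simp
        then have "\<bar>v \<bullet> b\<bar> / (2 * N) < N / (2 * N)" using N(1) by (intro divide_strict_right_mono) auto
        moreover define y where "y = v \<bullet> b / (2 * N)"
        ultimately have "\<bar>y\<bar> < 1 / 2" using N(1) by simp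
        moreover have "A v \<bullet> b = y + 1 / 2" by (simp add: A_def inner_add_left w[OF b] y_def)
        ultimately show "0 \<le> A v \<bullet> b \<and> A v \<bullet> b < 1" by linarith
      qed
      then show ?thesis using N(1) by (simp add: A_def)
    qed
  qed
qed

section \<open>Stieltjes sums and rational distribution functions\<close>

text \<open>A Riemann-Stieltjes sum over N cells of [0,1], evaluated at right endpoints. The extra
  term i = 0 belongs to (-1/N, 0] and catches an atom at the origin. All nodes are rational.\<close>

definition stieltjes_sum :: "(real \<Rightarrow> real) \<Rightarrow> (real \<Rightarrow> real) \<Rightarrow> nat \<Rightarrow> real" where
  "stieltjes_sum h F N = (\<Sum>i\<le>N. h (real i / real N) * (F (real i / real N) - F ((real i - 1) / real N)))"

text \<open>The sum is the exact integral of a step function that takes the value of h at the right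
  end of each cell, so the error is at most the oscillation of h over a cell.\<close>

lemma integral_stieltjes_sum:
  assumes m: "real_distribution m" and supp: "AE x in m. x \<in> {0..1}"
    and h: "continuous_on UNIV h" and N: "0 < N"
    and osc: "\<And>x y. x \<in> {0..1} \<Longrightarrow> y \<in> {0..1} \<Longrightarrow> \<bar>x - y\<bar> \<le> 1 / real N \<Longrightarrow> \<bar>h x - h y\<bar> \<le> e"
  shows "\<bar>(LINT x|m. h x) - stieltjes_sum h (cdf m) N\<bar> \<le> e"
proof -
  interpret real_distribution m by (rule m)
  define C where "C i = {(real i - 1) / real N<..real i / real N}" for i
  define \<sigma> where "\<sigma> x = (\<Sum>i\<le>N. h (real i / real N) * indicator (C i) x)" for x
  have \<sigma>_eq: "\<exists>y\<in>{0..1}. \<bar>x - y\<bar> \<le> 1 / real N \<and> \<sigma> x = h y" if x: "x \<in> {0..1}" for x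
  proof -
    \<comment> \<open>The index of the cell containing x; the ceiling is right because cells are
      open on the left and closed on the right.\<close>
    define j where "j = nat \<lceil>real N * x\<rceil>"
    have "0 \<le> real N * x" "real N * x \<le> real N" using x mult_left_mono[of x 1 "real N"] by auto
    then have "0 \<le> \<lceil>real N * x\<rceil>" "\<lceil>real N * x\<rceil> \<le> int N" by linarith+
    then have jr: "real j = of_int \<lceil>real N * x\<rceil>" "j \<le> N" unfolding j_def by linarith+
    then have j: "real j - 1 < real N * x" "real N * x \<le> real j" by linarith+
    have iff: "x \<in> C i \<longleftrightarrow> i = j" for i
    proof -
      have "x \<in> C i \<longleftrightarrow> real i - 1 < real N * x \<and> real N * x \<le> real i"
        using N by (simp add: C_def pos_divide_less_eq pos_le_divide_eq mult.commute)
      also have "\<dots> \<longleftrightarrow> i = j"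
      proof
        assume "real i - 1 < real N * x \<and> real N * x \<le> real i"
        then have "real i < real j + 1" "real j < real i + 1" using j by linarith+
        then show "i = j" by linarith
      qed (use j in auto)
      finally show ?thesis .
    qed
    have "\<sigma> x = (\<Sum>i\<le>N. if i = j then h (real i / real N) else 0)"
      unfolding \<sigma>_def by (intro sum.cong) (auto simp: iff)
    then have "\<sigma> x = h (real j / real N)" using jr(2) by simp
    moreover have "\<bar>x - real j / real N\<bar> \<le> 1 / real N"
    proof -
      have "\<bar>real N * x - real j\<bar> \<le> 1" using j by linarith
      then have "\<bar>real N * x - real j\<bar> / real N \<le> 1 / real N" by (intro divide_right_mono) auto
      moreover have "x - real j / real N = (real N * x - real j) / real N" using N by (simp add: field_simps)
      ultimately show ?thesis by simp
    qed
    ultimately show ?thesis using jr(2) N by (intro bexI[of _ "real j / real N"]) auto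
  qed
  have C_meas: "C i \<in> sets m" for i by (simp add: C_def)
  have ind_int: "integrable m (indicator (C i) :: real \<Rightarrow> real)" for i
    using C_meas by (simp add: emeasure_eq_measure)
  have \<sigma>_int: "integrable m \<sigma>"
    unfolding \<sigma>_def[abs_def] by (intro Bochner_Integration.integrable_sum integrable_mult_right ind_int)
  have "(LINT x|m. \<sigma> x) = (\<Sum>i\<le>N. LINT x|m. h (real i / real N) * indicator (C i) x)"
    unfolding \<sigma>_def by (intro Bochner_Integration.integral_sum integrable_mult_right ind_int)
  also have "\<dots> = (\<Sum>i\<le>N. h (real i / real N) * measure m (C i))"
    using ind_int by simp
  also have "\<dots> = stieltjes_sum h (cdf m) N"
    unfolding stieltjes_sum_def
  proof (rule sum.cong)
    fix i
    have "(real i - 1) / real N < real i / real N" using N by (simp add: divide_strict_right_mono)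
    then show "h (real i / real N) * measure m (C i)
        = h (real i / real N) * (cdf m (real i / real N) - cdf m ((real i - 1) / real N))"
      by (simp add: C_def cdf_diff_eq)
  qed simp
  finally have \<sigma>_sum: "(LINT x|m. \<sigma> x) = stieltjes_sum h (cdf m) N" .
  obtain B where B: "\<And>x. x \<in> {0..1} \<Longrightarrow> norm (h x) \<le> B"
    using continuous_on_bounded_set[OF h, of "{0..1}"] by auto
  have h_int: "integrable m h"
  proof (rule integrable_const_bound[where B = B])
    show "AE x in m. norm (h x) \<le> B" using supp by eventually_elim (rule B)
    show "h \<in> borel_measurable m" using borel_measurable_continuous_onI[OF h] by simp
  qed
  have "\<bar>LINT x|m. h x - \<sigma> x\<bar> \<le> (LINT x|m. \<bar>h x - \<sigma> x\<bar>)"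
    using integral_norm_bound[of m "\<lambda>x. h x - \<sigma> x"] by simp
  also have "\<dots> \<le> (LINT x|m. e)"
  proof (rule integral_mono_AE)
    show "AE x in m. \<bar>h x - \<sigma> x\<bar> \<le> e"
      using supp
    proof eventually_elim
      case (elim x)
      then show ?case using \<sigma>_eq[OF elim] osc by fastforce
    qed
  qed (use h_int \<sigma>_int in auto)
  also have "\<dots> = e" using prob_space by simp
  finally show ?thesis using h_int \<sigma>_int \<sigma>_sum by simp
qed

text \<open>Summation by parts moves the difference onto \<open>h\<close>; the differences of \<open>F\<close> and \<open>G\<close>
  telescope because \<open>F\<close> lies between \<open>G\<close> and the right neighbours of \<open>G\<close>.\<close>

lemma stieltjes_sum_perturb:
  assumes N: "0 < N"
    and osc: "\<And>x y. x \<in> {0..1} \<Longrightarrow> y \<in> {0..1} \<Longrightarrow> \<bar>x - y\<bar> \<le> 1 / real N \<Longrightarrow> \<bar>h x - h y\<bar> \<le> e"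
    and le: "\<And>i. i < N \<Longrightarrow> G (real i / real N) \<le> F (real i / real N) \<and> F (real i / real N) \<le> G (real (Suc i) / real N)"
    and bot: "F (- 1 / real N) = G (- 1 / real N)" and top: "F 1 = G 1" "G 1 - G 0 \<le> 1"
  shows "\<bar>stieltjes_sum h F N - stieltjes_sum h G N\<bar> \<le> e"
proof -
  define D where "D i = F (real i / real N) - G (real i / real N)" for i :: nat
  define H where "H i = h (real i / real N)" for i :: nat
  have D_le: "0 \<le> D i \<and> D i \<le> G (real (Suc i) / real N) - G (real i / real N)" if "i < N" for i
    using le[OF that] by (simp add: D_def)
  have DN: "D N = 0" using N top by (simp add: D_def)
  have "stieltjes_sum h F N - stieltjes_sum h G N
      = (\<Sum>i\<le>N. H i * (D i - (F ((real i - 1) / real N) - G ((real i - 1) / real N))))"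
    unfolding stieltjes_sum_def D_def H_def by (simp add: sum_subtractf[symmetric] algebra_simps)
  also have "\<dots> = H 0 * D 0 + (\<Sum>i<N. H (Suc i) * (D (Suc i) - D i))"
    using bot by (subst sum.atMost_shift) (simp add: D_def)
  also have "\<dots> = (\<Sum>i<N. (H i - H (Suc i)) * D i) + H N * D N"
  proof -
    have "H 0 * D 0 + (\<Sum>i<n. H (Suc i) * (D (Suc i) - D i)) = (\<Sum>i<n. (H i - H (Suc i)) * D i) + H n * D n" for n
      by (induction n) (simp_all add: algebra_simps)
    then show ?thesis .
  qed
  finally have eq: "stieltjes_sum h F N - stieltjes_sum h G N = (\<Sum>i<N. (H i - H (Suc i)) * D i)"
    using DN by simp
  have e: "0 \<le> e" using osc[of 0 0] by simp
  have "\<bar>\<Sum>i<N. (H i - H (Suc i)) * D i\<bar> \<le> (\<Sum>i<N. \<bar>(H i - H (Suc i)) * D i\<bar>)"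
    by (rule sum_abs)
  also have "\<dots> \<le> (\<Sum>i<N. e * (G (real (Suc i) / real N) - G (real i / real N)))"
  proof (rule sum_mono)
    fix i assume "i \<in> {..<N}"
    then have i: "i < N" by simp
    have "\<bar>H i - H (Suc i)\<bar> \<le> e"
      unfolding H_def using i N by (intro osc) (auto simp: diff_divide_distrib[symmetric] field_simps)
    then show "\<bar>(H i - H (Suc i)) * D i\<bar> \<le> e * (G (real (Suc i) / real N) - G (real i / real N))"
      unfolding abs_mult using D_le[OF i] e by (intro mult_mono) auto
  qed
  also have "\<dots> = e * (G (real N / real N) - G (real 0 / real N))"
    by (subst sum_distrib_left[symmetric], subst sum_lessThan_telescope) simp
  also have "\<dots> \<le> e * 1"
    using N top e by (intro mult_left_mono) auto
  finally show ?thesis using eq by simp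
qed

text \<open>A weak-* limit of distribution functions need not be right continuous. Its right limit F
  is, and F may differ from G even at rational points; only the sandwich between neighbouring values
  of G is retained, which suffices for \<open>stieltjes_sum_perturb\<close>.\<close>

lemma distribution_of_rational_cdf:
  fixes G :: "real \<Rightarrow> real"
  assumes mono: "\<And>p q. p \<in> \<rat> \<Longrightarrow> q \<in> \<rat> \<Longrightarrow> p \<le> q \<Longrightarrow> G p \<le> G q"
    and G0: "\<And>q. q \<in> \<rat> \<Longrightarrow> q < 0 \<Longrightarrow> G q = 0" and G1: "\<And>q. q \<in> \<rat> \<Longrightarrow> 1 \<le> q \<Longrightarrow> G q = 1"
  obtains m where "real_distribution m" "AE x in m. x \<in> {0..1}"
    "\<And>p q. p \<in> \<rat> \<Longrightarrow> q \<in> \<rat> \<Longrightarrow> p < q \<Longrightarrow> G p \<le> cdf m p \<and> cdf m p \<le> G q"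
    "\<And>x. x < 0 \<Longrightarrow> cdf m x = 0" "\<And>x. 1 \<le> x \<Longrightarrow> cdf m x = 1"
proof -
  define F where "F x = Inf (G ` {q \<in> \<rat>. x < q})" for x
  have ne: "G ` {q \<in> \<rat>. x < q} \<noteq> {}" for x
    using Rats_dense_in_real[of x "x + 1"] by auto
  have G_nonneg: "0 \<le> G q" if q: "q \<in> \<rat>" for q
  proof (cases "q < 0")
    case False
    then have "G (-1) \<le> G q" using q by (intro mono) auto
    then show ?thesis using G0[of "-1"] by simp
  qed (use G0 q in simp)
  have bdd: "bdd_below (G ` {q \<in> \<rat>. x < q})" for x
    using G_nonneg by (intro bdd_belowI[of _ 0]) auto
  have F_le: "F x \<le> G q" if "q \<in> \<rat>" "x < q" for x q
    unfolding F_def using that by (intro cInf_lower bdd) auto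
  have F_ge: "a \<le> F x" if "\<And>q. q \<in> \<rat> \<Longrightarrow> x < q \<Longrightarrow> a \<le> G q" for a x
    unfolding F_def using that by (intro cInf_greatest ne) auto
  have F_mono: "F x \<le> F y" if "x \<le> y" for x y
    using that by (intro F_ge F_le) auto
  have F_neg: "F x = 0" if neg: "x < 0" for x
  proof -
    obtain q where "q \<in> \<rat>" "x < q" "q < 0" using Rats_dense_in_real[OF neg] by auto
    then have "F x \<le> 0" using F_le[of q x] G0[of q] by simp
    moreover have "0 \<le> F x" by (rule F_ge) (rule G_nonneg)
    ultimately show ?thesis by simp
  qed
  have F_one: "F x = 1" if "1 \<le> x" for x
  proof -
    obtain q where "q \<in> \<rat>" "x < q" using Rats_dense_in_real[of x "x + 1"] by auto
    then have "F x \<le> 1" using F_le[of q x] G1[of q] that by simp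
    moreover have "1 \<le> F x" by (rule F_ge) (use G1 that in auto)
    ultimately show ?thesis by simp
  qed
  have F_rc: "continuous (at_right a) F" for a
    unfolding continuous_within
  proof (rule order_tendstoI)
    fix l assume "l < F a"
    then show "\<forall>\<^sub>F x in at_right a. l < F x"
      unfolding eventually_at_right_field using F_mono by (intro exI[of _ "a + 1"]) (auto intro: less_le_trans)
  next
    fix u assume "F a < u"
    then obtain q where q: "q \<in> \<rat>" "a < q" "G q < u"
      using cInf_lessD[OF ne, of a u] by (auto simp: F_def)
    then show "\<forall>\<^sub>F x in at_right a. F x < u"
      unfolding eventually_at_right_field using F_le by (intro exI[of _ q]) (auto intro: le_less_trans)
  qed
  have F_bot: "(F \<longlongrightarrow> 0) at_bot"
    by (rule tendsto_eventually) (use F_neg in \<open>auto simp: eventually_at_bot_dense\<close>)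
  have F_top: "(F \<longlongrightarrow> 1) at_top"
    by (rule tendsto_eventually) (use F_one in \<open>auto simp: eventually_at_top_linorder\<close>)
  define m where "m = interval_measure F"
  have m: "real_distribution m"
    unfolding m_def by (rule real_distribution_interval_measure[OF F_mono F_rc F_bot F_top])
  have cdf: "cdf m = F"
    unfolding m_def by (rule cdf_interval_measure[OF F_mono F_rc F_bot])
  interpret real_distribution m by (rule m)
  show ?thesis
  proof (rule that[OF m])
    have "measure m {..1} = 1" using fun_cong[OF cdf, of 1] F_one by (simp add: cdf_def)
    then have le1: "AE x in m. x \<le> 1" using prob_eq_1[of "{..1}"] by simp
    have "AE x in m. - (1 / (real n + 1)) < x" for n :: nat
    proof -
      have "measure m {..- (1 / (real n + 1))} = 0"
        using fun_cong[OF cdf, of "- (1 / (real n + 1))"] F_neg[of "- (1 / (real n + 1))"] by (simp add: cdf_def)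
      then have "{..- (1 / (real n + 1))} \<in> null_sets m"
        by (auto simp: null_sets_def emeasure_eq_measure)
      then show ?thesis by (auto dest!: AE_not_in elim!: eventually_mono)
    qed
    then have "AE x in m. \<forall>n::nat. - (1 / (real n + 1)) < x" by (simp add: AE_all_countable)
    then show "AE x in m. x \<in> {0..1}"
      using le1
    proof eventually_elim
      case (elim x)
      have "(\<lambda>n. - (1 / (real n + 1))) \<longlonglongrightarrow> - 0"
        using LIMSEQ_inverse_real_of_nat by (intro tendsto_intros) (simp add: divide_inverse add.commute)
      then have "- 0 \<le> x" by (rule LIMSEQ_le_const2) (use elim(1) in \<open>auto intro: less_imp_le\<close>)
      then show ?case using elim(2) by simp
    qed
    show "G p \<le> cdf m p \<and> cdf m p \<le> G q" if "p \<in> \<rat>" "q \<in> \<rat>" "p < q" for p q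
      unfolding cdf using that by (auto intro!: F_le F_ge mono)
    show "cdf m x = 0" if "x < 0" for x using F_neg[OF that] cdf by simp
    show "cdf m x = 1" if "1 \<le> x" for x using F_one[OF that] cdf by simp
  qed
qed

lemma uniform_oscillation:
  fixes h :: "real \<Rightarrow> real"
  assumes "continuous_on UNIV h" "0 < e"
  obtains N0 :: nat where "0 < N0" "\<And>N x y. N0 \<le> N \<Longrightarrow> x \<in> {0..1} \<Longrightarrow> y \<in> {0..1} \<Longrightarrow> \<bar>x - y\<bar> \<le> 1 / real N \<Longrightarrow> \<bar>h x - h y\<bar> \<le> e"
proof -
  have "uniformly_continuous_on {0..1} h"
    using assms(1) by (intro compact_uniformly_continuous) (auto intro: continuous_on_subset)
  then obtain d where d: "0 < d" "\<And>x y. x \<in> {0..1} \<Longrightarrow> y \<in> {0..1} \<Longrightarrow> dist x y < d \<Longrightarrow> dist (h x) (h y) < e"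
    using assms(2) unfolding uniformly_continuous_on_def by metis
  obtain n :: nat where n: "1 / real (Suc n) < d" using nat_approx_posE[OF d(1)] by metis
  show ?thesis
  proof (rule that[of "Suc n"])
    fix N x y assume *: "Suc n \<le> N" "x \<in> {0..1}" "y \<in> {0..1}" "\<bar>x - y\<bar> \<le> 1 / real N"
    have "1 / real N \<le> 1 / real (Suc n)" using *(1) by (intro divide_left_mono) auto
    then have "dist x y < d" using *(4) n by (simp add: dist_real_def)
    then show "\<bar>h x - h y\<bar> \<le> e" using d(2)[OF *(2,3)] by (simp add: dist_real_def)
  qed simp
qed

text \<open>One e pays for replacing the integral by a sum, the other for replacing the true
  distribution function by G.\<close>

lemma integral_rational_cdf_approx:
  fixes G :: "real \<Rightarrow> real"
  assumes m: "real_distribution m" "AE x in m. x \<in> {0..1}"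
    "\<And>p q. p \<in> \<rat> \<Longrightarrow> q \<in> \<rat> \<Longrightarrow> p < q \<Longrightarrow> G p \<le> cdf m p \<and> cdf m p \<le> G q"
    "\<And>x. x < 0 \<Longrightarrow> cdf m x = 0" "\<And>x. 1 \<le> x \<Longrightarrow> cdf m x = 1"
    and G: "\<And>q. q \<in> \<rat> \<Longrightarrow> q < 0 \<Longrightarrow> G q = 0" "\<And>q. q \<in> \<rat> \<Longrightarrow> 1 \<le> q \<Longrightarrow> G q = 1" "0 \<le> G 0"
    and h: "continuous_on UNIV h" and N: "0 < N"
    and osc: "\<And>x y. x \<in> {0..1} \<Longrightarrow> y \<in> {0..1} \<Longrightarrow> \<bar>x - y\<bar> \<le> 1 / real N \<Longrightarrow> \<bar>h x - h y\<bar> \<le> e"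
  shows "\<bar>(LINT x|m. h x) - stieltjes_sum h G N\<bar> \<le> 2 * e"
proof -
  have "\<bar>(LINT x|m. h x) - stieltjes_sum h (cdf m) N\<bar> \<le> e"
    by (rule integral_stieltjes_sum[OF m(1,2) h N osc])
  moreover have "\<bar>stieltjes_sum h (cdf m) N - stieltjes_sum h G N\<bar> \<le> e"
  proof (rule stieltjes_sum_perturb[OF N osc])
    fix i assume "i < N"
    then have "real i / real N < real (Suc i) / real N" by (intro divide_strict_right_mono) auto
    then show "G (real i / real N) \<le> cdf m (real i / real N) \<and> cdf m (real i / real N) \<le> G (real (Suc i) / real N)"
      by (intro m(3)) auto
  next
    show "cdf m (- 1 / real N) = G (- 1 / real N)"
      using N m(4)[of "- 1 / real N"] G(1)[of "- 1 / real N"] by simp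
    show "cdf m 1 = G 1" "G 1 - G 0 \<le> 1" using m(5)[of 1] G(2)[of 1] G(3) by auto
  qed
  ultimately show ?thesis by linarith
qed

section \<open>Young measures as kernels and their compactness\<close>

text \<open>The indicator of an open set is a pointwise limit of functions in \<open>C_0\<close>, so
  measurability of their pairings gives measurability of z \<mapsto> \<nu> z U. Open sets generate
  the Borel sets and are closed under intersection.\<close>

lemma young_measure_kernel:
  fixes \<nu> :: "'z \<Rightarrow> 'v::euclidean_space measure"
  assumes "young_measure M S \<nu>"
  shows "\<nu> \<in> M \<rightarrow>\<^sub>M prob_algebra borel"
proof (rule measurable_prob_algebra_generated[where G = "{U. open U}" and \<Omega> = UNIV])
  show "sets borel = sigma_sets UNIV {U :: 'v set. open U}"
    unfolding borel_def by (simp add: sets_measure_of)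
  show "Int_stable {U :: 'v set. open U}" by (auto simp: Int_stable_def)
  show prob: "prob_space (\<nu> z)" and sets: "sets (\<nu> z) = sets borel" if "z \<in> space M" for z
    using assms that by (auto simp: young_measure_def)
  fix U :: "'v set" assume "U \<in> {U. open U}"
  then have U: "open U" by simp
  show "(\<lambda>z. emeasure (\<nu> z) U) \<in> borel_measurable M"
  \<comment> \<open>The distance to an empty complement is 0 by convention, so the approximation
    below would fail for the whole space.\<close>
  proof (cases "U = UNIV")
    case True
    have "emeasure (\<nu> z) U = 1" if "z \<in> space M" for z
      using prob_space.emeasure_space_1[OF prob[OF that]] sets_eq_imp_space_eq[OF sets[OF that]] True by simp
    then have "(\<lambda>z. emeasure (\<nu> z) U) \<in> borel_measurable M \<longleftrightarrow> (\<lambda>z. 1 :: ennreal) \<in> borel_measurable M"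
      by (intro measurable_cong) simp
    then show ?thesis by simp
  next
    case False
    \<comment> \<open>The first factor rises to 1 inside U and vanishes outside; the second is a
      cutoff that vanishes outside the ball of radius n and tends to 1.\<close>
    define f where "f n x = min 1 (real n * infdist x (- U)) * max 0 (min 1 (real n - norm x))" for n and x :: 'v
    have f_cont: "continuous_on UNIV (f n)" for n
      unfolding f_def[abs_def] by (intro continuous_intros)
    have f_bound: "\<bar>f n x\<bar> \<le> 1" for n x
      unfolding f_def abs_mult by (intro mult_le_one) (auto simp: infdist_nonneg)
    have f_C0: "f n \<in> C_0" for n
    proof -
      have "\<forall>\<^sub>F x in at_infinity. f n x = 0"
        unfolding eventually_at_infinity f_def by (intro exI[of _ "real n"]) auto
      then have "(f n \<longlongrightarrow> 0) at_infinity" by (rule tendsto_eventually)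
      then show ?thesis using f_cont by (simp add: C_0_def)
    qed
    have f_lim: "(\<lambda>n. f n x) \<longlonglongrightarrow> indicator U x" for x
    proof (cases "x \<in> U")
      case True
      then have pos: "0 < infdist x (- U)"
        using False U by (intro infdist_pos_not_in_closed) auto
      obtain N :: nat where N: "1 / infdist x (- U) \<le> real N" "norm x + 1 \<le> real N"
        by (metis real_arch_simple max.bounded_iff)
      have "f n x = 1" if "N \<le> n" for n
      proof -
        have "1 / infdist x (- U) \<le> real n" "norm x + 1 \<le> real n" using N that by auto
        then have "1 \<le> real n * infdist x (- U)" using pos by (simp add: pos_divide_le_eq)
        then show ?thesis using \<open>norm x + 1 \<le> real n\<close> by (simp add: f_def)
      qed
      then have "\<forall>\<^sub>F n in sequentially. f n x = 1" by (auto simp: eventually_sequentially)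
      then show ?thesis using True by (simp add: tendsto_eventually)
    next
      case False
      then have "f n x = 0" for n by (simp add: f_def)
      then show ?thesis using False by simp
    qed
    have "(\<lambda>n. pairing \<nu> (f n) z) \<longlonglongrightarrow> measure (\<nu> z) U" if z: "z \<in> space M" for z
    proof -
      interpret prob_space "\<nu> z" by (rule prob[OF z])
      have U_sets: "U \<in> sets (\<nu> z)" using U sets[OF z] by simp
      have "(\<lambda>n. LINT v|\<nu> z. f n v) \<longlonglongrightarrow> (LINT v|\<nu> z. indicator U v)"
      proof (rule integral_dominated_convergence[where w = "\<lambda>_. 1"])
        show "f n \<in> borel_measurable (\<nu> z)" for n
          using borel_measurable_continuous_onI[OF f_cont] sets[OF z] by (simp cong: measurable_cong_sets)
        show "indicator U \<in> borel_measurable (\<nu> z)" using U_sets by simp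
      qed (use f_lim f_bound in auto)
      moreover have "(LINT v|\<nu> z. indicator U v) = measure (\<nu> z) U"
        using U_sets by (simp add: Int_absorb2 sets.sets_into_space)
      ultimately show ?thesis by (simp add: pairing_def)
    qed
    then have "(\<lambda>z. measure (\<nu> z) U) \<in> borel_measurable M"
      by (rule borel_measurable_LIMSEQ_real) (use assms f_C0 in \<open>auto simp: young_measure_def\<close>)
    then have "(\<lambda>z. ennreal (measure (\<nu> z) U)) \<in> borel_measurable M" by simp
    moreover have "emeasure (\<nu> z) U = ennreal (measure (\<nu> z) U)" if "z \<in> space M" for z
      using prob_space.finite_measure[OF prob[OF that]] by (simp add: finite_measure.emeasure_eq_measure)
    ultimately show ?thesis by (simp cong: measurable_cong)
  qed
qed auto

lemma kernelD:
  assumes "\<nu> \<in> M \<rightarrow>\<^sub>M prob_algebra borel" "z \<in> space M"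
  shows "prob_space (\<nu> z)" "sets (\<nu> z) = sets borel" "space (\<nu> z) = UNIV"
proof -
  have "\<nu> z \<in> space (prob_algebra borel)" using assms by (rule measurable_space)
  then show "prob_space (\<nu> z)" and s: "sets (\<nu> z) = sets borel" by (auto simp: space_prob_algebra)
  show "space (\<nu> z) = UNIV" using sets_eq_imp_space_eq[OF s] by simp
qed

lemma borel_measurable_pairing:
  fixes f :: "'v::euclidean_space \<Rightarrow> 'b::{banach, second_countable_topology}"
  assumes "\<nu> \<in> M \<rightarrow>\<^sub>M prob_algebra borel" "f \<in> borel_measurable borel"
  shows "pairing \<nu> f \<in> borel_measurable M"
  unfolding pairing_def[abs_def]
  by (rule measurable_compose[OF measurable_prob_algebraD[OF assms(1)] integral_measurable_subprob_algebra[OF assms(2)]])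

lemma young_measure_UNIV:
  fixes \<nu> :: "'z \<Rightarrow> 'v::euclidean_space measure"
  assumes "\<nu> \<in> M \<rightarrow>\<^sub>M prob_algebra borel"
  shows "young_measure M UNIV \<nu>"
  unfolding young_measure_def
  using kernelD[OF assms]
  by (auto simp: C_0_def intro!: borel_measurable_pairing[OF assms] borel_measurable_continuous_onI)

lemma pushforward_kernel:
  assumes "\<nu> \<in> M \<rightarrow>\<^sub>M prob_algebra borel" "F \<in> borel_measurable borel"
  shows "pushforward F \<nu> \<in> M \<rightarrow>\<^sub>M prob_algebra borel"
  unfolding pushforward_def[abs_def]
  by (rule measurable_compose[OF assms(1) measurable_distr_prob_space[OF assms(2)]])

lemma pairing_AE_bound:
  fixes f :: "'v::euclidean_space \<Rightarrow> 'b::{banach, second_countable_topology}"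
  assumes "prob_space (\<nu> z)" "f \<in> borel_measurable (\<nu> z)" "AE v in \<nu> z. norm (f v) \<le> B"
  shows "integrable (\<nu> z) f" "norm (pairing \<nu> f z) \<le> B"
proof -
  interpret prob_space "\<nu> z" by fact
  show i: "integrable (\<nu> z) f" by (rule integrable_const_bound[OF assms(3,2)])
  have "norm (pairing \<nu> f z) \<le> (LINT v|\<nu> z. norm (f v))"
    unfolding pairing_def by (rule integral_norm_bound)
  also have "\<dots> \<le> (LINT v|\<nu> z. B)"
    by (rule integral_mono_AE) (use i assms(3) in auto)
  finally show "norm (pairing \<nu> f z) \<le> B" using prob_space by simp
qed

lemma integrable_mult_bounded_AE:
  fixes f g :: "'a \<Rightarrow> real"
  assumes "integrable M f" "g \<in> borel_measurable M" "AE x in M. \<bar>g x\<bar> \<le> C"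
  shows "integrable M (\<lambda>x. g x * f x)"
proof (rule Bochner_Integration.integrable_bound)
  show "integrable M (\<lambda>x. C * f x)" using assms(1) by simp
  show "AE x in M. norm (g x * f x) \<le> norm (C * f x)"
    using assms(3)
  proof eventually_elim
    case (elim x)
    then have "\<bar>g x\<bar> * \<bar>f x\<bar> \<le> \<bar>C\<bar> * \<bar>f x\<bar>" by (intro mult_right_mono) auto
    then show ?case by (simp add: abs_mult)
  qed
qed (use assms in auto)

lemma abs_integral_diff_mult_le:
  fixes a b h :: "'a \<Rightarrow> real"
  assumes "integrable M h" "integrable M (\<lambda>x. a x * h x)" "integrable M (\<lambda>x. b x * h x)"
    and "AE x in M. \<bar>a x - b x\<bar> \<le> e"
  shows "\<bar>(LINT x|M. a x * h x) - (LINT x|M. b x * h x)\<bar> \<le> e * (LINT x|M. \<bar>h x\<bar>)"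
proof -
  have "\<bar>(LINT x|M. a x * h x) - (LINT x|M. b x * h x)\<bar> = \<bar>LINT x|M. (a x - b x) * h x\<bar>"
    using assms(2,3) by (simp add: left_diff_distrib)
  also have "\<dots> \<le> (LINT x|M. \<bar>(a x - b x) * h x\<bar>)"
    using integral_norm_bound[of M "\<lambda>x. (a x - b x) * h x"] by simp
  also have "\<dots> \<le> (LINT x|M. e * \<bar>h x\<bar>)"
  proof (rule integral_mono_AE)
    show "integrable M (\<lambda>x. \<bar>(a x - b x) * h x\<bar>)"
      using assms(2,3) by (simp add: left_diff_distrib)
    show "AE x in M. \<bar>(a x - b x) * h x\<bar> \<le> e * \<bar>h x\<bar>"
      using assms(4) by eventually_elim (auto simp: abs_mult intro: mult_right_mono)
  qed (use assms(1) in auto)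
  finally show ?thesis by simp
qed

text \<open>Test with the indicator of the set where g exceeds g'. The integral of g - g' over it is
  nonpositive in the limit and nonnegative by construction.\<close>

lemma weakstar_AE_le:
  fixes f f' :: "nat \<Rightarrow> 'a \<Rightarrow> real"
  assumes g: "integrable M g" "integrable M g'"
    and lim: "\<And>h. integrable M h \<Longrightarrow> (\<lambda>k. LINT x|M. f k x * h x) \<longlonglongrightarrow> (LINT x|M. g x * h x)"
      "\<And>h. integrable M h \<Longrightarrow> (\<lambda>k. LINT x|M. f' k x * h x) \<longlonglongrightarrow> (LINT x|M. g' x * h x)"
    and fin: "finite_measure M"
    and f: "\<And>k. integrable M (f k)" "\<And>k. integrable M (f' k)" "\<And>k. AE x in M. f k x \<le> f' k x"
  shows "AE x in M. g x \<le> g' x"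
proof -
  interpret finite_measure M by (rule fin)
  define A where "A = {x \<in> space M. g' x < g x}"
  have A: "A \<in> sets M" unfolding A_def using g by measurable
  have ind: "integrable M (indicator A :: 'a \<Rightarrow> real)" using A by (simp add: emeasure_eq_measure)
  have prod: "integrable M (\<lambda>x. u x * indicator A x)" if "integrable M u" for u :: "'a \<Rightarrow> real"
    using that A by (rule integrable_real_mult_indicator[rotated])
  have "(LINT x|M. f k x * indicator A x) \<le> (LINT x|M. f' k x * indicator A x)" for k
    by (rule integral_mono_AE[OF prod[OF f(1)] prod[OF f(2)]])
      (use f(3)[of k] in \<open>eventually_elim, auto simp: indicator_def\<close>)
  then have le: "(LINT x|M. g x * indicator A x) \<le> (LINT x|M. g' x * indicator A x)"
    using lim(1)[OF ind] lim(2)[OF ind] by (intro LIMSEQ_le) auto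
  have nn: "AE x in M. 0 \<le> (g x - g' x) * indicator A x"
    by (auto simp: A_def indicator_def)
  have i: "integrable M (\<lambda>x. (g x - g' x) * indicator A x)" using prod g by simp
  have "(LINT x|M. (g x - g' x) * indicator A x) = 0"
    using le integral_nonneg_AE[OF nn] prod[OF g(1)] prod[OF g(2)] by (simp add: left_diff_distrib)
  then have "AE x in M. (g x - g' x) * indicator A x = 0"
    using integral_nonneg_eq_0_iff_AE[OF i nn] by simp
  then show ?thesis
    using AE_space by eventually_elim (auto simp: A_def indicator_def split: if_splits)
qed

text \<open>F k z is the distribution function of the coded measure. Its values at rational points
  converge weak-* along one subsequence, and the limits G z are, for almost every z, the rational
  values from which a measure on [0,1] is rebuilt; c carries it to the state space. The limit thus
  lives on the range of c rather than on K, and B bounds that range. Integrals are compared through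
  Stieltjes sums on a fixed partition, which involve finitely many rational points.\<close>

theorem young_compactness:
  fixes \<nu> :: "nat \<Rightarrow> 'z \<Rightarrow> 'v::euclidean_space measure"
  assumes fin: "finite_measure M" and sep: "separable_measure M"
    and \<nu>: "\<And>k. \<nu> k \<in> M \<rightarrow>\<^sub>M prob_algebra borel"
    and K: "bounded K" and supp: "\<And>k. AE z in M. AE v in \<nu> k z. v \<in> K"
  obtains r \<mu> B where "strict_mono (r :: nat \<Rightarrow> nat)" "\<mu> \<in> M \<rightarrow>\<^sub>M prob_algebra borel"
    "\<And>z. z \<in> space M \<Longrightarrow> AE v in \<mu> z. norm v \<le> B"
    "\<And>(f :: 'v \<Rightarrow> real) (h :: 'z \<Rightarrow> real). continuous_on UNIV f \<Longrightarrow> integrable M h \<Longrightarrow>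
      (\<lambda>k. LINT z|M. pairing (\<nu> (r k)) f z * h z) \<longlonglongrightarrow> (LINT z|M. pairing \<mu> f z * h z)"
proof -
  interpret finite_measure M by (rule fin)
  obtain c :: "real \<Rightarrow> 'v" and s :: "'v \<Rightarrow> real" where
    c: "continuous_on UNIV c" "bounded (range c)" and s: "s \<in> borel_measurable borel"
    and s01: "\<And>v. s v \<in> {0..1}" and cs: "\<And>v. v \<in> K \<Longrightarrow> c (s v) = v"
    by (rule bounded_set_coded_curve[OF K]) blast
  have c_borel: "c \<in> borel_measurable borel" by (rule borel_measurable_continuous_onI[OF c(1)])
  obtain B where B: "\<And>t. norm (c t) \<le> B" using c(2) by (auto simp: bounded_iff)
  define F where "F k z x = measure (\<nu> k z) {v. s v \<le> x}" for k z x
  have sx: "{v. s v \<le> x} \<in> sets borel" for x using s by measurable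
  have F_meas: "(\<lambda>z. F k z x) \<in> borel_measurable M" for k x
    unfolding F_def by (rule measurable_compose[OF \<nu> measurable_measure_prob_algebra[OF sx]])
  have F01: "0 \<le> F k z x \<and> F k z x \<le> 1" if "z \<in> space M" for k z x
    using prob_space.prob_le_1[OF kernelD(1)[OF \<nu> that]] by (simp add: F_def)
  define q where "q j = from_nat_into (\<rat> :: real set) j" for j
  obtain r g where r: "strict_mono (r :: nat \<Rightarrow> nat)"
    and g: "\<And>j. g j \<in> borel_measurable M" "\<And>j x. 0 \<le> g j x \<and> g j x \<le> 1"
    and lim: "\<And>j (h :: 'z \<Rightarrow> real). integrable M h \<Longrightarrow> (\<lambda>k. LINT z|M. F (r k) z (q j) * h z) \<longlonglongrightarrow> (LINT z|M. g j z * h z)"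
    by (rule weakstar_compactness[OF fin sep, of "\<lambda>j k z. F k z (q j)"]) (use F_meas F01 in auto)
  define G where "G z x = g (to_nat_on (\<rat> :: real set) x) z" for z x
  have G_meas: "(\<lambda>z. G z x) \<in> borel_measurable M" for x using g by (simp add: G_def)
  have G01: "0 \<le> G z x \<and> G z x \<le> 1" for z x using g by (simp add: G_def)
  have G_lim: "(\<lambda>k. LINT z|M. F (r k) z x * h z) \<longlonglongrightarrow> (LINT z|M. G z x * h z)"
    if "x \<in> \<rat>" "integrable M h" for x and h :: "'z \<Rightarrow> real"
    using lim[OF that(2), of "to_nat_on \<rat> x"] that(1) by (simp add: q_def G_def countable_rat)
  have F_int: "integrable M (\<lambda>z. F k z x)" for k x
    by (rule integrable_const_bound[where B = 1, OF _ F_meas]) (use F01 in auto)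
  have G_int: "integrable M (\<lambda>z. G z x)" for x
    by (rule integrable_const_bound[where B = 1, OF _ G_meas]) (use G01 in auto)
  \<comment> \<open>Quantifying over the countable type of rationals makes measurability of
    \<open>good\<close> automatic; \<open>good_def\<close> translates back to rational
    reals.\<close>
  define good where good_rat: "good z \<longleftrightarrow> (\<forall>p q::rat. real_of_rat p \<le> real_of_rat q \<longrightarrow> G z (of_rat p) \<le> G z (of_rat q)) \<and>
    (\<forall>q::rat. real_of_rat q < 0 \<longrightarrow> G z (of_rat q) = 0) \<and> (\<forall>q::rat. 1 \<le> real_of_rat q \<longrightarrow> G z (of_rat q) = 1)" for z
  have good_meas: "Measurable.pred M good"
  proof -
    note G_meas [measurable]
    show ?thesis unfolding good_rat by measurable
  qed
  have good_def: "good z \<longleftrightarrow> (\<forall>p\<in>\<rat>. \<forall>q\<in>\<rat>. p \<le> q \<longrightarrow> G z p \<le> G z q) \<and>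
    (\<forall>q\<in>\<rat>. q < 0 \<longrightarrow> G z q = 0) \<and> (\<forall>q\<in>\<rat>. 1 \<le> q \<longrightarrow> G z q = 1)" for z
    unfolding good_rat Rats_def by blast
  have good_AE: "AE z in M. good z"
  proof -
    have 1: "AE z in M. G z p \<le> G z q" if "p \<in> \<rat>" "q \<in> \<rat>" "p \<le> q" for p q
    proof (rule weakstar_AE_le[OF G_int G_int G_lim[OF that(1)] G_lim[OF that(2)] fin F_int F_int])
      have "F (r k) z p \<le> F (r k) z q" if z: "z \<in> space M" for k z
      proof -
        interpret prob_space "\<nu> (r k) z" by (rule kernelD(1)[OF \<nu> z])
        show ?thesis unfolding F_def
          using \<open>p \<le> q\<close> sx kernelD(2)[OF \<nu> z] by (intro finite_measure_mono) auto
      qed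
      then show "AE z in M. F (r k) z p \<le> F (r k) z q" for k by simp
    qed
    have 2: "AE z in M. G z q = 0" if "q \<in> \<rat>" "q < 0" for q
    proof -
      have "{v. s v \<le> q} = {}" using s01 that(2) by (auto simp: not_le intro: less_le_trans)
      then have F0: "F k z q = 0" for k z by (simp add: F_def)
      have "AE z in M. G z q \<le> 0"
        by (rule weakstar_AE_le[OF G_int _ G_lim[OF that(1)] _ fin F_int, of "\<lambda>_. 0" "\<lambda>_ _. 0"]) (auto simp: F0)
      then show ?thesis by eventually_elim (use G01 in \<open>auto intro: antisym\<close>)
    qed
    have 3: "AE z in M. G z q = 1" if "q \<in> \<rat>" "1 \<le> q" for q
    proof -
      have U: "{v. s v \<le> q} = UNIV" using s01 that(2) by (auto intro: order_trans)
      have F1: "F k z q = 1" if z: "z \<in> space M" for k z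
        using prob_space.prob_space[OF kernelD(1)[OF \<nu> z]] kernelD(3)[OF \<nu> z] U by (simp add: F_def)
      have "AE z in M. 1 \<le> G z q"
        by (rule weakstar_AE_le[OF _ G_int _ G_lim[OF that(1)] fin _ F_int, of "\<lambda>_. 1" "\<lambda>_ _. 1"]) (auto simp: F1)
      then show ?thesis by eventually_elim (use G01 in \<open>auto intro: antisym\<close>)
    qed
    have "AE z in M. \<forall>p\<in>\<rat>. \<forall>q\<in>\<rat>. p \<le> q \<longrightarrow> G z p \<le> G z q"
      using 1 by (auto simp: AE_ball_countable[OF countable_rat])
    moreover have "AE z in M. \<forall>q\<in>\<rat>. q < 0 \<longrightarrow> G z q = 0"
      using 2 by (auto simp: AE_ball_countable[OF countable_rat])
    moreover have "AE z in M. \<forall>q\<in>\<rat>. 1 \<le> q \<longrightarrow> G z q = 1"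
      using 3 by (auto simp: AE_ball_countable[OF countable_rat])
    ultimately show ?thesis by eventually_elim (simp add: good_def)
  qed
  define P where "P z m \<longleftrightarrow> real_distribution m \<and> (AE x in m. x \<in> {0..1}) \<and>
    (\<forall>p q. p \<in> \<rat> \<longrightarrow> q \<in> \<rat> \<longrightarrow> p < q \<longrightarrow> G z p \<le> cdf m p \<and> cdf m p \<le> G z q) \<and>
    (\<forall>x<0. cdf m x = 0) \<and> (\<forall>x\<ge>1. cdf m x = 1)" for z m
  \<comment> \<open>On the exceptional set a Dirac mass serves as default, so that a probability
    measure is attached to every z and measurability can be checked by cases.\<close>
  have "\<exists>m. (good z \<longrightarrow> P z m) \<and> (\<not> good z \<longrightarrow> m = return borel 0)" for z
  proof (cases "good z")
    case True
    show ?thesis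
      by (rule distribution_of_rational_cdf[of "G z"]) (use True in \<open>auto simp: good_def P_def\<close>)
  qed simp
  then obtain m where m: "\<And>z. good z \<Longrightarrow> P z (m z)" "\<And>z. \<not> good z \<Longrightarrow> m z = return borel 0"
    by metis
  have m_prob: "prob_space (m z)" "sets (m z) = sets borel" for z
  proof -
    have "real_distribution (m z)" if "good z" using m(1)[OF that] by (simp add: P_def)
    then show "prob_space (m z)" "sets (m z) = sets borel"
      using m(2)[of z] by (cases "good z"; auto simp: real_distribution_def real_distribution_axioms_def prob_space_return)+
  qed
  define \<mu> where "\<mu> z = distr (m z) borel c" for z
  have c_meas: "c \<in> measurable (m z) borel" for z
    using c_borel by (simp add: measurable_cong_sets[OF m_prob(2) refl])
  have \<mu>_prob: "prob_space (\<mu> z)" "sets (\<mu> z) = sets borel" for z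
    unfolding \<mu>_def using prob_space.prob_space_distr[OF m_prob(1) c_meas] by auto
  have \<mu>_bound: "AE v in \<mu> z. norm v \<le> B" for z
    unfolding \<mu>_def using B by (subst AE_distr_iff[OF c_meas]) auto
  have comp_cont: "continuous_on UNIV (\<lambda>t. f (c t))" if "continuous_on UNIV f" for f :: "'v \<Rightarrow> real"
    by (rule continuous_on_compose2[OF that c(1)]) simp
  have \<mu>_pairing: "pairing \<mu> f z = (LINT t|m z. f (c t))" if "continuous_on UNIV f" for f :: "'v \<Rightarrow> real" and z
    unfolding pairing_def \<mu>_def
    by (rule integral_distr[OF c_meas borel_measurable_continuous_onI[OF that]])
  have \<mu>_approx: "\<bar>pairing \<mu> f z - stieltjes_sum (\<lambda>t. f (c t)) (G z) N\<bar> \<le> 2 * e"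
    if f: "continuous_on UNIV f" and z: "good z" and N: "0 < N"
      and osc: "\<And>x y. x \<in> {0..1} \<Longrightarrow> y \<in> {0..1} \<Longrightarrow> \<bar>x - y\<bar> \<le> 1 / real N \<Longrightarrow> \<bar>f (c x) - f (c y)\<bar> \<le> e"
    for f :: "'v \<Rightarrow> real" and z N e
    unfolding \<mu>_pairing[OF f]
    by (rule integral_rational_cdf_approx[OF _ _ _ _ _ _ _ _ comp_cont[OF f] N osc])
      (use m(1)[OF z] z G01 in \<open>auto simp: P_def good_def\<close>)
  have S_meas: "(\<lambda>z. stieltjes_sum h (G z) N) \<in> borel_measurable M" for h N
    unfolding stieltjes_sum_def using G_meas by measurable
  \<comment> \<open>The measures m z were chosen pointwise, without regard to measurability in z. It
    is recovered here: pairings are limits of Stieltjes sums of G z, which depend measurably on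
    z.\<close>
  have pairing_meas: "pairing \<mu> f \<in> borel_measurable M" if f: "continuous_on UNIV f" for f :: "'v \<Rightarrow> real"
  proof (rule borel_measurable_LIMSEQ_real)
    show "(\<lambda>N. if good z then stieltjes_sum (\<lambda>t. f (c t)) (G z) N else f (c 0)) \<longlonglongrightarrow> pairing \<mu> f z" for z
    proof (cases "good z")
      case True
      have "(\<lambda>N. stieltjes_sum (\<lambda>t. f (c t)) (G z) N) \<longlonglongrightarrow> pairing \<mu> f z"
      proof (rule LIMSEQ_I)
        fix e :: real assume "0 < e"
        then obtain N0 where N0: "0 < N0" "\<And>N x y. N0 \<le> N \<Longrightarrow> x \<in> {0..1} \<Longrightarrow> y \<in> {0..1} \<Longrightarrow>
            \<bar>x - y\<bar> \<le> 1 / real N \<Longrightarrow> \<bar>f (c x) - f (c y)\<bar> \<le> e / 4"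
          using uniform_oscillation[OF comp_cont[OF f], of "e / 4"] by (metis zero_less_divide_iff zero_less_numeral)
        show "\<exists>N0. \<forall>N\<ge>N0. norm (stieltjes_sum (\<lambda>t. f (c t)) (G z) N - pairing \<mu> f z) < e"
        proof (intro exI[of _ N0] allI impI)
          fix N assume N: "N0 \<le> N"
          have "\<bar>pairing \<mu> f z - stieltjes_sum (\<lambda>t. f (c t)) (G z) N\<bar> \<le> 2 * (e / 4)"
            by (rule \<mu>_approx[OF f True]) (use N N0 in auto)
          then show "norm (stieltjes_sum (\<lambda>t. f (c t)) (G z) N - pairing \<mu> f z) < e"
            using \<open>0 < e\<close> by (simp add: abs_minus_commute)
        qed
      qed
      then show ?thesis using True by simp
    next
      case False
      have "pairing \<mu> f z = f (c 0)"
        unfolding \<mu>_pairing[OF f] m(2)[OF False]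
        using borel_measurable_continuous_onI[OF comp_cont[OF f]] by (subst integral_return) auto
      then show ?thesis using False by simp
    qed
    show "(\<lambda>z. if good z then stieltjes_sum (\<lambda>t. f (c t)) (G z) N else f (c 0)) \<in> borel_measurable M" for N
      using S_meas good_meas by (intro measurable_If) (auto simp: pred_def)
  qed
  have \<mu>_kernel: "\<mu> \<in> M \<rightarrow>\<^sub>M prob_algebra borel"
    by (rule young_measure_kernel[where S = UNIV])
      (use \<mu>_prob pairing_meas in \<open>auto simp: young_measure_def C_0_def\<close>)
  show ?thesis
  proof (rule that[OF r \<mu>_kernel \<mu>_bound])
    fix f :: "'v \<Rightarrow> real" and h :: "'z \<Rightarrow> real" assume f: "continuous_on UNIV f" and h: "integrable M h"
    have f_borel: "f \<in> borel_measurable borel" by (rule borel_measurable_continuous_onI[OF f])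
    \<comment> \<open>K carries the approximating measures and the range of c the limit; one
      constant bounds f on both.\<close>
    obtain C where C: "\<And>v. v \<in> K \<union> range c \<Longrightarrow> norm (f v) \<le> C"
      using continuous_on_bounded_set[OF f, of "K \<union> range c"] K c(2) by auto
    have \<nu>_bound: "AE z in M. \<bar>pairing (\<nu> k) f z\<bar> \<le> C" for k
      using supp[of k] AE_space
    proof eventually_elim
      case (elim z)
      have "norm (pairing (\<nu> k) f z) \<le> C"
        using elim(1) f_borel C kernelD(2)[OF \<nu> elim(2)]
        by (intro pairing_AE_bound kernelD(1)[OF \<nu> elim(2)]) (auto elim!: eventually_mono cong: measurable_cong_sets)
      then show ?case by simp
    qed
    have \<mu>_bd: "\<bar>pairing \<mu> f z\<bar> \<le> C" for z
    proof -
      have "AE v in \<mu> z. norm (f v) \<le> C"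
        unfolding \<mu>_def by (subst AE_distr_iff[OF c_meas]) (use C f_borel in auto)
      then have "norm (pairing \<mu> f z) \<le> C"
        using f_borel \<mu>_prob by (intro pairing_AE_bound) (auto cong: measurable_cong_sets)
      then show ?thesis by simp
    qed
    have \<nu>_int: "integrable M (\<lambda>z. pairing (\<nu> k) f z * h z)" for k
      by (rule integrable_mult_bounded_AE[OF h borel_measurable_pairing[OF \<nu> f_borel] \<nu>_bound])
    have \<mu>_int: "integrable M (\<lambda>z. pairing \<mu> f z * h z)"
      by (rule integrable_mult_bounded_AE[OF h pairing_meas[OF f], of C]) (use \<mu>_bd in auto)
    have Fh: "integrable M (\<lambda>z. F k z x * h z)" for k x
      by (rule integrable_mult_bounded_AE[OF h F_meas, of _ _ 1]) (use F01 in auto)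
    have Gh: "integrable M (\<lambda>z. G z x * h z)" for x
      by (rule integrable_mult_bounded_AE[OF h G_meas, of _ 1]) (use G01 in auto)
    have expand: "integrable M (\<lambda>z. stieltjes_sum u (A z) N * h z)"
      "(LINT z|M. stieltjes_sum u (A z) N * h z) = (\<Sum>i\<le>N. u (real i / real N) *
        ((LINT z|M. A z (real i / real N) * h z) - (LINT z|M. A z ((real i - 1) / real N) * h z)))"
      if "\<And>x. integrable M (\<lambda>z. A z x * h z)" for u N and A :: "'z \<Rightarrow> real \<Rightarrow> real"
    proof -
      have eq: "stieltjes_sum u (A z) N * h z = (\<Sum>i\<le>N. u (real i / real N) *
        (A z (real i / real N) * h z - A z ((real i - 1) / real N) * h z))" for z
        unfolding stieltjes_sum_def sum_distrib_right by (intro sum.cong) (auto simp: algebra_simps)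
      show "integrable M (\<lambda>z. stieltjes_sum u (A z) N * h z)"
        unfolding eq using that by (intro Bochner_Integration.integrable_sum integrable_mult_right Bochner_Integration.integrable_diff)
      show "(LINT z|M. stieltjes_sum u (A z) N * h z) = (\<Sum>i\<le>N. u (real i / real N) *
        ((LINT z|M. A z (real i / real N) * h z) - (LINT z|M. A z ((real i - 1) / real N) * h z)))"
        unfolding eq using that
        by (subst Bochner_Integration.integral_sum) (auto intro!: Bochner_Integration.integrable_diff)
    qed
    show "(\<lambda>k. LINT z|M. pairing (\<nu> (r k)) f z * h z) \<longlonglongrightarrow> (LINT z|M. pairing \<mu> f z * h z)"
    proof (rule tendsto_approx)
      fix e :: real assume e: "0 < e"
      define I where "I = (LINT z|M. \<bar>h z\<bar>)"
      have I: "0 \<le> I" unfolding I_def by (rule Bochner_Integration.integral_nonneg) simp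
      \<comment> \<open>The 2 matches the error 2 d of \<open>\<mu>_approx\<close>, and the summand
        1 keeps the quotient meaningful when h integrates to zero.\<close>
      define d where "d = e / (2 * (I + 1))"
      have d: "0 < d" using e I by (simp add: d_def)
      have dI: "2 * d * I \<le> e" 
        using e I by (simp add: d_def pos_divide_le_eq mult_left_mono)
      obtain N where N: "0 < N" "\<And>x y. x \<in> {0..1} \<Longrightarrow> y \<in> {0..1} \<Longrightarrow>
            \<bar>x - y\<bar> \<le> 1 / real N \<Longrightarrow> \<bar>f (c x) - f (c y)\<bar> \<le> d"
        using uniform_oscillation[OF comp_cont[OF f] d] by (metis order_refl)
      let ?S = "\<lambda>A. stieltjes_sum (\<lambda>t. f (c t)) A N"
      have rat: "real i / real N \<in> \<rat>" "(real i - 1) / real N \<in> \<rat>" for i by auto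
      have "(\<lambda>k. LINT z|M. ?S (F (r k) z) * h z) \<longlonglongrightarrow> (LINT z|M. ?S (G z) * h z)"
        unfolding expand(2)[OF Fh] expand(2)[OF Gh]
        by (intro tendsto_sum tendsto_mult tendsto_const tendsto_diff G_lim rat h)
      moreover have "\<bar>(LINT z|M. pairing (\<nu> k) f z * h z) - (LINT z|M. ?S (F k z) * h z)\<bar> \<le> e" for k
      proof -
        have "AE z in M. \<bar>pairing (\<nu> k) f z - ?S (F k z)\<bar> \<le> d"
          using supp[of k] AE_space
        proof eventually_elim
          case (elim z)
          have s_meas: "s \<in> measurable (\<nu> k z) borel"
            using s by (simp add: measurable_cong_sets[OF kernelD(2)[OF \<nu> elim(2)] refl])
          define n where "n = distr (\<nu> k z) borel s"
          have n: "real_distribution n"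
            using prob_space.prob_space_distr[OF kernelD(1)[OF \<nu> elim(2)] s_meas]
            by (simp add: n_def real_distribution_def real_distribution_axioms_def)
          have cdf: "cdf n = F k z"
            using s_meas kernelD(3)[OF \<nu> elim(2)] by (auto simp: cdf_def n_def F_def measure_distr vimage_def)
          have "AE x in n. x \<in> {0..1}"
            unfolding n_def by (subst AE_distr_iff[OF s_meas]) (use s01 in auto)
          then have "\<bar>(LINT x|n. f (c x)) - stieltjes_sum (\<lambda>t. f (c t)) (cdf n) N\<bar> \<le> d"
            by (rule integral_stieltjes_sum[OF n _ comp_cont[OF f] N])
          moreover have "(LINT x|n. f (c x)) = pairing (\<nu> k) f z"
          proof -
            have "(LINT x|n. f (c x)) = (LINT v|\<nu> k z. f (c (s v)))"
              unfolding n_def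
              by (rule integral_distr[OF s_meas borel_measurable_continuous_onI[OF comp_cont[OF f]]])
            also have "\<dots> = (LINT v|\<nu> k z. f v)"
            proof (rule integral_cong_AE)
              show "AE v in \<nu> k z. f (c (s v)) = f v" using elim(1) by eventually_elim (simp add: cs)
              show "(\<lambda>v. f (c (s v))) \<in> borel_measurable (\<nu> k z)"
                by (rule measurable_compose[OF s_meas borel_measurable_continuous_onI[OF comp_cont[OF f]]])
              show "f \<in> borel_measurable (\<nu> k z)"
                using f_borel by (simp add: measurable_cong_sets[OF kernelD(2)[OF \<nu> elim(2)] refl])
            qed
            finally show ?thesis by (simp add: pairing_def)
          qed
          ultimately show ?case by (simp add: cdf)
        qed
        from abs_integral_diff_mult_le[OF h \<nu>_int expand(1)[OF Fh] this]
        show ?thesis using dI d I by (simp add: I_def[symmetric])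
      qed
      moreover have "\<bar>(LINT z|M. pairing \<mu> f z * h z) - (LINT z|M. ?S (G z) * h z)\<bar> \<le> e"
      proof -
        have "AE z in M. \<bar>pairing \<mu> f z - ?S (G z)\<bar> \<le> 2 * d"
          using good_AE by eventually_elim (rule \<mu>_approx[OF f _ N])
        from abs_integral_diff_mult_le[OF h \<mu>_int expand(1)[OF Gh] this]
        show ?thesis using dI by (simp add: I_def[symmetric])
      qed
      ultimately show "\<exists>a' l'. a' \<longlonglongrightarrow> l' \<and> (\<forall>k. \<bar>(LINT z|M. pairing (\<nu> (r k)) f z * h z) - a' k\<bar> \<le> e) \<and>
          \<bar>(LINT z|M. pairing \<mu> f z * h z) - l'\<bar> \<le> e"
        by blast
    qed
  qed
qed

section \<open>Supports and initial traces\<close>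

text \<open>By second countability the complement of the support is covered by countably many basic
  open sets of measure zero.\<close>

lemma AE_in_supp:
  fixes m :: "'v::euclidean_space measure"
  assumes "sets m = sets borel"
  shows "AE v in m. v \<in> supp m"
proof -
  obtain \<B> :: "'v set set" where \<B>: "countable \<B>" "topological_basis \<B>"
    using ex_countable_basis by blast
  define \<N> where "\<N> = {U \<in> \<B>. emeasure m U = 0}"
  have "AE v in m. v \<notin> U" if "U \<in> \<N>" for U
    using that topological_basis_open[OF \<B>(2)] assms by (intro AE_not_in) (auto simp: null_sets_def \<N>_def)
  moreover have "countable \<N>" using \<B>(1) by (simp add: \<N>_def)
  ultimately have "AE v in m. \<forall>U\<in>\<N>. v \<notin> U" by (simp add: AE_ball_countable)
  then show ?thesis
  proof eventually_elim
    case (elim v)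
    show ?case
      unfolding supp_def
    proof (intro CollectI allI impI, rule ccontr)
      fix U assume U: "open U \<and> v \<in> U" "\<not> 0 < emeasure m U"
      obtain V where V: "V \<in> \<B>" "v \<in> V" "V \<subseteq> U"
        using topological_basisE[OF \<B>(2)] U(1) by metis
      have "emeasure m V \<le> emeasure m U" using V(3) U(1) assms by (intro emeasure_mono) auto
      then have "V \<in> \<N>" using V(1) U(2) by (simp add: \<N>_def)
      then show False using elim V(2) by blast
    qed
  qed
qed

lemma powr_diff_lower_bound:
  fixes a x y \<gamma> :: real
  assumes "0 < a" "a \<le> x" "a \<le> y" "1 < \<gamma>"
  shows "\<gamma> * a powr (\<gamma> - 1) * \<bar>x - y\<bar> \<le> \<bar>x powr \<gamma> - y powr \<gamma>\<bar>"
proof -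
  have *: "\<gamma> * a powr (\<gamma> - 1) * (y - x) \<le> y powr \<gamma> - x powr \<gamma>" if "a \<le> x" "x < y" for x y
  proof -
    have "\<exists>z. x < z \<and> z < y \<and> y powr \<gamma> - x powr \<gamma> = (y - x) * (\<gamma> * z powr (\<gamma> - 1))"
      using that assms(1) by (intro MVT2) (auto intro!: has_real_derivative_powr)
    then obtain z where z: "x < z" "y powr \<gamma> - x powr \<gamma> = (y - x) * (\<gamma> * z powr (\<gamma> - 1))" by blast
    have "a powr (\<gamma> - 1) \<le> z powr (\<gamma> - 1)" using z(1) that assms by (intro powr_mono2) auto
    then have "(y - x) * (\<gamma> * a powr (\<gamma> - 1)) \<le> (y - x) * (\<gamma> * z powr (\<gamma> - 1))"
      using that assms by (intro mult_left_mono) auto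
    then show ?thesis using z(2) by (simp add: mult_ac)
  qed
  consider "x < y" | "y < x" | "x = y" by linarith
  then show ?thesis
  proof cases
    case 1
    then show ?thesis using *[OF assms(2) 1] by simp
  next
    case 2
    then show ?thesis using *[OF assms(3) 2] by simp
  qed simp
qed

text \<open>Confinement away from vacuum enters here: above min \<eta> \<rho>bar the slope of the
  power law is at least the denominator of the constant, so a bound of order \<epsilon> on the
  difference of the powers can be inverted.\<close>

lemma rescaled_pressure_bound_density:
  assumes "0 < \<eta>" "\<eta> \<le> \<rho>" "0 < \<rho>bar" "1 < \<gamma>" "0 < \<epsilon>" "\<bar>rescaled_pressure \<gamma> \<rho>bar \<epsilon> \<rho>\<bar> \<le> B"
  shows "\<bar>\<rho> - \<rho>bar\<bar> \<le> B * \<rho>bar / (\<gamma> * min \<eta> \<rho>bar powr (\<gamma> - 1)) * \<epsilon>"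
proof -
  define D where "D = \<gamma> * min \<eta> \<rho>bar powr (\<gamma> - 1)"
  have D: "0 < D" using assms by (simp add: D_def)
  have "D * \<bar>\<rho> - \<rho>bar\<bar> \<le> \<bar>\<rho> powr \<gamma> - \<rho>bar powr \<gamma>\<bar>"
    unfolding D_def using assms by (intro powr_diff_lower_bound) auto
  also have "\<dots> = \<epsilon> * \<rho>bar * \<bar>rescaled_pressure \<gamma> \<rho>bar \<epsilon> \<rho>\<bar>"
    using assms by (simp add: rescaled_pressure_def abs_mult)
  also have "\<dots> \<le> \<epsilon> * \<rho>bar * B" using assms by (intro mult_left_mono) auto
  finally have "\<bar>\<rho> - \<rho>bar\<bar> \<le> \<epsilon> * \<rho>bar * B / D" using D by (simp add: pos_le_divide_eq mult.commute)
  then show ?thesis by (simp add: D_def mult_ac)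
qed

section \<open>Ramps and initial traces\<close>

lemma integral_space_time_slice:
  fixes g :: "real^'d \<Rightarrow> real" and a :: "real \<Rightarrow> real"
  assumes g: "continuous_on UNIV g" and a: "a \<in> borel_measurable borel" "\<And>t. \<bar>a t\<bar> \<le> A"
  shows "integrable (space_time T) (\<lambda>z. a (fst z) * g (snd z))"
    "(LINT z|space_time T. a (fst z) * g (snd z)) = (LINT t|lebesgue_on {0<..<T}. a t) * (LINT x|torus. g x)"
proof -
  interpret finite_measure "space_time T :: (real \<times> (real^'d)) measure" by (rule finite_measure_space_time)
  obtain G where G: "\<And>x. x \<in> unit_cell \<Longrightarrow> norm (g x) \<le> G"
    using continuous_on_bounded_set[OF g bounded_unit_cell] by blast
  have m: "(\<lambda>z :: real \<times> (real^'d). a (fst z) * g (snd z)) \<in> borel_measurable borel"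
  proof -
    have "(\<lambda>z :: real \<times> (real^'d). a (fst z)) \<in> borel_measurable borel"
      by (rule measurable_compose[OF _ a(1)]) (intro borel_measurable_continuous_onI continuous_intros)
    moreover have "(\<lambda>z :: real \<times> (real^'d). g (snd z)) \<in> borel_measurable borel"
      by (rule measurable_compose[OF _ borel_measurable_continuous_onI[OF g]])
        (intro borel_measurable_continuous_onI continuous_intros)
    ultimately show ?thesis by (rule borel_measurable_times)
  qed
  have "norm (a (fst z) * g (snd z)) \<le> A * G" if "z \<in> space (space_time T)" for z
    unfolding norm_mult using that a(2)[of "fst z"] G[of "snd z"] by (intro mult_mono) auto
  then show i: "integrable (space_time T) (\<lambda>z. a (fst z) * g (snd z))"
    by (intro integrable_const_bound[where B = "A * G"] borel_measurable_lebesgue_onI[OF m]) auto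
  show "(LINT z|space_time T. a (fst z) * g (snd z)) = (LINT t|lebesgue_on {0<..<T}. a t) * (LINT x|torus. g x)"
    using integral_lebesgue_on_prod[OF _ borel_unit_cell i] by simp
qed

lemma integral_initial_interval:
  fixes s T :: real
  assumes "0 < s" "s \<le> T"
  shows "(LINT t|lebesgue_on {0<..<T}. indicator {..<s} t) = s"
proof -
  have eq: "(\<lambda>t. indicator {0<..<T} t *\<^sub>R indicator {..<s} t :: real) = indicator {0<..<s}"
    using assms by (auto simp: fun_eq_iff indicator_def)
  have "(LINT t|lebesgue_on {0<..<T}. indicator {..<s} t :: real) = (LINT t|lborel. indicator {0<..<s} t)"
    using integral_lebesgue_on_borel[of "{0<..<T}" "indicator {..<s} :: real \<Rightarrow> real"] unfolding eq by simp
  then show ?thesis using assms by simp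
qed

text \<open>The pair \<open>(m, p)\<close> has initial trace \<open>M\<^sub>0\<close> if \<open>\<partial>\<^sub>t m = p\<close> and \<open>m(0) = M\<^sub>0\<close> after integration in
  space.  Testing with ramps turns this into an identity that needs no smoothness in time.\<close>

lemma ramp_identity:
  fixes m p :: "real \<times> (real^'d) \<Rightarrow> real"
  assumes m: "integrable (space_time T) m" and p: "integrable (space_time T) p" and s: "0 < s" "s < T"
    and eq: "\<And>k. (LINT z|space_time T. m z * ramp_deriv k s (fst z) + p z * ramp k s (fst z)) = - (ramp k s 0 * M0)"
  shows "(LINT z|space_time T. m z * indicator {..<s} (fst z))
    - (LINT z|space_time T. p z * ((s - fst z) * indicator {..<s} (fst z))) = s * M0"
proof -
  let ?M = "space_time T :: (real \<times> (real^'d)) measure"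
  have fst_m: "(\<lambda>z :: real \<times> (real^'d). a (fst z)) \<in> borel_measurable ?M" if "a \<in> borel_measurable borel" for a :: "real \<Rightarrow> real"
    by (intro borel_measurable_lebesgue_onI measurable_compose[OF _ that] borel_measurable_continuous_onI continuous_intros)
  have r: "ramp k s \<in> borel_measurable borel" for k
    by (intro borel_measurable_continuous_onI C_infinity_continuous_on C_infinity_ramp)
  have rd: "ramp_deriv k s \<in> borel_measurable borel" for k
    unfolding ramp_deriv_def[abs_def]
    by (intro borel_measurable_continuous_onI continuous_intros C_infinity_continuous_on[OF C_infinity_bump_shift])
  have rb: "\<bar>ramp k s (fst z)\<bar> \<le> T" if "z \<in> space ?M" for k z
    using ramp_bound[of k s "fst z"] that s by auto
  have 1: "(\<lambda>k. LINT z|?M. m z * ramp_deriv k s (fst z)) \<longlonglongrightarrow> (LINT z|?M. m z * (- indicator {..<s} (fst z)))"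
    by (rule integral_bounded_convergence[OF m, where C = 2])
      (auto intro!: fst_m rd ramp_deriv_bound ramp_deriv_tendsto)
  have 2: "(\<lambda>k. LINT z|?M. p z * ramp k s (fst z)) \<longlonglongrightarrow> (LINT z|?M. p z * ((s - fst z) * indicator {..<s} (fst z)))"
  proof (rule integral_bounded_convergence[OF p, where C = T])
    show "(\<lambda>z. (s - fst z) * indicator {..<s} (fst z)) \<in> borel_measurable ?M"
      by (intro fst_m[of "\<lambda>t. (s - t) * indicator {..<s} t"]) measurable
  qed (auto intro!: fst_m r ramp_tendsto rb)
  have im: "integrable ?M (\<lambda>z. m z * ramp_deriv k s (fst z))" for k
    by (rule integrable_mult_bounded[OF m fst_m[OF rd]]) (rule ramp_deriv_bound)
  have ip: "integrable ?M (\<lambda>z. p z * ramp k s (fst z))" for k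
    by (rule integrable_mult_bounded[OF p fst_m[OF r]]) (rule rb)
  have "(\<lambda>k. - (ramp k s 0 * M0)) \<longlonglongrightarrow>
    (LINT z|?M. m z * (- indicator {..<s} (fst z))) + (LINT z|?M. p z * ((s - fst z) * indicator {..<s} (fst z)))"
    using tendsto_add[OF 1 2] eq im ip by simp
  moreover have "(\<lambda>k. - (ramp k s 0 * M0)) \<longlonglongrightarrow> - (s * M0)"
    using tendsto_mult[OF ramp_tendsto[of s 0] tendsto_const[of M0]] s by (intro tendsto_minus) simp
  ultimately have "- (s * M0) = (LINT z|?M. m z * (- indicator {..<s} (fst z)))
      + (LINT z|?M. p z * ((s - fst z) * indicator {..<s} (fst z)))"
    by (rule LIMSEQ_unique[rotated])
  then show ?thesis by simp
qed

text \<open>Divide the identity by s. The first integral is at most c s times the integral of g. The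
  second is of order s^2, since both the weight s - t and the length of the time interval are at
  most s; hence P, however large, disappears as s -> 0.\<close>

lemma trace_bound:
  fixes m p :: "real \<times> (real^'d) \<Rightarrow> real" and g :: "real^'d \<Rightarrow> real"
  assumes T: "0 < T" and m: "m \<in> borel_measurable (space_time T)" and p: "p \<in> borel_measurable (space_time T)"
    and g: "continuous_on UNIV g" and mb: "AE z in space_time T. \<bar>m z\<bar> \<le> c * g (snd z)"
    and pb: "AE z in space_time T. \<bar>p z\<bar> \<le> P"
    and eq: "\<And>s. 0 < s \<Longrightarrow> s < T \<Longrightarrow> (LINT z|space_time T. m z * indicator {..<s} (fst z))
    - (LINT z|space_time T. p z * ((s - fst z) * indicator {..<s} (fst z))) = s * M0"
  shows "\<bar>M0\<bar> \<le> c * (LINT x|torus. g x)"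
proof -
  let ?M = "space_time T :: (real \<times> (real^'d)) measure"
  interpret finite_measure ?M by (rule finite_measure_space_time)
  define V where "V = (LINT x|torus. (\<lambda>_ :: real^'d. 1 :: real) x)"
  have le: "\<bar>M0\<bar> \<le> c * (LINT x|torus. g x) + s * (\<bar>P\<bar> * V)" if s: "0 < s" "s < T" for s
  proof -
    note sl = integral_space_time_slice[where a = "indicator {..<s}" and A = 1 and T = T]
    have ii: "(\<lambda>t. indicator {..<s} t :: real) \<in> borel_measurable borel" "\<And>t. \<bar>indicator {..<s} t :: real\<bar> \<le> 1"
      by (auto simp: indicator_def)
    have ind_T: "(LINT t|lebesgue_on {0<..<T}. indicator {..<s} t) = s"
      using integral_initial_interval[of s T] s by simp
    have fst_m: "(\<lambda>z :: real \<times> (real^'d). a (fst z)) \<in> borel_measurable ?M" if "a \<in> borel_measurable borel" for a :: "real \<Rightarrow> real"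
      by (intro borel_measurable_lebesgue_onI measurable_compose[OF _ that] borel_measurable_continuous_onI continuous_intros)
    have bd: "\<bar>LINT z|?M. f z\<bar> \<le> (LINT z|?M. h z)"
      if "f \<in> borel_measurable ?M" "integrable ?M h" "AE z in ?M. \<bar>f z\<bar> \<le> h z" for f h :: "real \<times> (real^'d) \<Rightarrow> real"
    proof -
      have i: "integrable ?M f"
        by (rule Bochner_Integration.integrable_bound[OF that(2,1)]) (use that(3) in \<open>eventually_elim, auto\<close>)
      have "\<bar>LINT z|?M. f z\<bar> \<le> (LINT z|?M. \<bar>f z\<bar>)" using integral_norm_bound[of ?M f] by simp
      also have "\<dots> \<le> (LINT z|?M. h z)" by (rule integral_mono_AE) (use i that in auto)
      finally show ?thesis .
    qed
    have "\<bar>LINT z|?M. m z * indicator {..<s} (fst z)\<bar> \<le> (LINT z|?M. c * (indicator {..<s} (fst z) * g (snd z)))"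
    proof (rule bd)
      show "(\<lambda>z. m z * indicator {..<s} (fst z)) \<in> borel_measurable ?M"
        by (intro borel_measurable_times m fst_m ii)
      show "integrable ?M (\<lambda>z. c * (indicator {..<s} (fst z) * g (snd z)))"
        using sl(1)[OF g ii] by simp
      show "AE z in ?M. \<bar>m z * indicator {..<s} (fst z)\<bar> \<le> c * (indicator {..<s} (fst z) * g (snd z))"
        using mb by eventually_elim (auto simp: indicator_def)
    qed
    also have "\<dots> = c * (s * (LINT x|torus. g x))"
      using sl(2)[OF g ii] ind_T by simp
    finally have 1: "\<bar>LINT z|?M. m z * indicator {..<s} (fst z)\<bar> \<le> c * (s * (LINT x|torus. g x))" .
    have "\<bar>LINT z|?M. p z * ((s - fst z) * indicator {..<s} (fst z))\<bar> \<le> (LINT z|?M. \<bar>P\<bar> * s * (indicator {..<s} (fst z) * (\<lambda>_ :: real^'d. 1) (snd z)))"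
    proof (rule bd)
      show "(\<lambda>z. p z * ((s - fst z) * indicator {..<s} (fst z))) \<in> borel_measurable ?M"
        by (intro borel_measurable_times p fst_m[of "\<lambda>t. (s - t) * indicator {..<s} t", simplified]) measurable
      show "integrable ?M (\<lambda>z. \<bar>P\<bar> * s * (indicator {..<s} (fst z) * (\<lambda>_ :: real^'d. 1) (snd z)))"
        using sl(1)[of "\<lambda>_ :: real^'d. 1", OF _ ii] by simp
      show "AE z in ?M. \<bar>p z * ((s - fst z) * indicator {..<s} (fst z))\<bar> \<le> \<bar>P\<bar> * s * (indicator {..<s} (fst z) * (\<lambda>_ :: real^'d. 1) (snd z))"
        using pb AE_space
      proof eventually_elim
        case (elim z)
        then have "0 < fst z" by auto
        then show ?case
          using elim(1) by (cases "fst z < s") (auto simp: abs_mult intro!: mult_mono)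
      qed
    qed
    also have "\<dots> = \<bar>P\<bar> * s * (s * V)"
      using sl(2)[of "\<lambda>_ :: real^'d. 1", OF _ ii] ind_T by (simp add: V_def)
    finally have 2: "\<bar>LINT z|?M. p z * ((s - fst z) * indicator {..<s} (fst z))\<bar> \<le> \<bar>P\<bar> * s * (s * V)" .
    have "s * \<bar>M0\<bar> = \<bar>s * M0\<bar>" using s by (simp add: abs_mult)
    also have "\<dots> \<le> c * (s * (LINT x|torus. g x)) + \<bar>P\<bar> * s * (s * V)"
      unfolding eq[OF s, symmetric] using 1 2 by linarith
    also have "\<dots> = s * (c * (LINT x|torus. g x) + s * (\<bar>P\<bar> * V))" by (simp add: algebra_simps)
    finally show ?thesis using s(1) by simp
  qed
  have "((\<lambda>s. c * (LINT x|torus. g x) + s * (\<bar>P\<bar> * V)) \<longlongrightarrow> c * (LINT x|torus. g x) + 0 * (\<bar>P\<bar> * V)) (at_right 0)"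
    by (intro tendsto_intros)
  moreover have "\<forall>\<^sub>F s in at_right 0. \<bar>M0\<bar> \<le> c * (LINT x|torus. g x) + s * (\<bar>P\<bar> * V)"
    unfolding eventually_at_right_field using le T by (intro exI[of _ T]) auto
  ultimately have "\<bar>M0\<bar> \<le> c * (LINT x|torus. g x) + 0 * (\<bar>P\<bar> * V)"
    by (rule tendsto_lowerbound) simp
  then show ?thesis by simp
qed

section \<open>Solutions with confined pressure\<close>

lemma norm_tensor: "norm (u \<otimes>\<^sub>v v) = norm u * norm v"
proof -
  have row: "(u \<otimes>\<^sub>v v) $ i = u $ i *\<^sub>R v" for i
    by (simp add: tensor_def vec_eq_iff)
  have "norm (u \<otimes>\<^sub>v v) = L2_set (\<lambda>i. norm ((u \<otimes>\<^sub>v v) $ i)) UNIV"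
    by (rule norm_vec_def)
  also have "\<dots> = L2_set (\<lambda>i. norm (u $ i) * norm v) UNIV"
    by (simp only: row norm_scaleR real_norm_def)
  also have "\<dots> = L2_set (\<lambda>i. norm (u $ i)) UNIV * norm v"
    by (rule L2_set_left_distrib[symmetric]) simp
  finally show ?thesis by (simp only: norm_vec_def[of u])
qed

lemma continuous_on_tensor [continuous_intros]:
  "continuous_on S f \<Longrightarrow> continuous_on S g \<Longrightarrow> continuous_on S (\<lambda>x. f x \<otimes>\<^sub>v g x)"
  unfolding tensor_def by (intro continuous_intros continuous_on_vec_lambda continuous_on_component)

lemma pairing_pushforward:
  fixes f :: "'w::euclidean_space \<Rightarrow> 'b::{banach, second_countable_topology}"
  assumes "sets (\<nu> z) = sets borel" "F \<in> borel_measurable borel" "f \<in> borel_measurable borel"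
  shows "pairing (pushforward F \<nu>) f z = pairing \<nu> (\<lambda>v. f (F v)) z"
  unfolding pairing_def pushforward_def
  using assms by (intro integral_distr) (simp_all cong: measurable_cong_sets)

lemma borel_measurable_fst_borel: "(fst :: 'a::euclidean_space \<times> 'b::euclidean_space \<Rightarrow> 'a) \<in> borel_measurable borel"
  by (intro borel_measurable_continuous_onI continuous_intros)

lemma borel_measurable_powr_density:
  "(\<lambda>(\<rho>, u :: 'b::euclidean_space). a * \<rho> powr \<gamma>) \<in> borel_measurable (borel :: (real \<times> 'b) measure)"
  unfolding case_prod_unfold
  by (intro borel_measurable_times borel_measurable_const powr_real_measurable borel_measurable_fst_borel)

lemma borel_measurable_P_lift: "P_lift \<gamma> \<rho>bar \<epsilon> \<in> borel_measurable borel"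
proof -
  have "(\<lambda>v :: real \<times> (real^'d). (snd v, rescaled_pressure \<gamma> \<rho>bar \<epsilon> (fst v))) \<in> borel_measurable borel"
    unfolding rescaled_pressure_def
    by (intro borel_measurable_Pair borel_measurable_times borel_measurable_const borel_measurable_diff
        powr_real_measurable borel_measurable_fst_borel) (intro borel_measurable_continuous_onI continuous_intros)
  then show ?thesis by (simp add: P_lift_def case_prod_unfold)
qed

lemma borel_measurable_T_lift: "T_lift \<gamma> \<rho>bar \<epsilon> \<in> borel_measurable borel"
proof -
  have "(\<lambda>v :: real \<times> (real^'d). (fst v, snd v, rescaled_pressure \<gamma> \<rho>bar \<epsilon> (fst v))) \<in> borel_measurable borel"
    unfolding rescaled_pressure_def
    by (intro borel_measurable_Pair borel_measurable_times borel_measurable_const borel_measurable_diff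
        powr_real_measurable borel_measurable_fst_borel) (intro borel_measurable_continuous_onI continuous_intros)
  then show ?thesis by (simp add: T_lift_def case_prod_unfold)
qed

lemma integrable_bounded_AE:
  fixes f :: "'a \<Rightarrow> 'b::{banach, second_countable_topology}"
  assumes "finite_measure M" "f \<in> borel_measurable M" "AE x in M. norm (f x) \<le> b"
  shows "integrable M f"
  using assms by (intro finite_measure.integrable_const_bound)

lemma norm_integral_le_const:
  fixes f :: "'a \<Rightarrow> 'b::{banach, second_countable_topology}"
  assumes "finite_measure M" "f \<in> borel_measurable M" "AE x in M. norm (f x) \<le> b"
  shows "norm (LINT x|M. f x) \<le> b * measure M (space M)"
proof -
  interpret finite_measure M by fact
  have i: "integrable M f" by (rule integrable_bounded_AE[OF assms])
  have "norm (LINT x|M. f x) \<le> (LINT x|M. norm (f x))" by (rule integral_norm_bound)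
  also have "\<dots> \<le> (LINT x|M. b)" by (rule integral_mono_AE) (use i assms(3) in auto)
  finally show ?thesis by (simp add: mult.commute)
qed

text \<open>One solution at fixed \<epsilon>, with the support condition already expressed as bounds
  on the state. In the application C and B are common to all \<epsilon>, so each estimate below
  displays its dependence on \<epsilon>. The hypothesis \<open>small\<close> keeps the density
  comparable to \<rho>bar.\<close>

locale confined_solution =
  fixes T \<gamma> \<rho>bar \<epsilon> C B :: real
    and \<rho>0 :: "real^'d \<Rightarrow> real" and u0 :: "real^'d \<Rightarrow> real^'d"
    and \<nu> :: "real \<times> (real^'d) \<Rightarrow> (real \<times> (real^'d)) measure"
  assumes pos: "0 < T" "1 < \<gamma>" "0 < \<rho>bar" "0 < \<epsilon>" "0 \<le> C" "0 \<le> B"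
    and sol: "isentropic_mv_solution T \<gamma> \<epsilon> \<rho>0 u0 \<nu>"
    and small: "C * \<epsilon> \<le> \<rho>bar / 2"
    and confined: "AE z in space_time T. AE v in \<nu> z. \<bar>fst v - \<rho>bar\<bar> \<le> C * \<epsilon> \<and> norm (snd v) \<le> B
      \<and> \<bar>rescaled_pressure \<gamma> \<rho>bar \<epsilon> (fst v)\<bar> \<le> B"
begin

definition Q :: "(real \<times> (real^'d)) set" where
  "Q = {v. \<bar>fst v - \<rho>bar\<bar> \<le> C * \<epsilon> \<and> norm (snd v) \<le> B \<and> \<bar>rescaled_pressure \<gamma> \<rho>bar \<epsilon> (fst v)\<bar> \<le> B}"

abbreviation "\<sigma> \<equiv> pushforward (P_lift \<gamma> \<rho>bar \<epsilon>) \<nu>"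

lemma finite_M: "finite_measure (space_time T :: (real \<times> (real^'d)) measure)"
  by (rule finite_measure_space_time)

lemma Q_density: "(\<rho>, u) \<in> Q \<Longrightarrow> \<rho>bar / 2 \<le> \<rho> \<and> \<rho> \<le> 2 * \<rho>bar"
  using small pos by (auto simp: Q_def abs_le_iff)

lemma young: "young_measure (space_time T) ({0..} \<times> UNIV) \<nu>"
  using sol by (simp add: isentropic_mv_solution_def)

lemma kernel: "\<nu> \<in> space_time T \<rightarrow>\<^sub>M prob_algebra borel"
  by (rule young_measure_kernel[OF young])

lemma lift_kernel: "\<sigma> \<in> space_time T \<rightarrow>\<^sub>M prob_algebra borel"
  by (rule pushforward_kernel[OF kernel borel_measurable_P_lift])

lemma pairing_bound:
  fixes f :: "real \<times> (real^'d) \<Rightarrow> 'b::{banach, second_countable_topology}"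
  assumes "f \<in> borel_measurable borel" "\<forall>v\<in>Q. norm (f v) \<le> b"
  shows "AE z in space_time T. integrable (\<nu> z) f \<and> norm (pairing \<nu> f z) \<le> b"
  using confined AE_space
proof eventually_elim
  case (elim z)
  have "AE v in \<nu> z. norm (f v) \<le> b"
    using elim(1) by eventually_elim (use assms(2) in \<open>auto simp: Q_def\<close>)
  moreover have "f \<in> borel_measurable (\<nu> z)"
    using assms(1) by (simp add: measurable_cong_sets[OF kernelD(2)[OF kernel elim(2)] refl])
  ultimately show ?case
    using pairing_AE_bound[of \<nu> z f b] kernelD(1)[OF kernel elim(2)] by blast
qed

lemma pairing_diff_bound:
  fixes f g :: "real \<times> (real^'d) \<Rightarrow> 'b::{banach, second_countable_topology}"
  assumes f: "f \<in> borel_measurable borel" "\<forall>v\<in>Q. norm (f v) \<le> b"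
    and g: "g \<in> borel_measurable borel" "\<forall>v\<in>Q. norm (g v) \<le> b'"
    and d: "\<forall>v\<in>Q. norm (f v - g v) \<le> e"
  shows "AE z in space_time T. norm (pairing \<nu> f z - pairing \<nu> g z) \<le> e"
  using pairing_bound[OF f] pairing_bound[OF g] pairing_bound[OF borel_measurable_diff[OF f(1) g(1)] d]
  by eventually_elim (simp add: pairing_def)

lemma integrable_pairing_inner:
  fixes f :: "real \<times> (real^'d) \<Rightarrow> 'b::euclidean_space"
  assumes f: "f \<in> borel_measurable borel" "\<forall>v\<in>Q. norm (f v) \<le> b"
    and h: "h \<in> borel_measurable (space_time T)" "\<forall>z\<in>space (space_time T). norm (h z) \<le> H"
  shows "(\<lambda>z. h z \<bullet> pairing \<nu> f z) \<in> borel_measurable (space_time T)"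
    "AE z in space_time T. \<bar>h z \<bullet> pairing \<nu> f z\<bar> \<le> H * b"
    "integrable (space_time T) (\<lambda>z. h z \<bullet> pairing \<nu> f z)"
proof -
  show m: "(\<lambda>z. h z \<bullet> pairing \<nu> f z) \<in> borel_measurable (space_time T)"
    by (rule borel_measurable_inner[OF h(1) borel_measurable_pairing[OF kernel f(1)]])
  show b: "AE z in space_time T. \<bar>h z \<bullet> pairing \<nu> f z\<bar> \<le> H * b"
    using pairing_bound[OF f] AE_space
  proof eventually_elim
    case (elim z)
    have "\<bar>h z \<bullet> pairing \<nu> f z\<bar> \<le> norm (h z) * norm (pairing \<nu> f z)" by (rule Cauchy_Schwarz_ineq2)
    also have "\<dots> \<le> H * b"
      using elim(1) bspec[OF h(2) elim(2)] by (intro mult_mono) (auto intro: order_trans[OF norm_ge_zero])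
    finally show ?case .
  qed
  show "integrable (space_time T) (\<lambda>z. h z \<bullet> pairing \<nu> f z)"
    by (rule integrable_bounded_AE[OF finite_M m, of "H * b"]) (use b in simp)
qed

lemma borel_density: "(\<lambda>(\<rho>, u). \<rho>) \<in> borel_measurable (borel :: (real \<times> (real^'d)) measure)"
  by (auto simp: case_prod_unfold intro!: borel_measurable_continuous_onI continuous_intros)

lemma borel_momentum: "(\<lambda>(\<rho>, u). \<rho> *\<^sub>R u) \<in> borel_measurable (borel :: (real \<times> (real^'d)) measure)"
  by (auto simp: case_prod_unfold intro!: borel_measurable_continuous_onI continuous_intros)

lemma borel_flux: "(\<lambda>(\<rho>, u). \<rho> *\<^sub>R (u \<otimes>\<^sub>v u)) \<in> borel_measurable (borel :: (real \<times> (real^'d)) measure)"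
  by (auto simp: case_prod_unfold intro!: borel_measurable_continuous_onI continuous_intros)

lemma bound_density: "\<forall>v\<in>Q. norm ((\<lambda>(\<rho>, u). \<rho>) v) \<le> 2 * \<rho>bar"
  using Q_density pos by fastforce

lemma bound_momentum: "\<forall>v\<in>Q. norm ((\<lambda>(\<rho>, u). \<rho> *\<^sub>R u) v) \<le> 2 * \<rho>bar * B"
proof
  fix v assume v: "v \<in> Q"
  have "\<bar>fst v\<bar> * norm (snd v) \<le> 2 * \<rho>bar * B"
    using v Q_density[of "fst v" "snd v"] pos by (intro mult_mono) (auto simp: Q_def)
  then show "norm ((\<lambda>(\<rho>, u). \<rho> *\<^sub>R u) v) \<le> 2 * \<rho>bar * B" by (simp add: case_prod_unfold)
qed

lemma bound_flux: "\<forall>v\<in>Q. norm ((\<lambda>(\<rho>, u). \<rho> *\<^sub>R (u \<otimes>\<^sub>v u)) v) \<le> 2 * \<rho>bar * (B * B)"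
proof
  fix v assume v: "v \<in> Q"
  have "\<bar>fst v\<bar> * (norm (snd v) * norm (snd v)) \<le> 2 * \<rho>bar * (B * B)"
    using v Q_density[of "fst v" "snd v"] pos by (intro mult_mono) (auto simp: Q_def)
  then show "norm ((\<lambda>(\<rho>, u). \<rho> *\<^sub>R (u \<otimes>\<^sub>v u)) v) \<le> 2 * \<rho>bar * (B * B)"
    by (simp add: case_prod_unfold norm_tensor)
qed

text \<open>Isolates the only part that blows up as \<epsilon> -> 0: a constant, which is multiplied
  by a divergence and so integrates to zero.\<close>

lemma pressure_split: "1 / \<epsilon> * \<rho> powr \<gamma> = \<rho>bar * rescaled_pressure \<gamma> \<rho>bar \<epsilon> \<rho> + \<rho>bar powr \<gamma> / \<epsilon>"
  using pos by (simp add: rescaled_pressure_def field_simps)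

lemma bound_pressure: "\<forall>v\<in>Q. norm ((\<lambda>(\<rho>, u). 1 / \<epsilon> * \<rho> powr \<gamma>) v) \<le> \<rho>bar * B + \<rho>bar powr \<gamma> / \<epsilon>"
proof
  fix v assume v: "v \<in> Q"
  obtain \<rho> u where [simp]: "v = (\<rho>, u)" by (cases v)
  have "\<bar>\<rho>bar * rescaled_pressure \<gamma> \<rho>bar \<epsilon> \<rho>\<bar> \<le> \<rho>bar * B"
    using v pos by (auto simp: Q_def abs_mult)
  then have "\<bar>\<rho>bar * rescaled_pressure \<gamma> \<rho>bar \<epsilon> \<rho> + \<rho>bar powr \<gamma> / \<epsilon>\<bar> \<le> \<rho>bar * B + \<rho>bar powr \<gamma> / \<epsilon>"
    using pos by (intro order_trans[OF abs_triangle_ineq add_mono]) auto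
  then show "norm ((\<lambda>(\<rho>, u). 1 / \<epsilon> * \<rho> powr \<gamma>) v) \<le> \<rho>bar * B + \<rho>bar powr \<gamma> / \<epsilon>"
    by (simp only: \<open>v = (\<rho>, u)\<close> prod.case pressure_split real_norm_def)
qed

abbreviation "mean_density \<equiv> pairing \<nu> (\<lambda>(\<rho>, u). \<rho>)"
abbreviation "mean_momentum \<equiv> pairing \<nu> (\<lambda>(\<rho>, u). \<rho> *\<^sub>R u)"
abbreviation "mean_flux \<equiv> pairing \<nu> (\<lambda>(\<rho>, u). \<rho> *\<^sub>R (u \<otimes>\<^sub>v u))"
abbreviation "mean_pressure \<equiv> pairing \<nu> (\<lambda>(\<rho>, u). 1 / \<epsilon> * \<rho> powr \<gamma>)"

lemma mean_density_close: "AE z in space_time T. \<bar>mean_density z - \<rho>bar\<bar> \<le> C * \<epsilon>"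
proof -
  have "AE z in space_time T. norm (mean_density z - pairing \<nu> (\<lambda>_. \<rho>bar) z) \<le> C * \<epsilon>"
    by (rule pairing_diff_bound[OF borel_density bound_density, of _ "\<bar>\<rho>bar\<bar>"]) (auto simp: Q_def)
  then show ?thesis
    using AE_space
  proof eventually_elim
    case (elim z)
    interpret prob_space "\<nu> z" by (rule kernelD(1)[OF kernel elim(2)])
    show ?case using elim(1) prob_space by (simp add: pairing_def)
  qed
qed

lemma snd_measurable:
  fixes g :: "real^'d \<Rightarrow> 'b::euclidean_space"
  assumes "continuous_on UNIV g"
  shows "(\<lambda>z. g (snd z)) \<in> borel_measurable (space_time T)"
  by (intro borel_measurable_lebesgue_onI borel_measurable_continuous_onI
      continuous_on_compose2[OF assms] continuous_intros) auto

lemma snd_bounded: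
  fixes g :: "real^'d \<Rightarrow> 'b::euclidean_space"
  assumes "continuous_on UNIV g"
  obtains H where "0 \<le> H" "\<forall>z\<in>space (space_time T). norm (g (snd z)) \<le> H"
    "\<forall>x\<in>unit_cell. norm (g x) \<le> H"
proof -
  obtain H where "0 \<le> H" "\<And>x. x \<in> unit_cell \<Longrightarrow> norm (g x) \<le> H"
    using continuous_on_bounded_set[OF assms bounded_unit_cell] by blast
  then show ?thesis by (intro that[of H]) auto
qed

section \<open>Initial data controlled by the balance laws\<close>

lemma mass_identity:
  assumes g: "g \<in> torus_smooth" and s: "0 < s" "s < T"
  shows "(LINT z|space_time T. (mean_density z * g (snd z)) * indicator {..<s} (fst z))
    - (LINT z|space_time T. (grad g (snd z) \<bullet> mean_momentum z) * ((s - fst z) * indicator {..<s} (fst z)))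
    = s * (LINT x|torus. \<rho>0 x * g x)"
proof -
  have gs: "C_infinity g" "periodic g" using g by (auto simp: torus_smooth_def)
  have gc: "continuous_on UNIV g" by (rule C_infinity_continuous_on[OF gs(1)])
  obtain G where G: "\<forall>z\<in>space (space_time T). norm (g (snd z)) \<le> G"
    by (rule snd_bounded[OF gc]) blast
  obtain H where H: "\<forall>z\<in>space (space_time T). norm (grad g (snd z)) \<le> H"
    by (rule snd_bounded[OF continuous_on_grad[OF gs(1)]]) blast
  have im: "integrable (space_time T) (\<lambda>z. mean_density z * g (snd z))"
    using integrable_pairing_inner(3)[OF borel_density bound_density snd_measurable[OF gc] G] by (simp add: mult.commute)
  have ip: "integrable (space_time T) (\<lambda>z. grad g (snd z) \<bullet> mean_momentum z)"
    by (rule integrable_pairing_inner(3)[OF borel_momentum bound_momentum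
          snd_measurable[OF continuous_on_grad[OF gs(1)]] H])
  show ?thesis
  proof (rule ramp_identity[OF im ip s])
    fix k
    have "(\<lambda>(t, x). ramp k s t *\<^sub>R g x) \<in> test_functions T"
      by (rule separated_test_function[OF C_infinity_ramp ramp_eq_0 s(2) gs])
    then have "(LINT z|space_time T. isentropic_mass_integrand \<nu> (\<lambda>(t, x). ramp k s t *\<^sub>R g x) z)
        = - (LINT x|torus. \<rho>0 x * (\<lambda>(t, x). ramp k s t *\<^sub>R g x) (0, x))"
      using sol unfolding isentropic_mv_solution_def by blast
    moreover have "isentropic_mass_integrand \<nu> (\<lambda>(t, x). ramp k s t *\<^sub>R g x) z
        = (mean_density z * g (snd z)) * ramp_deriv k s (fst z) + (grad g (snd z) \<bullet> mean_momentum z) * ramp k s (fst z)" for z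
      unfolding isentropic_mass_integrand_def
        time_deriv_separated[OF ramp_has_real_derivative] space_grad_separated[OF gs(1)]
      by (simp add: mult_ac)
    moreover have "(LINT x|torus. \<rho>0 x * (\<lambda>(t, x). ramp k s t *\<^sub>R g x) (0, x)) = ramp k s 0 * (LINT x|torus. \<rho>0 x * g x)"
      by (simp add: mult.left_commute[of "\<rho>0 _"])
    ultimately show "(LINT z|space_time T. (mean_density z * g (snd z)) * ramp_deriv k s (fst z)
        + (grad g (snd z) \<bullet> mean_momentum z) * ramp k s (fst z)) = - (ramp k s 0 * (LINT x|torus. \<rho>0 x * g x))"
      by simp
  qed
qed

lemma integral_initial_slab:
  fixes g :: "real^'d \<Rightarrow> real"
  assumes g: "continuous_on UNIV g" and s: "0 < s" "s < T"
  shows "integrable (space_time T) (\<lambda>z. indicator {..<s} (fst z) * g (snd z))"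
    "(LINT z|space_time T. indicator {..<s} (fst z) * g (snd z)) = s * (LINT x|torus. g x)"
proof -
  have ii: "(\<lambda>t. indicator {..<s} t :: real) \<in> borel_measurable borel" "\<And>t. \<bar>indicator {..<s} t :: real\<bar> \<le> 1"
    by (auto simp: indicator_def)
  show "integrable (space_time T) (\<lambda>z. indicator {..<s} (fst z) * g (snd z))"
    "(LINT z|space_time T. indicator {..<s} (fst z) * g (snd z)) = s * (LINT x|torus. g x)"
    using integral_space_time_slice[OF g ii] integral_initial_interval[of s T] s by simp_all
qed

lemma integrable_data_mult:
  fixes f g :: "real^'d \<Rightarrow> real"
  assumes "integrable torus f" "continuous_on UNIV g"
  shows "integrable torus (\<lambda>x. f x * g x)"
proof -
  obtain H where "\<And>x. x \<in> unit_cell \<Longrightarrow> norm (g x) \<le> H"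
    using continuous_on_bounded_set[OF assms(2) bounded_unit_cell] by blast
  then show ?thesis
    by (intro integrable_mult_bounded[OF assms(1), where C = H] borel_measurable_lebesgue_onI
        borel_measurable_continuous_onI assms(2)) auto
qed

lemma data_integrable: "integrable torus \<rho>0" "integrable torus u0" "integrable torus (\<lambda>x. \<rho>0 x *\<^sub>R u0 x)"
  using sol by (auto simp: isentropic_mv_solution_def)

lemma fst_measurable:
  "a \<in> borel_measurable borel \<Longrightarrow> (\<lambda>z. a (fst z) :: real) \<in> borel_measurable (space_time T :: (real \<times> (real^'d)) measure)"
  by (intro borel_measurable_lebesgue_onI measurable_compose[OF borel_measurable_fst_borel])

lemma indicator_mult_integrable:
  assumes "integrable (space_time T) (f :: real \<times> (real^'d) \<Rightarrow> real)"
  shows "integrable (space_time T) (\<lambda>z. f z * indicator {..<s} (fst z))"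
  by (rule integrable_mult_bounded[OF assms fst_measurable, of "indicator {..<s}" 1]) auto

text \<open>The constant density \<rho>bar contributes s \<rho>bar times the integral of g on both
  sides. Subtracting it leaves quantities that are small with \<epsilon>.\<close>

lemma mass_identity_perturbation:
  assumes g: "g \<in> torus_smooth" and s: "0 < s" "s < T"
  shows "(LINT z|space_time T. ((mean_density z - \<rho>bar) * g (snd z)) * indicator {..<s} (fst z))
    - (LINT z|space_time T. (grad g (snd z) \<bullet> mean_momentum z) * ((s - fst z) * indicator {..<s} (fst z)))
    = s * (LINT x|torus. (\<rho>0 x - \<rho>bar) * g x)"
proof -
  have gc: "continuous_on UNIV g" using g by (auto simp: torus_smooth_def intro: C_infinity_continuous_on)
  obtain G where G: "\<forall>z\<in>space (space_time T). norm (g (snd z)) \<le> G"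
    by (rule snd_bounded[OF gc]) blast
  have im: "integrable (space_time T) (\<lambda>z. (mean_density z * g (snd z)) * indicator {..<s} (fst z))"
    using integrable_pairing_inner(3)[OF borel_density bound_density snd_measurable[OF gc] G]
    by (intro indicator_mult_integrable) (simp add: mult.commute)
  note sl = integral_initial_slab[OF gc s]
  have "(LINT z|space_time T. ((mean_density z - \<rho>bar) * g (snd z)) * indicator {..<s} (fst z))
      = (LINT z|space_time T. (mean_density z * g (snd z)) * indicator {..<s} (fst z)
          - \<rho>bar * (indicator {..<s} (fst z) * g (snd z)))"
    by (simp add: algebra_simps)
  also have "\<dots> = (LINT z|space_time T. (mean_density z * g (snd z)) * indicator {..<s} (fst z)) - \<rho>bar * (s * (LINT x|torus. g x))"
    using im sl by simp
  finally have 1: "(LINT z|space_time T. ((mean_density z - \<rho>bar) * g (snd z)) * indicator {..<s} (fst z))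
    = (LINT z|space_time T. (mean_density z * g (snd z)) * indicator {..<s} (fst z)) - \<rho>bar * (s * (LINT x|torus. g x))" .
  have "(LINT x|torus. (\<rho>0 x - \<rho>bar) * g x) = (LINT x|torus. \<rho>0 x * g x - \<rho>bar * g x)"
    by (simp add: algebra_simps)
  also have "\<dots> = (LINT x|torus. \<rho>0 x * g x) - \<rho>bar * (LINT x|torus. g x)"
    using integrable_data_mult[OF data_integrable(1) gc]
      integrable_continuous_bounded_set[OF gc borel_unit_cell bounded_unit_cell] by simp
  finally have 2: "(LINT x|torus. (\<rho>0 x - \<rho>bar) * g x) = (LINT x|torus. \<rho>0 x * g x) - \<rho>bar * (LINT x|torus. g x)" .
  have "X - r * (s * I) - Y = s * (J - r * I)" if "X - Y = s * J" for X Y r I J :: real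
    using that by (simp add: algebra_simps)
  from this[OF mass_identity[OF g s]] show ?thesis unfolding 1 2 .
qed

text \<open>\<open>trace_bound\<close> with m = (mean density - \<rho>bar) g: the trace inherits the
  pointwise constant C \<epsilon> without loss, and the momentum flux is merely bounded.\<close>

lemma density_data_close: "AE x in torus. \<bar>\<rho>0 x - \<rho>bar\<bar> \<le> C * \<epsilon>"
proof (rule AE_torus_bound)
  interpret finite_measure "torus :: (real^'d) measure" by (rule finite_measure_torus)
  show "integrable torus (\<lambda>x. \<rho>0 x - \<rho>bar)" using data_integrable by simp
  fix g :: "real^'d \<Rightarrow> real" assume g: "g \<in> torus_smooth" "\<And>x. 0 \<le> g x"
  have gs: "C_infinity g" using g by (simp add: torus_smooth_def)
  have gc: "continuous_on UNIV g" by (rule C_infinity_continuous_on[OF gs])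
  obtain H where H: "\<forall>z\<in>space (space_time T). norm (grad g (snd z)) \<le> H"
    by (rule snd_bounded[OF continuous_on_grad[OF gs]]) blast
  note p = integrable_pairing_inner[OF borel_momentum bound_momentum
          snd_measurable[OF continuous_on_grad[OF gs]] H]
  show "\<bar>LINT x|torus. (\<rho>0 x - \<rho>bar) * g x\<bar> \<le> C * \<epsilon> * (LINT x|torus. g x)"
  proof (rule trace_bound[OF pos(1) _ p(1) gc _ p(2) mass_identity_perturbation[OF g(1)]])
    show "(\<lambda>z. (mean_density z - \<rho>bar) * g (snd z)) \<in> borel_measurable (space_time T)"
      by (intro borel_measurable_times borel_measurable_diff borel_measurable_const
          borel_measurable_pairing[OF kernel borel_density] snd_measurable[OF gc])
    show "AE z in space_time T. \<bar>(mean_density z - \<rho>bar) * g (snd z)\<bar> \<le> C * \<epsilon> * g (snd z)"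
      using mean_density_close by eventually_elim (use g(2) in \<open>auto simp: abs_mult intro: mult_right_mono\<close>)
  qed
qed

text \<open>The flux p includes the pressure, so its bound is of size 1/\<epsilon>. Only the
  existence of a bound is recorded, as the conclusion of \<open>trace_bound\<close> is independent
  of its value.\<close>

lemma momentum_identity:
  fixes G :: "real^'d \<Rightarrow> real^'d"
  assumes G: "C_infinity G" "periodic G" and s: "0 < s" "s < T"
  defines "p \<equiv> \<lambda>z. jacobian G (at (snd z)) \<bullet> mean_flux z + trace (jacobian G (at (snd z))) \<bullet> mean_pressure z"
  shows "(LINT z|space_time T. (G (snd z) \<bullet> mean_momentum z) * indicator {..<s} (fst z))
    - (LINT z|space_time T. p z * ((s - fst z) * indicator {..<s} (fst z)))
    = s * (LINT x|torus. G x \<bullet> (\<rho>0 x *\<^sub>R u0 x))" (is ?identity)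
    and "p \<in> borel_measurable (space_time T)" "\<exists>P. AE z in space_time T. \<bar>p z\<bar> \<le> P"
proof -
  have Gc: "continuous_on UNIV G" by (rule C_infinity_continuous_on[OF G(1)])
  have Jc: "continuous_on UNIV (\<lambda>x. jacobian G (at x))" by (rule continuous_on_jacobian[OF G(1)])
  have trc: "continuous_on UNIV (\<lambda>x. trace (jacobian G (at x)))"
    unfolding trace_def by (intro continuous_intros continuous_on_component Jc)
  obtain g where g: "\<forall>z\<in>space (space_time T). norm (G (snd z)) \<le> g"
    by (rule snd_bounded[OF Gc]) blast
  obtain j where j: "\<forall>z\<in>space (space_time T). norm (jacobian G (at (snd z))) \<le> j"
    by (rule snd_bounded[OF Jc]) blast
  obtain t where t: "\<forall>z\<in>space (space_time T). norm (trace (jacobian G (at (snd z)))) \<le> t"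
    by (rule snd_bounded[OF trc]) blast
  note 1 = integrable_pairing_inner[OF borel_flux bound_flux snd_measurable[OF Jc] j]
  note 2 = integrable_pairing_inner[OF borel_measurable_powr_density bound_pressure snd_measurable[OF trc] t]
  have im: "integrable (space_time T) (\<lambda>z. G (snd z) \<bullet> mean_momentum z)"
    by (rule integrable_pairing_inner(3)[OF borel_momentum bound_momentum snd_measurable[OF Gc] g])
  have ip: "integrable (space_time T) p"
    unfolding p_def by (rule Bochner_Integration.integrable_add[OF 1(3) 2(3)])
  show "p \<in> borel_measurable (space_time T)"
    using ip by (rule borel_measurable_integrable)
  have "AE z in space_time T. \<bar>p z\<bar> \<le> j * (2 * \<rho>bar * (B * B)) + t * (\<rho>bar * B + \<rho>bar powr \<gamma> / \<epsilon>)"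
    using 1(2) 2(2) by eventually_elim (auto simp: p_def intro: order_trans[OF abs_triangle_ineq add_mono])
  then show "\<exists>P. AE z in space_time T. \<bar>p z\<bar> \<le> P" by blast
  show ?identity
  proof (rule ramp_identity[OF im ip s])
    fix k
    have "(\<lambda>(t, x). ramp k s t *\<^sub>R G x) \<in> test_functions T"
      by (rule separated_test_function[OF C_infinity_ramp ramp_eq_0 s(2) G])
    then have "(LINT z|space_time T. isentropic_momentum_integrand \<gamma> \<epsilon> \<nu> (\<lambda>(t, x). ramp k s t *\<^sub>R G x) z)
        = - (LINT x|torus. (\<lambda>(t, x). ramp k s t *\<^sub>R G x) (0, x) \<bullet> (\<rho>0 x *\<^sub>R u0 x))"
      using sol unfolding isentropic_mv_solution_def by blast
    moreover have "isentropic_momentum_integrand \<gamma> \<epsilon> \<nu> (\<lambda>(t, x). ramp k s t *\<^sub>R G x) z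
        = (G (snd z) \<bullet> mean_momentum z) * ramp_deriv k s (fst z) + p z * ramp k s (fst z)" for z
      unfolding isentropic_momentum_integrand_def p_def
        time_deriv_separated[OF ramp_has_real_derivative] space_jacobian_separated[OF G(1)]
        space_div_separated[OF G(1)]
      by (simp add: algebra_simps)
    moreover have "(LINT x|torus. (\<lambda>(t, x). ramp k s t *\<^sub>R G x) (0, x) \<bullet> (\<rho>0 x *\<^sub>R u0 x))
        = ramp k s 0 * (LINT x|torus. G x \<bullet> (\<rho>0 x *\<^sub>R u0 x))"
      by (simp add: mult.left_commute[of "\<rho>0 _"])
    ultimately show "(LINT z|space_time T. (G (snd z) \<bullet> mean_momentum z) * ramp_deriv k s (fst z) + p z * ramp k s (fst z))
        = - (ramp k s 0 * (LINT x|torus. G x \<bullet> (\<rho>0 x *\<^sub>R u0 x)))"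
      by simp
  qed
qed

text \<open>\<open>AE_torus_bound\<close> is scalar, so the momentum is tested one component at a
  time, with g times a coordinate vector.\<close>

lemma momentum_data_bound: "AE x in torus. \<bar>(\<rho>0 x *\<^sub>R u0 x) $ i\<bar> \<le> 2 * \<rho>bar * B"
proof (rule AE_torus_bound)
  show "integrable torus (\<lambda>x. (\<rho>0 x *\<^sub>R u0 x) $ i)"
    using integrable_inner_left[OF data_integrable(3), of "axis i 1"]
    by (simp add: cart_eq_inner_axis)
  fix g :: "real^'d \<Rightarrow> real" assume g: "g \<in> torus_smooth" "\<And>x. 0 \<le> g x"
  have gs: "C_infinity g" "periodic g" using g by (auto simp: torus_smooth_def)
  have gc: "continuous_on UNIV g" by (rule C_infinity_continuous_on[OF gs(1)])
  define G where "G x = g x *\<^sub>R (axis i 1 :: real^'d)" for x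
  have G: "C_infinity G" "periodic G"
    unfolding G_def[abs_def] using gs by (auto intro!: C_infinity_scaleR simp: periodic_def)
  \<comment> \<open>The bound on the flux does not involve s; T / 2 is just an admissible
    instance.\<close>
  obtain P where P: "AE z in space_time T. \<bar>jacobian G (at (snd z)) \<bullet> mean_flux z + trace (jacobian G (at (snd z))) \<bullet> mean_pressure z\<bar> \<le> P"
    using momentum_identity(3)[OF G, of "T / 2"] pos(1) by auto
  have "\<bar>LINT x|torus. G x \<bullet> (\<rho>0 x *\<^sub>R u0 x)\<bar> \<le> 2 * \<rho>bar * B * (LINT x|torus. g x)"
  proof (rule trace_bound[OF pos(1) _ _ gc _ P momentum_identity(1)[OF G]])
    show "(\<lambda>z. G (snd z) \<bullet> mean_momentum z) \<in> borel_measurable (space_time T)"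
      by (intro borel_measurable_inner snd_measurable[OF C_infinity_continuous_on[OF G(1)]]
          borel_measurable_pairing[OF kernel borel_momentum])
    show "(\<lambda>z. jacobian G (at (snd z)) \<bullet> mean_flux z + trace (jacobian G (at (snd z))) \<bullet> mean_pressure z)
        \<in> borel_measurable (space_time T)"
      using momentum_identity(2)[OF G, of "T / 2"] pos(1) by auto
    show "AE z in space_time T. \<bar>G (snd z) \<bullet> mean_momentum z\<bar> \<le> 2 * \<rho>bar * B * g (snd z)"
      using pairing_bound[OF borel_momentum bound_momentum]
    proof eventually_elim
      case (elim z)
      have "\<bar>G (snd z) \<bullet> mean_momentum z\<bar> \<le> norm (G (snd z)) * norm (mean_momentum z)"
        by (rule Cauchy_Schwarz_ineq2)
      also have "\<dots> \<le> g (snd z) * (2 * \<rho>bar * B)"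
        using elim g(2) by (intro mult_mono) (auto simp: G_def)
      finally show ?case by (simp add: mult_ac)
    qed
  qed
  then show "\<bar>LINT x|torus. (\<rho>0 x *\<^sub>R u0 x) $ i * g x\<bar> \<le> 2 * \<rho>bar * B * (LINT x|torus. g x)"
    by (simp add: G_def inner_axis' mult_ac)
qed

text \<open>One factor 2 is that of the momentum bound, the other comes from dividing by a density
  of at least \<rho>bar / 2, and the dimension from estimating the norm by the sum of the
  components.\<close>

lemma velocity_data_bound: "AE x in torus. norm (u0 x) \<le> 4 * real CARD('d) * B"
proof -
  have "AE x in torus. \<forall>i. \<bar>(\<rho>0 x *\<^sub>R u0 x) $ i\<bar> \<le> 2 * \<rho>bar * B"
    using momentum_data_bound by (simp add: AE_all_countable)
  then show ?thesis
    using density_data_close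
  proof eventually_elim
    case (elim x)
    have \<rho>: "\<rho>bar / 2 \<le> \<rho>0 x" using elim(2) small by linarith
    have "norm (\<rho>0 x *\<^sub>R u0 x) \<le> (\<Sum>i\<in>UNIV. \<bar>(\<rho>0 x *\<^sub>R u0 x) $ i\<bar>)" by (rule norm_le_l1_cart)
    also have "\<dots> \<le> (\<Sum>i\<in>(UNIV :: 'd set). 2 * \<rho>bar * B)" using elim(1) by (intro sum_mono) auto
    finally have 1: "norm (\<rho>0 x *\<^sub>R u0 x) \<le> real CARD('d) * (2 * \<rho>bar * B)" by simp
    have "\<rho>bar / 2 * norm (u0 x) \<le> \<bar>\<rho>0 x\<bar> * norm (u0 x)" using \<rho> by (intro mult_right_mono) auto
    also have "\<dots> \<le> real CARD('d) * (2 * \<rho>bar * B)" using 1 by simp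
    also have "\<dots> = \<rho>bar / 2 * (4 * real CARD('d) * B)" by simp
    finally show ?case using pos(3) by (simp add: mult_le_cancel_left_pos mult_ac)
  qed
qed

end

section \<open>Comparison of the isentropic and incompressible balances\<close>

context confined_solution begin

lemma space_time_sets: "z \<in> space (space_time T) \<Longrightarrow> sets (\<nu> z) = sets borel"
  by (rule kernelD(2)[OF kernel])

lemma borel_lift:
  "(\<lambda>(u, P :: real). u) \<in> borel_measurable (borel :: ((real^'d) \<times> real) measure)"
  "(\<lambda>(u, P :: real). u \<otimes>\<^sub>v u) \<in> borel_measurable (borel :: ((real^'d) \<times> real) measure)"
  "(\<lambda>(u, P). P) \<in> borel_measurable (borel :: ((real^'d) \<times> real) measure)"
  "(\<lambda>(u, P :: real). (norm u)\<^sup>2) \<in> borel_measurable (borel :: ((real^'d) \<times> real) measure)"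
  by (auto simp: case_prod_unfold intro!: borel_measurable_continuous_onI continuous_intros)

lemma borel_solution:
  "snd \<in> borel_measurable (borel :: (real \<times> (real^'d)) measure)"
  "(\<lambda>v. snd v \<otimes>\<^sub>v snd v) \<in> borel_measurable (borel :: (real \<times> (real^'d)) measure)"
  "(\<lambda>v. rescaled_pressure \<gamma> \<rho>bar \<epsilon> (fst v)) \<in> borel_measurable (borel :: (real \<times> (real^'d)) measure)"
  "(\<lambda>v. (norm (snd v))\<^sup>2) \<in> borel_measurable (borel :: (real \<times> (real^'d)) measure)"
proof -
  show "(\<lambda>v :: real \<times> (real^'d). rescaled_pressure \<gamma> \<rho>bar \<epsilon> (fst v)) \<in> borel_measurable borel"
    unfolding rescaled_pressure_def
    by (intro borel_measurable_times borel_measurable_const borel_measurable_diff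
        powr_real_measurable borel_measurable_fst_borel)
qed (auto intro!: borel_measurable_continuous_onI continuous_intros)

lemma bound_solution:
  "\<forall>v\<in>Q. norm (snd v) \<le> B" "\<forall>v\<in>Q. norm (snd v \<otimes>\<^sub>v snd v) \<le> B * B"
  "\<forall>v\<in>Q. norm (rescaled_pressure \<gamma> \<rho>bar \<epsilon> (fst v)) \<le> B" "\<forall>v\<in>Q. norm ((norm (snd v))\<^sup>2) \<le> B * B"
  using pos by (auto simp: Q_def norm_tensor power2_eq_square intro!: mult_mono)

lemma pairing_lift:
  assumes "z \<in> space (space_time T)"
  shows "pairing \<sigma> (\<lambda>(u, P). u) z = pairing \<nu> snd z"
    "pairing \<sigma> (\<lambda>(u, P). u \<otimes>\<^sub>v u) z = pairing \<nu> (\<lambda>v. snd v \<otimes>\<^sub>v snd v) z"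
    "pairing \<sigma> (\<lambda>(u, P). P) z = pairing \<nu> (\<lambda>v. rescaled_pressure \<gamma> \<rho>bar \<epsilon> (fst v)) z"
    "pairing \<sigma> (\<lambda>(u, P). (norm u)\<^sup>2) z = pairing \<nu> (\<lambda>v. (norm (snd v))\<^sup>2) z"
proof -
  note lift = pairing_pushforward[where \<nu> = \<nu> and z = z, OF space_time_sets[OF assms] borel_measurable_P_lift]
  show "pairing \<sigma> (\<lambda>(u, P). u) z = pairing \<nu> snd z"
    by (subst lift[OF borel_lift(1)]) (simp add: P_lift_def case_prod_unfold)
  show "pairing \<sigma> (\<lambda>(u, P). u \<otimes>\<^sub>v u) z = pairing \<nu> (\<lambda>v. snd v \<otimes>\<^sub>v snd v) z"
    by (subst lift[OF borel_lift(2)]) (simp add: P_lift_def case_prod_unfold)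
  show "pairing \<sigma> (\<lambda>(u, P). P) z = pairing \<nu> (\<lambda>v. rescaled_pressure \<gamma> \<rho>bar \<epsilon> (fst v)) z"
    by (subst lift[OF borel_lift(3)]) (simp add: P_lift_def case_prod_unfold)
  show "pairing \<sigma> (\<lambda>(u, P). (norm u)\<^sup>2) z = pairing \<nu> (\<lambda>v. (norm (snd v))\<^sup>2) z"
    by (subst lift[OF borel_lift(4)]) (simp add: P_lift_def case_prod_unfold)
qed

lemma momentum_close:
  "AE z in space_time T. norm (mean_momentum z - \<rho>bar *\<^sub>R pairing \<nu> snd z) \<le> C * \<epsilon> * B"
proof -
  have b: "(\<lambda>v :: real \<times> (real^'d). \<rho>bar *\<^sub>R snd v) \<in> borel_measurable borel"
    by (intro borel_measurable_continuous_onI continuous_intros)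
  have "AE z in space_time T. norm (mean_momentum z - pairing \<nu> (\<lambda>v. \<rho>bar *\<^sub>R snd v) z) \<le> C * \<epsilon> * B"
  proof (rule pairing_diff_bound[OF borel_momentum bound_momentum b])
    show "\<forall>v\<in>Q. norm (\<rho>bar *\<^sub>R snd v) \<le> \<rho>bar * B" using bound_solution(1) pos by auto
    show "\<forall>v\<in>Q. norm ((\<lambda>(\<rho>, u). \<rho> *\<^sub>R u) v - \<rho>bar *\<^sub>R snd v) \<le> C * \<epsilon> * B"
    proof
      fix v assume v: "v \<in> Q"
      have "norm ((fst v - \<rho>bar) *\<^sub>R snd v) \<le> C * \<epsilon> * B"
        using v pos unfolding norm_scaleR by (intro mult_mono) (auto simp: Q_def)
      then show "norm ((\<lambda>(\<rho>, u). \<rho> *\<^sub>R u) v - \<rho>bar *\<^sub>R snd v) \<le> C * \<epsilon> * B"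
        by (simp add: case_prod_unfold scaleR_diff_left)
    qed
  qed
  then show ?thesis
    using pairing_bound[OF borel_solution(1) bound_solution(1)]
    by eventually_elim (simp add: pairing_def)
qed

lemma flux_close:
  "AE z in space_time T. norm (mean_flux z - \<rho>bar *\<^sub>R pairing \<nu> (\<lambda>v. snd v \<otimes>\<^sub>v snd v) z) \<le> C * \<epsilon> * (B * B)"
proof -
  have b: "(\<lambda>v :: real \<times> (real^'d). \<rho>bar *\<^sub>R (snd v \<otimes>\<^sub>v snd v)) \<in> borel_measurable borel"
    by (intro borel_measurable_continuous_onI continuous_intros)
  have "AE z in space_time T. norm (mean_flux z - pairing \<nu> (\<lambda>v. \<rho>bar *\<^sub>R (snd v \<otimes>\<^sub>v snd v)) z) \<le> C * \<epsilon> * (B * B)"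
  proof (rule pairing_diff_bound[OF borel_flux bound_flux b])
    show "\<forall>v\<in>Q. norm (\<rho>bar *\<^sub>R (snd v \<otimes>\<^sub>v snd v)) \<le> \<rho>bar * (B * B)" using bound_solution(2) pos by auto
    show "\<forall>v\<in>Q. norm ((\<lambda>(\<rho>, u). \<rho> *\<^sub>R (u \<otimes>\<^sub>v u)) v - \<rho>bar *\<^sub>R (snd v \<otimes>\<^sub>v snd v)) \<le> C * \<epsilon> * (B * B)"
    proof
      fix v assume v: "v \<in> Q"
      have "norm ((fst v - \<rho>bar) *\<^sub>R (snd v \<otimes>\<^sub>v snd v)) \<le> C * \<epsilon> * (B * B)"
        using v pos bspec[OF bound_solution(2) v] unfolding norm_scaleR
        by (intro mult_mono) (auto simp: Q_def)
      then show "norm ((\<lambda>(\<rho>, u). \<rho> *\<^sub>R (u \<otimes>\<^sub>v u)) v - \<rho>bar *\<^sub>R (snd v \<otimes>\<^sub>v snd v)) \<le> C * \<epsilon> * (B * B)"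
        by (simp add: case_prod_unfold scaleR_diff_left)
    qed
  qed
  then show ?thesis
    using pairing_bound[OF borel_solution(2) bound_solution(2)]
    by eventually_elim (simp add: pairing_def)
qed

lemma mean_pressure_split:
  "AE z in space_time T. mean_pressure z
    = \<rho>bar * pairing \<nu> (\<lambda>v. rescaled_pressure \<gamma> \<rho>bar \<epsilon> (fst v)) z + \<rho>bar powr \<gamma> / \<epsilon>"
  using pairing_bound[OF borel_solution(3) bound_solution(3)] AE_space
proof eventually_elim
  case (elim z)
  interpret prob_space "\<nu> z" by (rule kernelD(1)[OF kernel elim(2)])
  have "mean_pressure z = (LINT v|\<nu> z. \<rho>bar * rescaled_pressure \<gamma> \<rho>bar \<epsilon> (fst v) + \<rho>bar powr \<gamma> / \<epsilon>)"
    by (simp only: pairing_def case_prod_unfold pressure_split)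
  also have "\<dots> = \<rho>bar * pairing \<nu> (\<lambda>v. rescaled_pressure \<gamma> \<rho>bar \<epsilon> (fst v)) z + \<rho>bar powr \<gamma> / \<epsilon>"
    using elim(1) prob_space by (simp add: pairing_def)
  finally show ?case .
qed

lemma test_function_measurable:
  assumes "\<phi> \<in> test_functions T"
  shows "time_deriv \<phi> \<in> borel_measurable (lebesgue_on S)"
    "space_jacobian \<phi> \<in> borel_measurable (lebesgue_on S)"
    "space_div \<phi> \<in> borel_measurable (lebesgue_on S)"
proof -
  have \<phi>: "C_infinity \<phi>" using assms by (simp add: test_functions_def)
  show "time_deriv \<phi> \<in> borel_measurable (lebesgue_on S)"
    "space_jacobian \<phi> \<in> borel_measurable (lebesgue_on S)"
    "space_div \<phi> \<in> borel_measurable (lebesgue_on S)"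
    by (intro space_time_measurable_continuous continuous_on_time_deriv continuous_on_space_jacobian
        continuous_on_space_div \<phi>)+
qed

text \<open>E is the isentropic integrand minus \<rho>bar times the incompressible one minus a
  constant times the divergence. The pressures cancel exactly, leaving two terms that both stem from
  \<rho> - \<rho>bar, and the subtracted divergence has integral zero. The bound therefore contains
  no derivative other than those paired with momentum and flux.\<close>

lemma momentum_comparison:
  assumes \<phi>: "\<phi> \<in> test_functions T"
    and Dt: "\<forall>z\<in>space (space_time T). norm (time_deriv \<phi> z) \<le> Dt"
    and Dx: "\<forall>z\<in>space (space_time T). norm (space_jacobian \<phi> z) \<le> Dx"
  shows "\<bar>(LINT x|torus. \<phi> (0, x) \<bullet> (\<rho>0 x *\<^sub>R u0 x)) + \<rho>bar * (LINT z|space_time T. incompressible_momentum_integrand \<sigma> \<phi> z)\<bar>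
    \<le> \<epsilon> * (C * (Dt * B + Dx * (B * B)) * measure (space_time T :: (real \<times> (real^'d)) measure) (space (space_time T)))"
proof -
  let ?M = "space_time T :: (real \<times> (real^'d)) measure"
  have \<phi>': "C_infinity \<phi>" "\<And>t. periodic (\<lambda>x. \<phi> (t, x))" using \<phi> by (auto simp: test_functions_def)
  obtain Dd where Dd: "\<forall>z\<in>space ?M. norm (space_div \<phi> z) \<le> Dd"
    using continuous_on_bounded_set[OF continuous_on_space_div[OF \<phi>'(1)] bounded_space_time[of T]] by (metis space_lebesgue_on)
  have sol1: "integrable ?M (isentropic_momentum_integrand \<gamma> \<epsilon> \<nu> \<phi>)"
    "(LINT z|?M. isentropic_momentum_integrand \<gamma> \<epsilon> \<nu> \<phi> z) = - (LINT x|torus. \<phi> (0, x) \<bullet> (\<rho>0 x *\<^sub>R u0 x))"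
    using sol \<phi> by (auto simp: isentropic_mv_solution_def)
  define I where "I z = time_deriv \<phi> z \<bullet> pairing \<nu> snd z + space_jacobian \<phi> z \<bullet> pairing \<nu> (\<lambda>v. snd v \<otimes>\<^sub>v snd v) z
    + space_div \<phi> z \<bullet> pairing \<nu> (\<lambda>v. rescaled_pressure \<gamma> \<rho>bar \<epsilon> (fst v)) z" for z
  have I_eq: "(LINT z|?M. incompressible_momentum_integrand \<sigma> \<phi> z) = (LINT z|?M. I z)"
    by (intro Bochner_Integration.integral_cong refl)
      (simp add: I_def incompressible_momentum_integrand_def pairing_lift mult.commute)
  have I_int: "integrable ?M I"
    unfolding I_def[abs_def]
    by (intro Bochner_Integration.integrable_add
        integrable_pairing_inner(3)[OF borel_solution(1) bound_solution(1) test_function_measurable(1)[OF \<phi>] Dt]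
        integrable_pairing_inner(3)[OF borel_solution(2) bound_solution(2) test_function_measurable(2)[OF \<phi>] Dx]
        integrable_pairing_inner(3)[OF borel_solution(3) bound_solution(3) test_function_measurable(3)[OF \<phi>] Dd])
  define c where "c = \<rho>bar powr \<gamma> / \<epsilon>"
  have div_int: "integrable ?M (space_div \<phi>)"
    by (rule integrable_continuous_bounded_set[OF continuous_on_space_div[OF \<phi>'(1)] borel_space_time bounded_space_time])
  have div_0: "(LINT z|?M. space_div \<phi> z) = 0" by (rule integral_space_div_eq_0[OF \<phi>'])
  define E where "E z = isentropic_momentum_integrand \<gamma> \<epsilon> \<nu> \<phi> z - \<rho>bar * I z - c * space_div \<phi> z" for z
  have E_int: "integrable ?M E" unfolding E_def[abs_def] using sol1(1) I_int div_int by simp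
  have E_val: "(LINT z|?M. E z) = - (LINT x|torus. \<phi> (0, x) \<bullet> (\<rho>0 x *\<^sub>R u0 x)) - \<rho>bar * (LINT z|?M. I z)"
    unfolding E_def using sol1 I_int div_int div_0 by simp
  have "AE z in ?M. norm (E z) \<le> C * \<epsilon> * (Dt * B + Dx * (B * B))"
    using momentum_close flux_close mean_pressure_split AE_space
  proof eventually_elim
    case (elim z)
    have E_z: "E z = time_deriv \<phi> z \<bullet> (mean_momentum z - \<rho>bar *\<^sub>R pairing \<nu> snd z)
        + space_jacobian \<phi> z \<bullet> (mean_flux z - \<rho>bar *\<^sub>R pairing \<nu> (\<lambda>v. snd v \<otimes>\<^sub>v snd v) z)"
      unfolding E_def I_def isentropic_momentum_integrand_def elim(3) c_def
      by (simp add: inner_diff_right algebra_simps)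
    have "\<bar>time_deriv \<phi> z \<bullet> (mean_momentum z - \<rho>bar *\<^sub>R pairing \<nu> snd z)\<bar> \<le> Dt * (C * \<epsilon> * B)"
      using elim(1) bspec[OF Dt elim(4)]
      by (intro order_trans[OF Cauchy_Schwarz_ineq2 mult_mono]) (auto intro: order_trans[OF norm_ge_zero])
    moreover have "\<bar>space_jacobian \<phi> z \<bullet> (mean_flux z - \<rho>bar *\<^sub>R pairing \<nu> (\<lambda>v. snd v \<otimes>\<^sub>v snd v) z)\<bar> \<le> Dx * (C * \<epsilon> * (B * B))"
      using elim(2) bspec[OF Dx elim(4)]
      by (intro order_trans[OF Cauchy_Schwarz_ineq2 mult_mono]) (auto intro: order_trans[OF norm_ge_zero])
    ultimately have "\<bar>E z\<bar> \<le> Dt * (C * \<epsilon> * B) + Dx * (C * \<epsilon> * (B * B))"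
      unfolding E_z by linarith
    also have "\<dots> = C * \<epsilon> * (Dt * B + Dx * (B * B))" by (simp add: algebra_simps)
    finally show ?case by simp
  qed
  from norm_integral_le_const[OF finite_M borel_measurable_integrable[OF E_int] this]
  have "\<bar>LINT z|?M. E z\<bar> \<le> C * \<epsilon> * (Dt * B + Dx * (B * B)) * measure ?M (space ?M)" by simp
  then show ?thesis unfolding E_val I_eq by (simp add: mult_ac abs_le_iff)
qed

text \<open>The difference is the integral of \<Phi> against (\<rho>0 - \<rho>bar) u0, a factor of
  order \<epsilon> times a bounded one. Weak convergence of the two data alone would not control
  this product.\<close>

lemma initial_momentum_comparison:
  fixes \<Phi> :: "real^'d \<Rightarrow> real^'d"
  assumes \<Phi>: "continuous_on UNIV \<Phi>" "\<forall>x\<in>unit_cell. norm (\<Phi> x) \<le> H"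
  shows "\<bar>(LINT x|torus. \<Phi> x \<bullet> (\<rho>0 x *\<^sub>R u0 x)) - \<rho>bar * (LINT x|torus. \<Phi> x \<bullet> u0 x)\<bar>
    \<le> \<epsilon> * (C * (4 * real CARD('d) * B) * H * measure (torus :: (real^'d) measure) (space torus))"
proof -
  let ?N = "torus :: (real^'d) measure"
  have \<Phi>m: "\<Phi> \<in> borel_measurable ?N"
    by (rule space_time_measurable_continuous[OF \<Phi>(1)])
  have i: "integrable ?N (\<lambda>x. \<Phi> x \<bullet> w x)" if w: "integrable ?N w" for w
  proof (rule Bochner_Integration.integrable_bound[of _ "\<lambda>x. H * norm (w x)"])
    show "AE x in ?N. norm (\<Phi> x \<bullet> w x) \<le> norm (H * norm (w x))"
    proof (rule AE_I2)
      fix x :: "real^'d" assume x: "x \<in> space ?N"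
      have "\<bar>\<Phi> x \<bullet> w x\<bar> \<le> H * norm (w x)"
        using \<Phi>(2) x by (intro order_trans[OF Cauchy_Schwarz_ineq2 mult_right_mono]) auto
      then show "norm (\<Phi> x \<bullet> w x) \<le> norm (H * norm (w x))" by simp
    qed
  qed (use w \<Phi>m in auto)
  have "AE x in ?N. norm (\<Phi> x \<bullet> (\<rho>0 x *\<^sub>R u0 x) - \<rho>bar * (\<Phi> x \<bullet> u0 x)) \<le> H * (C * \<epsilon> * (4 * real CARD('d) * B))"
    using density_data_close velocity_data_bound AE_space
  proof eventually_elim
    case (elim x)
    have "norm ((\<rho>0 x - \<rho>bar) *\<^sub>R u0 x) \<le> C * \<epsilon> * (4 * real CARD('d) * B)"
      using elim(1,2) pos unfolding norm_scaleR by (intro mult_mono) auto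
    then have "\<bar>\<Phi> x \<bullet> ((\<rho>0 x - \<rho>bar) *\<^sub>R u0 x)\<bar> \<le> H * (C * \<epsilon> * (4 * real CARD('d) * B))"
      using \<Phi>(2) elim(3)
      by (intro order_trans[OF Cauchy_Schwarz_ineq2 mult_mono]) (auto intro: order_trans[OF norm_ge_zero])
    moreover have "\<Phi> x \<bullet> ((\<rho>0 x - \<rho>bar) *\<^sub>R u0 x) = \<Phi> x \<bullet> (\<rho>0 x *\<^sub>R u0 x) - \<rho>bar * (\<Phi> x \<bullet> u0 x)"
      by (simp add: algebra_simps)
    ultimately show ?case by simp
  qed
  from norm_integral_le_const[OF finite_measure_torus _ this]
  have "\<bar>LINT x|?N. \<Phi> x \<bullet> (\<rho>0 x *\<^sub>R u0 x) - \<rho>bar * (\<Phi> x \<bullet> u0 x)\<bar>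
      \<le> H * (C * \<epsilon> * (4 * real CARD('d) * B)) * measure ?N (space ?N)"
    using borel_measurable_integrable[OF i[OF data_integrable(3)]] borel_measurable_integrable[OF i[OF data_integrable(2)]]
    by simp
  moreover have "(LINT x|?N. \<Phi> x \<bullet> (\<rho>0 x *\<^sub>R u0 x) - \<rho>bar * (\<Phi> x \<bullet> u0 x))
    = (LINT x|?N. \<Phi> x \<bullet> (\<rho>0 x *\<^sub>R u0 x)) - \<rho>bar * (LINT x|?N. \<Phi> x \<bullet> u0 x)"
    using i[OF data_integrable(3)] i[OF data_integrable(2)] by (subst Bochner_Integration.integral_diff) auto
  ultimately show ?thesis by (simp add: mult_ac)
qed

text \<open>In the perturbed mass balance everything except the momentum term carries the factor
  \<rho> - \<rho>bar, inside the domain or in the data, so the momentum term is of order \<epsilon>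
  too. Replacing \<rho> u by \<rho>bar u costs another such term.\<close>

lemma divergence_comparison:
  assumes g: "g \<in> torus_smooth" and G: "\<forall>x\<in>unit_cell. \<bar>g x\<bar> \<le> G" and H: "\<forall>x\<in>unit_cell. norm (grad g x) \<le> H"
    and s: "0 < s" "s < T"
  shows "\<rho>bar * \<bar>LINT z|space_time T. (grad g (snd z) \<bullet> pairing \<sigma> (\<lambda>(u, P). u) z) * ((s - fst z) * indicator {..<s} (fst z))\<bar>
    \<le> \<epsilon> * (C * ((G + H * B * T) * measure (space_time T :: (real \<times> (real^'d)) measure) (space (space_time T))
      + T * G * measure (torus :: (real^'d) measure) (space torus)))"
proof -
  let ?M = "space_time T :: (real \<times> (real^'d)) measure" and ?N = "torus :: (real^'d) measure"
  define w where "w t = (s - t) * indicator {..<s} t" for t :: real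
  have w_meas: "w \<in> borel_measurable borel" unfolding w_def[abs_def] by measurable
  have w_bound: "\<bar>w (fst z)\<bar> \<le> T" if "z \<in> space ?M" for z
    using that s by (auto simp: w_def indicator_def)
  have gs: "C_infinity g" using g by (simp add: torus_smooth_def)
  have gc: "continuous_on UNIV g" by (rule C_infinity_continuous_on[OF gs])
  have g_meas: "(\<lambda>z. g (snd z)) \<in> borel_measurable ?M" by (rule snd_measurable[OF gc])
  have grad_meas: "(\<lambda>z. grad g (snd z)) \<in> borel_measurable ?M" by (rule snd_measurable[OF continuous_on_grad[OF gs]])
  have H': "\<forall>z\<in>space ?M. norm (grad g (snd z)) \<le> H" using H by auto
  note 1 = integrable_pairing_inner(3)[OF borel_momentum bound_momentum grad_meas H']
  note 2 = integrable_pairing_inner(3)[OF borel_solution(1) bound_solution(1) grad_meas H']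
  have i1: "integrable ?M (\<lambda>z. (grad g (snd z) \<bullet> mean_momentum z) * w (fst z))"
    by (rule integrable_mult_bounded[OF 1 fst_measurable[OF w_meas]]) (rule w_bound)
  have i2: "integrable ?M (\<lambda>z. (grad g (snd z) \<bullet> pairing \<nu> snd z) * w (fst z))"
    by (rule integrable_mult_bounded[OF 2 fst_measurable[OF w_meas]]) (rule w_bound)
  have "AE z in ?M. norm ((grad g (snd z) \<bullet> mean_momentum z) * w (fst z) - \<rho>bar * ((grad g (snd z) \<bullet> pairing \<nu> snd z) * w (fst z)))
      \<le> H * (C * \<epsilon> * B) * T"
    using momentum_close AE_space
  proof eventually_elim
    case (elim z)
    have "\<bar>grad g (snd z) \<bullet> (mean_momentum z - \<rho>bar *\<^sub>R pairing \<nu> snd z)\<bar> \<le> H * (C * \<epsilon> * B)"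
      using elim(1) bspec[OF H' elim(2)]
      by (intro order_trans[OF Cauchy_Schwarz_ineq2 mult_mono]) (auto intro: order_trans[OF norm_ge_zero])
    then have "\<bar>(grad g (snd z) \<bullet> (mean_momentum z - \<rho>bar *\<^sub>R pairing \<nu> snd z)) * w (fst z)\<bar> \<le> H * (C * \<epsilon> * B) * T"
      unfolding abs_mult using w_bound[OF elim(2)] by (intro mult_mono) auto
    then show ?case by (simp add: inner_diff_right algebra_simps)
  qed
  from norm_integral_le_const[OF finite_M _ this]
  have A: "\<bar>(LINT z|?M. (grad g (snd z) \<bullet> mean_momentum z) * w (fst z)) - \<rho>bar * (LINT z|?M. (grad g (snd z) \<bullet> pairing \<nu> snd z) * w (fst z))\<bar>
      \<le> H * (C * \<epsilon> * B) * T * measure ?M (space ?M)"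
    using i1 i2 by simp
  have m: "(\<lambda>z. ((mean_density z - \<rho>bar) * g (snd z)) * indicator {..<s} (fst z)) \<in> borel_measurable ?M"
    by (intro borel_measurable_times borel_measurable_diff borel_measurable_const g_meas
        borel_measurable_pairing[OF kernel borel_density] fst_measurable) simp
  have "AE z in ?M. norm (((mean_density z - \<rho>bar) * g (snd z)) * indicator {..<s} (fst z)) \<le> C * \<epsilon> * G"
    using mean_density_close AE_space
  proof eventually_elim
    case (elim z)
    have le: "\<bar>mean_density z - \<rho>bar\<bar> * \<bar>g (snd z)\<bar> \<le> C * \<epsilon> * G"
      using elim G pos by (intro mult_mono) auto
    moreover have "0 \<le> C * \<epsilon> * G"
      by (rule order_trans[OF mult_nonneg_nonneg[OF abs_ge_zero abs_ge_zero] le])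
    ultimately show ?case by (cases "fst z < s") (simp_all add: abs_mult)
  qed
  from norm_integral_le_const[OF finite_M m this]
  have Bd: "\<bar>LINT z|?M. ((mean_density z - \<rho>bar) * g (snd z)) * indicator {..<s} (fst z)\<bar> \<le> C * \<epsilon> * G * measure ?M (space ?M)"
    by simp
  have data_ae: "AE x in ?N. norm ((\<rho>0 x - \<rho>bar) * g x) \<le> C * \<epsilon> * G"
    using density_data_close AE_space by eventually_elim (use G pos in \<open>auto simp: abs_mult intro!: mult_mono\<close>)
  have data_meas: "(\<lambda>x. (\<rho>0 x - \<rho>bar) * g x) \<in> borel_measurable ?N"
    by (intro borel_measurable_times borel_measurable_diff borel_measurable_const
        borel_measurable_integrable[OF data_integrable(1)] space_time_measurable_continuous[OF gc])
  have "\<bar>LINT x|?N. (\<rho>0 x - \<rho>bar) * g x\<bar> \<le> C * \<epsilon> * G * measure ?N (space ?N)"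
    using norm_integral_le_const[OF finite_measure_torus data_meas data_ae] by (simp only: real_norm_def)
  then have "s * \<bar>LINT x|?N. (\<rho>0 x - \<rho>bar) * g x\<bar> \<le> T * (C * \<epsilon> * G * measure ?N (space ?N))"
    using s by (intro mult_mono) auto
  then have Cd: "\<bar>s * (LINT x|?N. (\<rho>0 x - \<rho>bar) * g x)\<bar> \<le> T * (C * \<epsilon> * G * measure ?N (space ?N))"
    using s by (simp add: abs_mult)
  have "\<bar>\<rho>bar * (LINT z|?M. (grad g (snd z) \<bullet> pairing \<nu> snd z) * w (fst z))\<bar>
      \<le> H * (C * \<epsilon> * B) * T * measure ?M (space ?M) + C * \<epsilon> * G * measure ?M (space ?M) + T * (C * \<epsilon> * G * measure ?N (space ?N))"
    using A Bd Cd mass_identity_perturbation[OF g s] unfolding w_def by linarith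
  also have "\<dots> = \<epsilon> * (C * ((G + H * B * T) * measure ?M (space ?M) + T * G * measure ?N (space ?N)))"
    by (simp add: algebra_simps)
  finally have "\<rho>bar * \<bar>LINT z|?M. (grad g (snd z) \<bullet> pairing \<nu> snd z) * w (fst z)\<bar>
      \<le> \<epsilon> * (C * ((G + H * B * T) * measure ?M (space ?M) + T * G * measure ?N (space ?N)))"
    using pos by (simp add: abs_mult)
  moreover have "(LINT z|?M. (grad g (snd z) \<bullet> pairing \<sigma> (\<lambda>(u, P). u) z) * w (fst z))
    = (LINT z|?M. (grad g (snd z) \<bullet> pairing \<nu> snd z) * w (fst z))"
    by (intro Bochner_Integration.integral_cong refl) (simp add: pairing_lift)
  ultimately show ?thesis unfolding w_def by simp
qed

end

section \<open>Energy and the tangent of the power law\<close>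

text \<open>A bound for the second derivative of the power law on [r/2, 2 r]. That derivative is
  monotone in one direction or the other according to the sign of \<gamma> - 2; adding both endpoint
  values covers the two cases.\<close>

definition powr_curvature :: "real \<Rightarrow> real \<Rightarrow> real" where
  "powr_curvature \<gamma> r = \<gamma> * (\<gamma> - 1) * ((r / 2) powr (\<gamma> - 2) + (2 * r) powr (\<gamma> - 2))"

text \<open>The mean value theorem is used twice, for the power law and for its derivative. Since z
  lies between r and x, the product (x - r) (z - r) lies between 0 and (x - r)^2, which gives
  convexity and the quadratic remainder together.\<close>

lemma powr_tangent:
  assumes r: "0 < r" and x: "r / 2 \<le> x" "x \<le> 2 * r" and \<gamma>: "1 < \<gamma>"
  shows "r powr \<gamma> + \<gamma> * r powr (\<gamma> - 1) * (x - r) \<le> x powr \<gamma>"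
    "x powr \<gamma> \<le> r powr \<gamma> + \<gamma> * r powr (\<gamma> - 1) * (x - r) + powr_curvature \<gamma> r * (x - r)\<^sup>2"
proof -
  have pos: "0 < y" if "r / 2 \<le> y" for y using that r by linarith
  have mvt: "\<exists>z. min a b \<le> z \<and> z \<le> max a b \<and> b powr q - a powr q = (b - a) * (q * z powr (q - 1))"
    if "r / 2 \<le> a" "r / 2 \<le> b" for a b q
  proof -
    consider "a < b" | "b < a" | "a = b" by linarith
    then show ?thesis
    proof cases
      case 1
      have "\<exists>z. a < z \<and> z < b \<and> b powr q - a powr q = (b - a) * (q * z powr (q - 1))"
        using 1 that pos by (intro MVT2) (auto intro!: has_real_derivative_powr)
      then obtain z where "a < z" "z < b" "b powr q - a powr q = (b - a) * (q * z powr (q - 1))" by blast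
      then show ?thesis by (intro exI[of _ z]) auto
    next
      case 2
      have "\<exists>z. b < z \<and> z < a \<and> a powr q - b powr q = (a - b) * (q * z powr (q - 1))"
        using 2 that pos by (intro MVT2) (auto intro!: has_real_derivative_powr)
      then obtain z where "b < z" "z < a" "a powr q - b powr q = (a - b) * (q * z powr (q - 1))" by blast
      then show ?thesis by (intro exI[of _ z]) (auto simp: algebra_simps)
    qed auto
  qed
  have r2: "r / 2 \<le> r" "r \<le> 2 * r" using r by auto
  obtain z where z: "min r x \<le> z" "z \<le> max r x" "x powr \<gamma> - r powr \<gamma> = (x - r) * (\<gamma> * z powr (\<gamma> - 1))"
    using mvt[OF r2(1) x(1)] by blast
  have z2: "r / 2 \<le> z" "z \<le> 2 * r" using z(1,2) x r2 by linarith+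
  obtain w where w: "min r z \<le> w" "w \<le> max r z"
    "z powr (\<gamma> - 1) - r powr (\<gamma> - 1) = (z - r) * ((\<gamma> - 1) * w powr (\<gamma> - 1 - 1))"
    using mvt[OF r2(1) z2(1)] by blast
  have w2: "r / 2 \<le> w" "w \<le> 2 * r" using w(1,2) z2 r2 by linarith+
  have prod: "0 \<le> (x - r) * (z - r)" "(x - r) * (z - r) \<le> (x - r)\<^sup>2"
  proof -
    consider "r \<le> x" | "x \<le> r" by linarith
    then have "0 \<le> (x - r) * (z - r) \<and> (x - r) * (z - r) \<le> (x - r) * (x - r)"
    proof cases
      case 1
      then have "r \<le> z" "z \<le> x" using z(1,2) by auto
      then show ?thesis using 1 by (auto intro!: mult_left_mono)
    next
      case 2
      then have "z \<le> r" "x \<le> z" using z(1,2) by auto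
      then show ?thesis using 2 by (auto intro!: mult_nonpos_nonpos mult_left_mono_neg)
    qed
    then show "0 \<le> (x - r) * (z - r)" "(x - r) * (z - r) \<le> (x - r)\<^sup>2" by (auto simp: power2_eq_square)
  qed
  have eq: "x powr \<gamma> - (r powr \<gamma> + \<gamma> * r powr (\<gamma> - 1) * (x - r))
      = ((x - r) * (z - r)) * (\<gamma> * (\<gamma> - 1) * w powr (\<gamma> - 2))"
  proof -
    have "x powr \<gamma> - (r powr \<gamma> + \<gamma> * r powr (\<gamma> - 1) * (x - r))
        = (x - r) * \<gamma> * (z powr (\<gamma> - 1) - r powr (\<gamma> - 1))"
      using z(3) by (simp add: algebra_simps)
    then show ?thesis unfolding w(3) by (simp add: algebra_simps)
  qed
  have nn: "0 \<le> \<gamma> * (\<gamma> - 1) * w powr (\<gamma> - 2)" using \<gamma> by simp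
  have "w powr (\<gamma> - 2) \<le> (r / 2) powr (\<gamma> - 2) + (2 * r) powr (\<gamma> - 2)"
  proof (cases "2 \<le> \<gamma>")
    case True
    then have "w powr (\<gamma> - 2) \<le> (2 * r) powr (\<gamma> - 2)"
      using w2 pos[OF w2(1)] by (intro powr_mono2) auto
    then show ?thesis by (simp add: add_increasing)
  next
    case False
    then have "w powr (\<gamma> - 2) \<le> (r / 2) powr (\<gamma> - 2)"
      using w2 r by (intro powr_mono2') auto
    then show ?thesis by (simp add: add_increasing2)
  qed
  then have le: "\<gamma> * (\<gamma> - 1) * w powr (\<gamma> - 2) \<le> powr_curvature \<gamma> r"
    unfolding powr_curvature_def using \<gamma> by (intro mult_left_mono) auto
  have "0 \<le> ((x - r) * (z - r)) * (\<gamma> * (\<gamma> - 1) * w powr (\<gamma> - 2))"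
    using prod(1) nn by (rule mult_nonneg_nonneg)
  then show "r powr \<gamma> + \<gamma> * r powr (\<gamma> - 1) * (x - r) \<le> x powr \<gamma>" using eq by linarith
  have "((x - r) * (z - r)) * (\<gamma> * (\<gamma> - 1) * w powr (\<gamma> - 2)) \<le> (x - r)\<^sup>2 * powr_curvature \<gamma> r"
    by (intro mult_mono prod(2) le nn) auto
  then show "x powr \<gamma> \<le> r powr \<gamma> + \<gamma> * r powr (\<gamma> - 1) * (x - r) + powr_curvature \<gamma> r * (x - r)\<^sup>2"
    using eq by (simp add: mult.commute) 
qed

context confined_solution begin

lemma integrable_pairing:
  fixes f :: "real \<times> (real^'d) \<Rightarrow> 'b::{banach, second_countable_topology}"
  assumes "f \<in> borel_measurable borel" "\<forall>v\<in>Q. norm (f v) \<le> b"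
  shows "integrable (space_time T) (pairing \<nu> f)"
proof (rule integrable_bounded_AE[OF finite_M borel_measurable_pairing[OF kernel assms(1)]])
  show "AE z in space_time T. norm (pairing \<nu> f z) \<le> b"
    using pairing_bound[OF assms] by eventually_elim (rule conjunct2)
qed

text \<open>Testing with the constant function 1 removes the flux, and the resulting identity for
  all s is resolved by \<open>AE_eq_0_initial_integrals\<close>.\<close>

lemma mass_conservation:
  "AE t in lebesgue_on {0<..<T}. (LINT x|torus. mean_density (t, x)) = (LINT x|torus. \<rho>0 x)"
proof -
  let ?I = "lebesgue_on {0<..<T}"
  have T_borel: "{0<..<T} \<in> sets borel" by simp
  interpret finite_measure ?I by (rule finite_measure_lebesgue_on_bounded) auto
  have mi: "integrable (space_time T) mean_density"
    by (rule integrable_pairing[OF borel_density bound_density])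
  define h where "h t = (LINT x|torus. mean_density (t, x)) - (LINT x|torus. \<rho>0 x)" for t
  have mt: "integrable ?I (\<lambda>t. LINT x|torus. mean_density (t, x))"
    by (rule integrable_integral_slice_lebesgue_on[OF T_borel borel_unit_cell mi])
  have "AE t in ?I. h t = 0"
  proof (rule AE_eq_0_initial_integrals)
    show "integrable ?I h" unfolding h_def[abs_def] using mt by simp
    fix s assume s: "0 < s" "s < T"
    have "(LINT z|space_time T. mean_density z * indicator {..<s} (fst z))
        = (LINT t|?I. LINT x|torus. mean_density (t, x) * indicator {..<s} t)"
      using integral_lebesgue_on_prod[OF T_borel borel_unit_cell indicator_mult_integrable[OF mi, of s]] by simp
    also have "\<dots> = (LINT t|?I. (LINT x|torus. mean_density (t, x)) * indicator {..<s} t)"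
      by simp
    finally have 1: "(LINT z|space_time T. mean_density z * indicator {..<s} (fst z))
        = (LINT t|?I. (LINT x|torus. mean_density (t, x)) * indicator {..<s} t)" .
    have "frechet_derivative (\<lambda>x :: real^'d. 1 :: real) (at x) v = 0" for x v
      using frechet_derivative_const by metis
    then have "grad (\<lambda>x :: real^'d. 1 :: real) x = 0" for x
      by (simp add: grad_def vec_eq_iff)
    then have 2: "(LINT z|space_time T. mean_density z * indicator {..<s} (fst z)) = s * (LINT x|torus. \<rho>0 x)"
      using mass_identity[OF torus_smooth_const[of 1] s] by simp
    have im: "integrable ?I (\<lambda>t. (LINT x|torus. mean_density (t, x)) * indicator {..<s} t)"
      by (rule integrable_mult_bounded[OF mt, of _ 1]) (auto intro!: borel_measurable_lebesgue_onI)
    have ii: "integrable ?I (indicator {..<s} :: real \<Rightarrow> real)"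
      by (rule integrable_const_bound[where B = 1]) (auto intro!: borel_measurable_lebesgue_onI)
    have "(LINT t|?I. h t * indicator {..<s} t)
        = (LINT t|?I. (LINT x|torus. mean_density (t, x)) * indicator {..<s} t - (LINT x|torus. \<rho>0 x) * indicator {..<s} t)"
      by (simp add: h_def left_diff_distrib)
    also have "\<dots> = (LINT t|?I. (LINT x|torus. mean_density (t, x)) * indicator {..<s} t)
        - (LINT x|torus. \<rho>0 x) * (LINT t|?I. indicator {..<s} t)"
      using im ii by simp
    also have "\<dots> = 0" using 1 2 integral_initial_interval[of s T] s by (simp add: mult.commute[of s])
    finally show "(LINT t|?I. h t * indicator {..<s} t) = 0" .
  qed
  then show ?thesis by (simp add: h_def)
qed

text \<open>Internal energy is bounded below by the tangent at time t, and above by the tangent plus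
  a remainder of order \<epsilon>^2 at time 0. Tangents are affine in the density, so their
  integrals coincide by conservation of mass; the weight \<kappa> of order 1/\<epsilon> turns the
  remainder into order \<epsilon>. In the kinetic energy, replacing \<rho> by \<rho>bar costs C
  \<epsilon> B^2. Clearing the 1/2 of the kinetic energy produces the factor 2 before the
  curvature.\<close>

lemma energy_comparison:
  assumes adm: "isentropic_energy_admissible T \<gamma> \<epsilon> \<rho>0 u0 \<nu>"
    and u2: "integrable torus (\<lambda>x. (norm (u0 x))\<^sup>2)"
  shows "AE t in lebesgue_on {0<..<T}. \<rho>bar * (LINT x|torus. pairing \<sigma> (\<lambda>(u, P). (norm u)\<^sup>2) (t, x))
    \<le> (\<rho>bar + C * \<epsilon>) * (LINT x|torus. (norm (u0 x))\<^sup>2)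
      + \<epsilon> * ((C * (B * B) + 2 * powr_curvature \<gamma> \<rho>bar * C\<^sup>2 / (\<gamma> - 1)) * measure (torus :: (real^'d) measure) (space torus))"
proof -
  let ?I = "lebesgue_on {0<..<T}" and ?M = "space_time T :: (real \<times> (real^'d)) measure"
    and ?N = "torus :: (real^'d) measure"
  interpret N: finite_measure ?N by (rule finite_measure_torus)
  have T_borel: "{0<..<T} \<in> sets borel" by simp
  define \<kappa> where "\<kappa> = 1 / (\<gamma> - 1) * (1 / \<epsilon>)"
  have \<kappa>: "0 < \<kappa>" using pos by (simp add: \<kappa>_def)
  \<comment> \<open>A0 + A1 (\<rho> - \<rho>bar) is the tangent of the power law at \<rho>bar, and W
    bounds the curvature.\<close>
  define A0 where "A0 = \<rho>bar powr \<gamma>"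
  define A1 where "A1 = \<gamma> * \<rho>bar powr (\<gamma> - 1)"
  define W where "W = powr_curvature \<gamma> \<rho>bar"
  have W: "0 \<le> W" using pos by (simp add: W_def powr_curvature_def)
  define e where "e = (isentropic_energy \<gamma> \<epsilon> :: real \<times> (real^'d) \<Rightarrow> real)"
  have e_eq: "e v = 1 / 2 * fst v * (norm (snd v))\<^sup>2 + \<kappa> * fst v powr \<gamma>" for v
    by (simp add: e_def isentropic_energy_def case_prod_unfold \<kappa>_def)
  have e_borel: "e \<in> borel_measurable borel"
  proof -
    have "(\<lambda>v. 1 / 2 * fst v * (norm (snd v))\<^sup>2 + \<kappa> * fst v powr \<gamma>) \<in> borel_measurable (borel :: (real \<times> (real^'d)) measure)"
      by (intro borel_measurable_add borel_measurable_times borel_measurable_const borel_measurable_fst_borel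
          powr_real_measurable borel_solution(4))
    then show ?thesis by (simp add: e_eq[abs_def])
  qed
  have e_nonneg: "0 \<le> e v" if "v \<in> Q" for v
    using Q_density[of "fst v" "snd v"] that pos \<kappa> by (simp add: e_eq)
  have e_bound: "\<forall>v\<in>Q. norm (e v) \<le> \<rho>bar * (B * B) + \<kappa> * (2 * \<rho>bar) powr \<gamma>"
  proof
    fix v assume v: "v \<in> Q"
    have \<rho>: "\<rho>bar / 2 \<le> fst v" "fst v \<le> 2 * \<rho>bar" using Q_density[of "fst v" "snd v"] v by auto
    have "1 / 2 * fst v * (norm (snd v))\<^sup>2 \<le> \<rho>bar * (B * B)"
      using \<rho> pos bspec[OF bound_solution(4) v] by (intro mult_mono) auto
    moreover have "\<kappa> * fst v powr \<gamma> \<le> \<kappa> * (2 * \<rho>bar) powr \<gamma>"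
      using \<rho> pos \<kappa> by (intro mult_left_mono powr_mono2) auto
    ultimately show "norm (e v) \<le> \<rho>bar * (B * B) + \<kappa> * (2 * \<rho>bar) powr \<gamma>"
      using e_nonneg[OF v] by (simp add: e_eq)
  qed
  define pe where "pe = pairing \<nu> e"
  define pu where "pu = pairing \<nu> (\<lambda>v. (norm (snd v))\<^sup>2)"
  have pe_int: "integrable ?M pe"
    unfolding pe_def by (rule integrable_pairing[OF e_borel e_bound])
  have pu_int: "integrable ?M pu"
    unfolding pu_def by (rule integrable_pairing[OF borel_solution(4) bound_solution(4)])
  have mi: "integrable ?M mean_density"
    by (rule integrable_pairing[OF borel_density bound_density])
  have AE_Q: "AE z in ?M. AE v in \<nu> z. v \<in> Q"
    using confined by eventually_elim (simp add: Q_def)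
  have nn_e: "AE z in ?M. (\<integral>\<^sup>+v. ennreal (e v) \<partial>\<nu> z) = ennreal (pe z) \<and> 0 \<le> pe z"
    using pairing_bound[OF e_borel e_bound] AE_Q
  proof eventually_elim
    case (elim z)
    have nn: "AE v in \<nu> z. 0 \<le> e v" using elim(2) by eventually_elim (rule e_nonneg)
    show ?case
      using nn_integral_eq_integral[OF _ nn] integral_nonneg_AE[OF nn] elim(1) by (simp add: pe_def pairing_def)
  qed
  have lower: "AE z in ?M. 1 / 2 * \<rho>bar * pu z - 1 / 2 * (C * \<epsilon> * (B * B)) + \<kappa> * (A0 + A1 * (mean_density z - \<rho>bar)) \<le> pe z"
    using pairing_bound[OF e_borel e_bound] pairing_bound[OF borel_solution(4) bound_solution(4)]
      pairing_bound[OF borel_density bound_density] AE_Q AE_space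
  proof eventually_elim
    case (elim z)
    interpret prob_space "\<nu> z" by (rule kernelD(1)[OF kernel elim(5)])
    have i: "integrable (\<nu> z) fst" using elim(3) by (simp add: case_prod_unfold)
    have "(LINT v|\<nu> z. 1 / 2 * \<rho>bar * (norm (snd v))\<^sup>2 - 1 / 2 * (C * \<epsilon> * (B * B)) + \<kappa> * (A0 + A1 * (fst v - \<rho>bar))) \<le> (LINT v|\<nu> z. e v)"
    proof (rule integral_mono_AE)
      show "integrable (\<nu> z) (\<lambda>v. 1 / 2 * \<rho>bar * (norm (snd v))\<^sup>2 - 1 / 2 * (C * \<epsilon> * (B * B)) + \<kappa> * (A0 + A1 * (fst v - \<rho>bar)))"
        using i elim(2) by simp
      show "integrable (\<nu> z) e" using elim(1) by simp
      show "AE v in \<nu> z. 1 / 2 * \<rho>bar * (norm (snd v))\<^sup>2 - 1 / 2 * (C * \<epsilon> * (B * B)) + \<kappa> * (A0 + A1 * (fst v - \<rho>bar)) \<le> e v"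
        using elim(4)
      proof eventually_elim
        case (elim v)
        have \<rho>: "\<rho>bar / 2 \<le> fst v" "fst v \<le> 2 * \<rho>bar" using Q_density[of "fst v" "snd v"] elim by auto
        have "A0 + A1 * (fst v - \<rho>bar) \<le> fst v powr \<gamma>"
          using powr_tangent(1)[OF pos(3) \<rho> pos(2)] by (simp add: A0_def A1_def)
        then have 1: "\<kappa> * (A0 + A1 * (fst v - \<rho>bar)) \<le> \<kappa> * fst v powr \<gamma>"
          using \<kappa> by (intro mult_left_mono) auto
        have "(\<rho>bar - fst v) * (norm (snd v))\<^sup>2 \<le> \<bar>\<rho>bar - fst v\<bar> * (norm (snd v))\<^sup>2"
          by (intro mult_right_mono) auto
        also have "\<dots> \<le> C * \<epsilon> * (B * B)"
          using elim bspec[OF bound_solution(4) elim] pos by (intro mult_mono) (auto simp: Q_def abs_minus_commute)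
        finally have "\<rho>bar * (norm (snd v))\<^sup>2 - fst v * (norm (snd v))\<^sup>2 \<le> C * \<epsilon> * (B * B)"
          by (simp add: left_diff_distrib)
        then show ?case using 1 by (simp add: e_eq)
      qed
    qed
    moreover have "(LINT v|\<nu> z. 1 / 2 * \<rho>bar * (norm (snd v))\<^sup>2 - 1 / 2 * (C * \<epsilon> * (B * B)) + \<kappa> * (A0 + A1 * (fst v - \<rho>bar)))
      = 1 / 2 * \<rho>bar * pu z - 1 / 2 * (C * \<epsilon> * (B * B)) + \<kappa> * (A0 + A1 * (mean_density z - \<rho>bar))"
      using i elim(2) prob_space by (simp add: pu_def pairing_def case_prod_unfold)
    ultimately show ?case by (simp add: pe_def pairing_def)
  qed
  \<comment> \<open>A majorant of the initial energy density; the data lie within C \<epsilon> of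
    \<rho>bar, so the quadratic remainder is at most W (C \<epsilon>)^2.\<close>
  define up where "up x = 1 / 2 * (\<rho>bar + C * \<epsilon>) * (norm (u0 x))\<^sup>2 + \<kappa> * (A0 + A1 * (\<rho>0 x - \<rho>bar) + W * (C * \<epsilon>)\<^sup>2)" for x
  have up_int: "integrable ?N up"
    unfolding up_def[abs_def] using u2 data_integrable(1) by simp
  have e_up: "AE x in ?N. 0 \<le> e (\<rho>0 x, u0 x) \<and> e (\<rho>0 x, u0 x) \<le> up x"
    using density_data_close
  proof eventually_elim
    case (elim x)
    have \<rho>: "\<rho>bar / 2 \<le> \<rho>0 x" "\<rho>0 x \<le> 2 * \<rho>bar" using elim small pos(3) by linarith+
    have "(\<rho>0 x - \<rho>bar)\<^sup>2 \<le> (C * \<epsilon>)\<^sup>2" using elim power_mono[of "\<bar>\<rho>0 x - \<rho>bar\<bar>" "C * \<epsilon>" 2] by simp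
    then have "W * (\<rho>0 x - \<rho>bar)\<^sup>2 \<le> W * (C * \<epsilon>)\<^sup>2" using W by (rule mult_left_mono)
    then have "\<rho>0 x powr \<gamma> \<le> A0 + A1 * (\<rho>0 x - \<rho>bar) + W * (C * \<epsilon>)\<^sup>2"
      using powr_tangent(2)[OF pos(3) \<rho> pos(2)] by (simp add: A0_def A1_def W_def)
    then have "\<kappa> * \<rho>0 x powr \<gamma> \<le> \<kappa> * (A0 + A1 * (\<rho>0 x - \<rho>bar) + W * (C * \<epsilon>)\<^sup>2)"
      using \<kappa> by (intro mult_left_mono) auto
    moreover have "1 / 2 * \<rho>0 x * (norm (u0 x))\<^sup>2 \<le> 1 / 2 * (\<rho>bar + C * \<epsilon>) * (norm (u0 x))\<^sup>2"
      using elim by (intro mult_right_mono) auto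
    ultimately have "e (\<rho>0 x, u0 x) \<le> up x"
      unfolding e_eq up_def fst_conv snd_conv by (intro add_mono)
    moreover have "0 \<le> \<rho>0 x" using \<rho> pos by linarith
    then have "0 \<le> e (\<rho>0 x, u0 x)" using \<kappa> by (simp add: e_eq)
    ultimately show ?case by simp
  qed
  define U where "U = (LINT x|?N. up x)"
  have up_nonneg: "AE x in ?N. 0 \<le> up x" using e_up by eventually_elim simp
  have E0: "(\<integral>\<^sup>+x. ennreal (e (\<rho>0 x, u0 x)) \<partial>?N) \<le> ennreal U"
  proof -
    have "(\<integral>\<^sup>+x. ennreal (e (\<rho>0 x, u0 x)) \<partial>?N) \<le> (\<integral>\<^sup>+x. ennreal (up x) \<partial>?N)"
      by (rule nn_integral_mono_AE) (use e_up in \<open>eventually_elim, auto intro: ennreal_leI\<close>)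
    also have "\<dots> = ennreal U" unfolding U_def by (rule nn_integral_eq_integral[OF up_int up_nonneg])
    finally show ?thesis .
  qed
  have U_nonneg: "0 \<le> U" unfolding U_def by (rule integral_nonneg_AE[OF up_nonneg])
  have "AE t in ?I. (\<integral>\<^sup>+x. (\<integral>\<^sup>+v. ennreal (e v) \<partial>\<nu> (t, x)) \<partial>?N) \<le> ennreal U"
  proof -
    have "esssup ?I (\<lambda>t. \<integral>\<^sup>+x. (\<integral>\<^sup>+v. ennreal (e v) \<partial>\<nu> (t, x)) \<partial>?N) \<le> ennreal U"
      using adm E0 unfolding isentropic_energy_admissible_def e_def by (blast intro: order_trans)
    then show ?thesis
      using esssup_AE[where M = ?I and f = "\<lambda>t. \<integral>\<^sup>+x. (\<integral>\<^sup>+v. ennreal (e v) \<partial>\<nu> (t, x)) \<partial>?N"]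
      by (auto elim!: eventually_mono intro: order_trans)
  qed
  then show ?thesis
    using AE_lebesgue_on_pair[OF T_borel borel_unit_cell nn_e]
      AE_lebesgue_on_pair[OF T_borel borel_unit_cell lower]
      AE_integrable_slice_lebesgue_on[OF T_borel borel_unit_cell pe_int]
      AE_integrable_slice_lebesgue_on[OF T_borel borel_unit_cell pu_int]
      AE_integrable_slice_lebesgue_on[OF T_borel borel_unit_cell mi]
      mass_conservation AE_space
  proof eventually_elim
    case (elim t)
    let ?V = "measure ?N (space ?N)"
    have "(\<integral>\<^sup>+x. (\<integral>\<^sup>+v. ennreal (e v) \<partial>\<nu> (t, x)) \<partial>?N) = (\<integral>\<^sup>+x. ennreal (pe (t, x)) \<partial>?N)"
      by (rule nn_integral_cong_AE) (use elim(2) in \<open>eventually_elim, simp\<close>)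
    also have "\<dots> = ennreal (LINT x|?N. pe (t, x))"
      by (rule nn_integral_eq_integral[OF elim(4)]) (use elim(2) in \<open>eventually_elim, simp\<close>)
    finally have "ennreal (LINT x|?N. pe (t, x)) \<le> ennreal U" using elim(1) by simp
    then have 1: "(LINT x|?N. pe (t, x)) \<le> U" using U_nonneg by (simp add: ennreal_le_iff)
    have i: "integrable ?N (\<lambda>x. mean_density (t, x) - \<rho>bar)" using elim(6) by simp
    have "(LINT x|?N. 1 / 2 * \<rho>bar * pu (t, x) - 1 / 2 * (C * \<epsilon> * (B * B)) + \<kappa> * (A0 + A1 * (mean_density (t, x) - \<rho>bar)))
        \<le> (LINT x|?N. pe (t, x))"
      by (rule integral_mono_AE) (use elim(3,4,5) i in auto)
    moreover have "(LINT x|?N. 1 / 2 * \<rho>bar * pu (t, x) - 1 / 2 * (C * \<epsilon> * (B * B)) + \<kappa> * (A0 + A1 * (mean_density (t, x) - \<rho>bar)))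
        = 1 / 2 * \<rho>bar * (LINT x|?N. pu (t, x)) - 1 / 2 * (C * \<epsilon> * (B * B)) * ?V
          + \<kappa> * (A0 * ?V + A1 * ((LINT x|?N. \<rho>0 x) - \<rho>bar * ?V))"
      using elim(5,6,7) by (simp add: mult_ac)
    moreover have "U = 1 / 2 * (\<rho>bar + C * \<epsilon>) * (LINT x|?N. (norm (u0 x))\<^sup>2)
        + \<kappa> * (A0 * ?V + A1 * ((LINT x|?N. \<rho>0 x) - \<rho>bar * ?V) + W * (C * \<epsilon>)\<^sup>2 * ?V)"
      unfolding U_def up_def using u2 data_integrable(1) by (simp add: mult_ac)
    ultimately have "1 / 2 * \<rho>bar * (LINT x|?N. pu (t, x)) \<le> 1 / 2 * (\<rho>bar + C * \<epsilon>) * (LINT x|?N. (norm (u0 x))\<^sup>2)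
        + \<kappa> * (W * (C * \<epsilon>)\<^sup>2 * ?V) + 1 / 2 * (C * \<epsilon> * (B * B)) * ?V"
      using 1 by (simp add: distrib_left)
    moreover have "\<kappa> * (W * (C * \<epsilon>)\<^sup>2 * ?V) = \<epsilon> * (W * C\<^sup>2 / (\<gamma> - 1) * ?V)"
      using pos by (simp add: \<kappa>_def power2_eq_square)
    moreover have "\<epsilon> * ((C * (B * B) + 2 * W * C\<^sup>2 / (\<gamma> - 1)) * ?V) = 2 * (\<epsilon> * (W * C\<^sup>2 / (\<gamma> - 1) * ?V)) + C * \<epsilon> * (B * B) * ?V"
      by (simp add: distrib_left distrib_right mult_ac)
    moreover have "(LINT x|?N. pairing \<sigma> (\<lambda>(u, P). (norm u)\<^sup>2) (t, x)) = (LINT x|?N. pu (t, x))"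
      using elim(8) by (intro Bochner_Integration.integral_cong refl) (simp add: pairing_lift pu_def)
    ultimately show ?case by (simp add: W_def)
  qed
qed

end

section \<open>Preparations for the passage to the limit\<close>

text \<open>A Borel measure on a Euclidean space is carried by its support, so the support condition
  on the lift pulls back to almost every state under \<nu> z. B bounds K in norm, hence velocity and
  pressure at once, and C is the constant of \<open>rescaled_pressure_bound_density\<close>.\<close>

lemma confined_solutionI:
  fixes \<nu> :: "real \<times> (real^'d) \<Rightarrow> (real \<times> (real^'d)) measure"
  assumes pos: "0 < T" "1 < \<gamma>" "0 < \<rho>bar" "0 < \<epsilon>" and \<eta>: "0 < \<eta>" and K: "compact K" "\<forall>w\<in>K. norm w \<le> B" "0 \<le> B"
    and C: "C = B * \<rho>bar / (\<gamma> * min \<eta> \<rho>bar powr (\<gamma> - 1))" and small: "C * \<epsilon> \<le> \<rho>bar / 2"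
    and sol: "isentropic_mv_solution T \<gamma> \<epsilon> \<rho>0 u0 \<nu>"
    and supp: "AE z in space_time T. supp (pushforward (T_lift \<gamma> \<rho>bar \<epsilon>) \<nu> z) \<subseteq> {\<eta>..R} \<times> K"
  shows "confined_solution T \<gamma> \<rho>bar \<epsilon> C B \<rho>0 u0 \<nu>"
proof
  show "0 \<le> C" unfolding C using pos \<eta> K(3) by simp
  have kernel: "\<nu> \<in> space_time T \<rightarrow>\<^sub>M prob_algebra borel"
    using sol by (intro young_measure_kernel) (auto simp: isentropic_mv_solution_def)
  show "AE z in space_time T. AE v in \<nu> z. \<bar>fst v - \<rho>bar\<bar> \<le> C * \<epsilon> \<and> norm (snd v) \<le> B
      \<and> \<bar>rescaled_pressure \<gamma> \<rho>bar \<epsilon> (fst v)\<bar> \<le> B"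
    using supp AE_space
  proof eventually_elim
    case (elim z)
    let ?m = "pushforward (T_lift \<gamma> \<rho>bar \<epsilon>) \<nu> z"
    have T_meas: "T_lift \<gamma> \<rho>bar \<epsilon> \<in> measurable (\<nu> z) borel"
      using borel_measurable_T_lift by (simp add: measurable_cong_sets[OF kernelD(2)[OF kernel elim(2)] refl])
    have "closed ({\<eta>..R} \<times> K)" using K(1) by (intro closed_Times closed_real_atLeastAtMost compact_imp_closed)
    then have S: "{v \<in> space borel. v \<in> {\<eta>..R} \<times> K} \<in> sets borel" by simp
    have "AE v in ?m. v \<in> supp ?m" by (rule AE_in_supp) (simp add: pushforward_def)
    then have "AE v in ?m. v \<in> {\<eta>..R} \<times> K" by eventually_elim (use elim(1) in blast)
    then have "AE v in \<nu> z. T_lift \<gamma> \<rho>bar \<epsilon> v \<in> {\<eta>..R} \<times> K"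
      unfolding pushforward_def by (simp only: AE_distr_iff[OF T_meas S])
    then show ?case
    proof eventually_elim
      case (elim v)
      obtain \<rho> u where v: "v = (\<rho>, u)" by (cases v)
      have "\<eta> \<le> \<rho>" and uP: "(u, rescaled_pressure \<gamma> \<rho>bar \<epsilon> \<rho>) \<in> K" using elim by (auto simp: T_lift_def v)
      have "norm u \<le> B" "norm (rescaled_pressure \<gamma> \<rho>bar \<epsilon> \<rho>) \<le> B"
        using norm_fst_le[of u "rescaled_pressure \<gamma> \<rho>bar \<epsilon> \<rho>"] norm_snd_le[of "rescaled_pressure \<gamma> \<rho>bar \<epsilon> \<rho>" u]
          bspec[OF K(2) uP] by linarith+
      moreover from this have "\<bar>\<rho> - \<rho>bar\<bar> \<le> C * \<epsilon>"
        unfolding C using pos \<eta> \<open>\<eta> \<le> \<rho>\<close> by (intro rescaled_pressure_bound_density) auto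
      ultimately show ?case by (simp add: v)
    qed
  qed
qed (use assms in auto)

text \<open>Convergence is available for scalar functions of the state only, so vector and matrix
  moments are split into their components.\<close>

lemma
  fixes f :: "'v::euclidean_space \<Rightarrow> 'b::euclidean_space" and \<Phi> :: "'z \<Rightarrow> 'b"
  assumes \<nu>: "\<nu> \<in> M \<rightarrow>\<^sub>M prob_algebra borel" and bound: "AE z in M. AE v in \<nu> z. norm v \<le> b"
    and f: "continuous_on UNIV f"
  shows AE_integrable_pairing: "AE z in M. integrable (\<nu> z) f"
    and integrable_inner_pairing: "integrable M \<Phi> \<Longrightarrow> integrable M (\<lambda>z. \<Phi> z \<bullet> pairing \<nu> f z)"
    and integral_inner_pairing: "integrable M \<Phi> \<Longrightarrow> (LINT z|M. \<Phi> z \<bullet> pairing \<nu> f z)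
      = (\<Sum>i\<in>Basis. LINT z|M. pairing \<nu> (\<lambda>v. f v \<bullet> i) z * (\<Phi> z \<bullet> i))"
    and pairing_bounded: "\<exists>C. AE z in M. norm (pairing \<nu> f z) \<le> C"
proof -
  obtain C where C: "\<And>v. v \<in> cball 0 b \<Longrightarrow> norm (f v) \<le> C"
    using continuous_on_bounded_set[OF f, of "cball 0 b"] by auto
  have f_borel: "f \<in> borel_measurable borel" by (rule borel_measurable_continuous_onI[OF f])
  have ae: "AE z in M. integrable (\<nu> z) f \<and> norm (pairing \<nu> f z) \<le> C"
    using bound AE_space
  proof eventually_elim
    case (elim z)
    have b: "AE v in \<nu> z. norm (f v) \<le> C" using elim(1) by eventually_elim (rule C, simp)
    have m: "f \<in> borel_measurable (\<nu> z)"
      using f_borel by (simp add: measurable_cong_sets[OF kernelD(2)[OF \<nu> elim(2)] refl])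
    show ?case using pairing_AE_bound[where \<nu> = \<nu> and z = z, OF kernelD(1)[OF \<nu> elim(2)] m b] by (rule conjI)
  qed
  then show ae1: "AE z in M. integrable (\<nu> z) f" by eventually_elim (rule conjunct1)
  have ae2: "AE z in M. norm (pairing \<nu> f z) \<le> C" using ae by eventually_elim (rule conjunct2)
  then show "\<exists>C. AE z in M. norm (pairing \<nu> f z) \<le> C" by blast
  have m: "pairing \<nu> f \<in> borel_measurable M" by (rule borel_measurable_pairing[OF \<nu> f_borel])
  assume \<Phi>: "integrable M \<Phi>"
  have comp: "AE z in M. pairing \<nu> (\<lambda>v. f v \<bullet> i) z = pairing \<nu> f z \<bullet> i" for i
    using ae1 by eventually_elim (simp add: pairing_def)
  have i1: "integrable M (\<lambda>z. (pairing \<nu> f z \<bullet> i) * (\<Phi> z \<bullet> i))" if "i \<in> Basis" for i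
  proof (rule integrable_mult_bounded_AE[where C = C])
    show "integrable M (\<lambda>z. \<Phi> z \<bullet> i)" using \<Phi> by simp
    show "(\<lambda>z. pairing \<nu> f z \<bullet> i) \<in> borel_measurable M" using m by simp
    show "AE z in M. \<bar>pairing \<nu> f z \<bullet> i\<bar> \<le> C"
      using ae2 by eventually_elim (use Basis_le_norm[OF that] in \<open>auto intro: order_trans\<close>)
  qed
  have expand: "\<Phi> z \<bullet> pairing \<nu> f z = (\<Sum>i\<in>Basis. (pairing \<nu> f z \<bullet> i) * (\<Phi> z \<bullet> i))" for z
    by (subst euclidean_inner) (simp add: mult.commute)
  show "integrable M (\<lambda>z. \<Phi> z \<bullet> pairing \<nu> f z)"
    unfolding expand by (intro Bochner_Integration.integrable_sum i1)
  have "(LINT z|M. \<Phi> z \<bullet> pairing \<nu> f z) = (\<Sum>i\<in>Basis. LINT z|M. (pairing \<nu> f z \<bullet> i) * (\<Phi> z \<bullet> i))"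
    unfolding expand by (intro Bochner_Integration.integral_sum i1)
  also have "\<dots> = (\<Sum>i\<in>Basis. LINT z|M. pairing \<nu> (\<lambda>v. f v \<bullet> i) z * (\<Phi> z \<bullet> i))"
  proof (intro sum.cong refl integral_cong_AE)
    fix i :: 'b assume i: "i \<in> Basis"
    have "(\<lambda>v. f v \<bullet> i) \<in> borel_measurable borel" using f_borel by simp
    from borel_measurable_pairing[OF \<nu> this]
    show "(\<lambda>z. pairing \<nu> (\<lambda>v. f v \<bullet> i) z * (\<Phi> z \<bullet> i)) \<in> borel_measurable M" using \<Phi> by simp
    show "(\<lambda>z. (pairing \<nu> f z \<bullet> i) * (\<Phi> z \<bullet> i)) \<in> borel_measurable M"
      using i1[OF i] by (rule borel_measurable_integrable)
    show "AE z in M. (pairing \<nu> f z \<bullet> i) * (\<Phi> z \<bullet> i) = pairing \<nu> (\<lambda>v. f v \<bullet> i) z * (\<Phi> z \<bullet> i)"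
      using comp[of i] by eventually_elim simp
  qed
  finally show "(LINT z|M. \<Phi> z \<bullet> pairing \<nu> f z)
      = (\<Sum>i\<in>Basis. LINT z|M. pairing \<nu> (\<lambda>v. f v \<bullet> i) z * (\<Phi> z \<bullet> i))" .
qed

text \<open>Differencing in \<open>s\<close> reduces this to \<open>AE_eq_0_initial_integrals\<close>.\<close>

lemma AE_eq_0_ramp_integrals:
  fixes h :: "real \<Rightarrow> real"
  assumes h: "integrable (lebesgue_on {0<..<T}) h" and bound: "AE t in lebesgue_on {0<..<T}. \<bar>h t\<bar> \<le> H"
    and zero: "\<And>s. 0 < s \<Longrightarrow> s < T \<Longrightarrow> (LINT t|lebesgue_on {0<..<T}. h t * ((s - t) * indicator {..<s} t)) = 0"
  shows "AE t in lebesgue_on {0<..<T}. h t = 0"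
proof (rule AE_eq_0_initial_integrals[OF h])
  let ?I = "lebesgue_on {0<..<T}"
  interpret finite_measure ?I by (rule finite_measure_lebesgue_on_bounded) auto
  fix s assume s: "0 < s" "s < T"
  have bm: "a \<in> borel_measurable ?I" if "a \<in> borel_measurable borel" for a :: "real \<Rightarrow> real"
    using that by (rule borel_measurable_lebesgue_onI)
  have i1: "integrable ?I (\<lambda>t. h t * indicator {..<s} t)"
    by (rule integrable_mult_bounded[OF h bm, of _ 1]) auto
  have iw: "integrable ?I (\<lambda>t. h t * ((u - t) * indicator {..<u} t))" if "0 < u" "u < T" for u
    by (rule integrable_mult_bounded[OF h bm, of _ T]) (use that in \<open>auto simp: indicator_def\<close>)
  have le: "\<bar>LINT t|?I. h t * indicator {..<s} t\<bar> \<le> \<bar>H\<bar> * (LINT t|?I. indicator {s..<s + \<delta>} t)" if \<delta>: "0 < \<delta>" "s + \<delta> < T" for \<delta>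
  proof -
    let ?s = "s + \<delta>"
    have s': "0 < ?s" using s \<delta> by simp
    define r where "r t = (?s - t) * indicator {s..<?s} t" for t
    have r_meas: "r \<in> borel_measurable borel" unfolding r_def[abs_def] by measurable
    have ir: "integrable ?I (\<lambda>t. h t * r t)"
      by (rule integrable_mult_bounded[OF h bm[OF r_meas], of T]) (use s \<delta> in \<open>auto simp: r_def indicator_def\<close>)
    have ii: "integrable ?I (indicator {s..<?s} :: real \<Rightarrow> real)"
      by (rule integrable_const_bound[where B = 1]) (auto intro!: bm)
    have split: "h t * ((?s - t) * indicator {..<?s} t) - h t * ((s - t) * indicator {..<s} t)
        = \<delta> * (h t * indicator {..<s} t) + h t * r t" for t
      using \<delta> by (auto simp: r_def indicator_def algebra_simps)
    have "(LINT t|?I. h t * ((?s - t) * indicator {..<?s} t)) - (LINT t|?I. h t * ((s - t) * indicator {..<s} t))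
        = (LINT t|?I. \<delta> * (h t * indicator {..<s} t) + h t * r t)"
      using Bochner_Integration.integral_diff[OF iw[OF s' \<delta>(2)] iw[OF s]] by (simp only: split)
    also have "\<dots> = \<delta> * (LINT t|?I. h t * indicator {..<s} t) + (LINT t|?I. h t * r t)"
      using i1 ir by simp
    finally have eq: "\<delta> * (LINT t|?I. h t * indicator {..<s} t) = - (LINT t|?I. h t * r t)"
      using zero[OF s] zero[OF s' \<delta>(2)] by simp
    have "\<bar>LINT t|?I. h t * r t\<bar> \<le> (LINT t|?I. \<bar>h t * r t\<bar>)"
      using integral_norm_bound[of ?I "\<lambda>t. h t * r t"] by simp
    also have "\<dots> \<le> (LINT t|?I. \<bar>H\<bar> * \<delta> * indicator {s..<?s} t)"
    proof (rule integral_mono_AE)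
      show "AE t in ?I. \<bar>h t * r t\<bar> \<le> \<bar>H\<bar> * \<delta> * indicator {s..<?s} t"
        using bound by eventually_elim (auto simp: r_def indicator_def abs_mult intro!: mult_mono)
    qed (use ir ii in auto)
    also have "\<dots> = \<bar>H\<bar> * \<delta> * (LINT t|?I. indicator {s..<?s} t)" by simp
    finally have "\<delta> * \<bar>LINT t|?I. h t * indicator {..<s} t\<bar> \<le> \<delta> * (\<bar>H\<bar> * (LINT t|?I. indicator {s..<?s} t))"
      using eq \<delta> by (metis abs_minus_cancel abs_mult abs_of_pos mult.assoc mult.commute)
    then show ?thesis using \<delta> by simp
  qed
  have ind: "(LINT t|?I. indicator {s..<s + \<delta>} t) = \<delta>" if "0 < \<delta>" "s + \<delta> < T" for \<delta>
  proof -
    have "(\<lambda>t. indicator {0<..<T} t *\<^sub>R indicator {s..<s + \<delta>} t :: real) = indicator {s..<s + \<delta>}"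
      using that s by (auto simp: fun_eq_iff indicator_def)
    then show ?thesis
      using integral_lebesgue_on_borel[of "{0<..<T}" "indicator {s..<s + \<delta>} :: real \<Rightarrow> real"] that by simp
  qed
  have "((\<lambda>\<delta>. \<bar>H\<bar> * \<delta>) \<longlongrightarrow> \<bar>H\<bar> * 0) (at_right 0)" by (intro tendsto_intros)
  moreover have "\<forall>\<^sub>F \<delta> in at_right 0. \<bar>LINT t|?I. h t * indicator {..<s} t\<bar> \<le> \<bar>H\<bar> * \<delta>"
    unfolding eventually_at_right_field
  proof (intro exI[of _ "T - s"] conjI allI impI)
    fix \<delta> assume "0 < \<delta>" "\<delta> < T - s"
    then have \<delta>: "0 < \<delta>" "s + \<delta> < T" by auto
    show "\<bar>LINT t|?I. h t * indicator {..<s} t\<bar> \<le> \<bar>H\<bar> * \<delta>"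
      using le[OF \<delta>] unfolding ind[OF \<delta>] .
  qed (use s in simp)
  ultimately have "\<bar>LINT t|?I. h t * indicator {..<s} t\<bar> \<le> \<bar>H\<bar> * 0"
    by (rule tendsto_lowerbound) simp
  then show "(LINT t|?I. h t * indicator {..<s} t) = 0" by simp
qed

section \<open>The low Mach number limit\<close>

lemma (in confined_solution) lift_bound: "AE z in space_time T. AE v in \<sigma> z. v \<in> cball 0 (2 * B)"
  using confined AE_space
proof eventually_elim
  case (elim z)
  have m: "P_lift \<gamma> \<rho>bar \<epsilon> \<in> measurable (\<nu> z) borel"
    using borel_measurable_P_lift by (simp add: measurable_cong_sets[OF kernelD(2)[OF kernel elim(2)] refl])
  have "AE v in \<nu> z. P_lift \<gamma> \<rho>bar \<epsilon> v \<in> cball 0 (2 * B)"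
    using elim(1)
  proof eventually_elim
    case (elim v)
    have "norm (P_lift \<gamma> \<rho>bar \<epsilon> v) \<le> norm (snd v) + norm (rescaled_pressure \<gamma> \<rho>bar \<epsilon> (fst v))"
      unfolding P_lift_def case_prod_unfold by (rule norm_Pair_le)
    then show ?case using elim by simp
  qed
  then show ?case
    unfolding pushforward_def by (subst AE_distr_iff[OF m]) auto
qed

text \<open>The situation after extraction of a subsequence. \<open>conv\<close> covers all
  continuous functions of the state, since all measures are carried by bounded sets common to all k;
  this admits the moments u, the tensor square of u, P and the square of the norm, none of which
  vanishes at infinity.\<close>

locale low_mach_limit =
  fixes T \<gamma> \<rho>bar C B B\<mu> :: real and e :: "nat \<Rightarrow> real"
    and \<rho> :: "nat \<Rightarrow> real^'d \<Rightarrow> real" and u :: "nat \<Rightarrow> real^'d \<Rightarrow> real^'d"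
    and \<nu> :: "nat \<Rightarrow> real \<times> (real^'d) \<Rightarrow> (real \<times> (real^'d)) measure"
    and u0 :: "real^'d \<Rightarrow> real^'d"
    and \<mu> :: "real \<times> (real^'d) \<Rightarrow> ((real^'d) \<times> real) measure"
  assumes conf: "\<And>k. confined_solution T \<gamma> \<rho>bar (e k) C B (\<rho> k) (u k) (\<nu> k)"
    and e_lim: "e \<longlonglongrightarrow> 0"
    and \<mu>: "\<mu> \<in> space_time T \<rightarrow>\<^sub>M prob_algebra borel"
    and \<mu>_bound: "\<And>z. z \<in> space (space_time T) \<Longrightarrow> AE v in \<mu> z. norm v \<le> B\<mu>"
    and conv: "\<And>(f :: (real^'d) \<times> real \<Rightarrow> real) h. continuous_on UNIV f \<Longrightarrow> integrable (space_time T) h \<Longrightarrow>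
      (\<lambda>k. LINT z|space_time T. pairing (pushforward (P_lift \<gamma> \<rho>bar (e k)) (\<nu> k)) f z * h z)
        \<longlonglongrightarrow> (LINT z|space_time T. pairing \<mu> f z * h z)"
    and u0: "integrable torus u0"
    and data: "\<And>g. g \<in> L_infinity torus \<Longrightarrow> (\<lambda>k. LINT x|torus. u k x \<bullet> g x) \<longlonglongrightarrow> (LINT x|torus. u0 x \<bullet> g x)"
begin

abbreviation "\<sigma> k \<equiv> pushforward (P_lift \<gamma> \<rho>bar (e k)) (\<nu> k)"

abbreviation "M \<equiv> space_time T :: (real \<times> (real^'d)) measure"

lemmas pos = confined_solution.pos[OF conf]

lemma \<sigma>_kernel: "\<sigma> k \<in> M \<rightarrow>\<^sub>M prob_algebra borel"
  by (rule confined_solution.lift_kernel[OF conf])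

lemma \<sigma>_bound: "AE z in M. AE v in \<sigma> k z. norm v \<le> 2 * B"
  using confined_solution.lift_bound[OF conf] by simp

lemma \<mu>_bound': "AE z in M. AE v in \<mu> z. norm v \<le> B\<mu>"
  by (rule AE_I2) (rule \<mu>_bound)

lemma inner_conv:
  fixes f :: "(real^'d) \<times> real \<Rightarrow> 'b::euclidean_space"
  assumes f: "continuous_on UNIV f" and \<Phi>: "integrable M \<Phi>"
  shows "(\<lambda>k. LINT z|M. \<Phi> z \<bullet> pairing (\<sigma> k) f z) \<longlonglongrightarrow> (LINT z|M. \<Phi> z \<bullet> pairing \<mu> f z)"
  unfolding integral_inner_pairing[OF \<sigma>_kernel \<sigma>_bound f \<Phi>] integral_inner_pairing[OF \<mu> \<mu>_bound' f \<Phi>]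
  using f \<Phi> by (intro tendsto_sum conv continuous_intros integrable_inner_left)

lemma pairing_L_infinity:
  fixes \<kappa> :: "real \<times> (real^'d) \<Rightarrow> 'v::euclidean_space measure" and f :: "'v \<Rightarrow> real"
  assumes "\<kappa> \<in> M \<rightarrow>\<^sub>M prob_algebra borel" "AE z in M. AE v in \<kappa> z. norm v \<le> b" "continuous_on UNIV f"
  shows "pairing \<kappa> f \<in> L_infinity M"
  unfolding L_infinity_def
  using borel_measurable_pairing[OF assms(1) borel_measurable_continuous_onI[OF assms(3)]]
    pairing_bounded[OF assms] by blast

lemma lifts_converge: "young_converges M \<sigma> \<mu>"
  unfolding young_converges_def weakstar_converges_Linf_def
proof (intro ballI conjI allI impI)
  fix f :: "(real^'d) \<times> real \<Rightarrow> real" assume "f \<in> C_0"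
  then have f: "continuous_on UNIV f" by (simp add: C_0_def)
  show "pairing (\<sigma> k) f \<in> L_infinity M" for k
    by (rule pairing_L_infinity[OF \<sigma>_kernel \<sigma>_bound f])
  show "pairing \<mu> f \<in> L_infinity M"
    by (rule pairing_L_infinity[OF \<mu> \<mu>_bound' f])
  show "(\<lambda>k. LINT z|M. pairing (\<sigma> k) f z * g z) \<longlonglongrightarrow> (LINT z|M. pairing \<mu> f z * g z)" if "integrable M g" for g
    by (rule conv[OF f that])
qed

lemma continuous_lift:
  "continuous_on UNIV (\<lambda>(u, P). u :: real^'d)"
  "continuous_on UNIV (\<lambda>(u :: real^'d, P :: real). u \<otimes>\<^sub>v u)"
  "continuous_on UNIV (\<lambda>(u :: real^'d, P). P :: real)"
  "continuous_on UNIV (\<lambda>(u :: real^'d, P :: real). (norm u)\<^sup>2)"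
  by (auto simp: case_prod_unfold intro!: continuous_intros)

lemma tends_to_0_times: "(\<lambda>k. e k * c) \<longlonglongrightarrow> 0"
  using tendsto_mult[OF e_lim tendsto_const[of c]] by simp

lemma null_comparison:
  fixes a :: "nat \<Rightarrow> real"
  assumes "\<And>k. \<bar>a k\<bar> \<le> e k * c"
  shows "a \<longlonglongrightarrow> 0"
  by (rule Lim_null_comparison[OF _ tends_to_0_times[of c]]) (simp add: assms)

lemma momentum_limit:
  assumes \<phi>: "\<phi> \<in> test_functions T"
  shows "integrable M (incompressible_momentum_integrand \<mu> \<phi>)"
    "(LINT z|M. incompressible_momentum_integrand \<mu> \<phi> z) = - (LINT x|torus. \<phi> (0, x) \<bullet> u0 x)"
proof -
  have \<phi>': "C_infinity \<phi>" using \<phi> by (simp add: test_functions_def)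
  note int = integrable_continuous_bounded_set[OF _ borel_space_time bounded_space_time]
  have i: "integrable M (time_deriv \<phi>)" "integrable M (space_jacobian \<phi>)" "integrable M (space_div \<phi>)"
    by (intro int continuous_on_time_deriv continuous_on_space_jacobian continuous_on_space_div \<phi>')+
  have eq: "incompressible_momentum_integrand \<kappa> \<phi> = (\<lambda>z. time_deriv \<phi> z \<bullet> pairing \<kappa> (\<lambda>(u, P). u) z
      + space_jacobian \<phi> z \<bullet> pairing \<kappa> (\<lambda>(u, P). u \<otimes>\<^sub>v u) z + space_div \<phi> z \<bullet> pairing \<kappa> (\<lambda>(u, P). P) z)" for \<kappa>
    by (simp add: incompressible_momentum_integrand_def fun_eq_iff mult.commute)
  have \<mu>i: "integrable M (\<lambda>z. time_deriv \<phi> z \<bullet> pairing \<mu> (\<lambda>(u, P). u) z)"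
    "integrable M (\<lambda>z. space_jacobian \<phi> z \<bullet> pairing \<mu> (\<lambda>(u, P). u \<otimes>\<^sub>v u) z)"
    "integrable M (\<lambda>z. space_div \<phi> z \<bullet> pairing \<mu> (\<lambda>(u, P). P) z)"
    by (rule integrable_inner_pairing[OF \<mu> \<mu>_bound' continuous_lift(1) i(1)]
        integrable_inner_pairing[OF \<mu> \<mu>_bound' continuous_lift(2) i(2)]
        integrable_inner_pairing[OF \<mu> \<mu>_bound' continuous_lift(3) i(3)])+
  have \<sigma>i: "integrable M (\<lambda>z. time_deriv \<phi> z \<bullet> pairing (\<sigma> k) (\<lambda>(u, P). u) z)"
    "integrable M (\<lambda>z. space_jacobian \<phi> z \<bullet> pairing (\<sigma> k) (\<lambda>(u, P). u \<otimes>\<^sub>v u) z)"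
    "integrable M (\<lambda>z. space_div \<phi> z \<bullet> pairing (\<sigma> k) (\<lambda>(u, P). P) z)" for k
    by (rule integrable_inner_pairing[OF \<sigma>_kernel \<sigma>_bound continuous_lift(1) i(1)]
        integrable_inner_pairing[OF \<sigma>_kernel \<sigma>_bound continuous_lift(2) i(2)]
        integrable_inner_pairing[OF \<sigma>_kernel \<sigma>_bound continuous_lift(3) i(3)])+
  show "integrable M (incompressible_momentum_integrand \<mu> \<phi>)"
    unfolding eq by (intro Bochner_Integration.integrable_add \<mu>i)
  define J where "J k = (LINT z|M. incompressible_momentum_integrand (\<sigma> k) \<phi> z)" for k
  have J_lim: "J \<longlonglongrightarrow> (LINT z|M. incompressible_momentum_integrand \<mu> \<phi> z)"
    unfolding J_def[abs_def] eq
      Bochner_Integration.integral_add[OF Bochner_Integration.integrable_add[OF \<sigma>i(1,2)] \<sigma>i(3)]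
      Bochner_Integration.integral_add[OF \<sigma>i(1,2)]
      Bochner_Integration.integral_add[OF Bochner_Integration.integrable_add[OF \<mu>i(1,2)] \<mu>i(3)]
      Bochner_Integration.integral_add[OF \<mu>i(1,2)]
    by (intro tendsto_add inner_conv continuous_lift i)
  \<comment> \<open>The initial momentum a is only an intermediary: one comparison ties it to the
    integrals J, the other to the initial velocities b, and it is eliminated without computing its
    own limit.\<close>
  define a where "a k = (LINT x|torus. \<phi> (0, x) \<bullet> (\<rho> k x *\<^sub>R u k x))" for k
  define b where "b k = (LINT x|torus. \<phi> (0, x) \<bullet> u k x)" for k
  have \<phi>0: "continuous_on UNIV (\<lambda>x. \<phi> (0, x))"
    by (rule continuous_on_compose2[OF C_infinity_continuous_on[OF \<phi>', of UNIV]]) (auto intro!: continuous_intros)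
  obtain H where H: "\<forall>x\<in>unit_cell. norm (\<phi> (0, x)) \<le> H"
    using continuous_on_bounded_set[OF \<phi>0 bounded_unit_cell] by metis
  have b_lim: "b \<longlonglongrightarrow> (LINT x|torus. \<phi> (0, x) \<bullet> u0 x)"
  proof -
    have "AE x in torus. norm (\<phi> (0, x)) \<le> H" by (rule AE_I2) (use H in simp)
    then have "(\<lambda>x. \<phi> (0, x)) \<in> L_infinity torus"
      unfolding L_infinity_def using space_time_measurable_continuous[OF \<phi>0] by blast
    from data[OF this] show ?thesis by (simp add: b_def[abs_def] inner_commute)
  qed
  obtain Dt where Dt: "\<forall>z\<in>space M. norm (time_deriv \<phi> z) \<le> Dt"
    using continuous_on_bounded_set[OF continuous_on_time_deriv[OF \<phi>'] bounded_space_time[of T]] by (metis space_lebesgue_on)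
  obtain Dx where Dx: "\<forall>z\<in>space M. norm (space_jacobian \<phi> z) \<le> Dx"
    using continuous_on_bounded_set[OF continuous_on_space_jacobian[OF \<phi>'] bounded_space_time[of T]] by (metis space_lebesgue_on)
  have 1: "(\<lambda>k. a k + \<rho>bar * J k) \<longlonglongrightarrow> 0"
    unfolding a_def J_def by (rule null_comparison) (rule confined_solution.momentum_comparison[OF conf \<phi> Dt Dx])
  have 2: "(\<lambda>k. a k - \<rho>bar * b k) \<longlonglongrightarrow> 0"
    unfolding a_def b_def by (rule null_comparison) (rule confined_solution.initial_momentum_comparison[OF conf \<phi>0 H])
  have "(\<lambda>k. \<rho>bar * J k) \<longlonglongrightarrow> \<rho>bar * (LINT z|M. incompressible_momentum_integrand \<mu> \<phi> z)"
    by (intro tendsto_intros J_lim)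
  moreover have "(\<lambda>k. (a k + \<rho>bar * J k) - (a k - \<rho>bar * b k) - \<rho>bar * b k) \<longlonglongrightarrow> 0 - 0 - \<rho>bar * (LINT x|torus. \<phi> (0, x) \<bullet> u0 x)"
    by (intro tendsto_intros 1 2 b_lim)
  then have "(\<lambda>k. \<rho>bar * J k) \<longlonglongrightarrow> - (\<rho>bar * (LINT x|torus. \<phi> (0, x) \<bullet> u0 x))" by simp
  ultimately have "\<rho>bar * (LINT z|M. incompressible_momentum_integrand \<mu> \<phi> z) = - (\<rho>bar * (LINT x|torus. \<phi> (0, x) \<bullet> u0 x))"
    by (rule LIMSEQ_unique)
  then show "(LINT z|M. incompressible_momentum_integrand \<mu> \<phi> z) = - (LINT x|torus. \<phi> (0, x) \<bullet> u0 x)"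
    using pos(3) unfolding mult_minus_right[symmetric] by (subst (asm) mult_cancel_left) simp
qed

text \<open>\<open>divergence_comparison\<close> yields the condition against the weights (s - t) on
  {..<s} only. These determine a bounded function of time, so \<open>AE_eq_0_ramp_integrals\<close>
  localizes the condition, with an exceptional null set that may depend on \<psi>.\<close>

lemma divergence_limit:
  assumes \<psi>: "\<psi> \<in> torus_smooth"
  shows "AE t in lebesgue_on {0<..<T}.
    integrable torus (\<lambda>x. grad \<psi> x \<bullet> pairing \<mu> (\<lambda>(u, P). u) (t, x)) \<and>
    (LINT x|torus. grad \<psi> x \<bullet> pairing \<mu> (\<lambda>(u, P). u) (t, x)) = 0"
proof -
  let ?I = "lebesgue_on {0<..<T}" and ?N = "torus :: (real^'d) measure"
  interpret N: finite_measure ?N by (rule finite_measure_torus)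
  have T_borel: "{0<..<T} \<in> sets borel" by simp
  have \<psi>s: "C_infinity \<psi>" using \<psi> by (simp add: torus_smooth_def)
  have gc: "continuous_on UNIV (\<lambda>z :: real \<times> (real^'d). grad \<psi> (snd z))"
    by (rule continuous_on_compose2[OF continuous_on_grad[OF \<psi>s]]) (auto intro!: continuous_intros)
  have gi: "integrable M (\<lambda>z. grad \<psi> (snd z))"
    by (rule integrable_continuous_bounded_set[OF gc borel_space_time bounded_space_time])
  define p where "p z = grad \<psi> (snd z) \<bullet> pairing \<mu> (\<lambda>(u, P). u) z" for z
  have pi: "integrable M p"
    unfolding p_def[abs_def] by (rule integrable_inner_pairing[OF \<mu> \<mu>_bound' continuous_lift(1) gi])
  obtain G where G: "\<forall>x\<in>unit_cell. \<bar>\<psi> x\<bar> \<le> G"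
    using continuous_on_bounded_set[OF C_infinity_continuous_on[OF \<psi>s] bounded_unit_cell] by (metis real_norm_def)
  obtain H where H: "0 \<le> H" "\<forall>x\<in>unit_cell. norm (grad \<psi> x) \<le> H"
    using continuous_on_bounded_set[OF continuous_on_grad[OF \<psi>s] bounded_unit_cell] by metis
  obtain D where D: "AE z in M. norm (pairing \<mu> (\<lambda>(u, P). u) z) \<le> D"
    using pairing_bounded[OF \<mu> \<mu>_bound' continuous_lift(1)] by blast
  define h where "h t = (LINT x|?N. p (t, x))" for t
  have hi: "integrable ?I h"
    unfolding h_def[abs_def] by (rule integrable_integral_slice_lebesgue_on[OF T_borel borel_unit_cell pi])
  have slices: "AE t in ?I. integrable ?N (\<lambda>x. p (t, x))"
    by (rule AE_integrable_slice_lebesgue_on[OF T_borel borel_unit_cell pi])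
  have "AE t in ?I. h t = 0"
  proof (rule AE_eq_0_ramp_integrals[OF hi])
    have "AE z in M. \<bar>p z\<bar> \<le> H * D"
      using D AE_space
    proof eventually_elim
      case (elim z)
      have "norm (grad \<psi> (snd z)) \<le> H" using H(2) elim(2) by auto
      then show ?case
        unfolding p_def using elim(1) H(1) by (intro order_trans[OF Cauchy_Schwarz_ineq2 mult_mono]) auto
    qed
    from AE_lebesgue_on_pair[OF T_borel borel_unit_cell this] slices
    show "AE t in ?I. \<bar>h t\<bar> \<le> H * D * measure ?N (space ?N)"
    proof eventually_elim
      case (elim t)
      have "norm (LINT x|?N. p (t, x)) \<le> H * D * measure ?N (space ?N)"
        by (rule norm_integral_le_const[OF finite_measure_torus borel_measurable_integrable[OF elim(2)]])
          (use elim(1) in simp)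
      then show ?case by (simp add: h_def)
    qed
    fix s assume s: "0 < s" "s < T"
    define w where "w t = (s - t) * indicator {..<s} t" for t :: real
    have w_meas: "w \<in> borel_measurable borel" unfolding w_def[abs_def] by measurable
    have fst_w: "(\<lambda>z. w (fst z)) \<in> borel_measurable M"
      by (intro borel_measurable_lebesgue_onI measurable_compose[OF borel_measurable_fst_borel w_meas])
    have w_bound: "\<bar>w (fst z)\<bar> \<le> T" if "z \<in> space M" for z
      using that s by (auto simp: w_def indicator_def)
    have \<Phi>: "integrable M (\<lambda>z. w (fst z) *\<^sub>R grad \<psi> (snd z))"
    proof (rule Bochner_Integration.integrable_bound[of _ "\<lambda>z. T *\<^sub>R grad \<psi> (snd z)"])
      show "integrable M (\<lambda>z. T *\<^sub>R grad \<psi> (snd z))" using gi by simp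
      show "(\<lambda>z. w (fst z) *\<^sub>R grad \<psi> (snd z)) \<in> borel_measurable M"
        using fst_w borel_measurable_integrable[OF gi] by (rule borel_measurable_scaleR)
      show "AE z in M. norm (w (fst z) *\<^sub>R grad \<psi> (snd z)) \<le> norm (T *\<^sub>R grad \<psi> (snd z))"
      proof (rule AE_I2)
        fix z assume "z \<in> space M"
        then have "\<bar>w (fst z)\<bar> \<le> \<bar>T\<bar>" using w_bound[of z] by simp
        then show "norm (w (fst z) *\<^sub>R grad \<psi> (snd z)) \<le> norm (T *\<^sub>R grad \<psi> (snd z))"
          unfolding norm_scaleR by (rule mult_right_mono) simp
      qed
    qed
    have eq: "(LINT z|M. (w (fst z) *\<^sub>R grad \<psi> (snd z)) \<bullet> pairing \<kappa> (\<lambda>(u, P). u) z)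
        = (LINT z|M. (grad \<psi> (snd z) \<bullet> pairing \<kappa> (\<lambda>(u, P). u) z) * w (fst z))" for \<kappa>
      by (simp add: mult.commute)
    have lim: "(\<lambda>k. LINT z|M. (grad \<psi> (snd z) \<bullet> pairing (\<sigma> k) (\<lambda>(u, P). u) z) * w (fst z)) \<longlonglongrightarrow> (LINT z|M. p z * w (fst z))"
      using inner_conv[OF continuous_lift(1) \<Phi>] unfolding eq p_def .
    have "(\<lambda>k. \<rho>bar * (LINT z|M. (grad \<psi> (snd z) \<bullet> pairing (\<sigma> k) (\<lambda>(u, P). u) z) * w (fst z))) \<longlonglongrightarrow> 0"
    proof (rule null_comparison)
      fix k
      have "\<bar>\<rho>bar * x\<bar> = \<rho>bar * \<bar>x\<bar>" for x using pos(3) by (simp add: abs_mult)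
      then show "\<bar>\<rho>bar * (LINT z|M. (grad \<psi> (snd z) \<bullet> pairing (\<sigma> k) (\<lambda>(u, P). u) z) * w (fst z))\<bar> \<le>
          e k * (C * ((G + H * B * T) * measure M (space M) + T * G * measure ?N (space ?N)))"
        unfolding w_def using confined_solution.divergence_comparison[OF conf \<psi> G H(2) s] by (simp only:)
    qed
    then have "\<rho>bar * (LINT z|M. p z * w (fst z)) = 0"
      using LIMSEQ_unique[OF tendsto_mult[OF tendsto_const[of \<rho>bar] lim]] by blast
    then have "(LINT z|M. p z * w (fst z)) = 0" using pos(3) by simp
    moreover have "integrable M (\<lambda>z. p z * w (fst z))"
      by (rule integrable_mult_bounded[OF pi fst_w]) (rule w_bound)
    from integral_lebesgue_on_prod[OF T_borel borel_unit_cell this]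
    have "(LINT z|M. p z * w (fst z)) = (LINT t|?I. h t * w t)" by (simp add: h_def)
    ultimately show "(LINT t|?I. h t * ((s - t) * indicator {..<s} t)) = 0" by (simp add: w_def)
  qed
  then show ?thesis
    using slices by eventually_elim (simp add: h_def p_def)
qed

lemma augmented_solution: "augmented_mv_solution T u0 \<mu>"
  unfolding augmented_mv_solution_def
proof (intro conjI ballI)
  show "young_measure M UNIV \<mu>" by (rule young_measure_UNIV[OF \<mu>])
  show "AE z in M. integrable (\<mu> z) (\<lambda>(u, P). u) \<and> integrable (\<mu> z) (\<lambda>(u, P). u \<otimes>\<^sub>v u) \<and>
      integrable (\<mu> z) (\<lambda>(u, P). P) \<and> integrable (\<mu> z) (\<lambda>(u, P). (norm u)\<^sup>2)"
    using AE_integrable_pairing[OF \<mu> \<mu>_bound' continuous_lift(1)]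
      AE_integrable_pairing[OF \<mu> \<mu>_bound' continuous_lift(2)]
      AE_integrable_pairing[OF \<mu> \<mu>_bound' continuous_lift(3)]
      AE_integrable_pairing[OF \<mu> \<mu>_bound' continuous_lift(4)]
    by eventually_elim simp
  show "pairing \<mu> (\<lambda>(u, P). (norm u)\<^sup>2) \<in> L_infinity M"
    by (rule pairing_L_infinity[OF \<mu> \<mu>_bound' continuous_lift(4)])
qed (use u0 momentum_limit divergence_limit in blast)+

end

section \<open>Energy of the limit\<close>

lemma norm_powr_two: "norm x powr 2 = (norm x)\<^sup>2"
  by simp

lemma L_p_two_integrable: "f \<in> L_p M 2 \<Longrightarrow> integrable M (\<lambda>x. (norm (f x))\<^sup>2)"
  by (simp add: L_p_def norm_powr_two)

lemma L_p_norm_two_squared: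
  "(L_p_norm M 2 f)\<^sup>2 = (LINT x|M. (norm (f x))\<^sup>2)"
proof -
  define y where "y = (LINT x|M. (norm (f x))\<^sup>2)"
  have "0 \<le> y" unfolding y_def by (rule Bochner_Integration.integral_nonneg) simp
  then have "(y powr (1 / 2))\<^sup>2 = y" by (simp add: powr_half_sqrt)
  then show ?thesis by (simp add: L_p_norm_def norm_powr_two y_def)
qed

text \<open>Young's inequality with a free weight: the reference term keeps a factor arbitrarily
  close to 1, while the distance term, however heavily weighted, tends to zero under strong
  convergence.\<close>

lemma norm_sq_le_weighted:
  fixes a b :: "'a::real_normed_vector"
  assumes "0 < \<delta>"
  shows "(norm a)\<^sup>2 \<le> (1 + \<delta>) * (norm b)\<^sup>2 + (1 + 1 / \<delta>) * (norm (a - b))\<^sup>2"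
proof -
  define x where "x = norm b"
  define y where "y = norm (a - b)"
  have "norm a \<le> x + y" unfolding x_def y_def using norm_triangle_sub[of a b] by simp
  then have "(norm a)\<^sup>2 \<le> (x + y)\<^sup>2" by (intro power_mono) auto
  also have "(x + y)\<^sup>2 \<le> (1 + \<delta>) * x\<^sup>2 + (1 + 1 / \<delta>) * y\<^sup>2"
  proof -
    have "0 \<le> (\<delta> * x - y)\<^sup>2 / \<delta>" using assms by simp
    also have "\<dots> = \<delta> * x\<^sup>2 + 1 / \<delta> * y\<^sup>2 - 2 * x * y"
      using assms by (simp add: power2_eq_square field_simps)
    finally show ?thesis by (simp add: power2_eq_square algebra_simps)
  qed
  finally show ?thesis by (simp add: x_def y_def)
qed

text \<open>Weak-* convergence does not act at a fixed time, so the energy inequality is integrated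
  over Borel sets A of times. First k tends to infinity at fixed weight \<delta>, then \<delta> to
  0; choosing for A the times at which the limit energy exceeds L gives the bound at almost every
  time.\<close>

lemma (in low_mach_limit) energy_limit:
  assumes adm: "\<And>k. isentropic_energy_admissible T \<gamma> (e k) (\<rho> k) (u k) (\<nu> k)"
    and u0L: "u0 \<in> L_p torus 2" and uL: "\<forall>\<^sub>F k in sequentially. u k \<in> L_p torus 2"
    and strong: "(\<lambda>k. L_p_norm torus 2 (\<lambda>x. u k x - u0 x)) \<longlonglongrightarrow> 0"
  shows "augmented_energy_admissible T u0 \<mu>"
proof -
  let ?I = "lebesgue_on {0<..<T}" and ?N = "torus :: (real^'d) measure"
  interpret I: finite_measure ?I by (rule finite_measure_lebesgue_on_bounded) auto
  have T_borel: "{0<..<T} \<in> sets borel" by simp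
  define L where "L = (LINT x|?N. (norm (u0 x))\<^sup>2)"
  define D where "D k = (LINT x|?N. (norm (u k x - u0 x))\<^sup>2)" for k
  have u02: "integrable ?N (\<lambda>x. (norm (u0 x))\<^sup>2)" by (rule L_p_two_integrable[OF u0L])
  have D_lim: "D \<longlonglongrightarrow> 0"
    using tendsto_power[OF strong, of 2] by (simp add: L_p_norm_two_squared D_def[abs_def])
  have u_bound: "(LINT x|?N. (norm (u k x))\<^sup>2) \<le> (1 + \<delta>) * L + (1 + 1 / \<delta>) * D k"
    if uk: "u k \<in> L_p torus 2" and \<delta>: "0 < \<delta>" for k \<delta>
  proof -
    have i1: "integrable ?N (\<lambda>x. (norm (u k x))\<^sup>2)" by (rule L_p_two_integrable[OF uk])
    have i2: "integrable ?N (\<lambda>x. (norm (u k x - u0 x))\<^sup>2)"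
    proof (rule Bochner_Integration.integrable_bound[of _ "\<lambda>x. 2 * (norm (u k x))\<^sup>2 + 2 * (norm (u0 x))\<^sup>2"])
      show "(\<lambda>x. (norm (u k x - u0 x))\<^sup>2) \<in> borel_measurable ?N"
        using uk u0L by (intro borel_measurable_power measurable_compose[OF _ borel_measurable_norm] borel_measurable_diff) (simp_all add: L_p_def)
      show "AE x in ?N. norm ((norm (u k x - u0 x))\<^sup>2) \<le> norm (2 * (norm (u k x))\<^sup>2 + 2 * (norm (u0 x))\<^sup>2)"
      proof (rule AE_I2)
        fix x
        \<comment> \<open>Weight 1, with u k x as reference, so that the distance term is the norm
          of u0 x.\<close>
        show "norm ((norm (u k x - u0 x))\<^sup>2) \<le> norm (2 * (norm (u k x))\<^sup>2 + 2 * (norm (u0 x))\<^sup>2)"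
          using norm_sq_le_weighted[of 1 "u k x - u0 x" "u k x"] by simp
      qed
    qed (use i1 u02 in simp)
    have "(LINT x|?N. (norm (u k x))\<^sup>2) \<le> (LINT x|?N. (1 + \<delta>) * (norm (u0 x))\<^sup>2 + (1 + 1 / \<delta>) * (norm (u k x - u0 x))\<^sup>2)"
      by (rule integral_mono) (use i1 i2 u02 norm_sq_le_weighted[OF \<delta>] in auto)
    also have "\<dots> = (1 + \<delta>) * L + (1 + 1 / \<delta>) * D k"
      using i2 u02 by (simp add: L_def D_def)
    finally show ?thesis .
  qed
  define K where "K = (C * (B * B) + 2 * powr_curvature \<gamma> \<rho>bar * C\<^sup>2 / (\<gamma> - 1)) * measure ?N (space ?N)"
  \<comment> \<open>The right-hand side of \<open>energy_comparison\<close> with the L^2 norm of the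
    data replaced by its weighted bound, divided by \<rho>bar.\<close>
  define U where "U \<delta> k = ((\<rho>bar + C * e k) * ((1 + \<delta>) * L + (1 + 1 / \<delta>) * D k) + e k * K) / \<rho>bar" for \<delta> k
  have U_lim: "U \<delta> \<longlonglongrightarrow> (1 + \<delta>) * L" for \<delta>
  proof -
    have "U \<delta> \<longlonglongrightarrow> ((\<rho>bar + C * 0) * ((1 + \<delta>) * L + (1 + 1 / \<delta>) * 0) + 0 * K) / \<rho>bar"
      unfolding U_def[abs_def] using pos(3) by (intro tendsto_intros e_lim D_lim) auto
    then show ?thesis using pos(3) by simp
  qed
  define E :: "(real^'d) \<times> real \<Rightarrow> real" where "E = (\<lambda>(u, P). (norm u)\<^sup>2)"
  have E_cont: "continuous_on UNIV E" unfolding E_def by (rule continuous_lift(4))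
  have one: "integrable M (\<lambda>z. 1 :: real)"
    using finite_measure.integrable_const[OF finite_measure_space_time] .
  have \<sigma>i: "integrable M (pairing (\<sigma> k) E)" for k
    using integrable_inner_pairing[OF \<sigma>_kernel \<sigma>_bound E_cont one] by simp
  have \<mu>i: "integrable M (pairing \<mu> E)"
    using integrable_inner_pairing[OF \<mu> \<mu>_bound' E_cont one] by simp
  have fst_m: "(\<lambda>z. indicator A (fst z) :: real) \<in> borel_measurable M" if "A \<in> sets borel" for A
    using that by (intro borel_measurable_lebesgue_onI measurable_compose[OF borel_measurable_fst_borel]) simp
  have slab: "(LINT z|M. f z * indicator A (fst z)) = (LINT t|?I. (LINT x|?N. f (t, x)) * indicator A t)"
    if "integrable M f" "A \<in> sets borel" for f :: "real \<times> (real^'d) \<Rightarrow> real" and A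
  proof -
    have "integrable M (\<lambda>z. f z * indicator A (fst z))"
      by (rule integrable_mult_bounded[OF that(1) fst_m[OF that(2)], of 1]) simp
    from integral_lebesgue_on_prod[OF T_borel borel_unit_cell this] show ?thesis by simp
  qed
  have indI: "(indicator A :: real \<Rightarrow> real) \<in> borel_measurable ?I" if "A \<in> sets borel" for A
    using that by (intro borel_measurable_lebesgue_onI) simp
  have indi: "integrable ?I (indicator A :: real \<Rightarrow> real)" if "A \<in> sets borel" for A
    by (rule I.integrable_const_bound[where B = 1, OF _ indI[OF that]]) simp
  define q where "q t = (LINT x|?N. pairing \<mu> E (t, x))" for t
  have qi: "integrable ?I q"
    unfolding q_def[abs_def] by (rule integrable_integral_slice_lebesgue_on[OF T_borel borel_unit_cell \<mu>i])
  have qA: "(LINT t|?I. q t * indicator A t) \<le> L * (LINT t|?I. indicator A t)" if A: "A \<in> sets borel" for A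
  proof -
    have le_\<delta>: "(LINT t|?I. q t * indicator A t) \<le> (1 + \<delta>) * L * (LINT t|?I. indicator A t)" if \<delta>: "0 < \<delta>" for \<delta>
    proof (rule tendsto_le[OF sequentially_bot])
      show "(\<lambda>k. U \<delta> k * (LINT t|?I. indicator A t)) \<longlonglongrightarrow> (1 + \<delta>) * L * (LINT t|?I. indicator A t)"
        by (intro tendsto_mult U_lim tendsto_const)
      have ind_M: "integrable M (\<lambda>z. indicator A (fst z) :: real)"
        by (rule finite_measure.integrable_const_bound[OF finite_measure_space_time, of _ 1, OF _ fst_m[OF A]]) simp
      show "(\<lambda>k. LINT z|M. pairing (\<sigma> k) E z * indicator A (fst z)) \<longlonglongrightarrow> (LINT t|?I. q t * indicator A t)"
        using conv[OF E_cont ind_M] slab[OF \<mu>i A] by (simp add: q_def)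
      show "\<forall>\<^sub>F k in sequentially. (LINT z|M. pairing (\<sigma> k) E z * indicator A (fst z)) \<le> U \<delta> k * (LINT t|?I. indicator A t)"
        using uL
      proof eventually_elim
        case (elim k)
        have "AE t in ?I. \<rho>bar * (LINT x|?N. pairing (\<sigma> k) E (t, x)) \<le> (\<rho>bar + C * e k) * (LINT x|?N. (norm (u k x))\<^sup>2) + e k * K"
          using confined_solution.energy_comparison[OF conf adm L_p_two_integrable[OF elim]] by (simp add: K_def E_def)
        then have ae: "AE t in ?I. (LINT x|?N. pairing (\<sigma> k) E (t, x)) * indicator A t \<le> U \<delta> k * indicator A t"
        proof eventually_elim
          case (elim t)
          have "0 \<le> \<rho>bar + C * e k" using confined_solution.pos[OF conf[of k]] by simp
          then have "(\<rho>bar + C * e k) * (LINT x|?N. (norm (u k x))\<^sup>2) \<le> (\<rho>bar + C * e k) * ((1 + \<delta>) * L + (1 + 1 / \<delta>) * D k)"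
            by (intro mult_left_mono u_bound \<open>u k \<in> L_p torus 2\<close> \<delta>)
          then have "\<rho>bar * (LINT x|?N. pairing (\<sigma> k) E (t, x)) \<le> \<rho>bar * U \<delta> k"
            using elim pos(3) by (simp add: U_def)
          then have "(LINT x|?N. pairing (\<sigma> k) E (t, x)) \<le> U \<delta> k" using pos(3) by simp
          then show ?case by (intro mult_right_mono) auto
        qed
        have i: "integrable ?I (\<lambda>t. (LINT x|?N. pairing (\<sigma> k) E (t, x)) * indicator A t)"
          by (rule integrable_mult_bounded[OF integrable_integral_slice_lebesgue_on[OF T_borel borel_unit_cell \<sigma>i] indI[OF A], of 1]) simp
        have "(LINT z|M. pairing (\<sigma> k) E z * indicator A (fst z)) \<le> (LINT t|?I. U \<delta> k * indicator A t)"
          unfolding slab[OF \<sigma>i A] by (rule integral_mono_AE[OF i _ ae]) (use indi[OF A] in simp)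
        then show ?case by simp
      qed
    qed
    have "((\<lambda>\<delta>. (1 + \<delta>) * L * (LINT t|?I. indicator A t)) \<longlongrightarrow> (1 + 0) * L * (LINT t|?I. indicator A t)) (at_right 0)"
      by (intro tendsto_intros)
    moreover have "\<forall>\<^sub>F \<delta> in at_right 0. (LINT t|?I. q t * indicator A t) \<le> (1 + \<delta>) * L * (LINT t|?I. indicator A t)"
      using le_\<delta> by (auto simp: eventually_at_right_field intro: exI[of _ 1])
    ultimately have "(LINT t|?I. q t * indicator A t) \<le> (1 + 0) * L * (LINT t|?I. indicator A t)"
      by (rule tendsto_lowerbound) simp
    then show ?thesis by simp
  qed
  have q_le: "AE t in ?I. q t \<le> L"
  proof -
    \<comment> \<open>\<open>qA\<close> requires Borel sets of times, while q is only Lebesgue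
      measurable; a Borel representative makes the exceptional set admissible.\<close>
    obtain q' where q': "q' \<in> borel_measurable borel" and "AE t in lborel. t \<in> {0<..<T} \<longrightarrow> q t = q' t"
      by (rule lebesgue_on_borel_representative_real[OF T_borel borel_measurable_integrable[OF qi]]) blast
    then have eq: "AE t in ?I. q t = q' t" by (simp add: AE_lebesgue_on_borel_iff)
    define A where "A = {t. L < q' t}"
    have A: "A \<in> sets borel" unfolding A_def using q' by measurable
    have i1: "integrable ?I (\<lambda>t. q t * indicator A t)"
      by (rule integrable_mult_bounded[OF qi indI[OF A], of 1]) simp
    have i: "integrable ?I (\<lambda>t. (q t - L) * indicator A t)"
      using i1 indi[OF A] by (simp add: left_diff_distrib)
    have nn: "AE t in ?I. 0 \<le> (q t - L) * indicator A t"
      using eq by eventually_elim (auto simp: A_def indicator_def)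
    have "(LINT t|?I. (q t - L) * indicator A t) = (LINT t|?I. q t * indicator A t) - L * (LINT t|?I. indicator A t)"
      using i1 indi[OF A] by (simp add: left_diff_distrib)
    then have "(LINT t|?I. (q t - L) * indicator A t) = 0"
      using qA[OF A] integral_nonneg_AE[OF nn] by linarith
    then have "AE t in ?I. (q t - L) * indicator A t = 0"
      using integral_nonneg_eq_0_iff_AE[OF i nn] by simp
    then show ?thesis
      using eq by eventually_elim (auto simp: A_def indicator_def split: if_splits)
  qed
  define N where "N z = (\<integral>\<^sup>+v. ennreal (1 / 2 * E v) \<partial>\<mu> z)" for z
  have E_nonneg: "0 \<le> E v" for v by (simp add: E_def case_prod_unfold)
  have N_meas: "N \<in> borel_measurable M"
    unfolding N_def[abs_def]
    by (rule measurable_compose[OF measurable_prob_algebraD[OF \<mu>] nn_integral_measurable_subprob_algebra])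
      (use borel_measurable_continuous_onI[OF E_cont] in simp)
  have N_eq: "AE z in M. N z = ennreal (1 / 2 * pairing \<mu> E z) \<and> 0 \<le> pairing \<mu> E z"
    using AE_integrable_pairing[OF \<mu> \<mu>_bound' E_cont]
  proof eventually_elim
    case (elim z)
    have "N z = ennreal (LINT v|\<mu> z. 1 / 2 * E v)"
      unfolding N_def by (rule nn_integral_eq_integral) (use elim E_nonneg in auto)
    then show ?case using E_nonneg by (simp add: pairing_def Bochner_Integration.integral_nonneg)
  qed
  have "AE t in ?I. (\<integral>\<^sup>+x. N (t, x) \<partial>?N) \<le> ennreal (1 / 2 * L)"
    using q_le AE_lebesgue_on_pair[OF T_borel borel_unit_cell N_eq]
      AE_integrable_slice_lebesgue_on[OF T_borel borel_unit_cell \<mu>i]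
  proof eventually_elim
    case (elim t)
    have "(\<integral>\<^sup>+x. N (t, x) \<partial>?N) = (\<integral>\<^sup>+x. ennreal (1 / 2 * pairing \<mu> E (t, x)) \<partial>?N)"
      by (rule nn_integral_cong_AE) (use elim(2) in \<open>eventually_elim, simp\<close>)
    also have "\<dots> = ennreal (LINT x|?N. 1 / 2 * pairing \<mu> E (t, x))"
      by (rule nn_integral_eq_integral) (use elim(3) in simp, use elim(2) in \<open>eventually_elim, simp\<close>)
    also have "\<dots> \<le> ennreal (1 / 2 * L)"
      using elim(1) by (intro ennreal_leI) (simp add: q_def)
    finally show ?case .
  qed
  then have "esssup ?I (\<lambda>t. \<integral>\<^sup>+x. N (t, x) \<partial>?N) \<le> ennreal (1 / 2 * L)"
    by (intro esssup_I borel_measurable_nn_integral_lebesgue_on[OF T_borel borel_unit_cell N_meas])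
  also have "ennreal (1 / 2 * L) = (\<integral>\<^sup>+x. ennreal (1 / 2 * (norm (u0 x))\<^sup>2) \<partial>?N)"
    using nn_integral_eq_integral[of ?N "\<lambda>x. 1 / 2 * (norm (u0 x))\<^sup>2"] u02 by (simp add: L_def)
  finally show ?thesis
    using u0L by (simp add: augmented_energy_admissible_def N_def E_def case_prod_unfold)
qed

theorem theorem3p1:
  fixes T \<gamma> \<rho>bar :: real
    and \<nu> :: "real \<Rightarrow> real \<times> (real^'d) \<Rightarrow> (real \<times> (real^'d)) measure"
    and \<rho>\<epsilon> :: "real \<Rightarrow> real^'d \<Rightarrow> real"
    and u\<epsilon> :: "real \<Rightarrow> real^'d \<Rightarrow> real^'d"
    and u0 :: "real^'d \<Rightarrow> real^'d"
  assumes "T > 0" and "\<gamma> > 1"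
    and solutions: "\<And>\<epsilon>. \<epsilon> > 0 \<Longrightarrow> isentropic_mv_solution T \<gamma> \<epsilon> (\<rho>\<epsilon> \<epsilon>) (u\<epsilon> \<epsilon>) (\<nu> \<epsilon>)"
    and "\<rho>bar > 0" and "divergence_free u0"
    and density_data: "weakly_converges_L1 torus \<rho>\<epsilon> (\<lambda>x. \<rho>bar) (at_right 0)"
    and velocity_data: "weakly_converges_L1 torus u\<epsilon> u0 (at_right 0)"
    and support: "\<exists>\<eta> R K. 0 < \<eta> \<and> \<eta> < R \<and> compact K \<and>
       (\<forall>\<epsilon>>0. AE z in space_time T.
          supp (pushforward (T_lift \<gamma> \<rho>bar \<epsilon>) (\<nu> \<epsilon>) z) \<subseteq> {\<eta>..R} \<times> K)"
  shows "\<exists>\<epsilon>k \<mu>. (\<forall>k::nat. \<epsilon>k k > 0) \<and> \<epsilon>k \<longlonglongrightarrow> 0 \<and>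
     young_converges (space_time T)
       (\<lambda>k. pushforward (P_lift \<gamma> \<rho>bar (\<epsilon>k k)) (\<nu> (\<epsilon>k k))) \<mu> \<and>
     augmented_mv_solution T u0 \<mu> \<and>
     ((\<forall>\<epsilon>>0. isentropic_energy_admissible T \<gamma> \<epsilon> (\<rho>\<epsilon> \<epsilon>) (u\<epsilon> \<epsilon>) (\<nu> \<epsilon>)) \<and>
      strongly_converges_Lp torus \<gamma> \<rho>\<epsilon> (\<lambda>x. \<rho>bar) (at_right 0) \<and>
      strongly_converges_Lp torus 2 u\<epsilon> u0 (at_right 0)
      \<longrightarrow> augmented_energy_admissible T u0 \<mu>)"
proof -
  let ?M = "space_time T :: (real \<times> (real^'d)) measure"
  obtain \<eta> R K where \<eta>: "0 < \<eta>" and K: "compact K"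
    and supp: "\<And>\<epsilon>. 0 < \<epsilon> \<Longrightarrow> AE z in space_time T. supp (pushforward (T_lift \<gamma> \<rho>bar \<epsilon>) (\<nu> \<epsilon>) z) \<subseteq> {\<eta>..R} \<times> K"
    using support by blast
  obtain B where B: "0 < B" "\<forall>w\<in>K. norm w \<le> B"
    using compact_imp_bounded[OF K] unfolding bounded_pos by blast
  define C where "C = B * \<rho>bar / (\<gamma> * min \<eta> \<rho>bar powr (\<gamma> - 1))"
  have C: "0 \<le> C" unfolding C_def using assms(2,4) \<eta> B(1) by simp
  \<comment> \<open>The prefactor enforces C \<delta> n \<le> \<rho>bar / 2 already at n = 0, and C
    + 1 avoids dividing by zero.\<close>
  define \<delta> where "\<delta> n = \<rho>bar / (2 * (C + 1)) * (1 / (real n + 1))" for n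
  have \<delta>_pos: "0 < \<delta> n" for n using assms(4) C by (simp add: \<delta>_def)
  have \<delta>_small: "C * \<delta> n \<le> \<rho>bar / 2" for n
  proof -
    have "\<delta> n \<le> \<rho>bar / (2 * (C + 1)) * 1"
      unfolding \<delta>_def using assms(4) C by (intro mult_left_mono) auto
    then have "C * \<delta> n \<le> C * (\<rho>bar / (2 * (C + 1)))" using C by (intro mult_left_mono) auto
    also have "\<dots> \<le> (C + 1) * (\<rho>bar / (2 * (C + 1)))" using C assms(4) by (intro mult_right_mono) auto
    also have "\<dots> = \<rho>bar / 2" using C by (simp add: field_simps)
    finally show ?thesis .
  qed
  have \<delta>_lim: "\<delta> \<longlonglongrightarrow> 0"
  proof -
    have "\<delta> \<longlonglongrightarrow> \<rho>bar / (2 * (C + 1)) * 0"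
      unfolding \<delta>_def[abs_def] using LIMSEQ_inverse_real_of_nat
      by (intro tendsto_mult tendsto_const) (simp add: divide_inverse add.commute)
    then show ?thesis by simp
  qed
  have conf: "confined_solution T \<gamma> \<rho>bar (\<delta> n) C B (\<rho>\<epsilon> (\<delta> n)) (u\<epsilon> (\<delta> n)) (\<nu> (\<delta> n))" for n
    by (rule confined_solutionI[OF assms(1,2,4) \<delta>_pos \<eta> K B(2) less_imp_le[OF B(1)] C_def \<delta>_small
          solutions[OF \<delta>_pos] supp[OF \<delta>_pos]])
  obtain r \<mu> b where r: "strict_mono (r :: nat \<Rightarrow> nat)" and \<mu>: "\<mu> \<in> ?M \<rightarrow>\<^sub>M prob_algebra borel"
    "\<And>z. z \<in> space ?M \<Longrightarrow> AE v in \<mu> z. norm v \<le> b"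
    and conv: "\<And>(f :: (real^'d) \<times> real \<Rightarrow> real) h. continuous_on UNIV f \<Longrightarrow> integrable ?M h \<Longrightarrow>
      (\<lambda>k. LINT z|?M. pairing (pushforward (P_lift \<gamma> \<rho>bar (\<delta> (r k))) (\<nu> (\<delta> (r k)))) f z * h z)
        \<longlonglongrightarrow> (LINT z|?M. pairing \<mu> f z * h z)"
    by (rule young_compactness[where \<nu> = "\<lambda>n. pushforward (P_lift \<gamma> \<rho>bar (\<delta> n)) (\<nu> (\<delta> n))", OF finite_measure_space_time
          separable_measure_lebesgue_on[OF borel_space_time bounded_space_time]
          confined_solution.lift_kernel[OF conf] bounded_cball confined_solution.lift_bound[OF conf]]) blast
  define \<epsilon>k where "\<epsilon>k k = \<delta> (r k)" for k
  have \<epsilon>k_pos: "0 < \<epsilon>k k" for k by (simp add: \<epsilon>k_def \<delta>_pos)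
  have \<epsilon>k_lim: "\<epsilon>k \<longlonglongrightarrow> 0"
    using LIMSEQ_subseq_LIMSEQ[OF \<delta>_lim r] by (simp add: comp_def \<epsilon>k_def[abs_def])
  \<comment> \<open>Positivity upgrades convergence to 0 to convergence from the right, so that
    limits of the data as \<epsilon> -> 0 can be composed with the sequence.\<close>
  have \<epsilon>k_right: "filterlim \<epsilon>k (at_right 0) sequentially"
    using \<epsilon>k_lim \<epsilon>k_pos by (auto simp: filterlim_at less_imp_neq[symmetric])
  interpret low_mach_limit T \<gamma> \<rho>bar C B b \<epsilon>k "\<lambda>k. \<rho>\<epsilon> (\<epsilon>k k)" "\<lambda>k. u\<epsilon> (\<epsilon>k k)" "\<lambda>k. \<nu> (\<epsilon>k k)" u0 \<mu>
  proof (rule low_mach_limit.intro)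
    show "confined_solution T \<gamma> \<rho>bar (\<epsilon>k k) C B (\<rho>\<epsilon> (\<epsilon>k k)) (u\<epsilon> (\<epsilon>k k)) (\<nu> (\<epsilon>k k))" for k
      unfolding \<epsilon>k_def by (rule conf)
    show "integrable torus u0" using velocity_data by (simp add: weakly_converges_L1_def)
    show "(\<lambda>k. LINT x|torus. u\<epsilon> (\<epsilon>k k) x \<bullet> g x) \<longlonglongrightarrow> (LINT x|torus. u0 x \<bullet> g x)" if "g \<in> L_infinity torus" for g
    proof -
      have "((\<lambda>\<epsilon>. LINT x|torus. u\<epsilon> \<epsilon> x \<bullet> g x) \<longlongrightarrow> (LINT x|torus. u0 x \<bullet> g x)) (at_right 0)"
        using velocity_data that by (simp add: weakly_converges_L1_def)
      from filterlim_compose[OF this \<epsilon>k_right] show ?thesis .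
    qed
    show "(\<lambda>k. LINT z|?M. pairing (pushforward (P_lift \<gamma> \<rho>bar (\<epsilon>k k)) (\<nu> (\<epsilon>k k))) f z * h z)
        \<longlonglongrightarrow> (LINT z|?M. pairing \<mu> f z * h z)"
      if "continuous_on UNIV f" "integrable ?M h" for f :: "(real^'d) \<times> real \<Rightarrow> real" and h
      unfolding \<epsilon>k_def by (rule conv[OF that])
  qed (use \<mu> \<epsilon>k_lim in auto)
  have "augmented_energy_admissible T u0 \<mu>"
    if adm: "\<forall>\<epsilon>>0. isentropic_energy_admissible T \<gamma> \<epsilon> (\<rho>\<epsilon> \<epsilon>) (u\<epsilon> \<epsilon>) (\<nu> \<epsilon>)"
      and strong: "strongly_converges_Lp torus 2 u\<epsilon> u0 (at_right 0)"
  proof (rule energy_limit)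
    show "isentropic_energy_admissible T \<gamma> (\<epsilon>k k) (\<rho>\<epsilon> (\<epsilon>k k)) (u\<epsilon> (\<epsilon>k k)) (\<nu> (\<epsilon>k k))" for k
      using adm \<epsilon>k_pos by blast
    show "u0 \<in> L_p torus 2" using strong by (simp add: strongly_converges_Lp_def)
    have ev: "\<forall>\<^sub>F \<epsilon> in at_right 0. u\<epsilon> \<epsilon> \<in> L_p torus 2"
      and lim: "((\<lambda>\<epsilon>. L_p_norm torus 2 (\<lambda>x. u\<epsilon> \<epsilon> x - u0 x)) \<longlongrightarrow> 0) (at_right 0)"
      using strong by (simp_all add: strongly_converges_Lp_def)
    show "\<forall>\<^sub>F k in sequentially. u\<epsilon> (\<epsilon>k k) \<in> L_p torus 2"
      by (rule eventually_compose_filterlim[OF ev \<epsilon>k_right])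
    show "(\<lambda>k. L_p_norm torus 2 (\<lambda>x. u\<epsilon> (\<epsilon>k k) x - u0 x)) \<longlonglongrightarrow> 0"
      by (rule filterlim_compose[OF lim \<epsilon>k_right])
  qed
  then show ?thesis
    using \<epsilon>k_pos \<epsilon>k_lim lifts_converge augmented_solution by blast
qed

end
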